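(* Suppose Assumption 1 and Assumption 2 (both stated in the context) hold, and let $$G_{n,g}=\sup_{k\ge n+2}\frac1{g(k/n)}G_n(k)$$ be the open-end monitoring statistic, with $G_n(k)$ defined in the context. Under the null hypothesis $H_0$ (no change over the infinite monitoring horizon), as $n\to\infty$, $$G_{n,g}\stackrel{d}{\longrightarrow}G_g:=\frac{1}{\left[\int_0^1\{B(u)-uB(1)\}^2du\right]^{1/2}}\ \sup_{\tau\ge1}\ \sup_{1\le r\le\tau}\frac{\left|B(r)-\frac r\tau B(\tau)\right|}{g(\tau)},$$ where $B$ is a standard Brownian motion on $[0,\infty)$.
   Context: **Space and embeddings.** $(\mathcal X,d)$ is a separable metric space of negative type, i.e. $\sum_{i,j}a_ia_jd(x_i,x_j)\le 0$ for all finite families $x_i\in\mathcal X$ and reals $a_i$ with $\sum_i a_i=0$. Then there are a Hilbert space $\mathcal H$ and a map $\phi:\mathcal X\to\mathcal H$ with $d(x,x')=\|\phi(x)-\phi(x')\|_{\mathcal H}^2$; fix such a pair. Fix a finite Borel measure $v$ on $[0,\infty)$ with $v((0,\infty))>0$, put $f(x)=\int_{[0,\infty)}e^{-tx}\,dv(t)$ for $x\ge 0$, and let $\mathcal K(a,b)=f(\|a-b\|_{\mathcal H}^2)$, a positive definite kernel on $\mathcal H$ with reproducing kernel Hilbert space $\mathbb H$. For an $\mathcal X$-valued observation $X_t$ put $\widetilde Y_t=\mathcal K(\phi(X_t),\cdot)\in\mathbb H$, so that $\langle\widetilde Y_i,\widetilde Y_j\rangle_{\mathbb H}=f(d(X_i,X_j))$,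 and $\mu_t=\mathbb E\widetilde Y_t\in\mathbb H$. **Statistic.** $U_t=\sum_{i=1}^t\widetilde Y_i$. For $k\ge n+2$ and $s\in\{n+1,\dots,k-1\}$, $$T_{k,n}(s)=\left\langle \frac{U_k}{k},\frac1{\sqrt n}\Big(U_s-\frac skU_k\Big)\right\rangle_{\mathbb H},\qquad W_n=\frac1{n^4}\sum_{t=1}^n\left\langle U_n,U_t-\frac tnU_n\right\rangle_{\mathbb H}^2,\qquad G_n(k)=\max_{s=n+1,\dots,k-1}\frac{|T_{k,n}(s)|}{\sqrt{W_n}}.$$ **Mixing coefficients.** For a process $\{Z_t\}_{t\in\mathbb Z}$ and $I\subset\mathbb Z$ let $\mathcal F_I=\sigma(Z_t:t\in I)$. For $\sigma$-fields $\mathcal A,\mathcal B$, $\rho(\mathcal A,\mathcal B)=\sup |\mathrm{Cov}(U,V)|/\sqrt{\mathrm{Var}(U)\mathrm{Var}(V)}$ over real square-integrable $U$ ($\mathcal A$-measurable) and $V$ ($\mathcal B$-measurable) with positive variances, and $\alpha(\mathcal A,\mathcal B)=\sup\{|P(A\cap B)-P(A)P(B)|:A\in\mathcal A,B\in\mathcal B\}$. Set $\rho(m)=\sup\rho(\mathcal F_I,\mathcal F_J)$ over nonempty $I,J\subset\mathbb Z$ with $\min\{|i-j|:i\in I,j\in J\}\ge m$, and $\alpha_{1,1}(m)=\sup_{j\in\mathbb Z,\,k\ge m}\alpha(\mathcal F_{\{j\}},\mathcal F_{\{j+k\}})$. The process is $\rho$-mixing if $\rho(m)\to0$ as $m\to\infty$.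 **Model and $H_0$.** There is a jointly (strictly) stationary $\mathbb H\times\mathbb H$-valued process $\{(\widetilde Y_t^{(1)},\widetilde Y_t^{(2)})\}_{t\in\mathbb Z}$ (pre- and post-change regimes), whose components are embedded $\mathcal X$-valued time series (as in the definition of $\widetilde Y_t$). Under $H_0$, only the first regime is observed: $\widetilde Y_t=\widetilde Y_t^{(1)}$ for all $t\ge1$. **Assumption 1.** Let $Q$ be the long-run covariance operator of $\{\widetilde Y_t^{(1)}\}$: $\langle Qx,y\rangle_{\mathbb H}=\sum_{t\in\mathbb Z}\mathbb E(\langle\widetilde Y_0^{(1)}-\mu_1,x\rangle_{\mathbb H}\langle\widetilde Y_t^{(1)}-\mu_1,y\rangle_{\mathbb H})$ for $x,y\in\mathbb H$. The process $\{(\widetilde Y_t^{(1)},\widetilde Y_t^{(2)})\}_{t\in\mathbb Z}$ is $\rho$-mixing and for some $\delta>0$: (1) $\langle Q\mu_1,\mu_1\rangle_{\mathbb H}>0$; (2) $\sum_{m\ge1}[\alpha_{1,1}(m)]^{\delta/(2+\delta)}\le C$, with mixing coefficients those of the pair process and $C\in(0,\infty)$ independent of $n$. **Assumption 2.** $g:[1,\infty)\to(0,\infty)$ is continuous and nondecreasing, with $$\lim_{\tau\to\infty}\frac{\sqrt{\tau\log\log\tau}}{g(\tau)}=0,\qquad \lim_{T\to\infty}\sum_{\ell=0}^\infty\frac{2^\ell T}{g(2^\ell T)^2}=0.$$ *)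

theory Defs
  imports "HOL-Probability.Probability"
begin

section \<open>Negative type, Laplace kernel, reproducing kernel Hilbert space\<close>

definition negative_type :: "('x \<Rightarrow> 'x \<Rightarrow> real) \<Rightarrow> bool" where
  "negative_type d \<longleftrightarrow>
     (\<forall>(n::nat) (x :: nat \<Rightarrow> 'x) (a :: nat \<Rightarrow> real). (\<Sum>i<n. a i) = 0 \<longrightarrow>
        (\<Sum>i<n. \<Sum>j<n. a i * a j * d (x i) (x j)) \<le> 0)"

definition laplace_transform :: "real measure \<Rightarrow> real \<Rightarrow> real" where
  "laplace_transform v x = (\<integral>t. exp (- (t * x)) \<partial>v)"

definition laplace_kernel :: "real measure \<Rightarrow> 'h::real_inner \<Rightarrow> 'h \<Rightarrow> real" where
  "laplace_kernel v a b = laplace_transform v ((norm (a - b))\<^sup>2)"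

text \<open>The RKHS of a kernel is a Hilbert space of functions. Here its elements are the points of a
  Hilbert space type \<open>'k\<close>, and \<open>fn u\<close> is the function that the point \<open>u\<close> stands for; \<open>fn\<close> is
  linear and injective, every section of the kernel is one of these functions, and the section
  at \<open>a\<close> reproduces the values at \<open>a\<close>. The RKHS is thus determined up to isometric isomorphism,
  by the Moore--Aronszajn theorem.\<close>

definition is_rkhs ::
  "('h \<Rightarrow> 'h \<Rightarrow> real) \<Rightarrow> ('k::{real_inner,complete_space} \<Rightarrow> 'h \<Rightarrow> real) \<Rightarrow> bool" where
  "is_rkhs K fn \<longleftrightarrow>
     (\<forall>u w a. fn (u + w) a = fn u a + fn w a) \<and>
     (\<forall>c u a. fn (c *\<^sub>R u) a = c * fn u a) \<and>
     inj fn \<and>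
     (\<forall>a. \<exists>k. fn k = K a \<and> (\<forall>u. fn u a = u \<bullet> k))"

text \<open>The element \<open>K (\<phi> x, \<cdot>)\<close> of the RKHS.\<close>

definition rkhs_embed ::
  "real measure \<Rightarrow> ('k::{real_inner,complete_space} \<Rightarrow> 'h::real_inner \<Rightarrow> real) \<Rightarrow> ('x \<Rightarrow> 'h) \<Rightarrow> 'x \<Rightarrow> 'k" where
  "rkhs_embed v fn \<phi> x = inv fn (laplace_kernel v (\<phi> x))"


section \<open>Expectation and long-run covariance in a Hilbert space\<close>

text \<open>The library's Bochner integral needs a second countable range space. The expectation is
  therefore taken in the weak sense, which makes sense in every Hilbert space and is the same for
  the (bounded, separably valued) variables considered here.\<close>

definition has_expectation :: "'w measure \<Rightarrow> ('w \<Rightarrow> 'k::real_inner) \<Rightarrow> 'k \<Rightarrow> bool" where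
  "has_expectation M Z m \<longleftrightarrow>
     (\<forall>h. integrable M (\<lambda>\<omega>. Z \<omega> \<bullet> h) \<and> (\<integral>\<omega>. Z \<omega> \<bullet> h \<partial>M) = m \<bullet> h)"

definition is_long_run_cov ::
  "'w measure \<Rightarrow> (int \<Rightarrow> 'w \<Rightarrow> 'k::real_inner) \<Rightarrow> 'k \<Rightarrow> ('k \<Rightarrow> 'k) \<Rightarrow> bool" where
  "is_long_run_cov M Z m Q \<longleftrightarrow>
     (\<forall>x y. ((\<lambda>t. \<integral>\<omega>. ((Z 0 \<omega> - m) \<bullet> x) * ((Z t \<omega> - m) \<bullet> y) \<partial>M) has_sum (Q x \<bullet> y)) UNIV)"


section \<open>Stationarity and mixing\<close>

definition strictly_stationary :: "'w measure \<Rightarrow> 'z measure \<Rightarrow> (int \<Rightarrow> 'w \<Rightarrow> 'z) \<Rightarrow> bool" where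
  "strictly_stationary M S Z \<longleftrightarrow>
     (\<forall>t. Z t \<in> measurable M S) \<and>
     (\<forall>h. distr M (\<Pi>\<^sub>M t\<in>UNIV. S) (\<lambda>\<omega> t. Z (t + h) \<omega>) = distr M (\<Pi>\<^sub>M t\<in>UNIV. S) (\<lambda>\<omega> t. Z t \<omega>))"

definition gen_field ::
  "'w measure \<Rightarrow> 'z measure \<Rightarrow> (int \<Rightarrow> 'w \<Rightarrow> 'z) \<Rightarrow> int set \<Rightarrow> 'w measure" where
  "gen_field M S Z I = sigma (space M) {Z t -` A \<inter> space M | t A. t \<in> I \<and> A \<in> sets S}"

definition covar :: "'w measure \<Rightarrow> ('w \<Rightarrow> real) \<Rightarrow> ('w \<Rightarrow> real) \<Rightarrow> real" where
  "covar M U V = (\<integral>\<omega>. (U \<omega> - (\<integral>\<eta>. U \<eta> \<partial>M)) * (V \<omega> - (\<integral>\<eta>. V \<eta> \<partial>M)) \<partial>M)"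

text \<open>The values are extended nonnegative reals, so that the supremum is \<open>0\<close> if one of the
  \<open>\<sigma>\<close>-fields is trivial.\<close>

definition rho_coeff :: "'w measure \<Rightarrow> 'w measure \<Rightarrow> 'w measure \<Rightarrow> ennreal" where
  "rho_coeff M F G =
     Sup {ennreal (\<bar>covar M U V\<bar> / sqrt (covar M U U * covar M V V)) | U V.
        U \<in> borel_measurable F \<and> V \<in> borel_measurable G \<and>
        integrable M (\<lambda>\<omega>. (U \<omega>)\<^sup>2) \<and> integrable M (\<lambda>\<omega>. (V \<omega>)\<^sup>2) \<and>
        covar M U U > 0 \<and> covar M V V > 0}"

definition alpha_coeff :: "'w measure \<Rightarrow> 'w measure \<Rightarrow> 'w measure \<Rightarrow> real" where
  "alpha_coeff M F G =
     Sup {\<bar>measure M (A \<inter> B) - measure M A * measure M B\<bar> | A B. A \<in> sets F \<and> B \<in> sets G}"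

definition rho_mix :: "'w measure \<Rightarrow> 'z measure \<Rightarrow> (int \<Rightarrow> 'w \<Rightarrow> 'z) \<Rightarrow> nat \<Rightarrow> ennreal" where
  "rho_mix M S Z m =
     Sup {rho_coeff M (gen_field M S Z I) (gen_field M S Z J) | I J.
        I \<noteq> {} \<and> J \<noteq> {} \<and> (\<forall>i\<in>I. \<forall>j\<in>J. \<bar>i - j\<bar> \<ge> int m)}"

definition rho_mixing :: "'w measure \<Rightarrow> 'z measure \<Rightarrow> (int \<Rightarrow> 'w \<Rightarrow> 'z) \<Rightarrow> bool" where
  "rho_mixing M S Z \<longleftrightarrow> rho_mix M S Z \<longlonglongrightarrow> 0"

definition alpha11 :: "'w measure \<Rightarrow> 'z measure \<Rightarrow> (int \<Rightarrow> 'w \<Rightarrow> 'z) \<Rightarrow> nat \<Rightarrow> real" where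
  "alpha11 M S Z m =
     Sup {alpha_coeff M (gen_field M S Z {j}) (gen_field M S Z {j + k}) | j k. k \<ge> int m}"


section \<open>The two assumptions\<close>

definition pair_process :: "(int \<Rightarrow> 'w \<Rightarrow> 'k) \<Rightarrow> (int \<Rightarrow> 'w \<Rightarrow> 'k) \<Rightarrow> int \<Rightarrow> 'w \<Rightarrow> 'k \<times> 'k" where
  "pair_process Y1 Y2 t \<omega> = (Y1 t \<omega>, Y2 t \<omega>)"

definition mixing_assumption ::
  "'w measure \<Rightarrow> (int \<Rightarrow> 'w \<Rightarrow> 'k::real_inner) \<Rightarrow> (int \<Rightarrow> 'w \<Rightarrow> 'k) \<Rightarrow> 'k \<Rightarrow> ('k \<Rightarrow> 'k) \<Rightarrow> bool" where
  "mixing_assumption M Y1 Y2 \<mu>1 Q \<longleftrightarrow>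
     rho_mixing M (borel \<Otimes>\<^sub>M borel) (pair_process Y1 Y2) \<and>
     Q \<mu>1 \<bullet> \<mu>1 > 0 \<and>
     (\<exists>\<delta>>0. \<exists>C>0.
        summable (\<lambda>m. alpha11 M (borel \<Otimes>\<^sub>M borel) (pair_process Y1 Y2) (Suc m) powr (\<delta> / (2 + \<delta>))) \<and>
        (\<Sum>m. alpha11 M (borel \<Otimes>\<^sub>M borel) (pair_process Y1 Y2) (Suc m) powr (\<delta> / (2 + \<delta>))) \<le> C)"

definition weight_assumption :: "(real \<Rightarrow> real) \<Rightarrow> bool" where
  "weight_assumption g \<longleftrightarrow>
     (\<forall>\<tau>\<ge>1. g \<tau> > 0) \<and> continuous_on {1..} g \<and> mono_on {1..} g \<and>
     ((\<lambda>\<tau>. sqrt (\<tau> * ln (ln \<tau>)) / g \<tau>) \<longlongrightarrow> 0) at_top \<and>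
     ((\<lambda>T. \<Sum>l. ennreal (2 ^ l * T / (g (2 ^ l * T))\<^sup>2)) \<longlongrightarrow> 0) at_top"


section \<open>The monitoring statistic\<close>

definition psum :: "(nat \<Rightarrow> 'w \<Rightarrow> 'k::real_inner) \<Rightarrow> nat \<Rightarrow> 'w \<Rightarrow> 'k" where
  "psum Y t \<omega> = (\<Sum>i=1..t. Y i \<omega>)"

definition T_stat :: "(nat \<Rightarrow> 'w \<Rightarrow> 'k::real_inner) \<Rightarrow> nat \<Rightarrow> nat \<Rightarrow> nat \<Rightarrow> 'w \<Rightarrow> real" where
  "T_stat Y n k s \<omega> =
     ((1 / real k) *\<^sub>R psum Y k \<omega>) \<bullet>
     ((1 / sqrt (real n)) *\<^sub>R (psum Y s \<omega> - (real s / real k) *\<^sub>R psum Y k \<omega>))"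

definition W_stat :: "(nat \<Rightarrow> 'w \<Rightarrow> 'k::real_inner) \<Rightarrow> nat \<Rightarrow> 'w \<Rightarrow> real" where
  "W_stat Y n \<omega> =
     1 / real n ^ 4 *
     (\<Sum>t=1..n. (psum Y n \<omega> \<bullet> (psum Y t \<omega> - (real t / real n) *\<^sub>R psum Y n \<omega>))\<^sup>2)"

text \<open>On the event \<open>W_stat Y n = 0\<close> the quotient is \<open>0\<close>; its probability tends to \<open>0\<close>, so the
  convention does not affect limits in distribution.\<close>

definition G_stat :: "(nat \<Rightarrow> 'w \<Rightarrow> 'k::real_inner) \<Rightarrow> nat \<Rightarrow> nat \<Rightarrow> 'w \<Rightarrow> real" where
  "G_stat Y n k \<omega> = Max ((\<lambda>s. \<bar>T_stat Y n k s \<omega>\<bar> / sqrt (W_stat Y n \<omega>)) ` {n+1..k-1})"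

text \<open>The supremum over the infinite horizon is taken in the extended reals, since it need not be
  finite on every path.\<close>

definition open_end_stat ::
  "(real \<Rightarrow> real) \<Rightarrow> (nat \<Rightarrow> 'w \<Rightarrow> 'k::real_inner) \<Rightarrow> nat \<Rightarrow> 'w \<Rightarrow> ereal" where
  "open_end_stat g Y n \<omega> =
     (SUP k\<in>{n+2..}. ereal (1 / g (real k / real n) * G_stat Y n k \<omega>))"


section \<open>Brownian motion, the limit variable, convergence in distribution\<close>

definition standard_brownian_motion :: "'v measure \<Rightarrow> (real \<Rightarrow> 'v \<Rightarrow> real) \<Rightarrow> bool" where
  "standard_brownian_motion N B \<longleftrightarrow>
     prob_space N \<and>
     (\<forall>t\<ge>0. B t \<in> borel_measurable N) \<and>
     (\<forall>\<omega>\<in>space N. B 0 \<omega> = 0) \<and>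
     (\<forall>\<omega>\<in>space N. continuous_on {0..} (\<lambda>t. B t \<omega>)) \<and>
     (\<forall>s t. 0 \<le> s \<and> s < t \<longrightarrow>
        distributed N lborel (\<lambda>\<omega>. B t \<omega> - B s \<omega>) (normal_density 0 (sqrt (t - s)))) \<and>
     (\<forall>(m::nat) (u :: nat \<Rightarrow> real). 0 \<le> u 0 \<and> (\<forall>i<m. u i < u (Suc i)) \<longrightarrow>
        prob_space.indep_vars N (\<lambda>_. borel) (\<lambda>i \<omega>. B (u (Suc i)) \<omega> - B (u i) \<omega>) {..<m})"

definition limit_variable :: "(real \<Rightarrow> real) \<Rightarrow> (real \<Rightarrow> 'v \<Rightarrow> real) \<Rightarrow> 'v \<Rightarrow> ereal" where
  "limit_variable g B \<omega> =
     ereal (1 / sqrt (LBINT u:{0..1}. (B u \<omega> - u * B 1 \<omega>)\<^sup>2)) *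
     (SUP \<tau>\<in>{1..}. SUP r\<in>{1..\<tau>}. ereal (\<bar>B r \<omega> - r / \<tau> * B \<tau> \<omega>\<bar> / g \<tau>))"

text \<open>The library's \<open>weak_conv_m\<close> is confined to real-valued variables. For a limit that is almost
  surely finite, weak convergence in the extended reals is ordinary weak convergence.\<close>

definition converges_in_distribution ::
  "'w measure \<Rightarrow> (nat \<Rightarrow> 'w \<Rightarrow> 'b::topological_space) \<Rightarrow> 'v measure \<Rightarrow> ('v \<Rightarrow> 'b) \<Rightarrow> bool" where
  "converges_in_distribution M Z N L \<longleftrightarrow>
     (\<forall>n. Z n \<in> borel_measurable M) \<and> L \<in> borel_measurable N \<and>
     (\<forall>\<psi> :: 'b \<Rightarrow> real. continuous_on UNIV \<psi> \<and> bounded (range \<psi>) \<longrightarrow>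
        (\<lambda>n. \<integral>\<omega>. \<psi> (Z n \<omega>) \<partial>M) \<longlonglongrightarrow> (\<integral>\<omega>. \<psi> (L \<omega>) \<partial>N))"

end

theory Submission
  imports Defs
begin

text \<open>
  The coefficient \<open>\<rho>(m)\<close> compares arbitrary index sets at distance \<open>m\<close>, interlaced ones included.
  Hence a sum over \<open>m\<close>-spaced indices has second and fourth moments comparable with the averages,
  over all choices of signs, of the moments of the signed sums, and those averages are explicit. This gives
  \<open>E \<parallel>S\<parallel>\<^sup>4 \<le> C n\<^sup>2\<close> for the centred partial sums in the Hilbert space, a maximal inequality and, by
  blocks separated by gaps, a central limit theorem for \<open>\<langle>S, \<mu>\<rangle>\<close>.

  As \<open>U\<^sub>k / k\<close> is close to \<open>\<mu>\<close> and the means cancel in \<open>U\<^sub>s - (s/k) U\<^sub>k\<close>, the statistic is close to the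
  same functional of the scalar partial sums \<open>\<langle>S, \<mu>\<rangle>\<close>. On a bounded horizon it is approximated by a
  function of the increments over a fixed finite grid, which converge to those of Brownian motion.
  The maximal inequality on dyadic blocks bounds the part beyond \<open>T n\<close> by a multiple of
  \<open>\<Sum>\<^sub>l 2\<^sup>l T / g(2\<^sup>l T)\<^sup>2\<close>, uniformly in \<open>n\<close>.
\<close>

section \<open>Averages over signs\<close>

text \<open>Mixing in the sense of \<open>\<rho>\<close> comes without a rate, so a scheme with a
  growing number of blocks would accumulate an uncontrolled number of errors
  \<open>r (gap n)\<close>. The number \<open>d\<close> of blocks therefore stays fixed while
  \<open>n\<close> grows: every mixing error vanishes, a third-moment remainder of order
  \<open>1 / sqrt d\<close> survives, and \<open>d\<close> is released last. The later limits are
  iterated in the same way: mesh and horizon are frozen, \<open>n\<close> tends to infinity, and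
  only afterwards are they refined, which requires error bounds that hold for all large
  \<open>n\<close>. Convergence is tested with uniformly continuous functions of a pair, the
  weighted maximum and the root of the normaliser. The two are kept together because they come from
  the same path. Exceptional events are controlled by moments or by continuous cutoffs whose
  expectations converge. The quotient is formed late, because it is continuous only away from a zero
  normaliser; the Brownian bridge supplies the missing fact that the limiting normaliser is almost
  surely positive.\<close>

lemma sum_Pow_insert:
  fixes f :: "'a set \<Rightarrow> real"
  assumes "finite A" "a \<notin> A"
  shows "(\<Sum>B\<in>Pow (insert a A). f B) = (\<Sum>B\<in>Pow A. f B + f (insert a B))"
proof -
  have "(\<Sum>B\<in>Pow (insert a A). f B) = (\<Sum>B\<in>Pow A. f B) + (\<Sum>B\<in>insert a ` Pow A. f B)"
    unfolding Pow_insert using assms by (intro sum.union_disjoint) auto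
  also have "(\<Sum>B\<in>insert a ` Pow A. f B) = (\<Sum>B\<in>Pow A. f (insert a B))"
    using assms by (subst sum.reindex) (auto simp: inj_on_def)
  finally show ?thesis by (simp add: sum.distrib)
qed

lemma sign_sums_insert:
  fixes x :: "'a \<Rightarrow> 'k::real_vector"
  assumes "finite A" "a \<notin> A" "B \<subseteq> A"
  shows "u + sum x B - sum x (insert a A - B) = (u - x a) + sum x B - sum x (A - B)"
    and "u + sum x (insert a B) - sum x (insert a A - insert a B) = (u + x a) + sum x B - sum x (A - B)"
proof -
  have f: "finite B" using assms finite_subset by blast
  have "insert a A - B = insert a (A - B)" using assms by auto
  then show "u + sum x B - sum x (insert a A - B) = (u - x a) + sum x B - sum x (A - B)"
    using assms by simp
  have "insert a A - insert a B = A - B" "a \<notin> B" using assms by auto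
  then show "u + sum x (insert a B) - sum x (insert a A - insert a B) = (u + x a) + sum x B - sum x (A - B)"
    using f by (simp add: algebra_simps)
qed

lemma norm_sq_plus_minus:
  fixes u x :: "'k::real_inner"
  shows "(norm (u - x))\<^sup>2 + (norm (u + x))\<^sup>2 = 2 * ((norm u)\<^sup>2 + (norm x)\<^sup>2)"
  by (simp add: power2_norm_eq_inner algebra_simps inner_commute)

text \<open>Squaring \<open>a + b - 2 * c\<close> and \<open>a + b + 2 * c\<close> and adding
  cancels the odd terms. The remaining \<open>8 * c\<^sup>2\<close> is at most
  \<open>8 * a * b\<close> by Cauchy-Schwarz, which turns the mixed coefficient 2 into 6.\<close>

lemma norm_fourth_plus_minus:
  fixes u x :: "'k::real_inner"
  shows "(norm (u - x))^4 + (norm (u + x))^4 \<le> 2 * ((norm u)^4 + 6 * (norm u)\<^sup>2 * (norm x)\<^sup>2 + (norm x)^4)"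
proof -
  have n4: "(norm y)^4 = ((norm y)\<^sup>2)\<^sup>2" for y :: 'k by simp
  define a b c where "a = (norm u)\<^sup>2" and "b = (norm x)\<^sup>2" and "c = u \<bullet> x"
  have e: "(norm (u - x))\<^sup>2 = a + b - 2 * c" "(norm (u + x))\<^sup>2 = a + b + 2 * c"
    by (simp_all add: a_def b_def c_def power2_norm_eq_inner algebra_simps inner_commute)
  have "c\<^sup>2 \<le> a * b"
    unfolding a_def b_def c_def power2_norm_eq_inner by (rule Cauchy_Schwarz_ineq)
  then show ?thesis
    unfolding n4 e a_def[symmetric] b_def[symmetric] by (simp add: power2_eq_square algebra_simps)
qed

text \<open>A choice of signs is encoded by the set \<open>B\<close> of indices with sign plus. The
  free offset \<open>u\<close> carries the induction: the term of the new index joins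
  \<open>u\<close> with either sign, and the parallelogram law removes the cross term.\<close>

lemma sum_signs_sq:
  fixes x :: "'a \<Rightarrow> 'k::real_inner"
  assumes "finite A"
  shows "(\<Sum>B\<in>Pow A. (norm (u + sum x B - sum x (A - B)))\<^sup>2)
    = 2 ^ card A * ((norm u)\<^sup>2 + (\<Sum>i\<in>A. (norm (x i))\<^sup>2))"
  using assms
proof (induction A arbitrary: u rule: finite_induct)
  case (insert a A)
  have "(\<Sum>B\<in>Pow (insert a A). (norm (u + sum x B - sum x (insert a A - B)))\<^sup>2)
    = (\<Sum>B\<in>Pow A. (norm ((u - x a) + sum x B - sum x (A - B)))\<^sup>2)
      + (\<Sum>B\<in>Pow A. (norm ((u + x a) + sum x B - sum x (A - B)))\<^sup>2)"
    unfolding sum_Pow_insert[OF insert.hyps] sum.distrib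
    by (intro arg_cong2[where f="(+)"] sum.cong refl) (simp_all only: Pow_iff sign_sums_insert[OF insert.hyps])
  also have "\<dots> = 2 ^ card A * (((norm (u - x a))\<^sup>2 + (norm (u + x a))\<^sup>2) + 2 * (\<Sum>i\<in>A. (norm (x i))\<^sup>2))"
    unfolding insert.IH by (simp add: algebra_simps)
  also have "\<dots> = 2 ^ card (insert a A) * ((norm u)\<^sup>2 + (\<Sum>i\<in>insert a A. (norm (x i))\<^sup>2))"
    unfolding norm_sq_plus_minus using insert.hyps by (simp add: algebra_simps)
  finally show ?case .
qed auto

text \<open>A Khintchine inequality in Hilbert space with the Gaussian constant 3, which is the case
  \<open>u = 0\<close>. The offset again absorbs the new term.\<close>

lemma sum_signs_fourth:
  fixes x :: "'a \<Rightarrow> 'k::real_inner"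
  assumes "finite A"
  shows "(\<Sum>B\<in>Pow A. (norm (u + sum x B - sum x (A - B)))^4)
    \<le> 2 ^ card A * ((norm u)^4 + 6 * (norm u)\<^sup>2 * (\<Sum>i\<in>A. (norm (x i))\<^sup>2) + 3 * (\<Sum>i\<in>A. (norm (x i))\<^sup>2)\<^sup>2)"
  using assms
proof (induction A arbitrary: u rule: finite_induct)
  case (insert a A)
  define s where "s = (\<Sum>i\<in>A. (norm (x i))\<^sup>2)"
  have s0: "s \<ge> 0" by (simp add: s_def sum_nonneg)
  have "(\<Sum>B\<in>Pow (insert a A). (norm (u + sum x B - sum x (insert a A - B)))^4)
    = (\<Sum>B\<in>Pow A. (norm ((u - x a) + sum x B - sum x (A - B)))^4)
      + (\<Sum>B\<in>Pow A. (norm ((u + x a) + sum x B - sum x (A - B)))^4)"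
    unfolding sum_Pow_insert[OF insert.hyps] sum.distrib
    by (intro arg_cong2[where f="(+)"] sum.cong refl) (simp_all only: Pow_iff sign_sums_insert[OF insert.hyps])
  also have "\<dots> \<le> 2 ^ card A * ((norm (u - x a))^4 + 6 * (norm (u - x a))\<^sup>2 * s + 3 * s\<^sup>2)
      + 2 ^ card A * ((norm (u + x a))^4 + 6 * (norm (u + x a))\<^sup>2 * s + 3 * s\<^sup>2)"
    using insert.IH unfolding s_def by (intro add_mono) auto
  also have "\<dots> = 2 ^ card A * (((norm (u - x a))^4 + (norm (u + x a))^4)
      + 6 * ((norm (u - x a))\<^sup>2 + (norm (u + x a))\<^sup>2) * s + 6 * s\<^sup>2)"
    by (simp add: algebra_simps)
  also have "\<dots> \<le> 2 ^ card A * (2 * ((norm u)^4 + 6 * (norm u)\<^sup>2 * (norm (x a))\<^sup>2 + (norm (x a))^4)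
      + 6 * (2 * ((norm u)\<^sup>2 + (norm (x a))\<^sup>2)) * s + 6 * s\<^sup>2)"
    unfolding norm_sq_plus_minus using norm_fourth_plus_minus[of u "x a"]
    by (intro mult_left_mono add_right_mono) auto
  \<comment> \<open>The coefficient of \<open>(norm (x a))^4\<close> is raised from 1 to 3 to
    complete the square of the enlarged sum.\<close>
  also have "\<dots> \<le> 2 ^ card A * (2 * ((norm u)^4 + 6 * (norm u)\<^sup>2 * (norm (x a))\<^sup>2 + 3 * (norm (x a))^4)
      + 6 * (2 * ((norm u)\<^sup>2 + (norm (x a))\<^sup>2)) * s + 6 * s\<^sup>2)"
    by (intro mult_left_mono add_right_mono) auto
  also have "\<dots> = 2 ^ card (insert a A) * ((norm u)^4
      + 6 * (norm u)\<^sup>2 * (\<Sum>i\<in>insert a A. (norm (x i))\<^sup>2) + 3 * (\<Sum>i\<in>insert a A. (norm (x i))\<^sup>2)\<^sup>2)"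
    using insert.hyps unfolding s_def by (simp add: algebra_simps power2_eq_square power4_eq_xxxx)
  finally show ?case .
qed auto

text \<open>Cauchy-Schwarz against the constant 1, applied twice: to the norms and to their
  squares.\<close>

lemma norm_sum_fourth_le:
  fixes x :: "'a \<Rightarrow> 'k::real_normed_vector"
  assumes "finite A"
  shows "(norm (sum x A))^4 \<le> real (card A)^3 * (\<Sum>i\<in>A. (norm (x i))^4)"
proof -
  have sq: "(\<Sum>i\<in>A. c i)\<^sup>2 \<le> real (card A) * (\<Sum>i\<in>A. (c i)\<^sup>2)" for c :: "'a \<Rightarrow> real"
    using Cauchy_Schwarz_ineq_sum[of "\<lambda>_. 1" c A] by simp
  have "(norm (sum x A))^4 \<le> (\<Sum>i\<in>A. norm (x i))^4"
    by (intro power_mono norm_sum) auto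
  also have "\<dots> = ((\<Sum>i\<in>A. norm (x i))\<^sup>2)\<^sup>2" by simp
  also have "\<dots> \<le> (real (card A) * (\<Sum>i\<in>A. (norm (x i))\<^sup>2))\<^sup>2"
    by (intro power_mono sq) auto
  also have "\<dots> = (real (card A))\<^sup>2 * (\<Sum>i\<in>A. (norm (x i))\<^sup>2)\<^sup>2" by (simp add: power_mult_distrib)
  also have "\<dots> \<le> (real (card A))\<^sup>2 * (real (card A) * (\<Sum>i\<in>A. ((norm (x i))\<^sup>2)\<^sup>2))"
    by (intro mult_left_mono sq) auto
  finally show ?thesis by (simp add: power2_eq_square power3_eq_cube algebra_simps power4_eq_xxxx)
qed

lemma norm_plus_fourth_le:
  fixes a b :: "'k::real_normed_vector"
  shows "(norm (a + b))^4 \<le> 8 * ((norm a)^4 + (norm b)^4)"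
  using norm_sum_fourth_le[of "{True, False}" "\<lambda>i. if i then a else b"] by simp

section \<open>Orthonormal systems\<close>

text \<open>Zero vectors are allowed among the \<open>e i\<close>, so that linearly dependent
  \<open>y\<close> need no reindexing. Dependent choice builds finite prefixes \<open>E n\<close> as
  lists that extend each other.\<close>

lemma gram_schmidt_sequence:
  fixes y :: "nat \<Rightarrow> 'k::real_inner"
  obtains e :: "nat \<Rightarrow> 'k" where
    "\<And>i j. i \<noteq> j \<Longrightarrow> e i \<bullet> e j = 0" "\<And>i. norm (e i) = 1 \<or> e i = 0"
    "\<And>n. y n \<in> span (e ` {..n})"
proof -
  have "\<exists>E :: nat \<Rightarrow> 'k list. \<forall>n. (length (E n) = n \<and> (\<forall>i<n. norm (E n ! i) = 1 \<or> E n ! i = 0) \<and>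
      (\<forall>i<n. \<forall>j<n. i \<noteq> j \<longrightarrow> E n ! i \<bullet> E n ! j = 0) \<and> (\<forall>i<n. y i \<in> span (set (take (Suc i) (E n)))))
      \<and> (\<exists>a. E (Suc n) = E n @ [a])"
  proof (rule dependent_nat_choice)
    show "\<exists>x :: 'k list. length x = 0 \<and> (\<forall>i<0. norm (x ! i) = 1 \<or> x ! i = 0) \<and>
      (\<forall>i<0. \<forall>j<0. i \<noteq> j \<longrightarrow> x ! i \<bullet> x ! j = 0) \<and> (\<forall>i<0. y i \<in> span (set (take (Suc i) x)))" by auto
  next
    fix E :: "'k list" and n
    assume *: "length E = n \<and> (\<forall>i<n. norm (E ! i) = 1 \<or> E ! i = 0) \<and>
      (\<forall>i<n. \<forall>j<n. i \<noteq> j \<longrightarrow> E ! i \<bullet> E ! j = 0) \<and> (\<forall>i<n. y i \<in> span (set (take (Suc i) E)))"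
    define r where "r = y n - (\<Sum>i<n. (y n \<bullet> E ! i) *\<^sub>R E ! i)"
    have orth: "r \<bullet> E ! j = 0" if j: "j < n" for j
    proof -
      have "(\<Sum>i<n. (y n \<bullet> E ! i) *\<^sub>R E ! i) \<bullet> E ! j = (\<Sum>i<n. if i = j then (y n \<bullet> E ! j) * (E ! j \<bullet> E ! j) else 0)"
        unfolding inner_sum_left using * j by (intro sum.cong) auto
      also have "\<dots> = y n \<bullet> E ! j"
        using * j by (auto simp: norm_eq_1)
      finally show ?thesis by (simp add: r_def inner_diff_left)
    qed
    \<comment> \<open>\<open>sgn r\<close> is the normalised residual, and it is 0 when
      \<open>y n\<close> already lies in the span of the earlier vectors.\<close>
    define a where "a = sgn r"
    have a1: "norm a = 1 \<or> a = 0" by (auto simp: a_def norm_sgn)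
    have aorth: "a \<bullet> E ! j = 0" if "j < n" for j
      using orth[OF that] by (simp add: a_def sgn_div_norm)
    have "y n = norm r *\<^sub>R a + (\<Sum>i<n. (y n \<bullet> E ! i) *\<^sub>R E ! i)"
      by (cases "r = 0") (auto simp: a_def sgn_div_norm, simp_all add: r_def)
    moreover have "\<dots> \<in> span (set (E @ [a]))"
      using * by (intro span_add span_scale span_sum span_base) auto
    ultimately have yn: "y n \<in> span (set (E @ [a]))" by simp
    let ?F = "E @ [a]"
    have "(length ?F = Suc n \<and> (\<forall>i<Suc n. norm (?F ! i) = 1 \<or> ?F ! i = 0) \<and>
      (\<forall>i<Suc n. \<forall>j<Suc n. i \<noteq> j \<longrightarrow> ?F ! i \<bullet> ?F ! j = 0) \<and> (\<forall>i<Suc n. y i \<in> span (set (take (Suc i) ?F))))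
      \<and> (\<exists>a. ?F = E @ [a])"
      using * a1 aorth yn by (auto simp: nth_append less_Suc_eq inner_commute)
    then show "\<exists>F. (length F = Suc n \<and> (\<forall>i<Suc n. norm (F ! i) = 1 \<or> F ! i = 0) \<and>
      (\<forall>i<Suc n. \<forall>j<Suc n. i \<noteq> j \<longrightarrow> F ! i \<bullet> F ! j = 0) \<and> (\<forall>i<Suc n. y i \<in> span (set (take (Suc i) F))))
      \<and> (\<exists>a. F = E @ [a])" by blast
  qed
  then obtain E :: "nat \<Rightarrow> 'k list" where len: "\<And>n. length (E n) = n"
    and n1: "\<And>n i. i < n \<Longrightarrow> norm (E n ! i) = 1 \<or> E n ! i = 0"
    and o: "\<And>n i j. i < n \<Longrightarrow> j < n \<Longrightarrow> i \<noteq> j \<Longrightarrow> E n ! i \<bullet> E n ! j = 0"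
    and sp: "\<And>n i. i < n \<Longrightarrow> y i \<in> span (set (take (Suc i) (E n)))"
    and ext: "\<And>n. \<exists>a. E (Suc n) = E n @ [a]" by metis
  define e where "e i = E (Suc i) ! i" for i
  \<comment> \<open>Later prefixes extend earlier ones, so entry \<open>i\<close> never changes
    after stage \<open>Suc i\<close>.\<close>
  have stab: "E n ! i = e i" if "i < n" for n i
    using that
  proof (induction n)
    case (Suc n)
    show ?case
    proof (cases "i = n")
      case True then show ?thesis by (simp add: e_def)
    next
      case False
      then have "i < n" using Suc by simp
      moreover obtain a where "E (Suc n) = E n @ [a]" using ext by blast
      ultimately show ?thesis using Suc.IH len[of n] by (simp add: nth_append)
    qed
  qed simp
  have "set (take (Suc n) (E (Suc n))) = e ` {..n}" for n
  proof -
    have "set (take (Suc n) (E (Suc n))) = set (E (Suc n))" using len[of "Suc n"] by simp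
    also have "\<dots> = (\<lambda>i. E (Suc n) ! i) ` {..n}"
      unfolding set_conv_nth len by (auto simp: less_Suc_eq_le)
    also have "\<dots> = e ` {..n}" using stab[of _ "Suc n"] by (intro image_cong) auto
    finally show ?thesis .
  qed
  then have "y n \<in> span (e ` {..n})" for n using sp[of n "Suc n"] by simp
  moreover have "norm (e i) = 1 \<or> e i = 0" for i using n1[of i "Suc i"] by (simp add: e_def)
  moreover have "e i \<bullet> e j = 0" if "i \<noteq> j" for i j
    using o[of i "Suc (max i j)" j] that stab[of i "Suc (max i j)"] stab[of j "Suc (max i j)"] by simp
  ultimately show ?thesis using that by blast
qed

text \<open>\<open>P m a\<close> is the point of the span of the first \<open>m\<close> vectors
  nearest to \<open>a\<close>, so approximability of \<open>a\<close> by the spans forces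
  \<open>P m a\<close> to converge to \<open>a\<close>. Only \<open>a\<close> has to lie in the
  closed span; \<open>b\<close> is merely paired with the limit.\<close>

lemma parseval_closure:
  fixes e :: "nat \<Rightarrow> 'k::real_inner" and a b :: 'k
  assumes orth: "\<And>i j. i \<noteq> j \<Longrightarrow> e i \<bullet> e j = 0" and n1: "\<And>i. norm (e i) = 1 \<or> e i = 0"
    and cl: "\<And>\<epsilon>. \<epsilon> > 0 \<Longrightarrow> \<exists>n. \<exists>z\<in>span (e ` {..n}). norm (a - z) < \<epsilon>"
  shows "(\<lambda>m. \<Sum>l<m. (a \<bullet> e l) * (b \<bullet> e l)) \<longlonglongrightarrow> a \<bullet> b"
proof -
  define P where "P m x = (\<Sum>l<m. (x \<bullet> e l) *\<^sub>R e l)" for m and x :: 'k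
  have Pe: "P m x \<bullet> e l = (if l < m then x \<bullet> e l else 0)" for m x l
  proof -
    have "P m x \<bullet> e l = (\<Sum>i<m. if i = l then (x \<bullet> e l) * (e l \<bullet> e l) else 0)"
      unfolding P_def inner_sum_left using orth by (intro sum.cong) auto
    also have "\<dots> = (if l < m then (x \<bullet> e l) * (e l \<bullet> e l) else 0)" by simp
    also have "\<dots> = (if l < m then x \<bullet> e l else 0)" using n1[of l] by (auto simp: norm_eq_1)
    finally show ?thesis .
  qed
  have min: "norm (x - P m x) \<le> norm (x - z)" if z: "z \<in> span (e ` {..<m})" for m x z
  proof -
    have o1: "orthogonal (x - P m x) w" if "w \<in> span (e ` {..<m})" for w
      using that by (rule orthogonal_to_span) (use Pe in \<open>auto simp: orthogonal_def inner_diff_left\<close>)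
    have "P m x \<in> span (e ` {..<m})" unfolding P_def by (intro span_sum span_scale span_base) auto
    then have "orthogonal (x - P m x) (P m x - z)" using z by (intro o1 span_diff)
    then have "(norm (x - P m x + (P m x - z)))\<^sup>2 = (norm (x - P m x))\<^sup>2 + (norm (P m x - z))\<^sup>2"
      by (rule norm_add_Pythagorean)
    then have "(norm (x - P m x))\<^sup>2 \<le> (norm (x - z))\<^sup>2" by simp
    then show ?thesis by (rule power2_le_imp_le) simp
  qed
  have "(\<lambda>m. P m a) \<longlonglongrightarrow> a"
  proof (rule LIMSEQ_I)
    fix \<epsilon> :: real assume "\<epsilon> > 0"
    then obtain n z where z: "z \<in> span (e ` {..n})" "norm (a - z) < \<epsilon>" using cl by blast
    have "norm (P m a - a) < \<epsilon>" if "m \<ge> Suc n" for m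
    proof -
      have "span (e ` {..n}) \<subseteq> span (e ` {..<m})" using that by (intro span_mono) auto
      then show ?thesis using min[of z m a] z by (auto simp: norm_minus_commute)
    qed
    then show "\<exists>no. \<forall>m\<ge>no. norm (P m a - a) < \<epsilon>" by blast
  qed
  then have "(\<lambda>m. P m a \<bullet> b) \<longlonglongrightarrow> a \<bullet> b" by (intro tendsto_intros)
  moreover have "P m a \<bullet> b = (\<Sum>l<m. (a \<bullet> e l) * (b \<bullet> e l))" for m
    unfolding P_def inner_sum_left by (intro sum.cong) (auto simp: inner_commute)
  ultimately show ?thesis by simp
qed

section \<open>Moment bounds for mixing Hilbert space valued sequences\<close>

text \<open>The system \<open>e\<close> makes inner products of the \<open>Z i\<close> measurable although the Hilbert space
  need not be second countable.\<close>

locale mixing_process = prob_space M for M :: "'w measure" +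
  fixes F :: "int set \<Rightarrow> 'w measure" and Z :: "int \<Rightarrow> 'w \<Rightarrow> 'k::real_inner"
    and e :: "nat \<Rightarrow> 'k" and \<kappa> :: real and r :: "nat \<Rightarrow> real"
  assumes F_sub: "U \<in> borel_measurable (F I) \<Longrightarrow> U \<in> borel_measurable M"
    and Z_meas: "i \<in> I \<Longrightarrow> (\<lambda>\<omega>. Z i \<omega> \<bullet> h) \<in> borel_measurable (F I)"
    and Z_bound: "norm (Z i \<omega>) \<le> \<kappa>"
    and Z_inner: "(\<lambda>m. \<Sum>l<m. (Z i \<omega> \<bullet> e l) * (Z j \<omega> \<bullet> e l)) \<longlonglongrightarrow> Z i \<omega> \<bullet> Z j \<omega>"
    and Z_mean: "expectation (\<lambda>\<omega>. Z i \<omega> \<bullet> h) = 0"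
    and r_nonneg: "0 \<le> r m" and r_lim: "r \<longlonglongrightarrow> 0"
    and mixing: "\<lbrakk>U \<in> borel_measurable (F I); V \<in> borel_measurable (F J); I \<noteq> {}; J \<noteq> {};
      \<And>\<omega>. \<bar>U \<omega>\<bar> \<le> c; \<And>\<omega>. \<bar>V \<omega>\<bar> \<le> c; \<And>i j. i \<in> I \<Longrightarrow> j \<in> J \<Longrightarrow> int m \<le> \<bar>i - j\<bar>\<rbrakk>
      \<Longrightarrow> \<bar>expectation (\<lambda>\<omega>. U \<omega> * V \<omega>) - expectation U * expectation V\<bar>
        \<le> r m / 2 * (expectation (\<lambda>\<omega>. (U \<omega>)\<^sup>2) + expectation (\<lambda>\<omega>. (V \<omega>)\<^sup>2))"
begin

definition S :: "int set \<Rightarrow> 'w \<Rightarrow> 'k" where "S A \<omega> = (\<Sum>i\<in>A. Z i \<omega>)"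

lemma \<kappa>_nonneg: "0 \<le> \<kappa>"
  using Z_bound[of 0 undefined] norm_ge_zero order_trans by blast

lemma integrable_bounded:
  "U \<in> borel_measurable M \<Longrightarrow> (\<And>\<omega>. \<bar>U \<omega>\<bar> \<le> c) \<Longrightarrow> integrable M (U :: 'w \<Rightarrow> real)"
  by (intro integrable_const_bound[where B=c]) auto

lemma norm_S_le: "norm (S A \<omega>) \<le> real (card A) * \<kappa>"
  unfolding S_def by (rule sum_norm_bound) (rule Z_bound)

lemma S_inner_lim: "(\<lambda>m. \<Sum>l<m. (S A \<omega> \<bullet> e l) * (S B \<omega> \<bullet> e l)) \<longlonglongrightarrow> S A \<omega> \<bullet> S B \<omega>"
proof -
  have "(\<Sum>l<m. (S A \<omega> \<bullet> e l) * (S B \<omega> \<bullet> e l))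
      = (\<Sum>i\<in>A. \<Sum>j\<in>B. \<Sum>l<m. (Z i \<omega> \<bullet> e l) * (Z j \<omega> \<bullet> e l))" for m
    unfolding S_def inner_sum_left sum_product
    by (subst sum.swap, rule sum.cong[OF refl], rule sum.swap)
  moreover have "(\<lambda>m. \<Sum>i\<in>A. \<Sum>j\<in>B. \<Sum>l<m. (Z i \<omega> \<bullet> e l) * (Z j \<omega> \<bullet> e l))
      \<longlonglongrightarrow> (\<Sum>i\<in>A. \<Sum>j\<in>B. Z i \<omega> \<bullet> Z j \<omega>)"
    by (intro tendsto_sum Z_inner)
  moreover have "(\<Sum>i\<in>A. \<Sum>j\<in>B. Z i \<omega> \<bullet> Z j \<omega>) = S A \<omega> \<bullet> S B \<omega>"
    unfolding S_def inner_sum_left inner_sum_right by (rule sum.swap)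
  ultimately show ?thesis by simp
qed

lemma measurable_S: "A \<subseteq> I \<Longrightarrow> (\<lambda>\<omega>. S A \<omega> \<bullet> h) \<in> borel_measurable (F I)"
  unfolding S_def inner_sum_left by (intro borel_measurable_sum Z_meas) auto

lemma measurable_inner_S:
  "A \<subseteq> I \<Longrightarrow> B \<subseteq> I \<Longrightarrow> (\<lambda>\<omega>. S A \<omega> \<bullet> S B \<omega>) \<in> borel_measurable (F I)"
  by (rule borel_measurable_LIMSEQ_real[OF S_inner_lim]) (intro borel_measurable_sum borel_measurable_times measurable_S)

lemma measurable_norm_S:
  assumes "A \<subseteq> I"
  shows "(\<lambda>\<omega>. norm (S A \<omega>)) \<in> borel_measurable (F I)"
  unfolding norm_eq_sqrt_inner using measurable_inner_S[OF assms assms] by measurable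

lemma measurable_norm_S_M [measurable]: "(\<lambda>\<omega>. norm (S A \<omega>)) \<in> borel_measurable M"
  using F_sub measurable_norm_S by blast

lemma measurable_inner_S_M [measurable]: "(\<lambda>\<omega>. S A \<omega> \<bullet> h) \<in> borel_measurable M"
  "(\<lambda>\<omega>. S A \<omega> \<bullet> S B \<omega>) \<in> borel_measurable M"
  using F_sub[OF measurable_S, of A UNIV] F_sub[OF measurable_inner_S, of A UNIV B] by auto

lemma S_Un: "finite A \<Longrightarrow> finite B \<Longrightarrow> A \<inter> B = {} \<Longrightarrow> S (A \<union> B) \<omega> = S A \<omega> + S B \<omega>"
  by (simp add: S_def sum.union_disjoint)

lemma norm_S_diff_M [measurable]:
  "finite A \<Longrightarrow> finite B \<Longrightarrow> (\<lambda>\<omega>. norm (S A \<omega> - S B \<omega>)) \<in> borel_measurable M"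
  unfolding norm_eq_sqrt_inner inner_diff_left inner_diff_right by measurable

lemma integrable_S [simp]:
  "integrable M (\<lambda>\<omega>. norm (S A \<omega>) ^ k)"
  "integrable M (\<lambda>\<omega>. S A \<omega> \<bullet> S B \<omega>)"
  "integrable M (\<lambda>\<omega>. (S A \<omega> \<bullet> h) * (S B \<omega> \<bullet> h'))"
  "integrable M (\<lambda>\<omega>. (S A \<omega> \<bullet> h))"
  "integrable M (\<lambda>\<omega>. (S A \<omega> \<bullet> h)^k)"
proof -
  have b: "\<bar>S A \<omega> \<bullet> h\<bar> \<le> real (card A) * \<kappa> * norm h" for A \<omega> h
    using Cauchy_Schwarz_ineq2[of "S A \<omega>" h] mult_right_mono[OF norm_S_le[of A \<omega>] norm_ge_zero[of h]] by linarith
  show "integrable M (\<lambda>\<omega>. norm (S A \<omega>) ^ k)"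
    using norm_S_le by (intro integrable_bounded[where c="(real (card A) * \<kappa>)^k"]) (auto intro!: power_mono)
  show "integrable M (\<lambda>\<omega>. S A \<omega> \<bullet> S B \<omega>)"
    using norm_S_le[of A] norm_S_le[of B] \<kappa>_nonneg
    by (intro integrable_bounded[where c="(real (card A) * \<kappa>) * (real (card B) * \<kappa>)"])
      (auto intro!: order_trans[OF Cauchy_Schwarz_ineq2] mult_mono)
  show "integrable M (\<lambda>\<omega>. (S A \<omega> \<bullet> h) * (S B \<omega> \<bullet> h'))"
    using b[of A _ h] b[of B _ h'] \<kappa>_nonneg
    by (intro integrable_bounded[where c="(real (card A) * \<kappa> * norm h) * (real (card B) * \<kappa> * norm h')"])
      (auto simp: abs_mult intro!: mult_mono)
  show "integrable M (\<lambda>\<omega>. (S A \<omega> \<bullet> h))"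
    by (rule integrable_bounded[OF _ b]) measurable
  show "integrable M (\<lambda>\<omega>. (S A \<omega> \<bullet> h)^k)"
    using b[of A _ h] by (intro integrable_bounded[where c="(real (card A) * \<kappa> * norm h)^k"])
      (auto simp: power_abs intro!: power_mono)
qed

lemma integrable_norm_S_diff [simp]:
  assumes "finite A" "finite B"
  shows "integrable M (\<lambda>\<omega>. norm (S A \<omega> - S B \<omega>) ^ k)"
proof (rule integrable_bounded[where c="(real (card A) * \<kappa> + real (card B) * \<kappa>)^k"])
  show "\<bar>norm (S A \<omega> - S B \<omega>) ^ k\<bar> \<le> (real (card A) * \<kappa> + real (card B) * \<kappa>)^k" for \<omega>
    using norm_S_le[of A \<omega>] norm_S_le[of B \<omega>] norm_triangle_ineq4[of "S A \<omega>" "S B \<omega>"]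
    by (auto simp: intro!: power_mono)
qed (use assms in measurable)

lemma expectation_S: "expectation (\<lambda>\<omega>. S A \<omega> \<bullet> h) = 0"
proof -
  have "integrable M (\<lambda>\<omega>. Z i \<omega> \<bullet> h)" for i
    using integrable_S(4)[of "{i}" h] by (simp add: S_def)
  then show ?thesis by (simp add: S_def inner_sum_left Z_mean)
qed

definition apart :: "nat \<Rightarrow> int set \<Rightarrow> int set \<Rightarrow> bool" where
  "apart m A B \<longleftrightarrow> (\<forall>i\<in>A. \<forall>j\<in>B. int m \<le> \<bar>i - j\<bar>)"

text \<open>The scalar mixing bound is applied to each coordinate along \<open>e\<close>. It is
  additive in the two second moments, so the coordinate bounds can be summed, and Bessel's
  inequality yields one bound for all truncations of the expansion.\<close>

lemma abs_expectation_inner_S_le: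
  assumes fin: "finite A" "finite B" and ap: "apart m A B"
  shows "\<bar>expectation (\<lambda>\<omega>. S A \<omega> \<bullet> S B \<omega>)\<bar>
    \<le> r m / 2 * (expectation (\<lambda>\<omega>. (norm (S A \<omega>))\<^sup>2) + expectation (\<lambda>\<omega>. (norm (S B \<omega>))\<^sup>2))"
proof (cases "A = {} \<or> B = {}")
  case True
  then have "expectation (\<lambda>\<omega>. S A \<omega> \<bullet> S B \<omega>) = 0" by (auto simp: S_def)
  then show ?thesis using r_nonneg[of m] by simp
next
  case False
  define a where "a A l \<omega> = S A \<omega> \<bullet> e l" for A l \<omega>
  have [measurable]: "a A l \<in> borel_measurable M" for A l unfolding a_def by measurable
  have ab: "\<bar>a A l \<omega>\<bar> \<le> real (card A) * \<kappa> * norm (e l)" for A l \<omega>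
    unfolding a_def
    using Cauchy_Schwarz_ineq2[of "S A \<omega>" "e l"] mult_right_mono[OF norm_S_le[of A \<omega>], of "norm (e l)"] by simp
  have iab: "integrable M (\<lambda>\<omega>. a A l \<omega> * a B l \<omega>)" for A B l
    unfolding a_def by simp
  have bessel: "(\<Sum>l<n. (a A l \<omega>)\<^sup>2) \<le> (norm (S A \<omega>))\<^sup>2" for A n \<omega>
  proof -
    have "(\<lambda>m. \<Sum>l<m. (a A l \<omega>)\<^sup>2) \<longlonglongrightarrow> (norm (S A \<omega>))\<^sup>2"
      using S_inner_lim[of A \<omega> A] by (simp add: a_def power2_eq_square[symmetric] power2_norm_eq_inner)
    moreover have "incseq (\<lambda>m. \<Sum>l<m. (a A l \<omega>)\<^sup>2)"
      by (auto simp: incseq_def intro!: sum_mono2)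
    ultimately show ?thesis by (intro incseq_le)
  qed
  have iabsum: "integrable M (\<lambda>\<omega>. (a A l \<omega>)\<^sup>2)" for A l using iab[of A l A] by (simp add: power2_eq_square)
  have bound: "\<bar>expectation (\<lambda>\<omega>. \<Sum>l<n. a A l \<omega> * a B l \<omega>)\<bar>
    \<le> r m / 2 * (expectation (\<lambda>\<omega>. (norm (S A \<omega>))\<^sup>2) + expectation (\<lambda>\<omega>. (norm (S B \<omega>))\<^sup>2))" for n
  proof -
    have one: "\<bar>expectation (\<lambda>\<omega>. a A l \<omega> * a B l \<omega>)\<bar>
        \<le> r m / 2 * (expectation (\<lambda>\<omega>. (a A l \<omega>)\<^sup>2) + expectation (\<lambda>\<omega>. (a B l \<omega>)\<^sup>2))" for l
    proof -
      let ?c = "max (real (card A) * \<kappa> * norm (e l)) (real (card B) * \<kappa> * norm (e l))"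
      have "\<bar>expectation (\<lambda>\<omega>. a A l \<omega> * a B l \<omega>) - expectation (a A l) * expectation (a B l)\<bar>
        \<le> r m / 2 * (expectation (\<lambda>\<omega>. (a A l \<omega>)\<^sup>2) + expectation (\<lambda>\<omega>. (a B l \<omega>)\<^sup>2))"
      proof (rule mixing[where I=A and J=B and c="?c"])
        show "a A l \<in> borel_measurable (F A)" "a B l \<in> borel_measurable (F B)"
          unfolding a_def by (rule measurable_S, simp)+
        show "\<bar>a A l \<omega>\<bar> \<le> ?c" "\<bar>a B l \<omega>\<bar> \<le> ?c" for \<omega>
          using ab[of A l \<omega>] ab[of B l \<omega>] by auto
      qed (use False ap in \<open>auto simp: apart_def\<close>)
      moreover have "expectation (a A l) = 0" for A using expectation_S[of A "e l"] by (simp add: a_def[abs_def])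
      ultimately show ?thesis by simp
    qed
    have "\<bar>expectation (\<lambda>\<omega>. \<Sum>l<n. a A l \<omega> * a B l \<omega>)\<bar> \<le> (\<Sum>l<n. \<bar>expectation (\<lambda>\<omega>. a A l \<omega> * a B l \<omega>)\<bar>)"
      using iab by (simp add: sum_abs)
    also have "\<dots> \<le> (\<Sum>l<n. r m / 2 * (expectation (\<lambda>\<omega>. (a A l \<omega>)\<^sup>2) + expectation (\<lambda>\<omega>. (a B l \<omega>)\<^sup>2)))"
      by (intro sum_mono one)
    also have "\<dots> = r m / 2 * (expectation (\<lambda>\<omega>. \<Sum>l<n. (a A l \<omega>)\<^sup>2) + expectation (\<lambda>\<omega>. \<Sum>l<n. (a B l \<omega>)\<^sup>2))"
      unfolding sum_distrib_left[symmetric] sum.distrib using iabsum by simp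
    also have "\<dots> \<le> r m / 2 * (expectation (\<lambda>\<omega>. (norm (S A \<omega>))\<^sup>2) + expectation (\<lambda>\<omega>. (norm (S B \<omega>))\<^sup>2))"
      using iabsum bessel r_nonneg[of m] by (intro mult_left_mono add_mono integral_mono) auto
    finally show ?thesis .
  qed
  have "(\<lambda>n. expectation (\<lambda>\<omega>. \<Sum>l<n. a A l \<omega> * a B l \<omega>)) \<longlonglongrightarrow> expectation (\<lambda>\<omega>. S A \<omega> \<bullet> S B \<omega>)"
  proof (rule integral_dominated_convergence[where w="\<lambda>\<omega>. (norm (S A \<omega>))\<^sup>2 + (norm (S B \<omega>))\<^sup>2"])
    show "AE \<omega> in M. (\<lambda>n. \<Sum>l<n. a A l \<omega> * a B l \<omega>) \<longlonglongrightarrow> S A \<omega> \<bullet> S B \<omega>"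
      using S_inner_lim by (simp add: a_def)
    have "\<bar>\<Sum>l<n. a A l \<omega> * a B l \<omega>\<bar> \<le> (norm (S A \<omega>))\<^sup>2 + (norm (S B \<omega>))\<^sup>2" for n \<omega>
    proof -
      have "\<bar>\<Sum>l<n. a A l \<omega> * a B l \<omega>\<bar> \<le> (\<Sum>l<n. \<bar>a A l \<omega> * a B l \<omega>\<bar>)" by (rule sum_abs)
      also have "\<dots> \<le> (\<Sum>l<n. (a A l \<omega>)\<^sup>2 + (a B l \<omega>)\<^sup>2)"
      proof (intro sum_mono)
        show "\<bar>a A l \<omega> * a B l \<omega>\<bar> \<le> (a A l \<omega>)\<^sup>2 + (a B l \<omega>)\<^sup>2" for l
          using sum_squares_bound[of "\<bar>a A l \<omega>\<bar>" "\<bar>a B l \<omega>\<bar>"] mult_nonneg_nonneg[of "\<bar>a A l \<omega>\<bar>" "\<bar>a B l \<omega>\<bar>"]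
          unfolding abs_mult power2_abs by linarith
      qed
      also have "\<dots> \<le> (norm (S A \<omega>))\<^sup>2 + (norm (S B \<omega>))\<^sup>2"
        using bessel by (simp add: sum.distrib add_mono)
      finally show ?thesis .
    qed
    then show "AE \<omega> in M. norm (\<Sum>l<n. a A l \<omega> * a B l \<omega>) \<le> (norm (S A \<omega>))\<^sup>2 + (norm (S B \<omega>))\<^sup>2" for n by simp
  qed auto
  from LIMSEQ_le_const2[OF tendsto_rabs[OF this]] bound show ?thesis by blast
qed

definition spaced :: "nat \<Rightarrow> int set \<Rightarrow> bool" where
  "spaced m A \<longleftrightarrow> (\<forall>i\<in>A. \<forall>j\<in>A. i \<noteq> j \<longrightarrow> int m \<le> \<bar>i - j\<bar>)"

lemma apart_spaced: "spaced m A \<Longrightarrow> B \<subseteq> A \<Longrightarrow> apart m B (A - B)"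
  by (fastforce simp: apart_def spaced_def)

lemma S_split: "finite A \<Longrightarrow> B \<subseteq> A \<Longrightarrow> S A \<omega> = S B \<omega> + S (A - B) \<omega>"
  unfolding S_def by (metis sum.subset_diff add.commute)

text \<open>Every subset \<open>B\<close> of a spaced set is \<open>m\<close>-apart from its
  complement, however interlaced the two are. Hence flipping the signs on \<open>A - B\<close>
  changes the second moment by at most a factor 3, and averaging over all \<open>B\<close> leads to
  the explicit sign average.\<close>

lemma second_moment_spaced:
  assumes fin: "finite A" and sp: "spaced m A" and r: "r m \<le> 1 / 2"
  shows "expectation (\<lambda>\<omega>. (norm (S A \<omega>))\<^sup>2) \<le> 3 * \<kappa>\<^sup>2 * card A"
proof -
  have one: "expectation (\<lambda>\<omega>. (norm (S A \<omega>))\<^sup>2) \<le> 3 * expectation (\<lambda>\<omega>. (norm (S B \<omega> - S (A - B) \<omega>))\<^sup>2)"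
    if B: "B \<subseteq> A" for B
  proof -
    have fB: "finite B" "finite (A - B)" using fin B finite_subset by auto
    let ?a = "expectation (\<lambda>\<omega>. (norm (S B \<omega>))\<^sup>2)" and ?b = "expectation (\<lambda>\<omega>. (norm (S (A - B) \<omega>))\<^sup>2)"
      and ?c = "expectation (\<lambda>\<omega>. S B \<omega> \<bullet> S (A - B) \<omega>)"
    have ab: "?a \<ge> 0" "?b \<ge> 0" by auto
    have "\<bar>?c\<bar> \<le> r m / 2 * (?a + ?b)"
      using abs_expectation_inner_S_le[OF fB apart_spaced[OF sp B]] .
    also have "\<dots> \<le> (1 / 2) / 2 * (?a + ?b)"
      using r ab by (intro mult_right_mono) auto
    finally have c: "\<bar>?c\<bar> \<le> (?a + ?b) / 4" by simp
    have "expectation (\<lambda>\<omega>. (norm (S A \<omega>))\<^sup>2) = expectation (\<lambda>\<omega>. (norm (S B \<omega>))\<^sup>2 + (norm (S (A - B) \<omega>))\<^sup>2 + 2 * (S B \<omega> \<bullet> S (A - B) \<omega>))"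
      unfolding S_split[OF fin B] by (intro Bochner_Integration.integral_cong) (auto simp: power2_norm_eq_inner algebra_simps inner_commute)
    also have "\<dots> = ?a + ?b + 2 * ?c" by simp
    finally have e1: "expectation (\<lambda>\<omega>. (norm (S A \<omega>))\<^sup>2) = ?a + ?b + 2 * ?c" .
    have "expectation (\<lambda>\<omega>. (norm (S B \<omega> - S (A - B) \<omega>))\<^sup>2) = expectation (\<lambda>\<omega>. (norm (S B \<omega>))\<^sup>2 + (norm (S (A - B) \<omega>))\<^sup>2 - 2 * (S B \<omega> \<bullet> S (A - B) \<omega>))"
      by (intro Bochner_Integration.integral_cong) (auto simp: power2_norm_eq_inner algebra_simps inner_commute)
    also have "\<dots> = ?a + ?b - 2 * ?c" by simp
    finally have e2: "expectation (\<lambda>\<omega>. (norm (S B \<omega> - S (A - B) \<omega>))\<^sup>2) = ?a + ?b - 2 * ?c" .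
    \<comment> \<open>With \<open>\<bar>?c\<bar> \<le> (?a + ?b) / 4\<close>, the moment of the sum
      is at most 3/2 and that of the difference at least 1/2 of \<open>?a + ?b\<close>, whence the
      factor 3.\<close>
    show ?thesis unfolding e1 e2 using c unfolding abs_le_iff by argo
  qed
  have "2 ^ card A * expectation (\<lambda>\<omega>. (norm (S A \<omega>))\<^sup>2) = (\<Sum>B\<in>Pow A. expectation (\<lambda>\<omega>. (norm (S A \<omega>))\<^sup>2))"
    using fin by (simp add: card_Pow)
  also have "\<dots> \<le> (\<Sum>B\<in>Pow A. 3 * expectation (\<lambda>\<omega>. (norm (S B \<omega> - S (A - B) \<omega>))\<^sup>2))"
    using one by (intro sum_mono) auto
  also have "\<dots> = 3 * expectation (\<lambda>\<omega>. \<Sum>B\<in>Pow A. (norm (S B \<omega> - S (A - B) \<omega>))\<^sup>2)"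
    using fin by (subst Bochner_Integration.integral_sum) (auto simp: sum_distrib_left dest: finite_subset[OF _ fin])
  also have "\<dots> = 3 * expectation (\<lambda>\<omega>. 2 ^ card A * (\<Sum>i\<in>A. (norm (Z i \<omega>))\<^sup>2))"
    using sum_signs_sq[OF fin, of 0 "\<lambda>i. Z i _"] by (simp add: S_def)
  also have "\<dots> \<le> 3 * (2 ^ card A * (card A * \<kappa>\<^sup>2))"
  proof (intro mult_left_mono)
    have s: "(\<Sum>i\<in>A. (norm (Z i \<omega>))\<^sup>2) \<le> card A * \<kappa>\<^sup>2" for \<omega>
      using sum_bounded_above[of A "\<lambda>i. (norm (Z i \<omega>))\<^sup>2" "\<kappa>\<^sup>2"] Z_bound by (simp add: power_mono)
    have "integrable M (\<lambda>\<omega>. (norm (Z i \<omega>))\<^sup>2)" for i using integrable_S(1)[of "{i}" 2] by (simp add: S_def)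
    then have "expectation (\<lambda>\<omega>. \<Sum>i\<in>A. (norm (Z i \<omega>))\<^sup>2) \<le> expectation (\<lambda>\<omega>. card A * \<kappa>\<^sup>2)"
      by (intro integral_mono s) auto
    then show "expectation (\<lambda>\<omega>. 2 ^ card A * (\<Sum>i\<in>A. (norm (Z i \<omega>))\<^sup>2)) \<le> 2 ^ card A * (card A * \<kappa>\<^sup>2)"
      by (simp add: prob_space)
  qed auto
  finally show ?thesis by (simp add: algebra_simps)
qed

text \<open>The same comparison one level up, with mixing applied to squared norms. The constant is
  \<open>256 * 3 + 576\<close>: the 3 comes from the sign average of fourth powers, the 576 from
  products of second moments.\<close>

lemma fourth_moment_spaced:
  assumes fin: "finite A" and sp: "spaced m A" and r: "r m \<le> 1 / 2"
  shows "expectation (\<lambda>\<omega>. (norm (S A \<omega>))^4) \<le> 1344 * \<kappa>^4 * (card A)\<^sup>2"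
proof -
  have one: "expectation (\<lambda>\<omega>. (norm (S A \<omega>))^4)
      \<le> 256 * expectation (\<lambda>\<omega>. (norm (S B \<omega> - S (A - B) \<omega>))^4) + 576 * \<kappa>^4 * (card A)\<^sup>2"
    if B: "B \<subseteq> A" for B
  proof -
    have fB: "finite B" "finite (A - B)" using fin B finite_subset by auto
    let ?a = "expectation (\<lambda>\<omega>. (norm (S B \<omega>))\<^sup>2)" and ?b = "expectation (\<lambda>\<omega>. (norm (S (A - B) \<omega>))\<^sup>2)"
    let ?a4 = "expectation (\<lambda>\<omega>. (norm (S B \<omega>))^4)" and ?b4 = "expectation (\<lambda>\<omega>. (norm (S (A - B) \<omega>))^4)"
    let ?c = "expectation (\<lambda>\<omega>. (norm (S B \<omega>))\<^sup>2 * (norm (S (A - B) \<omega>))\<^sup>2)"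
    let ?d = "expectation (\<lambda>\<omega>. (norm (S B \<omega> - S (A - B) \<omega>))^4)"
    have sub: "B \<subseteq> A" "A - B \<subseteq> A" "B \<union> (A - B) = A" using B by auto
    have cards: "card B \<le> card A" "card (A - B) \<le> card A" using fin B by (auto intro: card_mono)
    have sm: "expectation (\<lambda>\<omega>. (norm (S B' \<omega>))\<^sup>2) \<le> 3 * \<kappa>\<^sup>2 * card A" if "B' \<subseteq> A" for B'
    proof -
      have "spaced m B'" "finite B'" using sp that fin by (auto simp: spaced_def dest: finite_subset[OF _ fin])
      then have "expectation (\<lambda>\<omega>. (norm (S B' \<omega>))\<^sup>2) \<le> 3 * \<kappa>\<^sup>2 * card B'" using r second_moment_spaced[of B' m] by blast
      also have "\<dots> \<le> 3 * \<kappa>\<^sup>2 * card A" using that fin by (intro mult_left_mono) (auto intro: card_mono)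
      finally show ?thesis .
    qed
    have P: "?a * ?b \<le> 9 * \<kappa>^4 * (card A)\<^sup>2"
    proof -
      have "?a * ?b \<le> (3 * \<kappa>\<^sup>2 * card A) * (3 * \<kappa>\<^sup>2 * card A)"
        by (intro mult_mono sm sub) auto
      also have "\<dots> = 9 * \<kappa>^4 * (card A)\<^sup>2" by (simp add: power2_eq_square power4_eq_xxxx)
      finally show ?thesis .
    qed
    \<comment> \<open>Squared norms over separated index sets are nearly uncorrelated. The mixing
      bound needs nonempty index sets; if one is empty, the mixed moment is 0.\<close>
    have c: "?c \<le> ?a * ?b + (?a4 + ?b4) / 4"
    proof (cases "B = {} \<or> A - B = {}")
      case True
      then have "(norm (S B \<omega>))\<^sup>2 * (norm (S (A - B) \<omega>))\<^sup>2 = 0" for \<omega>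
        by (elim disjE) (simp_all only: S_def sum.empty norm_zero zero_power2 mult_zero_left mult_zero_right)
      then have "(\<lambda>\<omega>. (norm (S B \<omega>))\<^sup>2 * (norm (S (A - B) \<omega>))\<^sup>2) = (\<lambda>_. 0)" by (intro ext)
      then have "?c = 0" by (simp only: Bochner_Integration.integral_zero)
      moreover have "?a * ?b \<ge> 0" "?a4 \<ge> 0" "?b4 \<ge> 0" by auto
      ultimately show ?thesis by simp
    next
      case False
      let ?C = "(real (card A) * \<kappa>)\<^sup>2"
      have nb: "norm (S B' \<omega>) \<le> real (card A) * \<kappa>" if "B' \<subseteq> A" for B' \<omega>
      proof -
        have "real (card B') * \<kappa> \<le> real (card A) * \<kappa>"
          using card_mono[OF fin that] \<kappa>_nonneg by (intro mult_right_mono) auto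
        then show ?thesis using norm_S_le[of B' \<omega>] by simp
      qed
      have "\<bar>?c - ?a * ?b\<bar> \<le> r m / 2 * (expectation (\<lambda>\<omega>. ((norm (S B \<omega>))\<^sup>2)\<^sup>2) + expectation (\<lambda>\<omega>. ((norm (S (A - B) \<omega>))\<^sup>2)\<^sup>2))"
        by (rule mixing[where I=B and J="A - B" and c="?C"])
          (use False apart_spaced[OF sp B] nb sub in \<open>auto simp: apart_def intro!: measurable_norm_S borel_measurable_power power_mono\<close>)
      also have "\<dots> = r m / 2 * (?a4 + ?b4)" by simp
      also have "\<dots> \<le> (1 / 2) / 2 * (?a4 + ?b4)"
        using r by (intro mult_right_mono) auto
      finally show ?thesis unfolding abs_le_iff by argo
    qed
    \<comment> \<open>The difference of the squared norms factors as
      \<open>(x - y) \<bullet> (x + y)\<close>. The weight 16 in the square below produces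
      \<open>1 / 32\<close>, which the factor 8 of \<open>norm_plus_fourth_le\<close> turns into the
      absorbable \<open>1 / 4\<close>.\<close>
    have pw: "(norm x)^4 + (norm y)^4 - 2 * ((norm x)\<^sup>2 * (norm y)\<^sup>2)
        \<le> 8 * (norm (x - y))^4 + ((norm x)^4 + (norm y)^4) / 4" for x y :: 'k
    proof -
      have "(norm x)^4 + (norm y)^4 - 2 * ((norm x)\<^sup>2 * (norm y)\<^sup>2) = ((norm x)\<^sup>2 - (norm y)\<^sup>2)\<^sup>2"
        by (simp add: power2_eq_square power4_eq_xxxx algebra_simps)
      also have "(norm x)\<^sup>2 - (norm y)\<^sup>2 = (x - y) \<bullet> (x + y)"
        by (simp add: power2_norm_eq_inner algebra_simps inner_commute)
      also have "((x - y) \<bullet> (x + y))\<^sup>2 \<le> (norm (x - y))\<^sup>2 * (norm (x + y))\<^sup>2"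
        unfolding power2_norm_eq_inner by (rule Cauchy_Schwarz_ineq)
      also have "\<dots> \<le> 8 * (norm (x - y))^4 + (norm (x + y))^4 / 32"
        using zero_le_power2[of "16 * (norm (x - y))\<^sup>2 - (norm (x + y))\<^sup>2"]
        by (simp add: power2_diff power_mult_distrib)
      also have "\<dots> \<le> 8 * (norm (x - y))^4 + ((norm x)^4 + (norm y)^4) / 4"
        using norm_plus_fourth_le[of x y] by simp
      finally show ?thesis .
    qed
    have int: "integrable M (\<lambda>\<omega>. (norm (S B \<omega>))\<^sup>2 * (norm (S (A - B) \<omega>))\<^sup>2)"
      using norm_S_le[of B] norm_S_le[of "A - B"] \<kappa>_nonneg
      by (intro integrable_bounded[where c="(real (card B) * \<kappa>)\<^sup>2 * (real (card (A-B)) * \<kappa>)\<^sup>2"])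
        (auto intro!: mult_mono power_mono)
    have "expectation (\<lambda>\<omega>. (norm (S B \<omega>))^4 + (norm (S (A - B) \<omega>))^4 - 2 * ((norm (S B \<omega>))\<^sup>2 * (norm (S (A - B) \<omega>))\<^sup>2))
      \<le> expectation (\<lambda>\<omega>. 8 * (norm (S B \<omega> - S (A - B) \<omega>))^4 + ((norm (S B \<omega>))^4 + (norm (S (A - B) \<omega>))^4) / 4)"
      using int fB by (intro integral_mono pw) auto
    then have X: "?a4 + ?b4 - 2 * ?c \<le> 8 * ?d + (?a4 + ?b4) / 4"
      using int fB by simp
    have "expectation (\<lambda>\<omega>. (norm (S A \<omega>))^4) \<le> expectation (\<lambda>\<omega>. 8 * ((norm (S B \<omega>))^4 + (norm (S (A - B) \<omega>))^4))"
      unfolding S_split[OF fin B] using S_split[OF fin B] integrable_S(1)[of A 4]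
      by (intro integral_mono norm_plus_fourth_le) auto
    then have "expectation (\<lambda>\<omega>. (norm (S A \<omega>))^4) \<le> 8 * (?a4 + ?b4)" by simp
    \<comment> \<open>With \<open>x\<close> the sum of the two fourth moments, the middle
      inequalities give \<open>x / 4 \<le> 8 * d + 2 * p\<close>. Multiplying by 32 gives
      \<open>256 * d + 64 * p\<close>, and \<open>64 * 9 = 576\<close>.\<close>
    moreover have "E \<le> 8 * x \<Longrightarrow> x - 2 * c \<le> 8 * d + x / 4 \<Longrightarrow> c \<le> p + x / 4 \<Longrightarrow> p \<le> 9 * q
      \<Longrightarrow> E \<le> 256 * d + 576 * q" for E x c d p q :: real by linarith
    ultimately show ?thesis using X c P unfolding mult.assoc by blast
  qed
  have "2 ^ card A * expectation (\<lambda>\<omega>. (norm (S A \<omega>))^4) = (\<Sum>B\<in>Pow A. expectation (\<lambda>\<omega>. (norm (S A \<omega>))^4))"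
    using fin by (simp add: card_Pow)
  also have "\<dots> \<le> (\<Sum>B\<in>Pow A. 256 * expectation (\<lambda>\<omega>. (norm (S B \<omega> - S (A - B) \<omega>))^4) + 576 * \<kappa>^4 * (card A)\<^sup>2)"
    using one by (intro sum_mono) auto
  also have "\<dots> = 256 * expectation (\<lambda>\<omega>. \<Sum>B\<in>Pow A. (norm (S B \<omega> - S (A - B) \<omega>))^4) + 2 ^ card A * (576 * \<kappa>^4 * (card A)\<^sup>2)"
    using fin by (subst Bochner_Integration.integral_sum) (auto simp: sum_distrib_left sum.distrib card_Pow dest: finite_subset[OF _ fin])
  also have "expectation (\<lambda>\<omega>. \<Sum>B\<in>Pow A. (norm (S B \<omega> - S (A - B) \<omega>))^4) \<le> 2 ^ card A * (3 * \<kappa>^4 * (card A)\<^sup>2)"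
  proof -
    have "(\<Sum>B\<in>Pow A. (norm (S B \<omega> - S (A - B) \<omega>))^4) \<le> 2 ^ card A * (3 * \<kappa>^4 * (card A)\<^sup>2)" for \<omega>
    proof -
      have "(\<Sum>B\<in>Pow A. (norm (S B \<omega> - S (A - B) \<omega>))^4) \<le> 2 ^ card A * (3 * (\<Sum>i\<in>A. (norm (Z i \<omega>))\<^sup>2)\<^sup>2)"
        using sum_signs_fourth[OF fin, of 0 "\<lambda>i. Z i \<omega>"] by (simp add: S_def)
      also have "\<dots> \<le> 2 ^ card A * (3 * (card A * \<kappa>\<^sup>2)\<^sup>2)"
        using sum_bounded_above[of A "\<lambda>i. (norm (Z i \<omega>))\<^sup>2" "\<kappa>\<^sup>2"] Z_bound
        by (intro mult_left_mono power_mono) (auto simp: power_mono sum_nonneg)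
      finally show ?thesis by (simp add: power_mult_distrib mult_ac)
    qed
    then have "expectation (\<lambda>\<omega>. \<Sum>B\<in>Pow A. (norm (S B \<omega> - S (A - B) \<omega>))^4) \<le> expectation (\<lambda>\<omega>. 2 ^ card A * (3 * \<kappa>^4 * (card A)\<^sup>2))"
      by (intro integral_mono Bochner_Integration.integrable_sum integrable_norm_S_diff) (use fin in \<open>auto dest: finite_subset[OF _ fin]\<close>)
    then show ?thesis by (simp add: prob_space)
  qed
  finally have "2 ^ card A * expectation (\<lambda>\<omega>. (norm (S A \<omega>))^4) \<le> 2 ^ card A * (1344 * \<kappa>^4 * (card A)\<^sup>2)"
    by (simp add: algebra_simps)
  then show ?thesis by simp
qed

text \<open>For a fixed \<open>m\<close> with \<open>r m \<le> 1 / 2\<close>, the residue classes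
  modulo \<open>m\<close> of any finite set are spaced. Recombining them costs \<open>m^3\<close> by
  the power mean inequality and one more \<open>m\<close> for the number of classes; the added 1
  keeps the constant positive.\<close>

lemma fourth_moment:
  obtains C :: real where "C > 0" "\<And>A. finite A \<Longrightarrow> expectation (\<lambda>\<omega>. (norm (S A \<omega>))^4) \<le> C * (card A)\<^sup>2"
proof -
  have "\<forall>\<^sub>F m in sequentially. r m < 1 / 2" using r_lim by (rule order_tendstoD) simp
  then have "\<forall>\<^sub>F m in sequentially. r m \<le> 1 / 2 \<and> m > 0"
    by (intro eventually_conj eventually_gt_at_top) (auto elim: eventually_mono)
  then obtain m where m: "r m \<le> 1 / 2" "m > 0"
    by (auto dest: eventually_happens)
  have "expectation (\<lambda>\<omega>. (norm (S A \<omega>))^4) \<le> (real m ^ 4 * (1344 * \<kappa>^4) + 1) * (card A)\<^sup>2" if fin: "finite A" for A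
  proof -
    define R where "R c = {i \<in> A. i mod int m = c}" for c
    have fR: "finite (R c)" for c using fin by (simp add: R_def)
    have spR: "spaced m (R c)" for c
    proof -
      have "int m \<le> \<bar>i - j\<bar>" if "i mod int m = j mod int m" "i \<noteq> j" for i j :: int
      proof -
        have "int m dvd i - j" using that by (simp add: mod_eq_dvd_iff)
        then show ?thesis using that dvd_imp_le_int[of "i - j" "int m"] by simp
      qed
      then show ?thesis by (auto simp: spaced_def R_def)
    qed
    have split: "S A \<omega> = sum (\<lambda>c. S (R c) \<omega>) {0..<int m}" for \<omega>
    proof -
      have "(\<lambda>i. i mod int m) ` A \<subseteq> {0..<int m}" using m by auto
      from sum.group[OF fin finite_atLeastLessThan_int this, of "\<lambda>i. Z i \<omega>"]
      show ?thesis unfolding S_def R_def by (rule sym)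
    qed
    have "(norm (S A \<omega>))^4 \<le> real m ^ 3 * (\<Sum>c\<in>{0..<int m}. (norm (S (R c) \<omega>))^4)" for \<omega>
      using norm_sum_fourth_le[of "{0..<int m}" "\<lambda>c. S (R c) \<omega>"]
      by (simp only: split finite_atLeastLessThan_int card_atLeastLessThan_int diff_zero nat_int simp_thms)
    then have "expectation (\<lambda>\<omega>. (norm (S A \<omega>))^4) \<le> expectation (\<lambda>\<omega>. real m ^ 3 * (\<Sum>c\<in>{0..<int m}. (norm (S (R c) \<omega>))^4))"
      by (intro integral_mono) auto
    also have "\<dots> = real m ^ 3 * (\<Sum>c\<in>{0..<int m}. expectation (\<lambda>\<omega>. (norm (S (R c) \<omega>))^4))" by simp
    also have "\<dots> \<le> real m ^ 3 * (\<Sum>c\<in>{0..<int m}. 1344 * \<kappa>^4 * (card A)\<^sup>2)"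
    proof (intro mult_left_mono sum_mono)
      fix c
      have "expectation (\<lambda>\<omega>. (norm (S (R c) \<omega>))^4) \<le> 1344 * \<kappa>^4 * (card (R c))\<^sup>2"
        by (rule fourth_moment_spaced[OF fR spR m(1)])
      also have "\<dots> \<le> 1344 * \<kappa>^4 * (card A)\<^sup>2"
      proof (intro mult_left_mono)
        have "card (R c) \<le> card A" using fin by (intro card_mono) (auto simp: R_def)
        then show "real ((card (R c))\<^sup>2) \<le> real ((card A)\<^sup>2)" by (intro of_nat_mono power_mono) auto
      qed auto
      finally show "expectation (\<lambda>\<omega>. (norm (S (R c) \<omega>))^4) \<le> 1344 * \<kappa>^4 * (card A)\<^sup>2" .
    qed auto
    also have "\<dots> = real m ^ 4 * (1344 * \<kappa>^4) * (card A)\<^sup>2"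
      by (simp add: power3_eq_cube power4_eq_xxxx)
    also have "\<dots> \<le> (real m ^ 4 * (1344 * \<kappa>^4) + 1) * (card A)\<^sup>2"
      by (intro mult_right_mono) auto
    finally show ?thesis .
  qed
  moreover have "real m ^ 4 * (1344 * \<kappa>^4) + 1 > 0" by (intro add_nonneg_pos) auto
  ultimately show ?thesis by (intro that)
qed

end

section \<open>Maximal inequality for partial sums\<close>

lemma plus_fourth_le:
  fixes x y :: real
  assumes "0 \<le> x" "0 \<le> y"
  shows "(x + y)^4 \<le> 3 / 2 * y^4 + 14641 * x^4"
\<comment> \<open>Splitting at 10 gives \<open>(11 / 10)^4 < 3 / 2\<close> in one case and
  \<open>11^4 = 14641\<close> in the other.\<close>
proof (cases "10 * x \<le> y")
  case True
  have "(x + y)^4 \<le> (11 / 10 * y)^4" using True assms by (intro power_mono) auto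
  also have "\<dots> = 14641 / 10000 * y^4" by (simp add: power_mult_distrib power_divide)
  also have "\<dots> \<le> 3 / 2 * y^4 + 14641 * x^4" using assms by (intro add_increasing2) auto
  finally show ?thesis .
next
  case False
  have "(x + y)^4 \<le> (11 * x)^4" using False assms by (intro power_mono) auto
  also have "\<dots> = 14641 * x^4" by (simp add: power_mult_distrib)
  also have "\<dots> \<le> 3 / 2 * y^4 + 14641 * x^4" using assms by simp
  finally show ?thesis .
qed

context mixing_process
begin

text \<open>The empty sum at \<open>j = 0\<close> is included, which makes the maximum nonnegative.
  The left end \<open>a\<close> is free because the doubling step restarts at the midpoint.\<close>

definition Smax :: "int \<Rightarrow> nat \<Rightarrow> 'w \<Rightarrow> real" where
  "Smax a n \<omega> = Max ((\<lambda>j. norm (S {a<..a + int j} \<omega>)) ` {..n})"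

lemma measurable_Smax [measurable]: "Smax a n \<in> borel_measurable M"
  unfolding Smax_def by measurable

lemma Smax_ge: "j \<le> n \<Longrightarrow> norm (S {a<..a + int j} \<omega>) \<le> Smax a n \<omega>"
  unfolding Smax_def by (intro Max_ge) auto

lemma Smax_nonneg: "0 \<le> Smax a n \<omega>"
  using Smax_ge[of 0 n a \<omega>] norm_ge_zero order_trans by blast

lemma Smax_attained: obtains j where "j \<le> n" "Smax a n \<omega> = norm (S {a<..a + int j} \<omega>)"
proof -
  have "Smax a n \<omega> \<in> (\<lambda>j. norm (S {a<..a + int j} \<omega>)) ` {..n}"
    unfolding Smax_def by (intro Max_in) auto
  then show ?thesis using that by auto
qed

lemma Smax_mono: "m \<le> n \<Longrightarrow> Smax a m \<omega> \<le> Smax a n \<omega>"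
  unfolding Smax_def by (intro Max_mono) auto

lemma Smax_le: "Smax a n \<omega> \<le> real n * \<kappa>"
proof -
  obtain j where j: "j \<le> n" "Smax a n \<omega> = norm (S {a<..a + int j} \<omega>)" by (rule Smax_attained)
  have "norm (S {a<..a + int j} \<omega>) \<le> real j * \<kappa>" using norm_S_le[of "{a<..a + int j}" \<omega>] by simp
  also have "\<dots> \<le> real n * \<kappa>" using j \<kappa>_nonneg by (intro mult_right_mono) auto
  finally show ?thesis using j by simp
qed

lemma integrable_Smax [simp]: "integrable M (\<lambda>\<omega>. Smax a n \<omega> ^ k)"
  using Smax_le Smax_nonneg
  by (intro integrable_bounded[where c="(real n * \<kappa>)^k"]) (auto intro!: power_mono simp: abs_of_nonneg)

lemma S_interval_split:
  "S {a<..a + int (m + i)} \<omega> = S {a<..a + int m} \<omega> + S {a + int m<..a + int m + int i} \<omega>"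
proof -
  have "{a<..a + int (m + i)} = {a<..a + int m} \<union> {a + int m<..a + int m + int i}" by auto
  then show ?thesis by (simp add: S_Un)
qed

text \<open>The maximum is attained in one of the two halves; in the second it is at most the total
  of the first half plus the maximum of the second. Keeping the weight of the second maximum at 3/2
  gives 5/2 in all, below the factor 4 by which \<open>n^2\<close> grows when \<open>n\<close>
  doubles.\<close>

lemma Smax_double:
  "Smax a (2 * m) \<omega> ^ 4 \<le> Smax a m \<omega> ^ 4 + 3 / 2 * Smax (a + int m) m \<omega> ^ 4
    + 14641 * (norm (S {a<..a + int m} \<omega>))^4"
proof -
  obtain j where j: "j \<le> 2 * m" "Smax a (2 * m) \<omega> = norm (S {a<..a + int j} \<omega>)" by (rule Smax_attained)
  show ?thesis
  proof (cases "j \<le> m")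
    case True
    then have "Smax a (2 * m) \<omega> ^ 4 \<le> Smax a m \<omega> ^ 4"
      unfolding j(2) by (intro power_mono Smax_ge) auto
    then show ?thesis by (simp add: add_increasing2)
  next
    case False
    then obtain i where i: "j = m + i" "i \<le> m" using j(1) by (metis add_le_cancel_left le_add_diff_inverse mult_2 nat_le_linear)
    have "Smax a (2 * m) \<omega> \<le> norm (S {a<..a + int m} \<omega>) + Smax (a + int m) m \<omega>"
      unfolding j(2) i(1) S_interval_split using norm_triangle_ineq Smax_ge[OF i(2), of "a + int m" \<omega>]
      by (meson add_left_mono order_trans)
    then have "Smax a (2 * m) \<omega> ^ 4 \<le> (norm (S {a<..a + int m} \<omega>) + Smax (a + int m) m \<omega>)^4"
      by (intro power_mono Smax_nonneg)
    also have "\<dots> \<le> 3 / 2 * Smax (a + int m) m \<omega> ^ 4 + 14641 * (norm (S {a<..a + int m} \<omega>))^4"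
      by (intro plus_fourth_le Smax_nonneg) auto
    also have "\<dots> \<le> Smax a m \<omega> ^ 4 + (3 / 2 * Smax (a + int m) m \<omega> ^ 4
    + 14641 * (norm (S {a<..a + int m} \<omega>))^4)" by simp
    finally show ?thesis by (simp only: add.assoc)
  qed
qed

lemma ex_power_two_between: "n > 0 \<Longrightarrow> \<exists>p. n \<le> 2 ^ p \<and> 2 ^ p \<le> 2 * (n::nat)"
proof -
  assume n: "n > 0"
  define p where "p = (LEAST p. n \<le> 2 ^ p)"
  have "n \<le> 2 ^ n" by (simp add: less_imp_le)
  then have 1: "n \<le> 2 ^ p" unfolding p_def by (rule LeastI)
  have "2 ^ p \<le> 2 * n"
  proof (cases p)
    case (Suc q)
    then have "\<not> n \<le> 2 ^ q" using not_less_Least[of q "\<lambda>p. n \<le> 2 ^ p"] p_def by auto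
    then show ?thesis using Suc by simp
  qed (use n in simp)
  with 1 show ?thesis by blast
qed

text \<open>Induction over dyadic lengths. The constant 10000 satisfies
  \<open>10000 * (1 + 3 / 2) + 14641 = 39641 \<le> 4 * 10000\<close>. Rounding a general
  \<open>n\<close> up to a power of two below \<open>2 * n\<close> costs another factor 4.\<close>

lemma fourth_moment_Smax:
  obtains C :: real where "C > 0" "\<And>a n. expectation (\<lambda>\<omega>. Smax a n \<omega> ^ 4) \<le> C * (real n)\<^sup>2"
    "\<And>A. finite A \<Longrightarrow> expectation (\<lambda>\<omega>. (norm (S A \<omega>))^4) \<le> C * (real (card A))\<^sup>2"
proof -
  obtain C :: real where C: "C > 0" "\<And>A. finite A \<Longrightarrow> expectation (\<lambda>\<omega>. (norm (S A \<omega>))^4) \<le> C * (card A)\<^sup>2"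
    by (rule fourth_moment) (rule that)
  have dyadic: "expectation (\<lambda>\<omega>. Smax a (2 ^ p) \<omega> ^ 4) \<le> 10000 * C * 4 ^ p" for a p
  proof (induction p arbitrary: a)
    case 0
    have "Smax a 1 \<omega> = norm (S {a<..a + 1} \<omega>)" for \<omega>
      unfolding Smax_def by (simp add: atMost_Suc S_def)
    then show ?case using C(2)[of "{a<..a + 1}"] C(1) by simp
  next
    case (Suc p)
    have c: "expectation (\<lambda>\<omega>. (norm (S {a<..a + int (2 ^ p)} \<omega>))^4) \<le> C * 4 ^ p"
      using C(2)[of "{a<..a + int (2 ^ p)}"] by (simp add: power_mult_distrib[symmetric] power2_eq_square)
    have "expectation (\<lambda>\<omega>. Smax a (2 ^ Suc p) \<omega> ^ 4)
      \<le> expectation (\<lambda>\<omega>. Smax a (2 ^ p) \<omega> ^ 4 + 3 / 2 * Smax (a + int (2 ^ p)) (2 ^ p) \<omega> ^ 4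
    + 14641 * (norm (S {a<..a + int (2 ^ p)} \<omega>))^4)"
      unfolding power_Suc by (intro integral_mono Smax_double) auto
    also have "\<dots> = expectation (\<lambda>\<omega>. Smax a (2 ^ p) \<omega> ^ 4) + 3 / 2 * expectation (\<lambda>\<omega>. Smax (a + int (2 ^ p)) (2 ^ p) \<omega> ^ 4)
    + 14641 * expectation (\<lambda>\<omega>. (norm (S {a<..a + int (2 ^ p)} \<omega>))^4)" by simp
    also have "\<dots> \<le> 10000 * C * 4 ^ p + 3 / 2 * (10000 * C * 4 ^ p) + 14641 * (C * 4 ^ p)"
      by (intro add_mono mult_left_mono Suc.IH c) auto
    also have "\<dots> = 39641 * (C * 4 ^ p)" by simp
    also have "\<dots> \<le> 40000 * (C * 4 ^ p)" using C(1) by (intro mult_right_mono) auto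
    finally show ?case by simp
  qed
  have main: "expectation (\<lambda>\<omega>. Smax a n \<omega> ^ 4) \<le> 40000 * C * (real n)\<^sup>2" for a n
  proof (cases "n = 0")
    case True
    then show ?thesis by (simp add: Smax_def S_def)
  next
    case False
    then obtain p where p: "n \<le> 2 ^ p" "2 ^ p \<le> 2 * n" using ex_power_two_between by blast
    have "expectation (\<lambda>\<omega>. Smax a n \<omega> ^ 4) \<le> expectation (\<lambda>\<omega>. Smax a (2 ^ p) \<omega> ^ 4)"
      using p by (intro integral_mono power_mono Smax_mono Smax_nonneg) auto
    also have "\<dots> \<le> 10000 * C * (2 ^ p)\<^sup>2" using dyadic[of a p] by (simp add: power2_eq_square power_mult_distrib[symmetric])
    also have "\<dots> \<le> 10000 * C * (2 * real n)\<^sup>2"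
    proof (intro mult_left_mono power_mono)
      show "2 ^ p \<le> 2 * real n" using p(2) by (metis of_nat_le_iff of_nat_mult of_nat_numeral of_nat_power)
    qed (use C in auto)
    finally show ?thesis by (simp add: power_mult_distrib)
  qed
  have "C * (real (card A))\<^sup>2 \<le> 40000 * C * (real (card A))\<^sup>2" for A :: "int set"
    using C(1) by (intro mult_right_mono) auto
  then have "expectation (\<lambda>\<omega>. (norm (S A \<omega>))^4) \<le> 40000 * C * (real (card A))\<^sup>2" if "finite A" for A
    using C(2)[OF that] by (simp add: order_trans)
  then show ?thesis using main C(1) by (intro that[of "40000 * C"]) auto
qed

text \<open>The moments of order two and three are interpolated pointwise on the natural scale:
  \<open>x^2 \<le> n + x^4 / n\<close> and
  \<open>x^3 \<le> sqrt n * x^2 + x^4 / sqrt n\<close>.\<close>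

lemma moments_Smax:
  obtains C :: real where "C > 0" "\<And>a n. expectation (\<lambda>\<omega>. Smax a n \<omega> ^ 4) \<le> C * (real n)\<^sup>2"
    "\<And>a n. expectation (\<lambda>\<omega>. Smax a n \<omega> ^ 2) \<le> C * real n"
    "\<And>a n. expectation (\<lambda>\<omega>. norm (S {a<..a + int n} \<omega>) ^ 3) \<le> C * (real n * sqrt (real n))"
proof -
  obtain C :: real where C: "C > 0" "\<And>a n. expectation (\<lambda>\<omega>. Smax a n \<omega> ^ 4) \<le> C * (real n)\<^sup>2"
    by (rule fourth_moment_Smax) (rule that)
  have two: "expectation (\<lambda>\<omega>. Smax a n \<omega> ^ 2) \<le> (1 + C) * real n" for a n
  proof (cases "n = 0")
    case True
    then show ?thesis by (simp add: Smax_def S_def)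
  next
    case False
    have pt: "Smax a n \<omega> ^ 2 \<le> real n + Smax a n \<omega> ^ 4 / real n" for \<omega>
    proof -
      have "0 \<le> (real n)\<^sup>2 + (Smax a n \<omega> ^ 2)\<^sup>2 - real n * Smax a n \<omega> ^ 2"
        using sum_squares_bound[of "real n" "Smax a n \<omega> ^ 2"] mult_nonneg_nonneg[OF of_nat_0_le_iff[of n] zero_le_power2[of "Smax a n \<omega>"]]
        by linarith
      then show ?thesis using False by (simp add: field_simps power2_eq_square power4_eq_xxxx)
    qed
    have "expectation (\<lambda>\<omega>. Smax a n \<omega> ^ 2) \<le> expectation (\<lambda>\<omega>. real n + Smax a n \<omega> ^ 4 / real n)"
      by (intro integral_mono pt) auto
    also have "\<dots> = real n + expectation (\<lambda>\<omega>. Smax a n \<omega> ^ 4) / real n" by (simp add: prob_space)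
    also have "\<dots> \<le> real n + C * (real n)\<^sup>2 / real n" using C by (intro add_left_mono divide_right_mono) auto
    finally show ?thesis using False by (simp add: power2_eq_square algebra_simps)
  qed
  have three: "expectation (\<lambda>\<omega>. norm (S {a<..a + int n} \<omega>) ^ 3) \<le> (1 + 2 * C) * (real n * sqrt (real n))" for a n
  proof (cases "n = 0")
    case True
    then show ?thesis by (simp add: S_def)
  next
    case False
    have pt0: "x ^ 3 \<le> s * x ^ 2 + x ^ 4 / s" if "x \<ge> 0" "s > 0" for x s :: real
    proof -
      have "0 \<le> x\<^sup>2 * ((x - s)\<^sup>2 + x * s)" using that by simp
      then show ?thesis using that by (simp add: field_simps power2_eq_square power3_eq_cube power4_eq_xxxx)
    qed
    have pt: "norm (S {a<..a + int n} \<omega>) ^ 3 \<le> sqrt n * Smax a n \<omega> ^ 2 + Smax a n \<omega> ^ 4 / sqrt n" for \<omega>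
    proof -
      have "norm (S {a<..a + int n} \<omega>) ^ 3 \<le> Smax a n \<omega> ^ 3" by (intro power_mono Smax_ge) auto
      also have "\<dots> \<le> sqrt n * Smax a n \<omega> ^ 2 + Smax a n \<omega> ^ 4 / sqrt n"
        using False by (intro pt0 Smax_nonneg) auto
      finally show ?thesis .
    qed
    have "expectation (\<lambda>\<omega>. norm (S {a<..a + int n} \<omega>) ^ 3) \<le> expectation (\<lambda>\<omega>. sqrt n * Smax a n \<omega> ^ 2 + Smax a n \<omega> ^ 4 / sqrt n)"
      by (intro integral_mono pt) auto
    also have "\<dots> = sqrt n * expectation (\<lambda>\<omega>. Smax a n \<omega> ^ 2) + expectation (\<lambda>\<omega>. Smax a n \<omega> ^ 4) / sqrt n" by simp
    also have "\<dots> \<le> sqrt n * ((1 + C) * real n) + C * (real n)\<^sup>2 / sqrt n"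
      using C two by (intro add_mono mult_left_mono divide_right_mono) auto
    also have "C * (real n)\<^sup>2 / sqrt n = C * real n * (real n / sqrt n)" by (simp add: power2_eq_square)
    also have "real n / sqrt n = sqrt n" by (simp add: real_div_sqrt)
    finally show ?thesis by (simp add: algebra_simps)
  qed
  have "C * (real n)\<^sup>2 \<le> (1 + 2 * C) * (real n)\<^sup>2" "(1 + C) * real n \<le> (1 + 2 * C) * real n" for n
    using C(1) by (auto intro!: mult_right_mono)
  note le = this
  show ?thesis
  proof (rule that[of "1 + 2 * C"])
    show "expectation (\<lambda>\<omega>. Smax a n \<omega> ^ 4) \<le> (1 + 2 * C) * (real n)\<^sup>2" for a n
      using C(2) le(1) by (rule order_trans)
    show "expectation (\<lambda>\<omega>. Smax a n \<omega> ^ 2) \<le> (1 + 2 * C) * real n" for a n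
      using two le(2) by (rule order_trans)
  qed (use C(1) three in auto)
qed

end

section \<open>The central limit theorem\<close>

lemma cmod_iexp_diff_le: "cmod (iexp x - iexp y) \<le> \<bar>x - y\<bar>"
proof -
  have "iexp x - iexp y = iexp y * (iexp (x - y) - 1)"
    by (simp add: algebra_simps exp_add[symmetric])
  moreover have "cmod (iexp (x - y) - 1) \<le> \<bar>x - y\<bar>" using iexp_approx1[of "x - y" 0] by simp
  ultimately show ?thesis by (simp add: norm_mult)
qed

lemma iexp_cos_sin: "iexp x = complex_of_real (cos x) + \<i> * complex_of_real (sin x)"
  by (simp add: exp_Euler cos_of_real sin_of_real)

lemma inverse_sqrt_tendsto_0: "(\<lambda>n. 1 / sqrt (real n)) \<longlonglongrightarrow> 0"
proof -
  have "filterlim (\<lambda>n. sqrt (real n)) at_top sequentially"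
    by (rule filterlim_compose[OF sqrt_at_top filterlim_real_sequentially])
  then show ?thesis
    using tendsto_inverse_0_at_top by (simp add: inverse_eq_divide[symmetric])
qed

text \<open>About the fourth root of \<open>n\<close>: it tends to infinity, so
  \<open>r (gap n)\<close> vanishes, but it is of smaller order than \<open>sqrt n\<close>, so
  dropping \<open>gap n\<close> bounded terms does not matter on the scale
  \<open>sqrt n\<close>.\<close>

definition gap :: "nat \<Rightarrow> nat" where "gap n = nat \<lfloor>sqrt (sqrt (real n))\<rfloor>"

lemma filterlim_sqrt_sqrt: "filterlim (\<lambda>n. sqrt (sqrt (real n))) at_top sequentially"
  by (intro filterlim_compose[OF sqrt_at_top] filterlim_real_sequentially)

lemma filterlim_gap: "filterlim gap at_top sequentially"
proof -
  have "filterlim (\<lambda>n. nat \<lfloor>sqrt (sqrt (real n))\<rfloor>) at_top sequentially"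
    by (intro filterlim_compose[OF filterlim_nat_sequentially] filterlim_compose[OF filterlim_floor_sequentially]
        filterlim_sqrt_sqrt)
  then show ?thesis by (simp add: gap_def[abs_def])
qed

lemma gap_over_sqrt: "(\<lambda>n. real (gap n) / sqrt (real n)) \<longlonglongrightarrow> 0"
proof (rule tendsto_sandwich[OF _ _ tendsto_const])
  show "(\<lambda>n. 1 / sqrt (sqrt (real n))) \<longlonglongrightarrow> 0"
    using tendsto_inverse_0_at_top[OF filterlim_sqrt_sqrt] by (simp add: inverse_eq_divide[symmetric])
  show "\<forall>\<^sub>F n in sequentially. real (gap n) / sqrt (real n) \<le> 1 / sqrt (sqrt (real n))"
  proof (rule eventually_sequentiallyI[of 1])
    fix n :: nat assume n: "1 \<le> n"
    have "real (gap n) / sqrt (real n) \<le> sqrt (sqrt (real n)) / sqrt (real n)"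
      by (intro divide_right_mono) (auto simp: gap_def)
    also have "\<dots> = 1 / sqrt (sqrt (real n))"
      using n by (simp add: divide_eq_eq eq_divide_eq)
    finally show "real (gap n) / sqrt (real n) \<le> 1 / sqrt (sqrt (real n))" .
  qed
qed auto

lemma div_over_tendsto:
  assumes "(\<lambda>n. real (p n) / real n) \<longlonglongrightarrow> c" "d > 0"
  shows "(\<lambda>n. real (p n div d) / real n) \<longlonglongrightarrow> c / real d"
proof -
  have e: "real (p n div d) / real n = real (p n) / real n / real d - real (p n mod d) / real d / real n" for n
  proof -
    have "real (p n) = real d * real (p n div d) + real (p n mod d)"
      by (metis mult_div_mod_eq of_nat_add of_nat_mult)
    then show ?thesis using assms(2) by (simp add: add_divide_distrib)
  qed
  have "(\<lambda>n. real (p n mod d) / real d / real n) \<longlonglongrightarrow> 0"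
  proof (rule tendsto_sandwich[OF _ _ tendsto_const])
    show "(\<lambda>n. 1 / real n) \<longlonglongrightarrow> 0" by (rule lim_1_over_n)
    have "real (p n mod d) / real d \<le> 1" for n using assms(2) by (simp add: less_imp_le)
    then show "\<forall>\<^sub>F n in sequentially. real (p n mod d) / real d / real n \<le> 1 / real n"
      by (intro always_eventually allI divide_right_mono) auto
  qed auto
  from tendsto_diff[OF tendsto_divide[OF assms(1) tendsto_const, of "real d"] this] assms(2)
  show ?thesis unfolding e by simp
qed

context mixing_process
begin

lemma mixing_le_1:
  assumes "U \<in> borel_measurable (F I)" "V \<in> borel_measurable (F J)" "I \<noteq> {}" "J \<noteq> {}" "apart m I J"
    "\<And>\<omega>. \<bar>U \<omega>\<bar> \<le> 1" "\<And>\<omega>. \<bar>V \<omega>\<bar> \<le> 1"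
  shows "\<bar>expectation (\<lambda>\<omega>. U \<omega> * V \<omega>) - expectation U * expectation V\<bar> \<le> r m"
proof -
  have sq: "expectation (\<lambda>\<omega>. (W \<omega>)\<^sup>2) \<le> 1" if [measurable]: "W \<in> borel_measurable M" and "\<And>\<omega>. \<bar>W \<omega>\<bar> \<le> 1" for W :: "'w \<Rightarrow> real"
  proof -
    have "(W \<omega>)\<^sup>2 \<le> 1" for \<omega> using that(2)[of \<omega>] unfolding abs_square_le_1 .
    moreover then have "integrable M (\<lambda>\<omega>. (W \<omega>)\<^sup>2)" by (intro integrable_bounded[where c=1]) auto
    ultimately have "expectation (\<lambda>\<omega>. (W \<omega>)\<^sup>2) \<le> expectation (\<lambda>_. 1)" by (intro integral_mono) auto
    then show ?thesis by (simp add: prob_space)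
  qed
  have "\<bar>expectation (\<lambda>\<omega>. U \<omega> * V \<omega>) - expectation U * expectation V\<bar>
      \<le> r m / 2 * (expectation (\<lambda>\<omega>. (U \<omega>)\<^sup>2) + expectation (\<lambda>\<omega>. (V \<omega>)\<^sup>2))"
    using assms(5) unfolding apart_def by (intro mixing[OF assms(1-4,6,7)]) blast
  also have "\<dots> \<le> r m / 2 * (1 + 1)"
    using r_nonneg[of m] F_sub[OF assms(1)] F_sub[OF assms(2)] assms(6,7)
    by (intro mult_left_mono add_mono sq) auto
  finally show ?thesis by simp
qed

text \<open>The real and the imaginary part of the product each combine two covariances of sines and
  cosines, so the bound for real functions bounded by 1 enters four times.\<close>

lemma mixing_iexp:
  assumes U: "U \<in> borel_measurable (F I)" and V: "V \<in> borel_measurable (F J)"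
    and IJ: "I \<noteq> {}" "J \<noteq> {}" "apart m I J"
  shows "cmod (expectation (\<lambda>\<omega>. iexp (U \<omega>) * iexp (V \<omega>))
    - expectation (\<lambda>\<omega>. iexp (U \<omega>)) * expectation (\<lambda>\<omega>. iexp (V \<omega>))) \<le> 4 * r m"
proof -
  have UM [measurable]: "U \<in> borel_measurable M" "V \<in> borel_measurable M"
    by (rule F_sub[OF U], rule F_sub[OF V])
  define cov where "cov f h = expectation (\<lambda>\<omega>. f (U \<omega>) * h (V \<omega>)) - expectation (\<lambda>\<omega>. f (U \<omega>)) * expectation (\<lambda>\<omega>. h (V \<omega>))"
    for f h :: "real \<Rightarrow> real"
  have cov: "\<bar>cov f h\<bar> \<le> r m" if "f \<in> {sin, cos}" "h \<in> {sin, cos}" for f h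
    unfolding cov_def
  proof (rule mixing_le_1[OF _ _ IJ])
    have "f \<in> borel_measurable borel" "h \<in> borel_measurable borel" using that by auto
    then show "(\<lambda>\<omega>. f (U \<omega>)) \<in> borel_measurable (F I)" "(\<lambda>\<omega>. h (V \<omega>)) \<in> borel_measurable (F J)"
      using U V measurable_compose by blast+
  qed (use that in auto)
  have int: "integrable M (\<lambda>\<omega>. f (U \<omega>) * h (V \<omega>))" if "f \<in> {sin, cos}" "h \<in> {sin, cos}" for f h
    using that by (intro integrable_bounded[where c=1]) (auto simp: abs_mult intro!: mult_le_one)
  have int1: "integrable M (\<lambda>\<omega>. f (W \<omega>))" if "f \<in> {sin, cos}" "W \<in> borel_measurable M" for f and W :: "'w \<Rightarrow> real"
    using that by (intro integrable_bounded[where c=1]) auto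
  have E1: "expectation (\<lambda>\<omega>. iexp (W \<omega>)) = complex_of_real (expectation (\<lambda>\<omega>. cos (W \<omega>)))
      + \<i> * complex_of_real (expectation (\<lambda>\<omega>. sin (W \<omega>)))" if [measurable]: "W \<in> borel_measurable M" for W
    unfolding iexp_cos_sin using int1[OF _ that] by (subst Bochner_Integration.integral_add) auto
  have "expectation (\<lambda>\<omega>. iexp (U \<omega>) * iexp (V \<omega>))
     = expectation (\<lambda>\<omega>. complex_of_real (cos (U \<omega>) * cos (V \<omega>) - sin (U \<omega>) * sin (V \<omega>))
        + \<i> * complex_of_real (cos (U \<omega>) * sin (V \<omega>) + sin (U \<omega>) * cos (V \<omega>)))"
    unfolding iexp_cos_sin by (intro Bochner_Integration.integral_cong) (auto simp: complex_eq_iff)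
  also have "\<dots> = complex_of_real (expectation (\<lambda>\<omega>. cos (U \<omega>) * cos (V \<omega>)) - expectation (\<lambda>\<omega>. sin (U \<omega>) * sin (V \<omega>)))
        + \<i> * complex_of_real (expectation (\<lambda>\<omega>. cos (U \<omega>) * sin (V \<omega>)) + expectation (\<lambda>\<omega>. sin (U \<omega>) * cos (V \<omega>)))"
    using int by (subst Bochner_Integration.integral_add) (auto simp del: of_real_add of_real_diff of_real_mult)
  finally have "expectation (\<lambda>\<omega>. iexp (U \<omega>) * iexp (V \<omega>)) - expectation (\<lambda>\<omega>. iexp (U \<omega>)) * expectation (\<lambda>\<omega>. iexp (V \<omega>))
     = complex_of_real (cov cos cos - cov sin sin) + \<i> * complex_of_real (cov cos sin + cov sin cos)"
    unfolding E1[OF UM(1)] E1[OF UM(2)] cov_def by (simp add: complex_eq_iff)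
  note eq = this
  have "cmod (complex_of_real (cov cos cos - cov sin sin) + \<i> * complex_of_real (cov cos sin + cov sin cos)) \<le> cmod (complex_of_real (cov cos cos - cov sin sin)) + cmod (\<i> * complex_of_real (cov cos sin + cov sin cos))"
    by (rule norm_triangle_ineq)
  also have "\<dots> = \<bar>cov cos cos - cov sin sin\<bar> + \<bar>cov cos sin + cov sin cos\<bar>"
    by (simp add: norm_mult del: of_real_add of_real_diff)
  also have "\<dots> \<le> 4 * r m"
    using cov[of cos cos] cov[of sin sin] cov[of cos sin] cov[of sin cos] by simp
  finally show ?thesis unfolding eq .
qed

lemma expectation_iexp_diff_le:
  assumes [measurable]: "U \<in> borel_measurable M" "V \<in> borel_measurable M" and "\<And>\<omega>. \<bar>U \<omega> - V \<omega>\<bar> \<le> \<delta>"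
  shows "cmod (expectation (\<lambda>\<omega>. iexp (U \<omega>)) - expectation (\<lambda>\<omega>. iexp (V \<omega>))) \<le> \<delta>"
proof -
  have i: "integrable M (\<lambda>\<omega>. iexp (W \<omega>))" if [measurable]: "W \<in> borel_measurable M" for W
    by (intro integrable_const_bound[where B=1]) auto
  have "cmod (expectation (\<lambda>\<omega>. iexp (U \<omega>)) - expectation (\<lambda>\<omega>. iexp (V \<omega>)))
    = cmod (expectation (\<lambda>\<omega>. iexp (U \<omega>) - iexp (V \<omega>)))" using i by simp
  also have "\<dots> \<le> expectation (\<lambda>\<omega>. cmod (iexp (U \<omega>) - iexp (V \<omega>)))" by (rule integral_norm_bound)
  also have "\<dots> \<le> expectation (\<lambda>\<omega>. \<delta>)"
    by (intro integral_mono integrable_norm Bochner_Integration.integrable_diff i order_trans[OF cmod_iexp_diff_le assms(3)]) auto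
  finally show ?thesis by (simp add: prob_space)
qed

lemma expectation_iexp_le_1:
  assumes [measurable]: "U \<in> borel_measurable M"
  shows "cmod (expectation (\<lambda>\<omega>. iexp (U \<omega>))) \<le> 1"
proof -
  have "cmod (expectation (\<lambda>\<omega>. iexp (U \<omega>))) \<le> expectation (\<lambda>\<omega>. cmod (iexp (U \<omega>)))" by (rule integral_norm_bound)
  then show ?thesis by (simp add: prob_space)
qed

end

section \<open>Characteristic functions of the partial sums projected on the mean\<close>

locale mixing_clt = mixing_process M F Z e \<kappa> r
  for M :: "'w measure" and F and Z :: "int \<Rightarrow> 'w \<Rightarrow> 'k::real_inner" and e \<kappa> r +
  fixes \<mu> :: 'k and \<sigma> :: real
  assumes \<sigma>_pos: "0 < \<sigma>"
    and var_lim: "(\<lambda>n. expectation (\<lambda>\<omega>. (S {0<..int n} \<omega> \<bullet> \<mu>)\<^sup>2) / real n) \<longlonglongrightarrow> \<sigma>\<^sup>2"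
    and stationary: "distr M borel (\<lambda>\<omega>. S {a<..a + int p} \<omega> \<bullet> \<mu>) = distr M borel (\<lambda>\<omega>. S {0<..int p} \<omega> \<bullet> \<mu>)"
begin

definition X :: "int set \<Rightarrow> 'w \<Rightarrow> real" where "X A \<omega> = S A \<omega> \<bullet> \<mu>"

lemma measurable_X [measurable]: "X A \<in> borel_measurable M"
  unfolding X_def[abs_def] by measurable

lemma measurable_X_F: "A \<subseteq> I \<Longrightarrow> X A \<in> borel_measurable (F I)"
  unfolding X_def[abs_def] by (rule measurable_S)

lemma abs_X_le_norm: "\<bar>X A \<omega>\<bar> \<le> norm (S A \<omega>) * norm \<mu>"
  unfolding X_def by (rule Cauchy_Schwarz_ineq2)

lemma abs_X_le: "\<bar>X A \<omega>\<bar> \<le> real (card A) * (\<kappa> * norm \<mu>)"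
  using abs_X_le_norm[of A \<omega>] mult_right_mono[OF norm_S_le[of A \<omega>] norm_ge_zero[of \<mu>]] by (simp add: mult.assoc)

lemma X_Un: "finite A \<Longrightarrow> finite B \<Longrightarrow> A \<inter> B = {} \<Longrightarrow> X (A \<union> B) \<omega> = X A \<omega> + X B \<omega>"
  by (simp add: X_def S_Un inner_add_left)

lemma X_split: "a \<le> b \<Longrightarrow> b \<le> c \<Longrightarrow> X {a<..c} \<omega> = X {a<..b} \<omega> + X {b<..c} \<omega>"
  using X_Un[of "{a<..b}" "{b<..c}" \<omega>] by (simp add: ivl_disj_un_two)

lemma distr_X: "distr M borel (X {a<..a + int p}) = distr M borel (X {0<..int p})"
  using stationary by (simp add: X_def[abs_def])

definition \<psi> :: "real \<Rightarrow> int set \<Rightarrow> complex" where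
  "\<psi> s A = expectation (\<lambda>\<omega>. iexp (s * X A \<omega>))"

lemma \<psi>_char: "\<psi> s A = char (distr M borel (X A)) s"
  unfolding \<psi>_def char_def by (subst integral_distr) auto

lemma \<psi>_shift: "\<psi> s {a<..a + int p} = \<psi> s {0<..int p}"
  unfolding \<psi>_char distr_X ..

lemma \<psi>_le_1: "cmod (\<psi> s A) \<le> 1"
  unfolding \<psi>_def by (rule expectation_iexp_le_1) measurable

lemma \<psi>_diff_le:
  assumes "a \<le> b" "b \<le> c"
  shows "cmod (\<psi> s {a<..c} - \<psi> s {a<..b}) \<le> \<bar>s\<bar> * (real_of_int (c - b) * (\<kappa> * norm \<mu>))"
    "cmod (\<psi> s {a<..c} - \<psi> s {b<..c}) \<le> \<bar>s\<bar> * (real_of_int (b - a) * (\<kappa> * norm \<mu>))"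
  unfolding \<psi>_def
proof -
  show "cmod (expectation (\<lambda>\<omega>. iexp (s * X {a<..c} \<omega>)) - expectation (\<lambda>\<omega>. iexp (s * X {a<..b} \<omega>))) \<le> \<bar>s\<bar> * (real_of_int (c - b) * (\<kappa> * norm \<mu>))"
    using X_split[OF assms] abs_X_le[of "{b<..c}"] assms
    by (intro expectation_iexp_diff_le) (auto simp: abs_mult right_diff_distrib[symmetric] simp del: of_int_diff intro!: mult_left_mono)
  show "cmod (expectation (\<lambda>\<omega>. iexp (s * X {a<..c} \<omega>)) - expectation (\<lambda>\<omega>. iexp (s * X {b<..c} \<omega>))) \<le> \<bar>s\<bar> * (real_of_int (b - a) * (\<kappa> * norm \<mu>))"
    using X_split[OF assms] abs_X_le[of "{a<..b}"] assms
    by (intro expectation_iexp_diff_le) (auto simp: abs_mult right_diff_distrib[symmetric] simp del: of_int_diff intro!: mult_left_mono)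
qed

text \<open>Appending a block costs three errors: the \<open>q\<close> indices at its left end are
  dropped, the rest is factored off by mixing, and the dropped indices are restored so that
  stationarity can shift the block to the origin. All factors have modulus at most 1, so the errors
  merely add up.\<close>

lemma \<psi>_blocks:
  assumes "q < L"
  shows "cmod (\<psi> s {0<..int (j * L)} - \<psi> s {0<..int L} ^ j)
    \<le> real j * (2 * \<bar>s\<bar> * real q * (\<kappa> * norm \<mu>) + 4 * r q)"
proof (induction j)
  case 0
  then show ?case by (simp add: \<psi>_def X_def S_def prob_space)
next
  case (Suc j)
  define b where "b = 2 * \<bar>s\<bar> * real q * (\<kappa> * norm \<mu>) + 4 * r q"
  have b0: "b \<ge> 0" unfolding b_def using \<kappa>_nonneg r_nonneg[of q] by simp
  have step: "cmod (\<psi> s {0<..int (Suc j * L)} - \<psi> s {0<..int (j * L)} * \<psi> s {0<..int L}) \<le> b"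
  \<comment> \<open>Mixing needs a nonempty past; without an earlier block the product formula is an
    identity.\<close>
  proof (cases "j = 0")
    case True
    then have "\<psi> s {0<..int (j * L)} = 1" by (simp add: \<psi>_def X_def S_def prob_space)
    then show ?thesis using True b0 by simp
  next
    case False
    define u where "u = int (j * L)"
    have u: "u > 0" using False assms by (simp add: u_def)
    have Suc_u: "int (Suc j * L) = u + int L" by (simp add: u_def)
    let ?I = "{0<..u}" and ?J = "{u + int q<..u + int L}"
    have sp: "X {0<..u + int L} \<omega> = X ?I \<omega> + X {u<..u + int q} \<omega> + X ?J \<omega>" for \<omega>
      using X_split[of 0 u "u + int L" \<omega>] X_split[of u "u + int q" "u + int L" \<omega>] u assms by simp
    have 1: "cmod (\<psi> s {0<..u + int L} - expectation (\<lambda>\<omega>. iexp (s * X ?I \<omega>) * iexp (s * X ?J \<omega>))) \<le> \<bar>s\<bar> * (real q * (\<kappa> * norm \<mu>))"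
    proof -
      have "expectation (\<lambda>\<omega>. iexp (s * X ?I \<omega>) * iexp (s * X ?J \<omega>)) = expectation (\<lambda>\<omega>. iexp (s * X ?I \<omega> + s * X ?J \<omega>))"
        by (simp add: exp_add[symmetric] algebra_simps)
      moreover have "cmod (expectation (\<lambda>\<omega>. iexp (s * X {0<..u + int L} \<omega>)) - expectation (\<lambda>\<omega>. iexp (s * X ?I \<omega> + s * X ?J \<omega>))) \<le> \<bar>s\<bar> * (real q * (\<kappa> * norm \<mu>))"
      proof (rule expectation_iexp_diff_le)
        show "\<bar>s * X {0<..u + int L} \<omega> - (s * X ?I \<omega> + s * X ?J \<omega>)\<bar> \<le> \<bar>s\<bar> * (real q * (\<kappa> * norm \<mu>))" for \<omega>
        proof -
          have "s * X {0<..u + int L} \<omega> - (s * X ?I \<omega> + s * X ?J \<omega>) = s * X {u<..u + int q} \<omega>"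
            by (simp add: sp algebra_simps)
          then show ?thesis using abs_X_le[of "{u<..u + int q}" \<omega>] by (simp add: abs_mult mult_left_mono)
        qed
      qed measurable
      ultimately show ?thesis by (simp add: \<psi>_def)
    qed
    have 2: "cmod (expectation (\<lambda>\<omega>. iexp (s * X ?I \<omega>) * iexp (s * X ?J \<omega>)) - \<psi> s ?I * \<psi> s ?J) \<le> 4 * r q"
      unfolding \<psi>_def
    proof (rule mixing_iexp)
      show "(\<lambda>\<omega>. s * X ?I \<omega>) \<in> borel_measurable (F ?I)" "(\<lambda>\<omega>. s * X ?J \<omega>) \<in> borel_measurable (F ?J)"
        by (intro borel_measurable_times borel_measurable_const measurable_X_F order_refl)+
      show "?I \<noteq> {}" "?J \<noteq> {}" using u assms by auto
      show "apart q ?I ?J" by (auto simp: apart_def)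
    qed
    have 3: "cmod (\<psi> s ?I * \<psi> s ?J - \<psi> s ?I * \<psi> s {0<..int L}) \<le> \<bar>s\<bar> * (real q * (\<kappa> * norm \<mu>))"
    proof -
      have "cmod (\<psi> s ?I * \<psi> s ?J - \<psi> s ?I * \<psi> s {0<..int L}) = cmod (\<psi> s ?I) * cmod (\<psi> s {u<..u + int L} - \<psi> s ?J)"
        by (simp add: \<psi>_shift right_diff_distrib[symmetric] norm_mult norm_minus_commute)
      also have "\<dots> \<le> 1 * (\<bar>s\<bar> * (real_of_int (u + int q - u) * (\<kappa> * norm \<mu>)))"
        using assms by (intro mult_mono \<psi>_le_1 \<psi>_diff_le) auto
      finally show ?thesis by simp
    qed
    have "cmod (\<psi> s {0<..u + int L} - \<psi> s ?I * \<psi> s {0<..int L}) \<le> \<bar>s\<bar> * (real q * (\<kappa> * norm \<mu>)) + 4 * r q + \<bar>s\<bar> * (real q * (\<kappa> * norm \<mu>))"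
      using norm_triangle_le[OF add_mono[OF norm_triangle_le[OF add_mono[OF 1 2]] 3]] by simp
    then show ?thesis unfolding Suc_u b_def u_def by (simp add: algebra_simps)
  qed
  have "cmod (\<psi> s {0<..int (Suc j * L)} - \<psi> s {0<..int L} ^ Suc j)
    = cmod ((\<psi> s {0<..int (Suc j * L)} - \<psi> s {0<..int (j * L)} * \<psi> s {0<..int L})
      + (\<psi> s {0<..int (j * L)} - \<psi> s {0<..int L} ^ j) * \<psi> s {0<..int L})"
    by (simp add: algebra_simps)
  also have "\<dots> \<le> b + (real j * b) * 1"
  proof (rule norm_triangle_le, rule add_mono[OF step])
    show "cmod ((\<psi> s {0<..int (j * L)} - \<psi> s {0<..int L} ^ j) * \<psi> s {0<..int L}) \<le> real j * b * 1"
      unfolding norm_mult using b0 by (intro mult_mono Suc.IH[folded b_def] \<psi>_le_1) auto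
  qed
  finally show ?case unfolding b_def[symmetric] by (simp add: algebra_simps)
qed

definition V :: "nat \<Rightarrow> real" where "V n = expectation (\<lambda>\<omega>. (X {0<..int n} \<omega>)\<^sup>2)"

lemma V_nonneg: "0 \<le> V n"
  by (simp add: V_def)

text \<open>Second-order Taylor expansion of the characteristic function. The linear term vanishes
  because the mean is 0, and the remainder is a third moment, of order
  \<open>n * sqrt n\<close>.\<close>

lemma \<psi>_expansion:
  obtains C :: real where "C > 0"
    "\<And>s n. cmod (\<psi> s {0<..int n} - (1 - s\<^sup>2 * V n / 2)) \<le> C * \<bar>s\<bar>^3 * (real n * sqrt (real n))"
proof -
  obtain C :: real where C: "C > 0" "\<And>a n. expectation (\<lambda>\<omega>. norm (S {a<..a + int n} \<omega>) ^ 3) \<le> C * (real n * sqrt (real n))"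
    by (rule moments_Smax) (rule that)
  have "cmod (\<psi> s {0<..int n} - (1 - s\<^sup>2 * V n / 2)) \<le> (norm \<mu> ^ 3 * C + 1) * \<bar>s\<bar>^3 * (real n * sqrt (real n))" for s n
  proof -
    let ?X = "X {0<..int n}"
    have E: "expectation ?X = 0" "integrable M ?X" "integrable M (\<lambda>\<omega>. (?X \<omega>)\<^sup>2)"
      using expectation_S by (auto simp: X_def[abs_def])
    have i3: "integrable M (\<lambda>\<omega>. \<bar>?X \<omega>\<bar>^3)"
      using abs_X_le[of "{0<..int n}"] by (intro integrable_bounded[where c="(real (card {0<..int n}) * (\<kappa> * norm \<mu>))^3"]) (auto intro!: power_mono)
    have "cmod (\<psi> s {0<..int n} - (1 - s\<^sup>2 * V n / 2)) \<le> s\<^sup>2 / 6 * expectation (\<lambda>\<omega>. min (6 * (?X \<omega>)\<^sup>2) (\<bar>s\<bar> * \<bar>?X \<omega>\<bar>^3))"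
      unfolding \<psi>_char using E by (intro char_approx3') (auto simp: V_def)
    also have "\<dots> \<le> s\<^sup>2 / 6 * expectation (\<lambda>\<omega>. \<bar>s\<bar> * (norm \<mu> ^ 3 * norm (S {0<..int n} \<omega>) ^ 3))"
    proof (intro mult_left_mono integral_mono)
      show "integrable M (\<lambda>\<omega>. min (6 * (?X \<omega>)\<^sup>2) (\<bar>s\<bar> * \<bar>?X \<omega>\<bar>^3))"
        using i3 E by (intro integrable_min) auto
      show "min (6 * (?X \<omega>)\<^sup>2) (\<bar>s\<bar> * \<bar>?X \<omega>\<bar>^3) \<le> \<bar>s\<bar> * (norm \<mu> ^ 3 * norm (S {0<..int n} \<omega>) ^ 3)" for \<omega>
      proof -
        have "\<bar>?X \<omega>\<bar>^3 \<le> (norm (S {0<..int n} \<omega>) * norm \<mu>)^3" by (intro power_mono abs_X_le_norm) auto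
        then have "\<bar>s\<bar> * \<bar>?X \<omega>\<bar>^3 \<le> \<bar>s\<bar> * (norm \<mu> ^ 3 * norm (S {0<..int n} \<omega>) ^ 3)"
          by (intro mult_left_mono) (auto simp: power_mult_distrib mult.commute)
        then show ?thesis by simp
      qed
    qed auto
    also have "\<dots> = s\<^sup>2 / 6 * (\<bar>s\<bar> * (norm \<mu> ^ 3 * expectation (\<lambda>\<omega>. norm (S {0<..int n} \<omega>) ^ 3)))" by simp
    also have "\<dots> \<le> s\<^sup>2 / 6 * (\<bar>s\<bar> * (norm \<mu> ^ 3 * (C * (real n * sqrt (real n)))))"
      using C(2)[of 0 n] by (intro mult_left_mono) auto
    also have "\<dots> = \<bar>s\<bar>^3 * (real n * sqrt (real n)) * (norm \<mu> ^ 3 * C / 6)"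
      by (simp add: power3_eq_cube power2_eq_square) 
    also have "\<dots> \<le> \<bar>s\<bar>^3 * (real n * sqrt (real n)) * (norm \<mu> ^ 3 * C + 1)"
      using C(1) by (intro mult_left_mono) (auto simp: field_simps add_nonneg_nonneg)
    finally show ?thesis by (simp add: mult_ac)
  qed
  moreover have "norm \<mu> ^ 3 * C + 1 > 0" using C(1) by (intro add_nonneg_pos) auto
  ultimately show ?thesis by (intro that[of "norm \<mu> ^ 3 * C + 1"]) auto
qed

text \<open>For fixed \<open>d\<close> the sum is cut into \<open>d\<close> blocks of length
  \<open>p n div d\<close>. The approximant \<open>b d n\<close> tends to
  \<open>(1 + (- (t\<^sup>2) / 2) / real d)^d\<close>, and the error bound \<open>bnd d n\<close> to
  a multiple of \<open>1 / sqrt d\<close>; \<open>d\<close> is chosen for the desired accuracy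
  before \<open>n\<close> grows.\<close>

lemma \<psi>_tendsto:
  assumes p: "(\<lambda>n. real (p n) / real n) \<longlonglongrightarrow> c" and c: "c > 0"
  shows "(\<lambda>n. \<psi> (t / (\<sigma> * sqrt (c * real n))) {0<..int (p n)}) \<longlonglongrightarrow> complex_of_real (exp (- (t\<^sup>2) / 2))"
proof -
  obtain C :: real where C: "C > 0"
    "\<And>s n. cmod (\<psi> s {0<..int n} - (1 - s\<^sup>2 * V n / 2)) \<le> C * \<bar>s\<bar>^3 * (real n * sqrt (real n))"
    by (rule \<psi>_expansion) (rule that)
  define \<beta> where "\<beta> = \<kappa> * norm \<mu>"
  define s where "s n = t / (\<sigma> * sqrt (c * real n))" for n
  have sqs': "(s n)\<^sup>2 = t\<^sup>2 / (\<sigma>\<^sup>2 * c * real n)" for n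
    using c by (simp add: s_def power_mult_distrib power_divide)
  have s0: "s \<longlonglongrightarrow> 0"
  proof -
    have "(\<lambda>n. t / (\<sigma> * sqrt c) * (1 / sqrt (real n))) \<longlonglongrightarrow> t / (\<sigma> * sqrt c) * 0"
      by (intro tendsto_mult tendsto_const inverse_sqrt_tendsto_0)
    then show ?thesis by (simp add: s_def[abs_def] real_sqrt_mult mult.assoc)
  qed
  have sgap: "(\<lambda>n. s n * real (gap n)) \<longlonglongrightarrow> 0"
  proof -
    have "(\<lambda>n. t / (\<sigma> * sqrt c) * (real (gap n) / sqrt (real n))) \<longlonglongrightarrow> t / (\<sigma> * sqrt c) * 0"
      by (intro tendsto_mult tendsto_const gap_over_sqrt)
    then show ?thesis by (simp add: s_def[abs_def] real_sqrt_mult mult.assoc)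
  qed
  have rgap: "(\<lambda>n. r (gap n)) \<longlonglongrightarrow> 0"
    using filterlim_compose[OF r_lim filterlim_gap] .
  \<comment> \<open>The three terms account for the fewer than \<open>d\<close> indices left over,
    for the factorisation into blocks, and for the Taylor error in \<open>d\<close> factors.\<close>
  define bnd where "bnd d n = \<bar>s n\<bar> * (real d * \<beta>) + real d * (2 * \<bar>s n\<bar> * real (gap n) * \<beta> + 4 * r (gap n))
      + real d * (C * \<bar>s n\<bar>^3 * (real (p n div d) * sqrt (real (p n div d))))" for d n
  define b where "b d n = (1 - (s n)\<^sup>2 * V (p n div d) / 2)^d" for d n
  have Ln: "(\<lambda>n. real (p n div d) / real n) \<longlonglongrightarrow> c / real d" if "d > 0" for d
    by (rule div_over_tendsto[OF p that])
  have Linf: "filterlim (\<lambda>n. p n div d) at_top sequentially" if "d > 0" for d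
  proof -
    have "filterlim (\<lambda>n. real (p n div d) / real n * real n) at_top sequentially"
      using c that by (intro filterlim_tendsto_pos_mult_at_top[OF Ln[OF that]] filterlim_real_sequentially) auto
    then have "filterlim (\<lambda>n. real (p n div d)) at_top sequentially"
    proof (rule filterlim_cong[THEN iffD1, rotated -1])
      show "\<forall>\<^sub>F n in sequentially. real (p n div d) / real n * real n = real (p n div d)"
        by (rule eventually_sequentiallyI[of 1]) auto
    qed auto
    then show ?thesis by (simp add: filterlim_sequentially_iff_filterlim_real)
  qed
  have gapL: "\<forall>\<^sub>F n in sequentially. gap n < p n div d" if d: "d > 0" for d
  proof -
    have "(\<lambda>n. real (gap n) / sqrt (real n) * (1 / sqrt (real n))) \<longlonglongrightarrow> 0 * 0"
      by (intro tendsto_mult gap_over_sqrt inverse_sqrt_tendsto_0)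
    from tendsto_diff[OF Ln[OF d] this]
    have "(\<lambda>n. real (p n div d) / real n - real (gap n) / sqrt (real n) * (1 / sqrt (real n))) \<longlonglongrightarrow> c / real d" by simp
    moreover have "c / real d > 0" using c d by simp
    ultimately have "\<forall>\<^sub>F n in sequentially. 0 < real (p n div d) / real n - real (gap n) / sqrt (real n) * (1 / sqrt (real n))"
      by (rule order_tendstoD)
    then show ?thesis
      using eventually_gt_at_top[of 0]
      by eventually_elim (simp add: divide_less_cancel)
  qed
  have sV: "(\<lambda>n. (s n)\<^sup>2 * V (p n div d)) \<longlonglongrightarrow> t\<^sup>2 / real d" if d: "d > 0" for d
  proof -
    have "(\<lambda>n. V n / real n) \<longlonglongrightarrow> \<sigma>\<^sup>2" using var_lim by (simp add: V_def X_def)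
    from filterlim_compose[OF this Linf[OF d]]
    have "(\<lambda>n. t\<^sup>2 / (\<sigma>\<^sup>2 * c) * (real (p n div d) / real n) * (V (p n div d) / real (p n div d)))
      \<longlonglongrightarrow> t\<^sup>2 / (\<sigma>\<^sup>2 * c) * (c / real d) * \<sigma>\<^sup>2"
      by (intro tendsto_mult tendsto_const Ln[OF d])
    moreover have "\<forall>\<^sub>F n in sequentially. t\<^sup>2 / (\<sigma>\<^sup>2 * c) * (real (p n div d) / real n) * (V (p n div d) / real (p n div d)) = (s n)\<^sup>2 * V (p n div d)"
      using gapL[OF d] eventually_gt_at_top[of 0]
    proof eventually_elim
      case (elim n)
      then show ?case by (simp add: sqs')
    qed
    ultimately show ?thesis using c \<sigma>_pos tendsto_cong by (force simp: field_simps)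
  qed
  have sL: "(\<lambda>n. \<bar>s n\<bar>^3 * (real (p n div d) * sqrt (real (p n div d)))) \<longlonglongrightarrow> (\<bar>t\<bar> / \<sigma>)^3 / (real d * sqrt (real d))" if d: "d > 0" for d
  proof -
    have "(\<lambda>n. (\<bar>t\<bar> / (\<sigma> * sqrt c))^3 * (sqrt (real (p n div d) / real n))^3) \<longlonglongrightarrow> (\<bar>t\<bar> / (\<sigma> * sqrt c))^3 * (sqrt (c / real d))^3"
      by (intro tendsto_intros Ln[OF d])
    moreover have "(\<bar>t\<bar> / (\<sigma> * sqrt c))^3 * (sqrt (c / real d))^3 = (\<bar>t\<bar> / \<sigma>)^3 / (real d * sqrt (real d))"
    proof -
      have "(\<bar>t\<bar> / (\<sigma> * sqrt c))^3 * (sqrt (c / real d))^3 = (\<bar>t\<bar> / \<sigma> / sqrt (real d))^3"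
        using c by (simp add: power_mult_distrib[symmetric] real_sqrt_divide)
      also have "\<dots> = (\<bar>t\<bar> / \<sigma>)^3 / (sqrt (real d))^3" by (rule power_divide)
      also have "(sqrt (real d))^3 = real d * sqrt (real d)" by (simp add: power3_eq_cube)
      finally show ?thesis .
    qed
    moreover have "(\<bar>t\<bar> / (\<sigma> * sqrt c))^3 * (sqrt (real (p n div d) / real n))^3 = \<bar>s n\<bar>^3 * (real (p n div d) * sqrt (real (p n div d)))" for n
    proof -
      have "\<bar>t\<bar> / (\<sigma> * sqrt c) * sqrt (real (p n div d) / real n) = \<bar>s n\<bar> * sqrt (real (p n div d))"
        using c \<sigma>_pos by (simp add: s_def real_sqrt_mult real_sqrt_divide abs_mult)
      then have "(\<bar>t\<bar> / (\<sigma> * sqrt c))^3 * (sqrt (real (p n div d) / real n))^3 = \<bar>s n\<bar>^3 * (sqrt (real (p n div d)))^3"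
        by (simp add: power_mult_distrib[symmetric])
      also have "(sqrt (real (p n div d)))^3 = real (p n div d) * sqrt (real (p n div d))" by (simp add: power3_eq_cube)
      finally show ?thesis .
    qed
    ultimately show ?thesis by simp
  qed
  have bnd_lim: "bnd d \<longlonglongrightarrow> C * (\<bar>t\<bar> / \<sigma>)^3 / sqrt (real d)" if d: "d > 0" for d
  proof -
    have "(\<lambda>n. \<bar>s n\<bar> * (real d * \<beta>) + real d * (2 * \<bar>s n * real (gap n)\<bar> * \<beta> + 4 * r (gap n))
      + real d * (C * (\<bar>s n\<bar>^3 * (real (p n div d) * sqrt (real (p n div d))))))
      \<longlonglongrightarrow> \<bar>0\<bar> * (real d * \<beta>) + real d * (2 * \<bar>0\<bar> * \<beta> + 4 * 0) + real d * (C * ((\<bar>t\<bar> / \<sigma>)^3 / (real d * sqrt (real d))))"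
      by (intro tendsto_add tendsto_mult tendsto_const tendsto_rabs s0 sgap rgap sL[OF d])
    then show ?thesis using d by (simp add: bnd_def[abs_def] abs_mult mult_ac)
  qed
  have b_lim: "b d \<longlonglongrightarrow> (1 + (- (t\<^sup>2) / 2) / real d)^d" if d: "d > 0" for d
  proof -
    have "b d \<longlonglongrightarrow> (1 - (t\<^sup>2 / real d) / 2)^d"
      unfolding b_def[abs_def] by (intro tendsto_intros sV[OF d]) auto
    then show ?thesis by (simp add: mult.commute)
  qed
  have main: "\<forall>\<^sub>F n in sequentially. cmod (\<psi> (s n) {0<..int (p n)} - complex_of_real (b d n)) \<le> bnd d n"
    if d: "d > 0" "real d > t\<^sup>2" for d
  proof -
    \<comment> \<open>Below 4 the number \<open>1 - ?s\<^sup>2 * V ?L / 2\<close> stays between -1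
      and 1, as the comparison of \<open>d\<close>-th powers requires.\<close>
    have "t\<^sup>2 / real d < 4" using d by (simp add: field_simps)
    from order_tendstoD(2)[OF sV[OF d(1)] this] gapL[OF d(1)]
    show ?thesis
    proof eventually_elim
      case (elim n)
      let ?L = "p n div d" and ?s = "s n"
      have dL: "int (d * ?L) \<le> int (p n)" "real_of_int (int (p n) - int (d * ?L)) \<le> real d"
        using d mult_div_mod_eq[of d "p n"] mod_less_divisor[OF d(1), of "p n"] by linarith+
      have 1: "cmod (\<psi> ?s {0<..int (p n)} - \<psi> ?s {0<..int (d * ?L)}) \<le> \<bar>?s\<bar> * (real d * \<beta>)"
      proof -
        have "cmod (\<psi> ?s {0<..int (p n)} - \<psi> ?s {0<..int (d * ?L)}) \<le> \<bar>?s\<bar> * (real_of_int (int (p n) - int (d * ?L)) * (\<kappa> * norm \<mu>))"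
          using dL by (intro \<psi>_diff_le) auto
        also have "\<dots> \<le> \<bar>?s\<bar> * (real d * \<beta>)" unfolding \<beta>_def
          using dL \<kappa>_nonneg by (intro mult_left_mono mult_right_mono) auto
        finally show ?thesis .
      qed
      have 2: "cmod (\<psi> ?s {0<..int (d * ?L)} - \<psi> ?s {0<..int ?L} ^ d) \<le> real d * (2 * \<bar>s n\<bar> * real (gap n) * \<beta> + 4 * r (gap n))"
        unfolding \<beta>_def using elim by (intro \<psi>_blocks) auto
      have n1: "norm (complex_of_real (1 - ?s\<^sup>2 * V ?L / 2)) \<le> 1"
        using elim V_nonneg[of ?L] unfolding norm_of_real by (simp add: abs_le_iff)
      have 3: "cmod (\<psi> ?s {0<..int ?L} ^ d - complex_of_real (1 - ?s\<^sup>2 * V ?L / 2) ^ d)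
        \<le> real d * (C * \<bar>s n\<bar>^3 * (real ?L * sqrt (real ?L)))"
        by (rule order_trans[OF norm_power_diff[OF \<psi>_le_1 n1]], rule mult_left_mono) (use C(2)[of ?s ?L] in auto)
      have "cmod (\<psi> ?s {0<..int (p n)} - complex_of_real (1 - ?s\<^sup>2 * V ?L / 2) ^ d) \<le> bnd d n"
        using norm_triangle_le[OF add_mono[OF norm_triangle_le[OF add_mono[OF 1 2]] 3]] unfolding bnd_def by simp
      then show ?case by (simp add: b_def)
    qed
  qed
  have "(\<lambda>n. \<psi> (s n) {0<..int (p n)}) \<longlonglongrightarrow> complex_of_real (exp (- (t\<^sup>2) / 2))"
  proof (rule tendstoI)
    fix \<epsilon> :: real assume \<epsilon>: "\<epsilon> > 0"
    have l1: "(\<lambda>d. C * (\<bar>t\<bar> / \<sigma>)^3 * (1 / sqrt (real d))) \<longlonglongrightarrow> C * (\<bar>t\<bar> / \<sigma>)^3 * 0"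
      by (intro tendsto_mult tendsto_const inverse_sqrt_tendsto_0)
    have "\<forall>\<^sub>F d in sequentially. C * (\<bar>t\<bar> / \<sigma>)^3 * (1 / sqrt (real d)) < \<epsilon> / 4"
      using l1 \<epsilon> by (intro order_tendstoD) auto
    moreover have "\<forall>\<^sub>F d in sequentially. dist ((1 + (- (t\<^sup>2) / 2) / real d)^d) (exp (- (t\<^sup>2) / 2)) < \<epsilon> / 4"
      using tendsto_exp_limit_sequentially[of "- (t\<^sup>2) / 2"] \<epsilon> by (intro tendstoD) auto
    moreover have "\<forall>\<^sub>F d in sequentially. real d > t\<^sup>2"
      using filterlim_real_sequentially by (simp add: filterlim_at_top_dense)
    ultimately have "\<forall>\<^sub>F d in sequentially. C * (\<bar>t\<bar> / \<sigma>)^3 * (1 / sqrt (real d)) < \<epsilon> / 4 \<and>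
      dist ((1 + (- (t\<^sup>2) / 2) / real d)^d) (exp (- (t\<^sup>2) / 2)) < \<epsilon> / 4 \<and> real d > t\<^sup>2 \<and> d > 0"
      using eventually_gt_at_top[of 0] by eventually_elim auto
    then obtain d where d: "C * (\<bar>t\<bar> / \<sigma>)^3 * (1 / sqrt (real d)) < \<epsilon> / 4"
      "dist ((1 + (- (t\<^sup>2) / 2) / real d)^d) (exp (- (t\<^sup>2) / 2)) < \<epsilon> / 4" "real d > t\<^sup>2" "d > 0"
      by (auto dest: eventually_happens)
    have "\<forall>\<^sub>F n in sequentially. bnd d n < \<epsilon> / 4" using bnd_lim[OF d(4)] d(1) by (intro order_tendstoD) auto
    moreover have "\<forall>\<^sub>F n in sequentially. dist (b d n) ((1 + (- (t\<^sup>2) / 2) / real d)^d) < \<epsilon> / 4"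
      using b_lim[OF d(4)] \<epsilon> by (intro tendstoD) auto
    ultimately show "\<forall>\<^sub>F n in sequentially. dist (\<psi> (s n) {0<..int (p n)}) (complex_of_real (exp (- (t\<^sup>2) / 2))) < \<epsilon>"
      using main[OF d(4,3)]
    proof eventually_elim
      case (elim n)
      have "dist (\<psi> (s n) {0<..int (p n)}) (complex_of_real (exp (- (t\<^sup>2) / 2)))
        \<le> dist (\<psi> (s n) {0<..int (p n)}) (complex_of_real (b d n)) + dist (complex_of_real (b d n)) (complex_of_real (exp (- (t\<^sup>2) / 2)))"
        by (rule dist_triangle)
      also have "dist (complex_of_real (b d n)) (complex_of_real (exp (- (t\<^sup>2) / 2))) = dist (b d n) (exp (- (t\<^sup>2) / 2))"
        by (rule dist_of_real)
      also have "dist (b d n) (exp (- (t\<^sup>2) / 2)) \<le> dist (b d n) ((1 + (- (t\<^sup>2) / 2) / real d)^d) + dist ((1 + (- (t\<^sup>2) / 2) / real d)^d) (exp (- (t\<^sup>2) / 2))"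
        by (rule dist_triangle)
      finally show ?case using elim d(2) \<epsilon> by (simp add: dist_norm)
    qed
  qed
  then show ?thesis by (simp add: s_def)
qed

theorem clt:
  assumes p: "(\<lambda>n. real (p n) / real n) \<longlonglongrightarrow> c" and c: "c > 0"
  shows "weak_conv_m (\<lambda>n. distr M borel (\<lambda>\<omega>. X {0<..int (p n)} \<omega> / (\<sigma> * sqrt (c * real n)))) std_normal_distribution"
proof (rule levy_continuity)
  show "real_distribution (distr M borel (\<lambda>\<omega>. X {0<..int (p n)} \<omega> / (\<sigma> * sqrt (c * real n))))" for n
    by (rule real_distribution_distr) measurable
  show "real_distribution std_normal_distribution" by (rule real_dist_normal_dist)
  fix t
  have "char (distr M borel (\<lambda>\<omega>. X {0<..int (p n)} \<omega> / (\<sigma> * sqrt (c * real n)))) t = \<psi> (t / (\<sigma> * sqrt (c * real n))) {0<..int (p n)}" for n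
    unfolding char_def \<psi>_def by (subst integral_distr) auto
  then show "(\<lambda>n. char (distr M borel (\<lambda>\<omega>. X {0<..int (p n)} \<omega> / (\<sigma> * sqrt (c * real n)))) t) \<longlonglongrightarrow> char std_normal_distribution t"
    using \<psi>_tendsto[OF assms] by (simp add: char_std_normal_distribution)
qed

end

section \<open>Weak convergence of finitely many coordinates\<close>

text \<open>The functions live on whole sequences, but closeness of the first \<open>d\<close>
  coordinates alone forces closeness of the values, so later coordinates are ignored. The type
  therefore stays the same when an induction over the dimension freezes a coordinate.\<close>

definition ucd :: "nat \<Rightarrow> ((nat \<Rightarrow> real) \<Rightarrow> real) \<Rightarrow> bool" where
  "ucd d f \<longleftrightarrow> (\<forall>\<epsilon>>0. \<exists>\<delta>>0. \<forall>x y. (\<forall>i<d. \<bar>x i - y i\<bar> < \<delta>) \<longrightarrow> \<bar>f x - f y\<bar> < \<epsilon>)"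

lemma ucdD:
  assumes "ucd d f" "\<epsilon> > 0"
  obtains \<delta> where "\<delta> > 0" "\<And>x y. (\<And>i. i < d \<Longrightarrow> \<bar>x i - y i\<bar> < \<delta>) \<Longrightarrow> \<bar>f x - f y\<bar> < \<epsilon>"
  using assms unfolding ucd_def by metis

lemma ucd_cong:
  assumes "ucd d f" "\<And>i. i < d \<Longrightarrow> x i = y i"
  shows "f x = f y"
proof (rule ccontr)
  assume "f x \<noteq> f y"
  then have "\<bar>f x - f y\<bar> > 0" by simp
  with ucdD[OF assms(1)] obtain \<delta> where "\<delta> > 0"
    "\<And>x' y'. (\<And>i. i < d \<Longrightarrow> \<bar>x' i - y' i\<bar> < \<delta>) \<Longrightarrow> \<bar>f x' - f y'\<bar> < \<bar>f x - f y\<bar>" by metis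
  from this(2)[of x y] assms(2) this(1) show False by auto
qed

lemma continuous_ucd:
  assumes "ucd d f"
  shows "continuous_on UNIV f"
  unfolding continuous_on_def
proof (intro ballI tendstoI)
  fix x :: "nat \<Rightarrow> real" and \<epsilon> :: real assume "\<epsilon> > 0"
  then obtain \<delta> where \<delta>: "\<delta> > 0" "\<And>x y. (\<And>i. i < d \<Longrightarrow> \<bar>x i - y i\<bar> < \<delta>) \<Longrightarrow> \<bar>f x - f y\<bar> < \<epsilon>"
    using ucdD[OF assms] by metis
  have "\<forall>\<^sub>F y in at x within UNIV. dist (y i) (x i) < \<delta>" for i
    using continuous_on_product_coordinates[of i, unfolded continuous_on_def, rule_format, of x] \<delta>(1)
    by (intro tendstoD) auto
  then have "\<forall>\<^sub>F y in at x within UNIV. \<forall>i\<in>{..<d}. dist (y i) (x i) < \<delta>"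
    by (intro eventually_ball_finite) auto
  then show "\<forall>\<^sub>F y in at x within UNIV. dist (f y) (f x) < \<epsilon>"
    by eventually_elim (auto simp: dist_real_def intro!: \<delta>)
qed

text \<open>Replacing the ignored coordinates by 0 makes the whole sequence measurable for the
  product topology, in which \<open>f\<close> is continuous.\<close>

lemma measurable_ucd:
  assumes f: "ucd d f" and m: "\<And>i. i < d \<Longrightarrow> Y i \<in> borel_measurable M"
  shows "(\<lambda>\<omega>. f (\<lambda>i. Y i \<omega>)) \<in> borel_measurable M"
proof -
  have "(\<lambda>\<omega>. f (\<lambda>i. Y i \<omega>)) = (\<lambda>\<omega>. f (\<lambda>i. if i < d then Y i \<omega> else 0))"
    by (intro ext ucd_cong[OF f]) auto
  moreover have "(\<lambda>\<omega> i. if i < d then Y i \<omega> else 0) \<in> borel_measurable M"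
  proof (rule measurable_coordinatewise_then_product)
    show "(\<lambda>\<omega>. if i < d then Y i \<omega> else 0) \<in> borel_measurable M" for i
      using m by (cases "i < d") auto
  qed
  from measurable_compose[OF this borel_measurable_continuous_onI[OF continuous_ucd[OF f]]]
  have "(\<lambda>\<omega>. f (\<lambda>i. if i < d then Y i \<omega> else 0)) \<in> borel_measurable M" .
  ultimately show ?thesis by simp
qed

lemma ucd_upd: "ucd (Suc d) f \<Longrightarrow> ucd d (\<lambda>x. f (x(d := a)))"
  unfolding ucd_def
proof (intro allI impI)
  fix \<epsilon> :: real assume f: "\<forall>\<epsilon>>0. \<exists>\<delta>>0. \<forall>x y. (\<forall>i<Suc d. \<bar>x i - y i\<bar> < \<delta>) \<longrightarrow> \<bar>f x - f y\<bar> < \<epsilon>" and "\<epsilon> > 0"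
  then obtain \<delta> where \<delta>: "\<delta> > 0" "\<And>x y. (\<forall>i<Suc d. \<bar>x i - y i\<bar> < \<delta>) \<Longrightarrow> \<bar>f x - f y\<bar> < \<epsilon>" by metis
  have "\<bar>f (x(d := a)) - f (y(d := a))\<bar> < \<epsilon>" if "\<forall>i<d. \<bar>x i - y i\<bar> < \<delta>" for x y
    using that \<delta>(1) by (intro \<delta>(2)) (auto simp: less_Suc_eq)
  then show "\<exists>\<delta>>0. \<forall>x y. (\<forall>i<d. \<bar>x i - y i\<bar> < \<delta>) \<longrightarrow> \<bar>f (x(d := a)) - f (y(d := a))\<bar> < \<epsilon>"
    using \<delta>(1) by blast
qed

definition ramp :: "real \<Rightarrow> real \<Rightarrow> real \<Rightarrow> real" where
  "ramp a h x = min 1 (max 0 ((x - a) / h))"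

lemma ramp_bounds: "0 \<le> ramp a h x" "ramp a h x \<le> 1" by (auto simp: ramp_def)

lemma ramp_lipschitz: "h > 0 \<Longrightarrow> \<bar>ramp a h x - ramp a h y\<bar> \<le> 1 / h * \<bar>x - y\<bar>"
proof -
  assume h: "h > 0"
  have "\<bar>min 1 (max 0 u) - min 1 (max 0 w)\<bar> \<le> \<bar>u - w\<bar>" for u w :: real by auto
  then have "\<bar>ramp a h x - ramp a h y\<bar> \<le> \<bar>(x - a) / h - (y - a) / h\<bar>" by (simp add: ramp_def)
  also have "(x - a) / h - (y - a) / h = (x - y) / h" by (simp add: diff_divide_distrib[symmetric])
  finally show ?thesis using h by (simp add: abs_divide)
qed

lemma measurable_ramp [measurable]: "ramp a h \<in> borel_measurable borel"
  unfolding ramp_def[abs_def] by measurable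

text \<open>The telescoping sum is the piecewise linear interpolation of \<open>\<phi>\<close> at the nodes
  \<open>a + k h\<close>; each term is a product of a node value and a function of \<open>x\<close>.\<close>

lemma interpolation:
  fixes \<phi> :: "real \<Rightarrow> real"
  assumes h: "h > 0"
  obtains j c where "j \<le> n" "0 \<le> c" "c \<le> 1" "c = 0 \<or> j < n"
    "\<phi> a + (\<Sum>k<n. (\<phi> (a + real (Suc k) * h) - \<phi> (a + real k * h)) * ramp (a + real k * h) h x)
      = (1 - c) * \<phi> (a + real j * h) + c * \<phi> (a + real (Suc j) * h)"
    "a \<le> x \<Longrightarrow> x \<le> a + real n * h \<Longrightarrow> a + real j * h \<le> x \<and> x \<le> a + real (Suc j) * h"
proof -
  let ?a = "\<lambda>k. a + real k * h"
  let ?g = "\<lambda>k. (\<phi> (?a (Suc k)) - \<phi> (?a k)) * ramp (?a k) h x"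
  have one: "ramp (?a k) h x = 1" if "x \<ge> ?a (Suc k)" for k
  proof -
    have "1 \<le> (x - ?a k) / h" using that h by (simp add: field_simps)
    then show ?thesis by (simp add: ramp_def)
  qed
  have zero: "ramp (?a k) h x = 0" if "x \<le> ?a k" for k
  proof -
    have "(x - ?a k) / h \<le> 0" using that h by (simp add: field_simps)
    then show ?thesis by (simp add: ramp_def)
  qed
  have tel: "(\<Sum>k<j. ?g k) = \<phi> (?a j) - \<phi> a" if "?a j \<le> x" for j
  proof -
    have "(\<Sum>k<j. ?g k) = (\<Sum>k<j. \<phi> (?a (Suc k)) - \<phi> (?a k))"
    proof (intro sum.cong refl)
      fix k assume "k \<in> {..<j}"
      then have "?a (Suc k) \<le> ?a j" using h by (intro add_left_mono mult_right_mono) auto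
      then have "ramp (?a k) h x = 1" using that by (intro one) auto
      then show "?g k = \<phi> (?a (Suc k)) - \<phi> (?a k)" by simp
    qed
    also have "\<dots> = \<phi> (?a j) - \<phi> (?a 0)" by (rule sum_lessThan_telescope)
    finally show ?thesis by simp
  qed
  have mono: "?a i \<le> ?a k" if "i \<le> k" for i k
    using that h by (intro add_left_mono mult_right_mono) auto
  consider "x < a" | "?a n \<le> x" | "a \<le> x" "x < ?a n" by linarith
  then show ?thesis
  proof cases
    case 1
    have "ramp (?a k) h x = 0" for k
      using 1 mono[of 0 k] by (intro zero) simp
    then have "(\<Sum>k<n. ?g k) = 0" by simp
    then show ?thesis using 1 by (intro that[of 0 0]) auto
  next
    case 2
    show ?thesis
    proof (rule that[of n 0])
      show "\<phi> a + (\<Sum>k<n. ?g k) = (1 - 0) * \<phi> (?a n) + 0 * \<phi> (?a (Suc n))" using tel[OF 2] by simp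
      show "?a n \<le> x \<and> x \<le> ?a (Suc n)" if "x \<le> ?a n" using 2 that mono[of n "Suc n"] by linarith
    qed auto
  next
    case 3
    define j where "j = nat \<lfloor>(x - a) / h\<rfloor>"
    have "0 \<le> (x - a) / h" using 3 h by simp
    then have "real j \<le> (x - a) / h" "(x - a) / h < real (Suc j)"
      unfolding j_def by linarith+
    then have j: "?a j \<le> x" "x \<le> ?a (Suc j)" using h by (simp_all add: field_simps)
    have "j < n"
    proof (rule ccontr)
      assume "\<not> j < n"
      then show False using mono[of n j] j 3 by linarith
    qed
    have "(\<Sum>k<n. ?g k) = (\<Sum>k<Suc j. ?g k)"
    proof (rule sum.mono_neutral_right)
      show "\<forall>i\<in>{..<n} - {..<Suc j}. ?g i = 0"
      proof
        fix i assume "i \<in> {..<n} - {..<Suc j}"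
        then have "ramp (?a i) h x = 0" using j mono[of "Suc j" i] by (intro zero) auto
        then show "?g i = 0" by simp
      qed
    qed (use \<open>j < n\<close> in auto)
    then have "(\<Sum>k<n. ?g k) = \<phi> (?a j) - \<phi> a + ?g j" using tel[OF j(1)] by simp
    then show ?thesis using ramp_bounds[of "?a j" h x] \<open>j < n\<close> j
      by (intro that[of j "ramp (?a j) h x"]) (auto simp: algebra_simps)
  qed
qed

text \<open>A continuous function that is 0 for \<open>\<bar>x\<bar> \<le> R\<close> and 1 for
  \<open>\<bar>x\<bar> \<ge> R + 1\<close>. By continuity its expectations converge, so tightness is
  inherited from the limit.\<close>

definition outside :: "real \<Rightarrow> real \<Rightarrow> real" where
  "outside R x = ramp R 1 \<bar>x\<bar>"

lemma outside_bounds: "0 \<le> outside R x" "outside R x \<le> 1" by (auto simp: outside_def ramp_bounds)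

lemma outside_eq_1: "R + 1 \<le> \<bar>x\<bar> \<Longrightarrow> outside R x = 1"
  by (simp add: outside_def ramp_def)

lemma outside_eq_0: "\<bar>x\<bar> \<le> R \<Longrightarrow> outside R x = 0"
  by (simp add: outside_def ramp_def)

lemma measurable_outside [measurable]: "outside R \<in> borel_measurable borel"
  unfolding outside_def[abs_def] by measurable

lemma continuous_outside: "continuous_on UNIV (outside R)"
  unfolding outside_def ramp_def by (intro continuous_intros) auto

lemma continuous_ramp: "h > 0 \<Longrightarrow> continuous_on UNIV (ramp a h)"
  unfolding ramp_def by (intro continuous_intros) auto

lemma (in prob_space) expectation_outside_tendsto_0:
  assumes [measurable]: "X \<in> borel_measurable M"
  shows "(\<lambda>R. expectation (\<lambda>\<omega>. outside (real R) (X \<omega>))) \<longlonglongrightarrow> 0"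
proof -
  have "(\<lambda>R. expectation (\<lambda>\<omega>. outside (real R) (X \<omega>))) \<longlonglongrightarrow> expectation (\<lambda>\<omega>. 0)"
  proof (rule integral_dominated_convergence[where w="\<lambda>_. 1"])
    show "AE \<omega> in M. (\<lambda>R. outside (real R) (X \<omega>)) \<longlonglongrightarrow> 0"
    proof (intro AE_I2 tendsto_eventually)
      fix \<omega>
      obtain k where "\<bar>X \<omega>\<bar> \<le> real k" using real_arch_simple by blast
      then show "\<forall>\<^sub>F R in sequentially. outside (real R) (X \<omega>) = 0"
        by (intro eventually_sequentiallyI[of k] outside_eq_0) linarith
    qed
  qed (auto simp: outside_bounds abs_of_nonneg)
  then show ?thesis by simp
qed

lemma (in prob_space) integrable_mult_le_1:
  fixes U V :: "'a \<Rightarrow> real"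
  assumes "U \<in> borel_measurable M" "V \<in> borel_measurable M" "\<And>\<omega>. \<bar>U \<omega>\<bar> \<le> 1" "\<And>\<omega>. \<bar>V \<omega>\<bar> \<le> 1"
  shows "integrable M (\<lambda>\<omega>. U \<omega> * V \<omega>)"
  using assms(1,2) mult_le_one[OF assms(3) _ assms(4)]
  by (intro integrable_const_bound[where B=1] AE_I2) (auto simp: abs_mult)

text \<open>Abstracts the convergence of increments: each coordinate of the array converges in law
  and is asymptotically independent of the earlier ones, while in the limit the independence is
  exact.\<close>

locale fdd_setting = M: prob_space M + N: prob_space N
  for M :: "'w measure" and N :: "'v measure" +
  fixes D :: "nat \<Rightarrow> nat \<Rightarrow> 'w \<Rightarrow> real" and G :: "nat \<Rightarrow> 'v \<Rightarrow> real"
  assumes D_meas: "D n j \<in> borel_measurable M" and G_meas: "G j \<in> borel_measurable N"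
    and marginal: "\<And>j (\<theta> :: real \<Rightarrow> real). continuous_on UNIV \<theta> \<Longrightarrow> (\<And>x. \<bar>\<theta> x\<bar> \<le> 1) \<Longrightarrow>
      (\<lambda>n. M.expectation (\<lambda>\<omega>. \<theta> (D n j \<omega>))) \<longlonglongrightarrow> N.expectation (\<lambda>\<omega>. \<theta> (G j \<omega>))"
    and factor_D: "\<And>d f (\<theta> :: real \<Rightarrow> real) K. ucd d f \<Longrightarrow> (\<And>x. \<bar>f x\<bar> \<le> 1) \<Longrightarrow> (\<And>x. \<bar>\<theta> x\<bar> \<le> 1) \<Longrightarrow> (\<And>x y. \<bar>\<theta> x - \<theta> y\<bar> \<le> K * \<bar>x - y\<bar>) \<Longrightarrow>
      \<theta> \<in> borel_measurable borel \<Longrightarrow>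
      (\<lambda>n. M.expectation (\<lambda>\<omega>. f (\<lambda>i. D n i \<omega>) * \<theta> (D n d \<omega>))
        - M.expectation (\<lambda>\<omega>. f (\<lambda>i. D n i \<omega>)) * M.expectation (\<lambda>\<omega>. \<theta> (D n d \<omega>))) \<longlonglongrightarrow> 0"
    and factor_G: "\<And>d f (\<theta> :: real \<Rightarrow> real). ucd d f \<Longrightarrow> (\<And>x. \<bar>f x\<bar> \<le> 1) \<Longrightarrow> (\<And>x. \<bar>\<theta> x\<bar> \<le> 1) \<Longrightarrow> \<theta> \<in> borel_measurable borel \<Longrightarrow>
      N.expectation (\<lambda>\<omega>. f (\<lambda>i. G i \<omega>) * \<theta> (G d \<omega>))
        = N.expectation (\<lambda>\<omega>. f (\<lambda>i. G i \<omega>)) * N.expectation (\<lambda>\<omega>. \<theta> (G d \<omega>))"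
begin

text \<open>Induction over the number of coordinates. Interpolation in the last coordinate turns
  \<open>f\<close>, up to a uniform error on a compact range, into a finite sum of products of a
  function of the earlier coordinates and a ramp of the last one, and to such products asymptotic
  independence applies.\<close>

lemma fdd_convergence_le_1:
  assumes "ucd d f" "\<And>x. \<bar>f x\<bar> \<le> 1"
  shows "(\<lambda>n. M.expectation (\<lambda>\<omega>. f (\<lambda>i. D n i \<omega>))) \<longlonglongrightarrow> N.expectation (\<lambda>\<omega>. f (\<lambda>i. G i \<omega>))"
  using assms
proof (induction d arbitrary: f)
  case 0
  define c where "c = f (\<lambda>_. 0)"
  have "f x = c" for x unfolding c_def using 0(1) by (rule ucd_cong) simp
  then show ?case by (simp add: M.prob_space N.prob_space)
next
  case (Suc d)
  note D_meas[measurable] G_meas[measurable]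
  show ?case
  proof (rule tendstoI)
    fix \<epsilon>0 :: real assume "\<epsilon>0 > 0"
    define \<epsilon> where "\<epsilon> = \<epsilon>0 / 10"
    have \<epsilon>: "\<epsilon> > 0" using \<open>\<epsilon>0 > 0\<close> by (simp add: \<epsilon>_def)
    obtain \<delta> where \<delta>: "\<delta> > 0" "\<And>x y. (\<And>i. i < Suc d \<Longrightarrow> \<bar>x i - y i\<bar> < \<delta>) \<Longrightarrow> \<bar>f x - f y\<bar> < \<epsilon>"
      using ucdD[OF Suc.prems(1) \<epsilon>] by metis
    have "\<forall>\<^sub>F R in sequentially. N.expectation (\<lambda>\<omega>. outside (real R) (G d \<omega>)) < \<epsilon>"
      using N.expectation_outside_tendsto_0[OF G_meas[of d]] \<epsilon> by (rule order_tendstoD)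
    then obtain R :: nat where R: "N.expectation (\<lambda>\<omega>. outside (real R) (G d \<omega>)) < \<epsilon>"
      by (auto dest: eventually_happens)
    define h where "h = \<delta> / 2"
    have h: "h > 0" "h < \<delta>" using \<delta> by (auto simp: h_def)
    define a where "a = - (real R + 1)"
    obtain n0 :: nat where "2 * (real R + 1) / h \<le> real n0" using real_arch_simple by blast
    then have n0: "real R + 1 \<le> a + real n0 * h" using h by (simp add: a_def field_simps)
    \<comment> \<open>Linear interpolation of \<open>f\<close> in coordinate \<open>d\<close> with
      mesh below \<open>\<delta>\<close>. Each value of \<open>P\<close> is a convex combination of
      two values of \<open>f\<close>, also off the grid, where \<open>outside\<close> pays for the
      error.\<close>
    define P where "P x = f (x(d := a)) + (\<Sum>k<n0. (f (x(d := a + real (Suc k) * h)) - f (x(d := a + real k * h))) * ramp (a + real k * h) h (x d))" for x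
    have near: "\<bar>f x - P x\<bar> \<le> \<epsilon> + 2 * outside R (x d)" for x
    proof -
      obtain j c where jc: "j \<le> n0" "0 \<le> c" "c \<le> 1" "c = 0 \<or> j < n0"
        "P x = (1 - c) * f (x(d := a + real j * h)) + c * f (x(d := a + real (Suc j) * h))"
        "a \<le> x d \<Longrightarrow> x d \<le> a + real n0 * h \<Longrightarrow> a + real j * h \<le> x d \<and> x d \<le> a + real (Suc j) * h"
        by (rule interpolation[OF h(1), of n0 "\<lambda>u. f (x(d := u))" a "x d", folded P_def]) (rule that)
      have decomp: "f x - P x = (1 - c) * (f x - f (x(d := a + real j * h))) + c * (f x - f (x(d := a + real (Suc j) * h)))"
        unfolding jc(5) by (simp add: algebra_simps)
      have conv: "\<bar>f x - P x\<bar> \<le> B" if "\<bar>f x - f (x(d := a + real j * h))\<bar> \<le> B" "\<bar>f x - f (x(d := a + real (Suc j) * h))\<bar> \<le> B" for B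
      proof -
        have "\<bar>f x - P x\<bar> \<le> (1 - c) * \<bar>f x - f (x(d := a + real j * h))\<bar> + c * \<bar>f x - f (x(d := a + real (Suc j) * h))\<bar>"
          unfolding decomp using jc(2,3) by (intro order_trans[OF abs_triangle_ineq]) (simp add: abs_mult)
        also have "\<dots> \<le> (1 - c) * B + c * B" using jc(2,3) that by (intro add_mono mult_left_mono) auto
        finally show ?thesis by (simp add: algebra_simps)
      qed
      show ?thesis
      proof (cases "\<bar>x d\<bar> \<le> real R + 1")
        case True
        then have "a \<le> x d" "x d \<le> a + real n0 * h" using n0 by (auto simp: a_def)
        then have loc: "a + real j * h \<le> x d" "x d \<le> a + real (Suc j) * h" using jc(6) by auto
        have "\<bar>f x - f (x(d := u))\<bar> \<le> \<epsilon>" if "\<bar>x d - u\<bar> < \<delta>" for u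
          using that \<delta>(1) by (intro less_imp_le \<delta>(2)) auto
        then have "\<bar>f x - P x\<bar> \<le> \<epsilon>" using loc h by (intro conv) (auto simp: algebra_simps)
        then show ?thesis using outside_bounds(1)[of R "x d"] by linarith
      next
        case False
        then have o: "outside R (x d) = 1" by (intro outside_eq_1) auto
        have "\<bar>f x - f y\<bar> \<le> 2" for y using Suc.prems(2)[of x] Suc.prems(2)[of y] by linarith
        then have "\<bar>f x - P x\<bar> \<le> 2" by (intro conv)
        then show ?thesis using o \<epsilon> by simp
      qed
    qed
    \<comment> \<open>Differences of \<open>f\<close> are halved to meet the bound 1 of the
      induction hypothesis; the factor 2 returns in \<open>P_eq\<close>.\<close>
    let ?u = "\<lambda>k x. (f (x(d := a + real (Suc k) * h)) - f (x(d := a + real k * h))) / 2"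
    have ucd_u: "ucd d (?u k)" for k
      unfolding ucd_def
    proof (intro allI impI)
      fix \<epsilon>' :: real assume "\<epsilon>' > 0"
      then obtain \<delta>' where \<delta>': "\<delta>' > 0" "\<And>x y. (\<And>i. i < Suc d \<Longrightarrow> \<bar>x i - y i\<bar> < \<delta>') \<Longrightarrow> \<bar>f x - f y\<bar> < \<epsilon>'"
        using ucdD[OF Suc.prems(1)] by metis
      have "\<bar>?u k x - ?u k y\<bar> < \<epsilon>'" if "\<forall>i<d. \<bar>x i - y i\<bar> < \<delta>'" for x y
      proof -
        have "\<bar>f (x(d := b)) - f (y(d := b))\<bar> < \<epsilon>'" for b
          using that \<delta>'(1) by (intro \<delta>'(2)) (auto simp: less_Suc_eq)
        from this[of "a + real (Suc k) * h"] this[of "a + real k * h"] show ?thesis by argo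
      qed
      then show "\<exists>\<delta>>0. \<forall>x y. (\<forall>i<d. \<bar>x i - y i\<bar> < \<delta>) \<longrightarrow> \<bar>?u k x - ?u k y\<bar> < \<epsilon>'" using \<delta>'(1) by blast
    qed
    have u1: "\<bar>?u k x\<bar> \<le> 1" for k x
      using Suc.prems(2)[of "x(d := a + real (Suc k) * h)"] Suc.prems(2)[of "x(d := a + real k * h)"] by argo
    have ucd_a: "ucd d (\<lambda>x. f (x(d := a)))" by (rule ucd_upd[OF Suc.prems(1)])
    have fa1: "\<bar>f (x(d := a))\<bar> \<le> 1" for x by (rule Suc.prems(2))
    let ?\<theta> = "\<lambda>k. ramp (a + real k * h) h"
    have \<theta>1: "\<bar>?\<theta> k x\<bar> \<le> 1" for k x using ramp_bounds[of "a + real k * h" h x] by auto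
    have P_eq: "P x = f (x(d := a)) + 2 * (\<Sum>k<n0. ?u k x * ?\<theta> k (x d))" for x
      by (simp add: P_def sum_distrib_left mult_ac)
    have [measurable]: "(\<lambda>\<omega>. ?u k (\<lambda>i. D n i \<omega>)) \<in> borel_measurable M" "(\<lambda>\<omega>. ?u k (\<lambda>i. G i \<omega>)) \<in> borel_measurable N"
      "(\<lambda>\<omega>. f ((\<lambda>i. D n i \<omega>)(d := a))) \<in> borel_measurable M" "(\<lambda>\<omega>. f ((\<lambda>i. G i \<omega>)(d := a))) \<in> borel_measurable N"
      "(\<lambda>\<omega>. f (\<lambda>i. D n i \<omega>)) \<in> borel_measurable M" "(\<lambda>\<omega>. f (\<lambda>i. G i \<omega>)) \<in> borel_measurable N" for k n
      by (rule measurable_ucd[OF ucd_u], rule D_meas) (rule measurable_ucd[OF ucd_u], rule G_meas,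
          rule measurable_ucd[OF ucd_a], rule D_meas, rule measurable_ucd[OF ucd_a], rule G_meas,
          rule measurable_ucd[OF Suc.prems(1)], rule D_meas, rule measurable_ucd[OF Suc.prems(1)], rule G_meas)
    have iM: "integrable M (\<lambda>\<omega>. ?u k (\<lambda>i. D n i \<omega>) * ?\<theta> k (D n d \<omega>))" for k n
      by (rule M.integrable_mult_le_1[OF _ _ u1 \<theta>1]) measurable
    have iN: "integrable N (\<lambda>\<omega>. ?u k (\<lambda>i. G i \<omega>) * ?\<theta> k (G d \<omega>))" for k
      by (rule N.integrable_mult_le_1[OF _ _ u1 \<theta>1]) measurable
    have iaM: "integrable M (\<lambda>\<omega>. f ((\<lambda>i. D n i \<omega>)(d := a)))" "integrable M (\<lambda>\<omega>. f (\<lambda>i. D n i \<omega>))" for n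
      using Suc.prems(2) by (auto intro!: M.integrable_const_bound[where B=1] AE_I2)
    have iaN: "integrable N (\<lambda>\<omega>. f ((\<lambda>i. G i \<omega>)(d := a)))" "integrable N (\<lambda>\<omega>. f (\<lambda>i. G i \<omega>))"
      using Suc.prems(2) by (auto intro!: N.integrable_const_bound[where B=1] AE_I2)
    have EPM: "M.expectation (\<lambda>\<omega>. P (\<lambda>i. D n i \<omega>)) = M.expectation (\<lambda>\<omega>. f ((\<lambda>i. D n i \<omega>)(d := a)))
        + 2 * (\<Sum>k<n0. M.expectation (\<lambda>\<omega>. ?u k (\<lambda>i. D n i \<omega>) * ?\<theta> k (D n d \<omega>)))" for n
      unfolding P_eq using iM iaM by simp
    have EPN: "N.expectation (\<lambda>\<omega>. P (\<lambda>i. G i \<omega>)) = N.expectation (\<lambda>\<omega>. f ((\<lambda>i. G i \<omega>)(d := a)))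
        + 2 * (\<Sum>k<n0. N.expectation (\<lambda>\<omega>. ?u k (\<lambda>i. G i \<omega>) * ?\<theta> k (G d \<omega>)))"
      unfolding P_eq using iN iaN by simp
    have prodlim: "(\<lambda>n. M.expectation (\<lambda>\<omega>. ?u k (\<lambda>i. D n i \<omega>) * ?\<theta> k (D n d \<omega>)))
        \<longlonglongrightarrow> N.expectation (\<lambda>\<omega>. ?u k (\<lambda>i. G i \<omega>) * ?\<theta> k (G d \<omega>))" for k
    proof -
      have 1: "(\<lambda>n. M.expectation (\<lambda>\<omega>. ?u k (\<lambda>i. D n i \<omega>))) \<longlonglongrightarrow> N.expectation (\<lambda>\<omega>. ?u k (\<lambda>i. G i \<omega>))"
        by (rule Suc.IH[OF ucd_u u1])
      have 2: "(\<lambda>n. M.expectation (\<lambda>\<omega>. ?\<theta> k (D n d \<omega>))) \<longlonglongrightarrow> N.expectation (\<lambda>\<omega>. ?\<theta> k (G d \<omega>))"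
        by (rule marginal[of "?\<theta> k" d]) (rule continuous_ramp[OF h(1)], rule \<theta>1)
      have 3: "(\<lambda>n. M.expectation (\<lambda>\<omega>. ?u k (\<lambda>i. D n i \<omega>) * ?\<theta> k (D n d \<omega>))
        - M.expectation (\<lambda>\<omega>. ?u k (\<lambda>i. D n i \<omega>)) * M.expectation (\<lambda>\<omega>. ?\<theta> k (D n d \<omega>))) \<longlonglongrightarrow> 0"
        by (rule factor_D[of d "?u k" "?\<theta> k" "1 / h"]) (rule ucd_u u1 \<theta>1 ramp_lipschitz[OF h(1)] measurable_ramp)+
      have 4: "N.expectation (\<lambda>\<omega>. ?u k (\<lambda>i. G i \<omega>) * ?\<theta> k (G d \<omega>))
        = N.expectation (\<lambda>\<omega>. ?u k (\<lambda>i. G i \<omega>)) * N.expectation (\<lambda>\<omega>. ?\<theta> k (G d \<omega>))"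
        by (rule factor_G[of d "?u k" "?\<theta> k"]) (rule ucd_u u1 \<theta>1 measurable_ramp)+
      show ?thesis
        using tendsto_add[OF 3 tendsto_mult[OF 1 2]] unfolding 4 by simp
    qed
    have Plim: "(\<lambda>n. M.expectation (\<lambda>\<omega>. P (\<lambda>i. D n i \<omega>))) \<longlonglongrightarrow> N.expectation (\<lambda>\<omega>. P (\<lambda>i. G i \<omega>))"
      unfolding EPM EPN by (intro tendsto_intros prodlim Suc.IH[OF ucd_a fa1])
    have iPM: "integrable M (\<lambda>\<omega>. P (\<lambda>i. D n i \<omega>))" for n unfolding P_eq using iM iaM by simp
    have iPN: "integrable N (\<lambda>\<omega>. P (\<lambda>i. G i \<omega>))" unfolding P_eq using iN iaN by simp
    have oM: "integrable M (\<lambda>\<omega>. outside R (D n d \<omega>))" for n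
      by (intro M.integrable_const_bound[where B=1] AE_I2) (auto simp: outside_bounds abs_of_nonneg)
    have oN: "integrable N (\<lambda>\<omega>. outside R (G d \<omega>))"
      by (intro N.integrable_const_bound[where B=1] AE_I2) (auto simp: outside_bounds abs_of_nonneg)
    have errM: "\<bar>M.expectation (\<lambda>\<omega>. f (\<lambda>i. D n i \<omega>)) - M.expectation (\<lambda>\<omega>. P (\<lambda>i. D n i \<omega>))\<bar>
        \<le> \<epsilon> + 2 * M.expectation (\<lambda>\<omega>. outside R (D n d \<omega>))" for n
    proof -
      have "\<bar>M.expectation (\<lambda>\<omega>. f (\<lambda>i. D n i \<omega>)) - M.expectation (\<lambda>\<omega>. P (\<lambda>i. D n i \<omega>))\<bar>
        = \<bar>M.expectation (\<lambda>\<omega>. f (\<lambda>i. D n i \<omega>) - P (\<lambda>i. D n i \<omega>))\<bar>" using iaM iPM by simp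
      also have "\<dots> \<le> M.expectation (\<lambda>\<omega>. \<bar>f (\<lambda>i. D n i \<omega>) - P (\<lambda>i. D n i \<omega>)\<bar>)" by (rule integral_abs_bound)
      also have "\<dots> \<le> M.expectation (\<lambda>\<omega>. \<epsilon> + 2 * outside R (D n d \<omega>))"
        using iaM iPM oM near by (intro integral_mono) auto
      finally show ?thesis using oM by (simp add: M.prob_space)
    qed
    have errN: "\<bar>N.expectation (\<lambda>\<omega>. f (\<lambda>i. G i \<omega>)) - N.expectation (\<lambda>\<omega>. P (\<lambda>i. G i \<omega>))\<bar>
        \<le> \<epsilon> + 2 * N.expectation (\<lambda>\<omega>. outside R (G d \<omega>))"
    proof -
      have "\<bar>N.expectation (\<lambda>\<omega>. f (\<lambda>i. G i \<omega>)) - N.expectation (\<lambda>\<omega>. P (\<lambda>i. G i \<omega>))\<bar>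
        = \<bar>N.expectation (\<lambda>\<omega>. f (\<lambda>i. G i \<omega>) - P (\<lambda>i. G i \<omega>))\<bar>" using iaN iPN by simp
      also have "\<dots> \<le> N.expectation (\<lambda>\<omega>. \<bar>f (\<lambda>i. G i \<omega>) - P (\<lambda>i. G i \<omega>)\<bar>)" by (rule integral_abs_bound)
      also have "\<dots> \<le> N.expectation (\<lambda>\<omega>. \<epsilon> + 2 * outside R (G d \<omega>))"
        using iaN iPN oN near by (intro integral_mono) auto
      finally show ?thesis using oN by (simp add: N.prob_space)
    qed
    \<comment> \<open>The cutoff is a continuous test function, so the tail bound of the limit
      carries over to \<open>D n d\<close> for large \<open>n\<close>.\<close>
    have "(\<lambda>n. M.expectation (\<lambda>\<omega>. outside R (D n d \<omega>))) \<longlonglongrightarrow> N.expectation (\<lambda>\<omega>. outside R (G d \<omega>))"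
      by (rule marginal[of "outside R" d]) (simp_all add: outside_bounds abs_of_nonneg continuous_outside)
    from order_tendstoD(2)[OF this R] tendstoD[OF Plim \<epsilon>]
    show "\<forall>\<^sub>F n in sequentially. dist (M.expectation (\<lambda>\<omega>. f (\<lambda>i. D n i \<omega>))) (N.expectation (\<lambda>\<omega>. f (\<lambda>i. G i \<omega>))) < \<epsilon>0"
    proof eventually_elim
      case (elim n)
      then show ?case using errM[of n] errN R unfolding dist_real_def \<epsilon>_def by argo
    qed
  qed
qed

lemma fdd_convergence:
  assumes "ucd d f" "\<And>x. \<bar>f x\<bar> \<le> c"
  shows "(\<lambda>n. M.expectation (\<lambda>\<omega>. f (\<lambda>i. D n i \<omega>))) \<longlonglongrightarrow> N.expectation (\<lambda>\<omega>. f (\<lambda>i. G i \<omega>))"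
proof -
  define c' where "c' = max c 1"
  have c': "c' > 0" by (simp add: c'_def)
  have "ucd d (\<lambda>x. f x / c')"
    unfolding ucd_def
  proof (intro allI impI)
    fix \<epsilon> :: real assume "\<epsilon> > 0"
    then have "\<epsilon> * c' > 0" using c' by simp
    then obtain \<delta> where "\<delta> > 0" "\<And>x y. (\<And>i. i < d \<Longrightarrow> \<bar>x i - y i\<bar> < \<delta>) \<Longrightarrow> \<bar>f x - f y\<bar> < \<epsilon> * c'"
      using ucdD[OF assms(1)] by metis
    moreover have "\<bar>f x / c' - f y / c'\<bar> = \<bar>f x - f y\<bar> / c'" for x y
      using c' by (simp add: diff_divide_distrib[symmetric])
    ultimately show "\<exists>\<delta>>0. \<forall>x y. (\<forall>i<d. \<bar>x i - y i\<bar> < \<delta>) \<longrightarrow> \<bar>f x / c' - f y / c'\<bar> < \<epsilon>"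
      using c' by (metis pos_divide_less_eq)
  qed
  moreover have "\<bar>f x / c'\<bar> \<le> 1" for x using assms(2)[of x] c' by (simp add: c'_def)
  ultimately have "(\<lambda>n. M.expectation (\<lambda>\<omega>. f (\<lambda>i. D n i \<omega>) / c')) \<longlonglongrightarrow> N.expectation (\<lambda>\<omega>. f (\<lambda>i. G i \<omega>) / c')"
    by (rule fdd_convergence_le_1)
  from tendsto_mult[OF this tendsto_const[of c']] c' show ?thesis by simp
qed

end

section \<open>Increments on a grid\<close>

locale brownian_motion =
  fixes N :: "'v measure" and B :: "real \<Rightarrow> 'v \<Rightarrow> real"
  assumes bm: "standard_brownian_motion N B"

sublocale brownian_motion \<subseteq> N: prob_space N
  using bm by (simp add: standard_brownian_motion_def)

context brownian_motion
begin

lemma B_measurable: "0 \<le> t \<Longrightarrow> B t \<in> borel_measurable N"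
  and B_0: "\<omega> \<in> space N \<Longrightarrow> B 0 \<omega> = 0"
  and B_continuous: "\<omega> \<in> space N \<Longrightarrow> continuous_on {0..} (\<lambda>t. B t \<omega>)"
  and B_normal: "0 \<le> s \<Longrightarrow> s < t \<Longrightarrow>
        distributed N lborel (\<lambda>\<omega>. B t \<omega> - B s \<omega>) (normal_density 0 (sqrt (t - s)))"
  and B_indep: "0 \<le> u 0 \<Longrightarrow> (\<And>i. i < k \<Longrightarrow> u i < u (Suc i)) \<Longrightarrow>
        N.indep_vars (\<lambda>_. borel) (\<lambda>i \<omega>. B (u (Suc i)) \<omega> - B (u i) \<omega>) {..<k}"
  using bm unfolding standard_brownian_motion_def by auto

definition G :: "nat \<Rightarrow> nat \<Rightarrow> 'v \<Rightarrow> real" where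
  "G m j \<omega> = B (real (Suc j) / real m) \<omega> - B (real j / real m) \<omega>"

lemma measurable_G [measurable]: "G m j \<in> borel_measurable N"
  unfolding G_def[abs_def] using B_measurable[of "real (Suc j) / real m"] B_measurable[of "real j / real m"] by simp

lemma G_std_normal:
  assumes "m > 0"
  shows "distr N borel (\<lambda>\<omega>. G m j \<omega> * sqrt (real m)) = std_normal_distribution"
proof -
  have e: "real (Suc j) / real m - real j / real m = 1 / real m" using assms by (simp add: field_simps)
  have "distributed N lborel (G m j) (normal_density 0 (sqrt (1 / real m)))"
    using B_normal[of "real j / real m" "real (Suc j) / real m"] assms e
    by (simp add: G_def[abs_def] divide_strict_right_mono)
  then have "distributed N lborel (\<lambda>\<omega>. (G m j \<omega> - 0) / sqrt (1 / real m)) std_normal_density"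
    using assms by (subst (asm) N.normal_standard_normal_convert) auto
  then have "distr N lborel (\<lambda>\<omega>. (G m j \<omega> - 0) / sqrt (1 / real m)) = std_normal_distribution"
    by (rule distributed_distr_eq_density)
  moreover have "distr N lborel (\<lambda>\<omega>. (G m j \<omega> - 0) / sqrt (1 / real m)) = distr N borel (\<lambda>\<omega>. G m j \<omega> * sqrt (real m))"
    using assms by (intro distr_cong) (auto simp: real_sqrt_divide)
  ultimately show ?thesis by simp
qed

text \<open>Increments over disjoint cells are independent, and \<open>f\<close> sees only the cells
  before \<open>d\<close>, so restricting the increments to those indices does not change
  it.\<close>

lemma G_factor:
  fixes \<theta> :: "real \<Rightarrow> real"
  assumes m: "m > 0" and f: "ucd d f" and f1: "\<And>x. \<bar>f x\<bar> \<le> 1" and \<theta>1: "\<And>x. \<bar>\<theta> x\<bar> \<le> 1"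
    and [measurable]: "\<theta> \<in> borel_measurable borel"
  shows "N.expectation (\<lambda>\<omega>. f (\<lambda>i. G m i \<omega>) * \<theta> (G m d \<omega>))
        = N.expectation (\<lambda>\<omega>. f (\<lambda>i. G m i \<omega>)) * N.expectation (\<lambda>\<omega>. \<theta> (G m d \<omega>))"
proof -
  have "N.indep_vars (\<lambda>_. borel) (G m) {..<Suc d}"
    using B_indep[of "\<lambda>i. real i / real m" "Suc d"] m by (simp add: G_def[abs_def] divide_strict_right_mono)
  then have "N.indep_var (PiM {..<d} (\<lambda>_. borel)) (\<lambda>\<omega>. restrict (\<lambda>i. G m i \<omega>) {..<d})
      (PiM {d} (\<lambda>_. borel)) (\<lambda>\<omega>. restrict (\<lambda>i. G m i \<omega>) {d})"
    by (rule N.indep_var_restrict) auto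
  then have "N.indep_var borel (f \<circ> (\<lambda>\<omega>. restrict (\<lambda>i. G m i \<omega>) {..<d})) borel ((\<lambda>z. \<theta> (z d)) \<circ> (\<lambda>\<omega>. restrict (\<lambda>i. G m i \<omega>) {d}))"
  proof (rule N.indep_var_compose)
    have "(\<lambda>z. f (\<lambda>i. z i)) \<in> borel_measurable (PiM {..<d} (\<lambda>_. borel))"
      by (rule measurable_ucd[OF f]) (auto intro: measurable_component_singleton)
    then show "f \<in> borel_measurable (PiM {..<d} (\<lambda>_. borel))" by simp
    show "(\<lambda>z. \<theta> (z d)) \<in> borel_measurable (PiM {d} (\<lambda>_. borel))" by measurable
  qed
  moreover have "f \<circ> (\<lambda>\<omega>. restrict (\<lambda>i. G m i \<omega>) {..<d}) = (\<lambda>\<omega>. f (\<lambda>i. G m i \<omega>))"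
    by (auto simp: fun_eq_iff intro!: ucd_cong[OF f])
  moreover have "(\<lambda>z. \<theta> (z d)) \<circ> (\<lambda>\<omega>. restrict (\<lambda>i. G m i \<omega>) {d}) = (\<lambda>\<omega>. \<theta> (G m d \<omega>))"
    by (auto simp: fun_eq_iff)
  ultimately have ind: "N.indep_var borel (\<lambda>\<omega>. f (\<lambda>i. G m i \<omega>)) borel (\<lambda>\<omega>. \<theta> (G m d \<omega>))" by simp
  have [measurable]: "(\<lambda>\<omega>. f (\<lambda>i. G m i \<omega>)) \<in> borel_measurable N"
    by (rule measurable_ucd[OF f]) measurable
  show ?thesis
    using f1 \<theta>1 by (intro N.indep_var_lebesgue_integral[OF ind] N.integrable_const_bound[where B=1] AE_I2) auto
qed

end

text \<open>The product is formed before the division: this is the index that belongs to the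
  rescaled time \<open>j / m\<close>, rounded down.\<close>

definition gridpt :: "nat \<Rightarrow> nat \<Rightarrow> nat \<Rightarrow> nat" where "gridpt m n j = n * j div m"

lemma gridpt_mono: "i \<le> j \<Longrightarrow> gridpt m n i \<le> gridpt m n j"
  by (simp add: gridpt_def div_le_mono)

lemma gridpt_tendsto: "m > 0 \<Longrightarrow> (\<lambda>n. real (gridpt m n j) / real n) \<longlonglongrightarrow> real j / real m"
  unfolding gridpt_def
proof (rule div_over_tendsto)
  show "(\<lambda>n. real (n * j) / real n) \<longlonglongrightarrow> real j"
    by (rule tendsto_eventually, rule eventually_sequentiallyI[of 1]) auto
qed

lemma gridpt_diff_tendsto:
  assumes "m > 0"
  shows "(\<lambda>n. real (gridpt m n (Suc j) - gridpt m n j) / real n) \<longlonglongrightarrow> 1 / real m"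
proof -
  have "(\<lambda>n. real (gridpt m n (Suc j)) / real n - real (gridpt m n j) / real n) \<longlonglongrightarrow> real (Suc j) / real m - real j / real m"
    by (intro tendsto_diff gridpt_tendsto assms)
  moreover have "real (Suc j) / real m - real j / real m = 1 / real m" using assms by (simp add: field_simps)
  ultimately show ?thesis using gridpt_mono[of j "Suc j" m] by (simp add: of_nat_diff diff_divide_distrib)
qed

lemma eventually_gap_less:
  assumes p: "(\<lambda>n. real (p n) / real n) \<longlonglongrightarrow> c" and c: "c > 0"
  shows "\<forall>\<^sub>F n in sequentially. gap n < p n"
proof -
  have "(\<lambda>n. real (gap n) / sqrt (real n) * (1 / sqrt (real n))) \<longlonglongrightarrow> 0 * 0"
    by (intro tendsto_mult gap_over_sqrt inverse_sqrt_tendsto_0)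
  from tendsto_diff[OF p this]
  have "(\<lambda>n. real (p n) / real n - real (gap n) / sqrt (real n) * (1 / sqrt (real n))) \<longlonglongrightarrow> c" by simp
  then have "\<forall>\<^sub>F n in sequentially. 0 < real (p n) / real n - real (gap n) / sqrt (real n) * (1 / sqrt (real n))"
    using c by (rule order_tendstoD)
  then show ?thesis
    using eventually_gt_at_top[of 0] by eventually_elim (simp add: divide_less_cancel)
qed

section \<open>Increments of the rescaled partial sums\<close>

context mixing_clt
begin

definition D :: "nat \<Rightarrow> nat \<Rightarrow> nat \<Rightarrow> 'w \<Rightarrow> real" where
  "D m n j \<omega> = X {int (gridpt m n j)<..int (gridpt m n (Suc j))} \<omega> / (\<sigma> * sqrt (real n))"

lemma measurable_D [measurable]: "D m n j \<in> borel_measurable M"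
  unfolding D_def[abs_def] by measurable

text \<open>Stationarity moves the increment to the origin, where the central limit theorem applies
  with \<open>c = 1 / m\<close>. The factor \<open>sqrt (real m)\<close> in \<open>\<theta>'\<close>
  undoes the normalisation to unit variance.\<close>

lemma D_marginal:
  fixes \<theta> :: "real \<Rightarrow> real"
  assumes BM: "brownian_motion N B" and m: "m > 0"
    and \<theta>: "continuous_on UNIV \<theta>" "\<And>x. \<bar>\<theta> x\<bar> \<le> 1"
  shows "(\<lambda>n. expectation (\<lambda>\<omega>. \<theta> (D m n j \<omega>))) \<longlonglongrightarrow> integral\<^sup>L N (\<lambda>\<omega>. \<theta> (brownian_motion.G B m j \<omega>))"
proof -
  interpret brownian_motion N B by (rule BM)
  define \<theta>' where "\<theta>' z = \<theta> (z / sqrt (real m))" for z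
  define p where "p n = gridpt m n (Suc j) - gridpt m n j" for n
  have p: "(\<lambda>n. real (p n) / real n) \<longlonglongrightarrow> 1 / real m" unfolding p_def by (rule gridpt_diff_tendsto[OF m])
  have [measurable]: "\<theta> \<in> borel_measurable borel" by (rule borel_measurable_continuous_onI[OF \<theta>(1)])
  have cont: "isCont \<theta>' x" for x
    using \<theta>(1) m unfolding \<theta>'_def
    by (intro continuous_at_compose[of x "\<lambda>z. z / sqrt (real m)" \<theta>, unfolded o_def] continuous_intros)
      (auto simp: continuous_on_eq_continuous_at)
  have [measurable]: "\<theta>' \<in> borel_measurable borel" unfolding \<theta>'_def[abs_def] by measurable
  let ?\<mu> = "\<lambda>n. distr M borel (\<lambda>\<omega>. X {0<..int (p n)} \<omega> / (\<sigma> * sqrt (1 / real m * real n)))"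
  interpret \<mu>: real_distribution "?\<mu> n" for n by (rule real_distribution_distr) measurable
  interpret std: real_distribution std_normal_distribution by (rule real_dist_normal_dist)
  have "(\<lambda>n. integral\<^sup>L (?\<mu> n) \<theta>') \<longlonglongrightarrow> integral\<^sup>L std_normal_distribution \<theta>'"
    using clt[OF p] m cont \<theta>(2)
    by (intro weak_conv_imp_integral_bdd_continuous_conv[where B=1] \<mu>.real_distribution_axioms std.real_distribution_axioms)
      (auto simp: \<theta>'_def)
  moreover have "integral\<^sup>L std_normal_distribution \<theta>' = integral\<^sup>L N (\<lambda>\<omega>. \<theta> (G m j \<omega>))"
    unfolding G_std_normal[OF m, of j, symmetric] using m by (subst integral_distr) (auto simp: \<theta>'_def)
  moreover have "integral\<^sup>L (?\<mu> n) \<theta>' = expectation (\<lambda>\<omega>. \<theta> (D m n j \<omega>))" for n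
  proof -
    have "integral\<^sup>L (?\<mu> n) \<theta>' = expectation (\<lambda>\<omega>. \<theta> (X {0<..int (p n)} \<omega> / (\<sigma> * sqrt (real n))))"
      using m by (subst integral_distr) (auto simp: \<theta>'_def real_sqrt_divide real_sqrt_mult)
    also have "\<dots> = integral\<^sup>L (distr M borel (X {0<..int (p n)})) (\<lambda>x. \<theta> (x / (\<sigma> * sqrt (real n))))"
      by (subst integral_distr) auto
    also have "\<dots> = integral\<^sup>L (distr M borel (X {int (gridpt m n j)<..int (gridpt m n j) + int (p n)})) (\<lambda>x. \<theta> (x / (\<sigma> * sqrt (real n))))"
      unfolding distr_X ..
    also have "\<dots> = expectation (\<lambda>\<omega>. \<theta> (D m n j \<omega>))"
      using gridpt_mono[of j "Suc j" m n] by (subst integral_distr) (auto simp: D_def p_def of_nat_diff)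
    finally show ?thesis .
  qed
  ultimately show ?thesis by simp
qed

text \<open>Increment \<open>d\<close> gives up \<open>gap n\<close> indices at its left end, which
  separates it from the earlier increments. The loss is deterministic: bounded terms and the
  Lipschitz constant of \<open>\<theta>\<close> give an error of order
  \<open>gap n / sqrt n\<close>.\<close>

lemma D_factor:
  fixes \<theta> :: "real \<Rightarrow> real"
  assumes m: "m > 0" and f: "ucd d f" and f1: "\<And>x. \<bar>f x\<bar> \<le> 1" and \<theta>1: "\<And>x. \<bar>\<theta> x\<bar> \<le> 1"
    and lip: "\<And>x y. \<bar>\<theta> x - \<theta> y\<bar> \<le> K * \<bar>x - y\<bar>" and [measurable]: "\<theta> \<in> borel_measurable borel"
  shows "(\<lambda>n. expectation (\<lambda>\<omega>. f (\<lambda>i. D m n i \<omega>) * \<theta> (D m n d \<omega>))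
        - expectation (\<lambda>\<omega>. f (\<lambda>i. D m n i \<omega>)) * expectation (\<lambda>\<omega>. \<theta> (D m n d \<omega>))) \<longlonglongrightarrow> 0"
\<comment> \<open>Without earlier increments the past would be an empty index set, which the mixing
  bound excludes; but then \<open>f\<close> is constant.\<close>
proof (cases "d = 0")
  case True
  define c where "c = f (\<lambda>_. 0)"
  have "f x = c" for x unfolding c_def using f unfolding True by (rule ucd_cong) simp
  then show ?thesis by (simp add: prob_space)
next
  case False
  have [measurable]: "(\<lambda>\<omega>. f (\<lambda>i. D m n i \<omega>)) \<in> borel_measurable M" for n
    by (rule measurable_ucd[OF f]) measurable
  let ?J = "\<lambda>n. {int (gridpt m n d) + int (gap n)<..int (gridpt m n (Suc d))}"
  define D' where "D' n \<omega> = X (?J n) \<omega> / (\<sigma> * sqrt (real n))" for n \<omega>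
  have [measurable]: "D' n \<in> borel_measurable M" for n unfolding D'_def[abs_def] by measurable
  define b where "b n = \<bar>K\<bar> * (\<kappa> * norm \<mu> / \<sigma>) * (real (gap n) / sqrt (real n))" for n
  have b0: "b \<longlonglongrightarrow> 0"
    using tendsto_mult[OF tendsto_const gap_over_sqrt, of "\<bar>K\<bar> * (\<kappa> * norm \<mu> / \<sigma>)"] by (simp add: b_def[abs_def])
  have rgap: "(\<lambda>n. r (gap n)) \<longlonglongrightarrow> 0"
    using filterlim_compose[OF r_lim filterlim_gap] .
  have ev1: "\<forall>\<^sub>F n in sequentially. gap n < gridpt m n (Suc d) - gridpt m n d"
    using m by (intro eventually_gap_less[OF gridpt_diff_tendsto[OF m]]) auto
  have ev2: "\<forall>\<^sub>F n in sequentially. gap n < gridpt m n d"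
    using m False by (intro eventually_gap_less[OF gridpt_tendsto[OF m]]) auto
  have main: "\<forall>\<^sub>F n in sequentially. \<bar>expectation (\<lambda>\<omega>. f (\<lambda>i. D m n i \<omega>) * \<theta> (D m n d \<omega>))
        - expectation (\<lambda>\<omega>. f (\<lambda>i. D m n i \<omega>)) * expectation (\<lambda>\<omega>. \<theta> (D m n d \<omega>))\<bar> \<le> 2 * b n + r (gap n)"
    using ev1 ev2
  proof eventually_elim
    case (elim n)
    let ?f = "\<lambda>\<omega>. f (\<lambda>i. D m n i \<omega>)" and ?I = "{0<..int (gridpt m n d)}"
    have near: "\<bar>\<theta> (D m n d \<omega>) - \<theta> (D' n \<omega>)\<bar> \<le> b n" for \<omega>
    proof -
      have "X {int (gridpt m n d)<..int (gridpt m n (Suc d))} \<omega>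
        = X {int (gridpt m n d)<..int (gridpt m n d) + int (gap n)} \<omega> + X (?J n) \<omega>"
        using elim by (intro X_split) auto
      then have "D m n d \<omega> - D' n \<omega> = X {int (gridpt m n d)<..int (gridpt m n d) + int (gap n)} \<omega> / (\<sigma> * sqrt (real n))"
        by (simp add: D_def D'_def diff_divide_distrib[symmetric])
      then have "\<bar>D m n d \<omega> - D' n \<omega>\<bar> = \<bar>X {int (gridpt m n d)<..int (gridpt m n d) + int (gap n)} \<omega>\<bar> / (\<sigma> * sqrt (real n))"
        using \<sigma>_pos by (simp add: abs_mult)
      also have "\<dots> \<le> (real (gap n) * (\<kappa> * norm \<mu>)) / (\<sigma> * sqrt (real n))"
        using abs_X_le[of "{int (gridpt m n d)<..int (gridpt m n d) + int (gap n)}" \<omega>] \<sigma>_pos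
        by (intro divide_right_mono) auto
      finally have le: "\<bar>D m n d \<omega> - D' n \<omega>\<bar> \<le> (real (gap n) * (\<kappa> * norm \<mu>)) / (\<sigma> * sqrt (real n))" .
      have "\<bar>\<theta> (D m n d \<omega>) - \<theta> (D' n \<omega>)\<bar> \<le> \<bar>K\<bar> * \<bar>D m n d \<omega> - D' n \<omega>\<bar>"
        using lip[of "D m n d \<omega>" "D' n \<omega>"] by (meson abs_ge_self abs_ge_zero mult_right_mono order_trans)
      also have "\<dots> \<le> \<bar>K\<bar> * ((real (gap n) * (\<kappa> * norm \<mu>)) / (\<sigma> * sqrt (real n)))"
        using le by (intro mult_left_mono) auto
      finally show ?thesis by (simp add: b_def mult_ac)
    qed
    have mix: "\<bar>expectation (\<lambda>\<omega>. ?f \<omega> * \<theta> (D' n \<omega>)) - expectation ?f * expectation (\<lambda>\<omega>. \<theta> (D' n \<omega>))\<bar> \<le> r (gap n)"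
    proof (rule mixing_le_1)
      show "?f \<in> borel_measurable (F ?I)"
      proof (rule measurable_ucd[OF f])
        fix i assume "i < d"
        then have "{int (gridpt m n i)<..int (gridpt m n (Suc i))} \<subseteq> ?I"
          using gridpt_mono[of "Suc i" d m n] by auto
        from measurable_X_F[OF this] show "D m n i \<in> borel_measurable (F ?I)" unfolding D_def[abs_def] by simp
      qed
      have "X (?J n) \<in> borel_measurable (F (?J n))" by (rule measurable_X_F) simp
      then have "(\<lambda>\<omega>. X (?J n) \<omega> / (\<sigma> * sqrt (real n))) \<in> borel_measurable (F (?J n))" by simp
      from measurable_compose[OF this \<open>\<theta> \<in> borel_measurable borel\<close>]
      show "(\<lambda>\<omega>. \<theta> (D' n \<omega>)) \<in> borel_measurable (F (?J n))" by (simp add: D'_def)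
      show "?I \<noteq> {}" "?J n \<noteq> {}" using elim by auto
      show "apart (gap n) ?I (?J n)" by (auto simp: apart_def)
    qed (rule f1 \<theta>1)+
    have i: "integrable M ?f" "integrable M (\<lambda>\<omega>. \<theta> (D m n d \<omega>))" "integrable M (\<lambda>\<omega>. \<theta> (D' n \<omega>))"
      by (rule integrable_bounded[OF _ f1], measurable) (rule integrable_bounded[OF _ \<theta>1], measurable)+
    have i2: "integrable M (\<lambda>\<omega>. ?f \<omega> * \<theta> (D m n d \<omega>))" "integrable M (\<lambda>\<omega>. ?f \<omega> * \<theta> (D' n \<omega>))"
      by (rule integrable_mult_le_1[OF _ _ f1 \<theta>1], measurable)+
    have nearE: "expectation (\<lambda>\<omega>. \<bar>\<theta> (D m n d \<omega>) - \<theta> (D' n \<omega>)\<bar>) \<le> b n"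
    proof -
      have "expectation (\<lambda>\<omega>. \<bar>\<theta> (D m n d \<omega>) - \<theta> (D' n \<omega>)\<bar>) \<le> expectation (\<lambda>_. b n)"
        using i near by (intro integral_mono) auto
      then show ?thesis by (simp add: prob_space)
    qed
    have d1: "\<bar>expectation (\<lambda>\<omega>. ?f \<omega> * \<theta> (D m n d \<omega>)) - expectation (\<lambda>\<omega>. ?f \<omega> * \<theta> (D' n \<omega>))\<bar> \<le> b n"
    proof -
      have "\<bar>expectation (\<lambda>\<omega>. ?f \<omega> * \<theta> (D m n d \<omega>)) - expectation (\<lambda>\<omega>. ?f \<omega> * \<theta> (D' n \<omega>))\<bar>
        = \<bar>expectation (\<lambda>\<omega>. ?f \<omega> * \<theta> (D m n d \<omega>) - ?f \<omega> * \<theta> (D' n \<omega>))\<bar>" using i2 by simp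
      also have "\<dots> \<le> expectation (\<lambda>\<omega>. \<bar>?f \<omega> * \<theta> (D m n d \<omega>) - ?f \<omega> * \<theta> (D' n \<omega>)\<bar>)" by (rule integral_abs_bound)
      also have "\<dots> \<le> expectation (\<lambda>\<omega>. \<bar>\<theta> (D m n d \<omega>) - \<theta> (D' n \<omega>)\<bar>)"
      proof (intro integral_mono)
        show "\<bar>?f \<omega> * \<theta> (D m n d \<omega>) - ?f \<omega> * \<theta> (D' n \<omega>)\<bar> \<le> \<bar>\<theta> (D m n d \<omega>) - \<theta> (D' n \<omega>)\<bar>" for \<omega>
          unfolding right_diff_distrib[symmetric] abs_mult
          using mult_right_mono[OF f1, of "\<bar>\<theta> (D m n d \<omega>) - \<theta> (D' n \<omega>)\<bar>"] by simp
      qed (use i i2 in auto)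
      finally show ?thesis using nearE by simp
    qed
    have d2: "\<bar>expectation ?f * expectation (\<lambda>\<omega>. \<theta> (D m n d \<omega>)) - expectation ?f * expectation (\<lambda>\<omega>. \<theta> (D' n \<omega>))\<bar> \<le> b n"
    proof -
      have "\<bar>expectation ?f\<bar> \<le> expectation (\<lambda>\<omega>. \<bar>?f \<omega>\<bar>)" by (rule integral_abs_bound)
      also have "\<dots> \<le> expectation (\<lambda>\<omega>. 1)" using i f1 by (intro integral_mono) auto
      finally have f1': "\<bar>expectation ?f\<bar> \<le> 1" by (simp add: prob_space)
      have "\<bar>expectation (\<lambda>\<omega>. \<theta> (D m n d \<omega>)) - expectation (\<lambda>\<omega>. \<theta> (D' n \<omega>))\<bar> = \<bar>expectation (\<lambda>\<omega>. \<theta> (D m n d \<omega>) - \<theta> (D' n \<omega>))\<bar>"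
        using i by simp
      also have "\<dots> \<le> expectation (\<lambda>\<omega>. \<bar>\<theta> (D m n d \<omega>) - \<theta> (D' n \<omega>)\<bar>)" by (rule integral_abs_bound)
      finally have "\<bar>expectation (\<lambda>\<omega>. \<theta> (D m n d \<omega>)) - expectation (\<lambda>\<omega>. \<theta> (D' n \<omega>))\<bar> \<le> b n" using nearE by simp
      then have "\<bar>expectation ?f\<bar> * \<bar>expectation (\<lambda>\<omega>. \<theta> (D m n d \<omega>)) - expectation (\<lambda>\<omega>. \<theta> (D' n \<omega>))\<bar> \<le> 1 * b n"
        using f1' by (intro mult_mono) auto
      then show ?thesis by (simp add: right_diff_distrib[symmetric] abs_mult)
    qed
    show ?case using d1 d2 mix by argo
  qed
  show ?thesis
  proof (rule Lim_null_comparison)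
    show "\<forall>\<^sub>F n in sequentially. norm (expectation (\<lambda>\<omega>. f (\<lambda>i. D m n i \<omega>) * \<theta> (D m n d \<omega>))
        - expectation (\<lambda>\<omega>. f (\<lambda>i. D m n i \<omega>)) * expectation (\<lambda>\<omega>. \<theta> (D m n d \<omega>))) \<le> 2 * b n + r (gap n)"
      using main by simp
    show "(\<lambda>n. 2 * b n + r (gap n)) \<longlonglongrightarrow> 0"
      using tendsto_add[OF tendsto_mult[OF tendsto_const b0, of 2] rgap] by simp
  qed
qed

lemma D_fdd:
  assumes BM: "brownian_motion N B" and m: "m > 0" and f: "ucd d f" "\<And>x. \<bar>f x\<bar> \<le> c"
  shows "(\<lambda>n. expectation (\<lambda>\<omega>. f (\<lambda>i. D m n i \<omega>))) \<longlonglongrightarrow> integral\<^sup>L N (\<lambda>\<omega>. f (\<lambda>i. brownian_motion.G B m i \<omega>))"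
proof -
  interpret brownian_motion N B by (rule BM)
  interpret fdd_setting M N "D m" "G m"
  proof
    show "(\<lambda>n. expectation (\<lambda>\<omega>. \<theta> (D m n j \<omega>))) \<longlonglongrightarrow> N.expectation (\<lambda>\<omega>. \<theta> (G m j \<omega>))"
      if "continuous_on UNIV \<theta>" "\<And>x. \<bar>\<theta> x\<bar> \<le> 1" for j and \<theta> :: "real \<Rightarrow> real"
      using D_marginal[OF BM m that] .
    show "(\<lambda>n. expectation (\<lambda>\<omega>. f (\<lambda>i. D m n i \<omega>) * \<theta> (D m n d \<omega>))
        - expectation (\<lambda>\<omega>. f (\<lambda>i. D m n i \<omega>)) * expectation (\<lambda>\<omega>. \<theta> (D m n d \<omega>))) \<longlonglongrightarrow> 0"
      if "ucd d f" "\<And>x. \<bar>f x\<bar> \<le> 1" "\<And>x. \<bar>\<theta> x\<bar> \<le> 1" "\<And>x y. \<bar>\<theta> x - \<theta> y\<bar> \<le> K * \<bar>x - y\<bar>"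
        "\<theta> \<in> borel_measurable borel" for d f and \<theta> :: "real \<Rightarrow> real" and K
      using D_factor[OF m that] .
  qed (use G_factor[OF m] in auto)
  show ?thesis by (rule fdd_convergence[OF f])
qed

end

section \<open>Discretisation of the functionals\<close>

lemma Max_image_close:
  fixes f h :: "'a \<Rightarrow> real"
  assumes "finite A" "A \<noteq> {}" "\<And>a. a \<in> A \<Longrightarrow> \<bar>f a - h a\<bar> \<le> c"
  shows "\<bar>Max (f ` A) - Max (h ` A)\<bar> \<le> c"
proof -
  have "Max (f ` A) \<le> Max (h ` A) + c"
    if "\<And>a. a \<in> A \<Longrightarrow> \<bar>f a - h a\<bar> \<le> c" for f h :: "'a \<Rightarrow> real"
  proof (rule Max.boundedI)
    fix y assume "y \<in> f ` A"
    then obtain a where a: "a \<in> A" "y = f a" by auto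
    then have "h a \<le> Max (h ` A)" using assms by (intro Max_ge) auto
    then show "y \<le> Max (h ` A) + c" using that[OF a(1)] a(2) by linarith
  qed (use assms in auto)
  from this[of f h] this[of h f] assms(3) show ?thesis by (force simp: abs_minus_commute)
qed

definition rms :: "'a set \<Rightarrow> ('a \<Rightarrow> real) \<Rightarrow> real" where
  "rms A f = sqrt ((\<Sum>i\<in>A. (f i)\<^sup>2) / real (card A))"

text \<open>Minkowski's inequality. Dividing by the cardinality makes the bound independent of the
  size of \<open>A\<close>.\<close>

lemma rms_close:
  assumes "\<And>i. i \<in> A \<Longrightarrow> \<bar>f i - h i\<bar> \<le> c" "0 \<le> c"
  shows "\<bar>rms A f - rms A h\<bar> \<le> c"
proof (cases "finite A \<and> A \<noteq> {}")
  case False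
  then show ?thesis using assms(2) by (auto simp: rms_def)
next
  case True
  then have n0: "real (card A) > 0" by (simp add: card_gt_0_iff)
  have rms: "rms A u = L2_set u A / sqrt (card A)" for u
    by (simp add: rms_def L2_set_def real_sqrt_divide)
  have le: "rms A u \<le> rms A w + c" if "\<And>i. i \<in> A \<Longrightarrow> \<bar>u i - w i\<bar> \<le> c" for u w
  proof -
    have "L2_set u A = L2_set (\<lambda>i. w i + (u i - w i)) A" by simp
    also have "\<dots> \<le> L2_set w A + L2_set (\<lambda>i. u i - w i) A" by (rule L2_set_triangle_ineq)
    also have "L2_set (\<lambda>i. u i - w i) A \<le> c * sqrt (card A)"
    proof -
      have "(\<Sum>i\<in>A. (u i - w i)\<^sup>2) \<le> card A * c\<^sup>2"
        using that assms(2) by (intro sum_bounded_above[of A _ "c\<^sup>2", simplified]) (simp add: abs_le_square_iff[symmetric])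
      then have "L2_set (\<lambda>i. u i - w i) A \<le> sqrt (card A * c\<^sup>2)" unfolding L2_set_def by (rule real_sqrt_le_mono)
      then show ?thesis using assms(2) by (simp add: real_sqrt_mult mult.commute)
    qed
    finally show ?thesis unfolding rms using n0 by (simp add: field_simps)
  qed
  show ?thesis using le[of f h] le[of h f] assms(1) by (force simp: abs_minus_commute)
qed

lemma abs_sqrt_diff_le:
  assumes "0 \<le> a" "0 \<le> b"
  shows "\<bar>sqrt a - sqrt b\<bar> \<le> sqrt \<bar>a - b\<bar>"
proof -
  have "sqrt u \<le> sqrt w + sqrt \<bar>u - w\<bar>" if "0 \<le> u" "0 \<le> w" for u w
  proof -
    have "sqrt u \<le> sqrt (w + \<bar>u - w\<bar>)" by (intro real_sqrt_le_mono) auto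
    also have "\<dots> \<le> sqrt w + sqrt \<bar>u - w\<bar>" using that by (intro sqrt_add_le_add_sqrt) auto
    finally show ?thesis .
  qed
  from this[of a b] this[of b a] assms show ?thesis by (simp add: abs_le_iff abs_minus_commute)
qed

lemma diff_scaled: "(a - r * b) - (c - r * d) = (a - c) - r * (b - d)" for a b c d r :: real
  by (simp add: algebra_simps)

lemma diff_scaled2: "(a - r * b) - (c - q * d) = (a - c) - r * (b - d) - (r - q) * d" for a b c d q r :: real
  by (simp add: algebra_simps)

lemma abs_diff3: "\<bar>a - b - c\<bar> \<le> \<bar>a\<bar> + \<bar>b\<bar> + \<bar>c\<bar>" for a b c :: real
  by linarith

section \<open>Functionals of a path on a grid\<close>

definition cs :: "(nat \<Rightarrow> real) \<Rightarrow> nat \<Rightarrow> real" where "cs x j = (\<Sum>i<j. x i)"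

text \<open>The grid form of \<open>1 \<le> r \<le> \<tau> < K\<close> with \<open>r = i / m\<close>
  and \<open>\<tau> = j / m\<close>.\<close>

definition gpairs :: "nat \<Rightarrow> nat \<Rightarrow> (nat \<times> nat) set" where
  "gpairs K m = {(i, j). m \<le> i \<and> i \<le> j \<and> j < K * m}"

lemma finite_gpairs: "finite (gpairs K m)"
  by (rule finite_subset[of _ "{..<K * m} \<times> {..<K * m}"]) (auto simp: gpairs_def)

lemma gpairs_nonempty: "2 \<le> K \<Longrightarrow> 0 < m \<Longrightarrow> gpairs K m \<noteq> {}"
proof -
  assume "2 \<le> K" "0 < m"
  then have "m < K * m" by (metis One_nat_def Suc_1 Suc_le_lessD mult_less_cancel2 mult_1)
  then have "(m, m) \<in> gpairs K m" by (simp add: gpairs_def)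
  then show ?thesis by blast
qed

text \<open>The ratio \<open>i / j\<close> is \<open>r / \<tau>\<close>, since the mesh cancels.
  With \<open>n\<close> in place of \<open>m\<close> the same formula serves for pairs of
  observation indices.\<close>

definition Fterm :: "(real \<Rightarrow> real) \<Rightarrow> nat \<Rightarrow> (nat \<Rightarrow> real) \<Rightarrow> nat \<times> nat \<Rightarrow> real" where
  "Fterm g m y = (\<lambda>(i, j). \<bar>y i - real i / real j * y j\<bar> / g (real j / real m))"

definition Fg :: "(real \<Rightarrow> real) \<Rightarrow> nat \<Rightarrow> nat \<Rightarrow> (nat \<Rightarrow> real) \<Rightarrow> real" where
  "Fg g K m y = Max (Fterm g m y ` gpairs K m)"

definition wg :: "nat \<Rightarrow> (nat \<Rightarrow> real) \<Rightarrow> real" where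
  "wg m y = rms {..<m} (\<lambda>i. y i - real i / real m * y m)"

text \<open>Test functions of the weighted maximum and the root of the normaliser. Their joint law
  is needed, since the statistic is the quotient of the two.\<close>

definition uc2 :: "(real \<Rightarrow> real \<Rightarrow> real) \<Rightarrow> bool" where
  "uc2 \<Theta> \<longleftrightarrow> (\<forall>\<epsilon>>0. \<exists>\<delta>>0. \<forall>a b w z. \<bar>a - b\<bar> < \<delta> \<longrightarrow> \<bar>w - z\<bar> < \<delta> \<longrightarrow> \<bar>\<Theta> a w - \<Theta> b z\<bar> < \<epsilon>)"

lemma uc2D:
  assumes "uc2 \<Theta>" "\<epsilon> > 0"
  obtains \<delta> where "\<delta> > 0" "\<And>a b w z. \<bar>a - b\<bar> < \<delta> \<Longrightarrow> \<bar>w - z\<bar> < \<delta> \<Longrightarrow> \<bar>\<Theta> a w - \<Theta> b z\<bar> < \<epsilon>"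
  using assms unfolding uc2_def by metis

locale weight =
  fixes g :: "real \<Rightarrow> real"
  assumes g: "weight_assumption g"
begin

lemma g_pos: "1 \<le> \<tau> \<Longrightarrow> 0 < g \<tau>"
  and g_cont: "continuous_on {1..} g"
  and g_sum: "((\<lambda>T. \<Sum>l. ennreal (2 ^ l * T / (g (2 ^ l * T))\<^sup>2)) \<longlongrightarrow> 0) at_top"
  using g by (auto simp: weight_assumption_def)

lemma g_mono: "1 \<le> u \<Longrightarrow> u \<le> w \<Longrightarrow> g u \<le> g w"
  using g by (auto simp: weight_assumption_def mono_on_def)

lemma inverse_g_le: "1 \<le> u \<Longrightarrow> 1 / g u \<le> 1 / g 1"
  using g_mono[of 1 u] g_pos[of 1] by (intro divide_left_mono) (auto intro: g_pos)

lemma divide_g_le: "1 \<le> u \<Longrightarrow> 0 \<le> a \<Longrightarrow> a / g u \<le> a / g 1"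
  using inverse_g_le[of u] mult_left_mono[of "1 / g u" "1 / g 1" a] by simp

lemma Fg_close:
  assumes K: "2 \<le> K" "0 < m" and c: "\<And>j. j \<le> K * m \<Longrightarrow> \<bar>x j - y j\<bar> \<le> \<eta>"
  shows "\<bar>Fg g K m x - Fg g K m y\<bar> \<le> 2 * \<eta> / g 1"
  unfolding Fg_def
proof (rule Max_image_close[OF finite_gpairs gpairs_nonempty[OF K]])
  fix p assume "p \<in> gpairs K m"
  then obtain i j where p: "p = (i, j)" "m \<le> i" "i \<le> j" "j < K * m" by (auto simp: gpairs_def)
  have g1: "1 \<le> real j / real m" using p K by simp
  have r: "0 \<le> real i / real j" "real i / real j \<le> 1" using p K by auto
  have "\<bar>\<bar>x i - real i / real j * x j\<bar> - \<bar>y i - real i / real j * y j\<bar>\<bar> \<le> \<bar>(x i - y i) - real i / real j * (x j - y j)\<bar>"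
    using abs_triangle_ineq3[of "x i - real i / real j * x j" "y i - real i / real j * y j"] unfolding diff_scaled .
  also have "\<dots> \<le> \<bar>x i - y i\<bar> + real i / real j * \<bar>x j - y j\<bar>"
    using r by (intro order_trans[OF abs_triangle_ineq4]) (simp add: abs_mult)
  also have "\<dots> \<le> \<eta> + 1 * \<eta>"
    using r p c[of i] c[of j] by (intro add_mono mult_mono) auto
  finally have n: "\<bar>\<bar>x i - real i / real j * x j\<bar> - \<bar>y i - real i / real j * y j\<bar>\<bar> \<le> 2 * \<eta>" by simp
  have "\<bar>Fterm g m x p - Fterm g m y p\<bar> = \<bar>\<bar>x i - real i / real j * x j\<bar> - \<bar>y i - real i / real j * y j\<bar>\<bar> / g (real j / real m)"
    using g_pos[OF g1] by (simp add: p Fterm_def diff_divide_distrib[symmetric])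
  also have "\<dots> \<le> \<bar>\<bar>x i - real i / real j * x j\<bar> - \<bar>y i - real i / real j * y j\<bar>\<bar> / g 1"
    by (intro divide_g_le g1) auto
  also have "\<dots> \<le> 2 * \<eta> / g 1" using n g_pos[of 1] by (intro divide_right_mono) auto
  finally show "\<bar>Fterm g m x p - Fterm g m y p\<bar> \<le> 2 * \<eta> / g 1" .
qed

lemma wg_close:
  assumes "0 < m" "\<And>j. j \<le> m \<Longrightarrow> \<bar>x j - y j\<bar> \<le> \<eta>"
  shows "\<bar>wg m x - wg m y\<bar> \<le> 2 * \<eta>"
  unfolding wg_def
proof (rule rms_close)
  fix i assume "i \<in> {..<m}"
  then have r: "0 \<le> real i / real m" "real i / real m \<le> 1" "i \<le> m" by auto
  have "\<bar>(x i - real i / real m * x m) - (y i - real i / real m * y m)\<bar> = \<bar>(x i - y i) - real i / real m * (x m - y m)\<bar>"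
    unfolding diff_scaled ..
  also have "\<dots> \<le> \<bar>x i - y i\<bar> + real i / real m * \<bar>x m - y m\<bar>"
    using r by (intro order_trans[OF abs_triangle_ineq4]) (simp add: abs_mult)
  also have "\<dots> \<le> \<eta> + 1 * \<eta>"
    using r assms by (intro add_mono mult_mono) auto
  finally show "\<bar>(x i - real i / real m * x m) - (y i - real i / real m * y m)\<bar> \<le> 2 * \<eta>" by simp
next
  show "0 \<le> 2 * \<eta>" using assms(2)[of 0] by simp
qed

lemma ucd_functional:
  assumes \<Theta>: "uc2 \<Theta>" and K: "2 \<le> K" "0 < m"
  shows "ucd (K * m) (\<lambda>x. \<Theta> (Fg g K m (cs x)) (wg m (cs x)))"
  unfolding ucd_def
proof (intro allI impI)
  fix \<epsilon> :: real assume "\<epsilon> > 0"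
  then obtain \<delta> where \<delta>: "\<delta> > 0" "\<And>a b w z. \<bar>a - b\<bar> < \<delta> \<Longrightarrow> \<bar>w - z\<bar> < \<delta> \<Longrightarrow> \<bar>\<Theta> a w - \<Theta> b z\<bar> < \<epsilon>"
    using uc2D[OF \<Theta>] by metis
  define \<eta> where "\<eta> = min (\<delta> * g 1 / 4) (\<delta> / 4)"
  have g1: "g 1 > 0" by (rule g_pos) simp
  have \<eta>: "\<eta> > 0" "2 * \<eta> / g 1 < \<delta>" "2 * \<eta> < \<delta>"
  proof -
    show "\<eta> > 0" using \<delta>(1) g1 by (simp add: \<eta>_def)
    have "2 * \<eta> \<le> \<delta> * g 1 / 2" "2 * \<eta> \<le> \<delta> / 2" by (auto simp: \<eta>_def min_def)
    moreover have "0 < \<delta> * g 1" using \<delta>(1) g1 by simp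
    ultimately have "2 * \<eta> < \<delta> * g 1" "2 * \<eta> < \<delta>" using \<delta>(1) by linarith+
    then show "2 * \<eta> / g 1 < \<delta>" "2 * \<eta> < \<delta>" using g1 by (auto simp: pos_divide_less_eq)
  qed
  have Km: "real (K * m) > 0" using K by simp
  \<comment> \<open>A grid value is a sum of at most \<open>K * m\<close> increments, so the
    tolerance \<open>\<eta>\<close> for values is shared among that many.\<close>
  define \<delta>' where "\<delta>' = \<eta> / real (K * m)"
  have "\<bar>\<Theta> (Fg g K m (cs x)) (wg m (cs x)) - \<Theta> (Fg g K m (cs y)) (wg m (cs y))\<bar> < \<epsilon>"
    if xy: "\<forall>i<K * m. \<bar>x i - y i\<bar> < \<delta>'" for x y
  proof -
    have c: "\<bar>cs x j - cs y j\<bar> \<le> \<eta>" if "j \<le> K * m" for j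
    proof -
      have "\<bar>cs x j - cs y j\<bar> \<le> (\<Sum>i<j. \<bar>x i - y i\<bar>)" unfolding cs_def sum_subtractf[symmetric] by (rule sum_abs)
      also have "\<dots> \<le> real j * \<delta>'"
        using xy that by (intro sum_bounded_above[of "{..<j}" _ \<delta>', simplified] less_imp_le) auto
      also have "\<dots> \<le> real (K * m) * \<delta>'" using that \<eta>(1) by (intro mult_right_mono) (auto simp: \<delta>'_def simp del: of_nat_mult)
      also have "\<dots> = \<eta>" using Km unfolding \<delta>'_def by (simp del: of_nat_mult)
      finally show ?thesis .
    qed
    have mK: "m \<le> K * m" using K by simp
    have c': "\<bar>cs x j - cs y j\<bar> \<le> \<eta>" if "j \<le> m" for j
      using c[OF order_trans[OF that mK]] .
    show ?thesis
      using \<eta> by (intro \<delta>(2) le_less_trans[OF Fg_close[OF K]] le_less_trans[OF wg_close[OF K(2)]])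
        (use c c' in auto)
  qed
  moreover have "\<delta>' > 0" using \<eta>(1) Km by (simp add: \<delta>'_def)
  ultimately show "\<exists>\<delta>>0. \<forall>x y. (\<forall>i<K * m. \<bar>x i - y i\<bar> < \<delta>) \<longrightarrow>
      \<bar>\<Theta> (Fg g K m (cs x)) (wg m (cs x)) - \<Theta> (Fg g K m (cs y)) (wg m (cs y))\<bar> < \<epsilon>" by blast
qed

definition spairs :: "nat \<Rightarrow> nat \<Rightarrow> (nat \<times> nat) set" where
  "spairs K n = {(s, k). n + 1 \<le> s \<and> s < k \<and> k < K * n}"

lemma finite_spairs: "finite (spairs K n)"
  by (rule finite_subset[of _ "{..<K * n} \<times> {..<K * n}"]) (auto simp: spairs_def)

lemma cell_bounds:
  fixes n m k :: nat
  assumes "0 < n" "0 < m"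
  shows "real (k * m div n) / real m \<le> real k / real n" "real k / real n \<le> real (k * m div n) / real m + 1 / real m"
proof -
  have "(k * m div n) * n \<le> k * m" "k * m < (k * m div n) * n + n"
    using assms div_mult_mod_eq[of "k * m" n] mod_less_divisor[of n "k * m"] by linarith+
  then have "real (k * m div n) * real n \<le> real k * real m" "real k * real m \<le> real (k * m div n) * real n + real n"
    by (metis of_nat_le_iff of_nat_mult, metis less_imp_le of_nat_add of_nat_le_iff of_nat_mult)
  then show "real (k * m div n) / real m \<le> real k / real n" "real k / real n \<le> real (k * m div n) / real m + 1 / real m"
    using assms by (simp_all add: field_simps)
qed

text \<open>\<open>gridpt\<close> rounds down and may fall into the preceding cell. Adding
  \<open>c\<close> indices, at least one, reaches cell \<open>j\<close>, and
  \<open>c * m < n\<close> prevents leaving it.\<close>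

lemma cell_gridpt:
  assumes "0 < m" "c * m < n" "0 < c"
  shows "(gridpt m n j + c) * m div n = j"
proof -
  have "gridpt m n j * m \<le> n * j" "n * j < gridpt m n j * m + m"
    unfolding gridpt_def using assms div_mult_mod_eq[of "n * j" m] mod_less_divisor[of m "n * j"] by linarith+
  moreover have "m \<le> c * m" using assms by simp
  ultimately have "n * j \<le> (gridpt m n j + c) * m" "(gridpt m n j + c) * m < n * (j + 1)"
    unfolding add_mult_distrib add_mult_distrib2 mult_1_right using assms by linarith+
  then show ?thesis by (intro div_nat_eqI) (auto simp: mult.commute)
qed

text \<open>Because the cell map is onto, the grid maximum can be rewritten as a maximum over the
  pairs of the statistic, and the two maxima can be compared term by term.\<close>

lemma cells_spairs:
  assumes m: "0 < m" and n: "2 * m < n"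
  shows "(\<lambda>(s, k). (s * m div n, k * m div n)) ` spairs K n = gpairs K m"
proof (intro equalityI subsetI)
  fix p assume "p \<in> (\<lambda>(s, k). (s * m div n, k * m div n)) ` spairs K n"
  then obtain s k where p: "p = (s * m div n, k * m div n)" "n + 1 \<le> s" "s < k" "k < K * n"
    by (auto simp: spairs_def)
  have "m = n * m div n" using n by simp
  also have "\<dots> \<le> s * m div n" using p by (intro div_le_mono mult_right_mono) auto
  finally have 1: "m \<le> s * m div n" .
  have 2: "s * m div n \<le> k * m div n" using p by (intro div_le_mono mult_right_mono) auto
  have "k * m < K * m * n" using p(4) m by (simp add: mult.commute mult.left_commute)
  then have 3: "k * m div n < K * m" by (rule less_mult_imp_div_less)
  show "p \<in> gpairs K m" using p 1 2 3 by (simp add: gpairs_def)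
next
  fix p assume "p \<in> gpairs K m"
  then obtain i j where p: "p = (i, j)" "m \<le> i" "i \<le> j" "j < K * m" by (auto simp: gpairs_def)
  \<comment> \<open>The shifts 1 and 2 secure \<open>n + 1 \<le> ?s\<close> and the strict
    inequality \<open>?s < ?k\<close> even for \<open>i = j\<close>; \<open>2 * m < n\<close> keeps
    both indices in their cells.\<close>
  let ?s = "gridpt m n i + 1" and ?k = "gridpt m n j + 2"
  have n1: "1 * m < n" using n m by linarith
  have "n = gridpt m n m" using m by (simp add: gridpt_def)
  also have "\<dots> \<le> gridpt m n i" by (rule gridpt_mono[OF p(2)])
  finally have s: "n + 1 \<le> ?s" by simp
  have sk: "?s < ?k" using gridpt_mono[OF p(3), of m n] by simp
  have k: "?k < K * n"
  proof (rule ccontr)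
    assume "\<not> ?k < K * n"
    then have "K * n * m \<le> ?k * m" by (intro mult_right_mono) auto
    also have "\<dots> \<le> n * j + 2 * m" by (simp add: gridpt_def)
    also have "\<dots> < n * (j + 1)" using n by simp
    also have "\<dots> \<le> n * (K * m)" using p(4) by (intro mult_left_mono) auto
    finally show False by (simp add: mult_ac)
  qed
  have "(?s, ?k) \<in> spairs K n" using s sk k by (simp add: spairs_def)
  moreover have "(?s * m div n, ?k * m div n) = p"
    using cell_gridpt[OF m n1] cell_gridpt[OF m n] by (simp only: p(1))
  ultimately show "p \<in> (\<lambda>(s, k). (s * m div n, k * m div n)) ` spairs K n"
    by (metis (no_types, lifting) case_prod_conv image_iff)
qed

definition An :: "nat \<Rightarrow> nat \<Rightarrow> (nat \<Rightarrow> real) \<Rightarrow> real" where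
  "An K n x = Max (Fterm g n x ` spairs K n)"

definition wn :: "nat \<Rightarrow> (nat \<Rightarrow> real) \<Rightarrow> real" where
  "wn n x = rms {..<n} (\<lambda>t. x t - real t / real n * x n)"

text \<open>Three errors: the oscillation of the path within a cell, the change of the ratio
  \<open>s / k\<close>, and the modulus of continuity of \<open>1 / g\<close>. As rescaled times are
  at least 1, moving numerator and denominator by \<open>1 / m\<close> each changes the ratio by at
  most \<open>2 / m\<close>.\<close>

lemma Fterm_cell_close:
  assumes m: "0 < m" and n: "2 * m < n" and p: "(s, k) \<in> spairs K n"
    and osc: "\<And>k. k < K * n \<Longrightarrow> \<bar>x k - y (k * m div n)\<bar> \<le> \<epsilon>"
    and sup: "\<And>k. k < K * n \<Longrightarrow> \<bar>x k\<bar> \<le> L" "\<And>j. j < K * m \<Longrightarrow> \<bar>y j\<bar> \<le> L"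
    and mod: "\<And>u w. 1 \<le> u \<Longrightarrow> u \<le> w \<Longrightarrow> w \<le> K \<Longrightarrow> w - u \<le> 1 / real m \<Longrightarrow> \<bar>1 / g u - 1 / g w\<bar> \<le> \<gamma>"
  shows "\<bar>Fterm g n x (s, k) - Fterm g m y (s * m div n, k * m div n)\<bar> \<le> (2 * \<epsilon> + 2 * L / real m) / g 1 + 2 * L * \<gamma>"
proof -
  define i j where "i = s * m div n" and "j = k * m div n"
  have sk: "n + 1 \<le> s" "s < k" "k < K * n" using p by (auto simp: spairs_def)
  have n0: "0 < n" using n by simp
  have "(i, j) \<in> gpairs K m" using cells_spairs[OF m n, of K] p unfolding i_def j_def by force
  then have ij: "m \<le> i" "i \<le> j" "j < K * m" by (auto simp: gpairs_def)
  have L0: "0 \<le> L" using sup(1)[OF sk(3)] by linarith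
  have \<epsilon>0: "0 \<le> \<epsilon>" using osc[OF sk(3)] by linarith
  define a u a' w where "a = real s / real n" and "u = real k / real n" and "a' = real i / real m" and "w = real j / real m"
  have au: "a' \<le> a" "a \<le> a' + 1 / real m" "w \<le> u" "u \<le> w + 1 / real m"
    unfolding a_def u_def a'_def w_def i_def j_def using cell_bounds[OF n0 m] by auto
  have w1: "1 \<le> w" "a' \<le> w" "1 \<le> a'" using ij m by (auto simp: w_def a'_def divide_right_mono)
  have uK: "u \<le> real K"
  proof -
    have "real k \<le> real K * real n" using sk(3) by (metis less_imp_le of_nat_le_iff of_nat_mult)
    then show ?thesis using n0 by (simp add: u_def pos_divide_le_eq)
  qed
  have au1: "a \<le> u" using sk n0 by (simp add: a_def u_def divide_right_mono)
  have ratios: "real s / real k = a / u" "real i / real j = a' / w"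
    using n0 m by (auto simp: a_def u_def a'_def w_def)
  have rd: "\<bar>a / u - a' / w\<bar> \<le> 2 / real m"
  proof -
    have "a / u - a' / w = (a - a') / u - a' / w * ((u - w) / u)"
      using w1 au by (simp add: field_simps)
    then have "\<bar>a / u - a' / w\<bar> \<le> \<bar>(a - a') / u\<bar> + \<bar>a' / w * ((u - w) / u)\<bar>" by (simp only: abs_triangle_ineq4)
    also have "\<dots> \<le> 1 / real m + 1 * (1 / real m)"
    proof (rule add_mono)
      have "(a - a') / u \<le> (1 / real m) / 1" using au w1 by (intro frac_le) auto
      then show "\<bar>(a - a') / u\<bar> \<le> 1 / real m" using au w1 by simp
      have uw: "(u - w) / u \<le> (1 / real m) / 1" using au w1 by (intro frac_le) auto
      have "\<bar>a' / w * ((u - w) / u)\<bar> = a' / w * ((u - w) / u)" using au w1 by simp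
      also have "\<dots> \<le> 1 * (1 / real m)" using uw au w1 by (intro mult_mono) auto
      finally show "\<bar>a' / w * ((u - w) / u)\<bar> \<le> 1 * (1 / real m)" .
    qed
    finally show ?thesis by simp
  qed
  define num num' where "num = x s - a / u * x k" and "num' = y i - a' / w * y j"
  have lt: "s < K * n" "i < K * m" using sk ij by auto
  have nn: "\<bar>num - num'\<bar> \<le> 2 * \<epsilon> + 2 * L / real m"
  proof -
    have "num - num' = (x s - y i) - a / u * (x k - y j) - (a / u - a' / w) * y j"
      by (simp add: num_def num'_def algebra_simps)
    then have "\<bar>num - num'\<bar> \<le> \<bar>x s - y i\<bar> + \<bar>a / u * (x k - y j)\<bar> + \<bar>(a / u - a' / w) * y j\<bar>"
      by linarith
    also have "\<dots> \<le> \<epsilon> + 1 * \<epsilon> + 2 / real m * L"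
    proof (intro add_mono)
      show "\<bar>x s - y i\<bar> \<le> \<epsilon>" unfolding i_def by (rule osc[OF lt(1)])
      have "\<bar>x k - y j\<bar> \<le> \<epsilon>" unfolding j_def by (rule osc[OF sk(3)])
      then show "\<bar>a / u * (x k - y j)\<bar> \<le> 1 * \<epsilon>"
        unfolding abs_mult using au1 au w1 by (intro mult_mono) auto
      show "\<bar>(a / u - a' / w) * y j\<bar> \<le> 2 / real m * L"
        unfolding abs_mult using sup(2)[OF ij(3)] by (intro mult_mono rd) auto
    qed
    finally show ?thesis by simp
  qed
  have n2: "\<bar>num'\<bar> \<le> 2 * L"
  proof -
    have "\<bar>num'\<bar> \<le> \<bar>y i\<bar> + \<bar>a' / w\<bar> * \<bar>y j\<bar>" unfolding num'_def abs_mult[symmetric] by (rule abs_triangle_ineq4)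
    also have "\<dots> \<le> L + 1 * L" using sup(2)[OF lt(2)] sup(2)[OF ij(3)] w1 by (intro add_mono mult_mono) auto
    finally show ?thesis by simp
  qed
  have gu: "1 \<le> u" using au w1 by linarith
  have gd: "\<bar>1 / g u - 1 / g w\<bar> \<le> \<gamma>" using mod[of w u] au w1 uK by (simp add: abs_minus_commute)
  have "\<bar>Fterm g n x (s, k) - Fterm g m y (i, j)\<bar> = \<bar>(\<bar>num\<bar> - \<bar>num'\<bar>) / g u + \<bar>num'\<bar> * (1 / g u - 1 / g w)\<bar>"
    unfolding Fterm_def case_prod_conv ratios num_def[symmetric] num'_def[symmetric] u_def[symmetric] w_def[symmetric]
    by (simp add: diff_divide_distrib algebra_simps)
  also have "\<dots> \<le> \<bar>(\<bar>num\<bar> - \<bar>num'\<bar>) / g u\<bar> + \<bar>\<bar>num'\<bar> * (1 / g u - 1 / g w)\<bar>" by (rule abs_triangle_ineq)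
  also have "\<dots> \<le> (2 * \<epsilon> + 2 * L / real m) / g 1 + 2 * L * \<gamma>"
  proof (rule add_mono)
    have "\<bar>(\<bar>num\<bar> - \<bar>num'\<bar>) / g u\<bar> = \<bar>\<bar>num\<bar> - \<bar>num'\<bar>\<bar> / g u" using g_pos[OF gu] by simp
    also have "\<dots> \<le> \<bar>\<bar>num\<bar> - \<bar>num'\<bar>\<bar> / g 1" by (intro divide_g_le gu) auto
    also have "\<dots> \<le> (2 * \<epsilon> + 2 * L / real m) / g 1"
      using nn g_pos[of 1] by (intro divide_right_mono) auto
    finally show "\<bar>(\<bar>num\<bar> - \<bar>num'\<bar>) / g u\<bar> \<le> (2 * \<epsilon> + 2 * L / real m) / g 1" .
    show "\<bar>\<bar>num'\<bar> * (1 / g u - 1 / g w)\<bar> \<le> 2 * L * \<gamma>"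
      unfolding abs_mult abs_abs using n2 gd by (intro mult_mono) auto
  qed
  finally show ?thesis by (simp add: i_def j_def)
qed

text \<open>\<open>cells_spairs\<close> puts both maxima over the same index set, so the termwise
  bound suffices.\<close>

lemma An_close:
  assumes K: "2 \<le> K" and m: "0 < m" and n: "2 * m < n"
    and osc: "\<And>k. k < K * n \<Longrightarrow> \<bar>x k - y (k * m div n)\<bar> \<le> \<epsilon>"
    and sup: "\<And>k. k < K * n \<Longrightarrow> \<bar>x k\<bar> \<le> L" "\<And>j. j < K * m \<Longrightarrow> \<bar>y j\<bar> \<le> L"
    and mod: "\<And>u w. 1 \<le> u \<Longrightarrow> u \<le> w \<Longrightarrow> w \<le> K \<Longrightarrow> w - u \<le> 1 / real m \<Longrightarrow> \<bar>1 / g u - 1 / g w\<bar> \<le> \<gamma>"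
  shows "\<bar>An K n x - Fg g K m y\<bar> \<le> (2 * \<epsilon> + 2 * L / real m) / g 1 + 2 * L * \<gamma>"
proof -
  let ?\<pi> = "\<lambda>(s, k). (s * m div n, k * m div n)"
  have ne: "spairs K n \<noteq> {}" using cells_spairs[OF m n, of K] gpairs_nonempty[OF K m] by auto
  have "Fg g K m y = Max ((\<lambda>p. Fterm g m y (?\<pi> p)) ` spairs K n)"
    unfolding Fg_def cells_spairs[OF m n, symmetric] image_image ..
  moreover have "\<bar>Max (Fterm g n x ` spairs K n) - Max ((\<lambda>p. Fterm g m y (?\<pi> p)) ` spairs K n)\<bar> \<le> (2 * \<epsilon> + 2 * L / real m) / g 1 + 2 * L * \<gamma>"
  proof (rule Max_image_close[OF finite_spairs ne])
    fix p assume "p \<in> spairs K n"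
    then obtain s k where p: "p = (s, k)" "(s, k) \<in> spairs K n" by (cases p) auto
    show "\<bar>Fterm g n x p - Fterm g m y (?\<pi> p)\<bar> \<le> (2 * \<epsilon> + 2 * L / real m) / g 1 + 2 * L * \<gamma>"
      unfolding p(1) case_prod_conv by (rule Fterm_cell_close[OF m n p(2)]; (rule osc sup mod; assumption))
  qed
  ultimately show ?thesis by (simp add: An_def)
qed

text \<open>Cell \<open>i\<close> is an interval of integers between \<open>i * n / m\<close> and
  \<open>Suc i * n / m\<close>, both rounded up, so its length differs from \<open>n / m\<close> by
  at most 1.\<close>

lemma card_cell:
  assumes m: "0 < m" and n: "0 < n" and that: "i < m"
  shows "\<bar>real (card {t. t < n \<and> t * m div n = i}) - real n / real m\<bar> \<le> 1"
proof -
  \<comment> \<open>Adding \<open>m - 1\<close> before the division rounds up: \<open>c i\<close> is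
    the first index of cell \<open>i\<close>.\<close>
  define c where "c i = (i * n + (m - 1)) div m" for i
  have c_le: "c i \<le> t \<longleftrightarrow> i * n \<le> t * m" for i t
  proof -
    have "c i \<le> t \<longleftrightarrow> c i < Suc t" by (rule less_Suc_eq_le[symmetric])
    also have "\<dots> \<longleftrightarrow> i * n + (m - 1) < Suc t * m" unfolding c_def using m by (rule div_less_iff_less_mult)
    also have "\<dots> \<longleftrightarrow> i * n \<le> t * m" using m by auto
    finally show ?thesis .
  qed
  have "{t. t < n \<and> t * m div n = i} = {c i..<c (Suc i)}"
  proof (intro set_eqI iffI)
    fix t assume "t \<in> {t. t < n \<and> t * m div n = i}"
    then have "t * m div n = i" by simp
    then have "i * n \<le> t * m" "t * m < Suc i * n"
      using div_mult_mod_eq[of "t * m" n] mod_less_divisor[OF n, of "t * m"] by auto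
    then show "t \<in> {c i..<c (Suc i)}" using c_le[of i t] c_le[of "Suc i" t] by auto
  next
    fix t assume "t \<in> {c i..<c (Suc i)}"
    then have t: "i * n \<le> t * m" "t * m < Suc i * n" using c_le[of i t] c_le[of "Suc i" t] by auto
    then have "t * m div n = i" by (intro div_nat_eqI) (auto simp: mult.commute)
    moreover have "Suc i * n \<le> m * n" using that by (intro mult_right_mono) auto
    with t(2) have "t * m < m * n" by (rule less_le_trans)
    then have "t * m < n * m" by (simp add: mult.commute)
    then have "t < n" by simp
    ultimately show "t \<in> {t. t < n \<and> t * m div n = i}" by simp
  qed
  then have card: "card {t. t < n \<and> t * m div n = i} = c (Suc i) - c i" by simp
  have mono: "c i \<le> c (Suc i)" unfolding c_def by (intro div_le_mono) simp
  have bnd: "real i * real n / real m \<le> real (c i)" "real (c i) \<le> real i * real n / real m + 1" for i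
  proof -
    have 1: "i * n \<le> c i * m" using c_le[of i "c i"] by simp
    have "c i * m \<le> i * n + (m - 1)" unfolding c_def by simp
    then have 2: "c i * m \<le> i * n + m" by simp
    have "real i * real n \<le> real (c i) * real m" "real (c i) * real m \<le> real i * real n + real m"
      using 1 2 by (metis of_nat_le_iff of_nat_mult, metis of_nat_add of_nat_le_iff of_nat_mult)
    then show "real i * real n / real m \<le> real (c i)" "real (c i) \<le> real i * real n / real m + 1"
      using m by (simp_all add: field_simps)
  qed
  have "real (Suc i) * real n / real m = real i * real n / real m + real n / real m"
    by (simp add: add_divide_distrib distrib_right)
  then show ?thesis unfolding card of_nat_diff[OF mono] using bnd[of i] bnd[of "Suc i"] by linarith
qed

text \<open>Each cell holds \<open>n / m\<close> indices up to 1, so giving all cells the weight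
  \<open>1 / m\<close> costs at most \<open>H / n\<close> per cell.\<close>

lemma cell_average:
  fixes h :: "nat \<Rightarrow> real"
  assumes m: "0 < m" and n: "0 < n" and h: "\<And>i. i < m \<Longrightarrow> \<bar>h i\<bar> \<le> H"
  shows "\<bar>(\<Sum>t<n. h (t * m div n)) / real n - (\<Sum>i<m. h i) / real m\<bar> \<le> real m * H / real n"
proof -
  have "(\<lambda>t. t * m div n) ` {..<n} \<subseteq> {..<m}"
    using m by (auto intro!: less_mult_imp_div_less simp: mult.commute)
  then have "(\<Sum>t<n. h (t * m div n)) = (\<Sum>i<m. \<Sum>t | t \<in> {..<n} \<and> t * m div n = i. h (t * m div n))"
    using sum.group[of "{..<n}" "{..<m}" "\<lambda>t. t * m div n" "\<lambda>t. h (t * m div n)"] by simp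
  also have "\<dots> = (\<Sum>i<m. real (card {t. t < n \<and> t * m div n = i}) * h i)"
    by (intro sum.cong refl) simp
  finally have "(\<Sum>t<n. h (t * m div n)) / real n - (\<Sum>i<m. h i) / real m
     = (\<Sum>i<m. (real (card {t. t < n \<and> t * m div n = i}) - real n / real m) * h i / real n)"
    using n m by (simp add: sum_divide_distrib sum_subtractf[symmetric] diff_divide_distrib algebra_simps)
  note eq = this
  have "\<bar>\<Sum>i<m. (real (card {t. t < n \<and> t * m div n = i}) - real n / real m) * h i / real n\<bar>
      \<le> (\<Sum>i<m. \<bar>(real (card {t. t < n \<and> t * m div n = i}) - real n / real m) * h i / real n\<bar>)"
    by (rule sum_abs)
  also have "\<dots> \<le> (\<Sum>i<m. 1 * H / real n)"
  proof (rule sum_mono)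
    fix i assume i: "i \<in> {..<m}"
    have "\<bar>(real (card {t. t < n \<and> t * m div n = i}) - real n / real m) * h i\<bar> \<le> 1 * H"
      unfolding abs_mult using i h[of i] card_cell[OF m n, of i] by (intro mult_mono) auto
    then show "\<bar>(real (card {t. t < n \<and> t * m div n = i}) - real n / real m) * h i / real n\<bar> \<le> 1 * H / real n"
      by (simp add: divide_right_mono)
  qed
  finally show ?thesis unfolding eq by simp
qed

text \<open>Replacing the path by its cell values is a uniform error and passes through
  \<open>rms\<close>. For the unequal cell sizes only the mean squares can be compared; taking roots
  produces the term with \<open>sqrt (real m / real n)\<close>.\<close>

lemma wn_close:
  assumes K: "2 \<le> K" and m: "0 < m" and n: "2 * m < n"
    and osc: "\<And>k. k < K * n \<Longrightarrow> \<bar>x k - y (k * m div n)\<bar> \<le> \<epsilon>"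
    and sup: "\<And>k. k < K * n \<Longrightarrow> \<bar>x k\<bar> \<le> L" "\<And>j. j < K * m \<Longrightarrow> \<bar>y j\<bar> \<le> L"
  shows "\<bar>wn n x - wg m y\<bar> \<le> 2 * \<epsilon> + L / real m + 2 * L * sqrt (real m / real n)"
proof -
  have n0: "0 < n" using n by simp
  have lt: "n < K * n" "m < K * m" using K n0 m by auto
  have L0: "0 \<le> L" using sup(1)[OF lt(1)] by linarith
  have \<epsilon>0: "0 \<le> \<epsilon>" using osc[OF lt(1)] by linarith
  have nm: "n * m div n = m" using n0 by simp
  let ?h = "\<lambda>i. y i - real i / real m * y m"
  have 1: "\<bar>wn n x - rms {..<n} (\<lambda>t. ?h (t * m div n))\<bar> \<le> 2 * \<epsilon> + L / real m"
    unfolding wn_def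
  proof (rule rms_close)
    fix t assume t: "t \<in> {..<n}"
    let ?i = "t * m div n"
    have "t < K * n" by (rule less_trans[OF _ lt(1)]) (use t in simp)
    have cb: "real ?i / real m \<le> real t / real n" "real t / real n \<le> real ?i / real m + 1 / real m"
      using cell_bounds[OF n0 m] by auto
    have "\<bar>(x t - real t / real n * x n) - ?h ?i\<bar>
      \<le> \<bar>x t - y ?i\<bar> + \<bar>real t / real n * (x n - y m)\<bar> + \<bar>(real t / real n - real ?i / real m) * y m\<bar>"
      unfolding diff_scaled2 by (rule abs_diff3)
    also have "\<dots> \<le> \<epsilon> + 1 * \<epsilon> + 1 / real m * L"
    proof (intro add_mono)
      show "\<bar>x t - y ?i\<bar> \<le> \<epsilon>" by (rule osc[OF \<open>t < K * n\<close>])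
      have "\<bar>x n - y m\<bar> \<le> \<epsilon>" using osc[OF lt(1)] nm by simp
      then show "\<bar>real t / real n * (x n - y m)\<bar> \<le> 1 * \<epsilon>"
        unfolding abs_mult using t by (intro mult_mono) auto
      show "\<bar>(real t / real n - real ?i / real m) * y m\<bar> \<le> 1 / real m * L"
        unfolding abs_mult using sup(2)[OF lt(2)] cb by (intro mult_mono) auto
    qed
    finally show "\<bar>(x t - real t / real n * x n) - ?h ?i\<bar> \<le> 2 * \<epsilon> + L / real m" by simp
  qed (use \<epsilon>0 L0 in simp)
  have 2: "\<bar>rms {..<n} (\<lambda>t. ?h (t * m div n)) - wg m y\<bar> \<le> 2 * L * sqrt (real m / real n)"
  proof -
    have h: "\<bar>(?h i)\<^sup>2\<bar> \<le> (2 * L)\<^sup>2" if "i < m" for i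
    proof -
      have "\<bar>?h i\<bar> \<le> \<bar>y i\<bar> + \<bar>real i / real m\<bar> * \<bar>y m\<bar>" unfolding abs_mult[symmetric] by (rule abs_triangle_ineq4)
      also have "\<dots> \<le> L + 1 * L" using that sup(2)[OF less_trans[OF that lt(2)]] sup(2)[OF lt(2)] by (intro add_mono mult_mono) auto
      finally have "\<bar>?h i\<bar> \<le> \<bar>2 * L\<bar>" using L0 by simp
      then show ?thesis unfolding abs_le_square_iff by simp
    qed
    have "\<bar>rms {..<n} (\<lambda>t. ?h (t * m div n)) - wg m y\<bar>
      \<le> sqrt \<bar>(\<Sum>t<n. (?h (t * m div n))\<^sup>2) / real n - (\<Sum>i<m. (?h i)\<^sup>2) / real m\<bar>"
      unfolding wg_def rms_def card_lessThan by (intro abs_sqrt_diff_le) (auto simp: sum_nonneg)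
    also have "\<dots> \<le> sqrt (real m * (2 * L)\<^sup>2 / real n)"
      by (intro real_sqrt_le_mono cell_average[OF m n0, of "\<lambda>i. (?h i)\<^sup>2"] h)
    also have "real m * (2 * L)\<^sup>2 / real n = (2 * L)\<^sup>2 * (real m / real n)" by simp
    also have "sqrt \<dots> = 2 * L * sqrt (real m / real n)" using L0 by (simp only: real_sqrt_mult real_sqrt_abs abs_mult abs_numeral abs_of_nonneg)
    finally show ?thesis .
  qed
  show ?thesis using 1 2 by linarith
qed

end

section \<open>From the process to the grid\<close>

text \<open>The pair is read as the first two coordinates of a sequence, which reduces the claim to
  \<open>measurable_ucd\<close>.\<close>

lemma measurable_uc2:
  assumes \<Theta>: "uc2 \<Theta>" and [measurable]: "A \<in> borel_measurable M" "W \<in> borel_measurable M"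
  shows "(\<lambda>\<omega>. \<Theta> (A \<omega>) (W \<omega>)) \<in> borel_measurable M"
proof -
  have "ucd 2 (\<lambda>z. \<Theta> (z 0) (z 1))"
    unfolding ucd_def
  proof (intro allI impI)
    fix \<epsilon> :: real assume "\<epsilon> > 0"
    then obtain \<delta> where "\<delta> > 0" "\<And>a b w z. \<bar>a - b\<bar> < \<delta> \<Longrightarrow> \<bar>w - z\<bar> < \<delta> \<Longrightarrow> \<bar>\<Theta> a w - \<Theta> b z\<bar> < \<epsilon>"
      using uc2D[OF \<Theta>] by metis
    then show "\<exists>\<delta>>0. \<forall>x y. (\<forall>i<2::nat. \<bar>x i - y i\<bar> < \<delta>) \<longrightarrow> \<bar>\<Theta> (x 0) (x 1) - \<Theta> (y 0) (y 1)\<bar> < \<epsilon>"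
      by (intro exI[of _ \<delta>]) simp
  qed
  from measurable_ucd[OF this, of "\<lambda>i. if i = 0 then A else W" M] show ?thesis by simp
qed

lemma uc2_tendsto:
  assumes \<Theta>: "uc2 \<Theta>" and "(a \<longlongrightarrow> A) net" "(w \<longlongrightarrow> W) net"
  shows "((\<lambda>n. \<Theta> (a n) (w n)) \<longlongrightarrow> \<Theta> A W) net"
proof (rule tendstoI)
  fix \<epsilon> :: real assume "\<epsilon> > 0"
  then obtain \<delta> where \<delta>: "\<delta> > 0" "\<And>a b w z. \<bar>a - b\<bar> < \<delta> \<Longrightarrow> \<bar>w - z\<bar> < \<delta> \<Longrightarrow> \<bar>\<Theta> a w - \<Theta> b z\<bar> < \<epsilon>"
    using uc2D[OF \<Theta>] by metis
  show "\<forall>\<^sub>F n in net. dist (\<Theta> (a n) (w n)) (\<Theta> A W) < \<epsilon>"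
    using tendstoD[OF assms(2) \<delta>(1)] tendstoD[OF assms(3) \<delta>(1)]
    by eventually_elim (auto simp: dist_real_def intro: \<delta>(2))
qed

context weight
begin

text \<open>Before the horizon only the compact range up to \<open>K\<close> matters, and there
  continuity of \<open>1 / g\<close> is uniform.\<close>

lemma inverse_g_modulus:
  assumes "\<gamma> > 0"
  shows "\<forall>\<^sub>F m in sequentially. \<forall>u w. 1 \<le> u \<longrightarrow> u \<le> w \<longrightarrow> w \<le> real K \<longrightarrow> w - u \<le> 1 / real m \<longrightarrow> \<bar>1 / g u - 1 / g w\<bar> \<le> \<gamma>"
proof -
  have "continuous_on {1..real K} (\<lambda>u. 1 / g u)"
  proof (intro continuous_intros)
    show "continuous_on {1..real K} g" by (rule continuous_on_subset[OF g_cont]) auto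
    show "\<forall>u\<in>{1..real K}. g u \<noteq> 0" using g_pos by (metis atLeastAtMost_iff less_irrefl)
  qed
  then have "uniformly_continuous_on {1..real K} (\<lambda>u. 1 / g u)"
    by (rule compact_uniformly_continuous) (rule compact_Icc)
  then obtain d where d: "d > 0" "\<And>u w. u \<in> {1..real K} \<Longrightarrow> w \<in> {1..real K} \<Longrightarrow> dist w u < d \<Longrightarrow> dist (1 / g w) (1 / g u) < \<gamma>"
    using assms unfolding uniformly_continuous_on_def by metis
  have "\<forall>\<^sub>F m in sequentially. 1 / real m < d"
    using lim_1_over_n d(1) by (rule order_tendstoD)
  then show ?thesis
  proof eventually_elim
    case (elim m)
    show ?case
    proof (intro allI impI)
      fix u w :: real assume "1 \<le> u" "u \<le> w" "w \<le> real K" "w - u \<le> 1 / real m"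
      then have "dist (1 / g w) (1 / g u) < \<gamma>" using elim by (intro d(2)) (auto simp: dist_real_def)
      then show "\<bar>1 / g u - 1 / g w\<bar> \<le> \<gamma>" by (simp add: dist_real_def abs_minus_commute)
    qed
  qed
qed

end

locale monitoring = mixing_clt M F Z e \<kappa> r \<mu> \<sigma> + weight g + brownian_motion N B
  for M :: "'w measure" and F and Z :: "int \<Rightarrow> 'w \<Rightarrow> 'k::real_inner" and e \<kappa> r \<mu> \<sigma>
    and g and N :: "'v measure" and B
begin

text \<open>The scaling makes \<open>x n \<omega> k\<close> the counterpart of standard Brownian
  motion at time \<open>k / n\<close>.\<close>

definition x :: "nat \<Rightarrow> 'w \<Rightarrow> nat \<Rightarrow> real" where
  "x n \<omega> k = X {0<..int k} \<omega> / (\<sigma> * sqrt (real n))"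

lemma measurable_x [measurable]: "(\<lambda>\<omega>. x n \<omega> k) \<in> borel_measurable M"
  unfolding x_def by measurable

lemma cs_D: "m > 0 \<Longrightarrow> cs (\<lambda>i. D m n i \<omega>) j = x n \<omega> (gridpt m n j)"
proof (induction j)
  case 0
  then show ?case by (simp add: cs_def x_def gridpt_def X_def S_def)
next
  case (Suc j)
  have "X {0<..int (gridpt m n (Suc j))} \<omega> = X {0<..int (gridpt m n j)} \<omega> + X {int (gridpt m n j)<..int (gridpt m n (Suc j))} \<omega>"
    using gridpt_mono[of j "Suc j" m n] by (intro X_split) auto
  then show ?case using Suc by (simp add: cs_def x_def D_def add_divide_distrib)
qed

lemma cs_G: "\<omega> \<in> space N \<Longrightarrow> cs (\<lambda>i. G m i \<omega>) j = B (real j / real m) \<omega>"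
proof (induction j)
  case 0
  then show ?case by (simp add: cs_def B_0)
next
  case (Suc j)
  then show ?case by (simp add: cs_def G_def)
qed

text \<open>On a fixed grid the functionals depend on the path only through \<open>K * m\<close>
  increments, summed up by \<open>cs\<close>, so convergence of these increments is enough.\<close>

lemma grid_limit:
  assumes \<Theta>: "uc2 \<Theta>" "\<And>a w. \<bar>\<Theta> a w\<bar> \<le> c" and K: "2 \<le> K" "0 < m"
  shows "(\<lambda>n. expectation (\<lambda>\<omega>. \<Theta> (Fg g K m (\<lambda>j. x n \<omega> (gridpt m n j))) (wg m (\<lambda>j. x n \<omega> (gridpt m n j)))))
    \<longlonglongrightarrow> N.expectation (\<lambda>\<omega>. \<Theta> (Fg g K m (\<lambda>j. B (real j / real m) \<omega>)) (wg m (\<lambda>j. B (real j / real m) \<omega>)))"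
proof -
  let ?f = "\<lambda>x. \<Theta> (Fg g K m (cs x)) (wg m (cs x))"
  have "(\<lambda>n. expectation (\<lambda>\<omega>. ?f (\<lambda>i. D m n i \<omega>))) \<longlonglongrightarrow> N.expectation (\<lambda>\<omega>. ?f (\<lambda>i. G m i \<omega>))"
    using K \<Theta>(2) by (intro D_fdd[OF brownian_motion_axioms _ ucd_functional[OF \<Theta>(1)], where c=c]) auto
  moreover have "N.expectation (\<lambda>\<omega>. ?f (\<lambda>i. G m i \<omega>))
    = N.expectation (\<lambda>\<omega>. \<Theta> (Fg g K m (\<lambda>j. B (real j / real m) \<omega>)) (wg m (\<lambda>j. B (real j / real m) \<omega>)))"
  proof (rule Bochner_Integration.integral_cong[OF refl])
    fix \<omega> assume "\<omega> \<in> space N"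
    then have "cs (\<lambda>i. G m i \<omega>) = (\<lambda>j. B (real j / real m) \<omega>)" by (intro ext cs_G)
    then show "?f (\<lambda>i. G m i \<omega>) = \<Theta> (Fg g K m (\<lambda>j. B (real j / real m) \<omega>)) (wg m (\<lambda>j. B (real j / real m) \<omega>))"
      by (simp only:)
  qed
  moreover have "cs (\<lambda>i. D m n i \<omega>) = (\<lambda>j. x n \<omega> (gridpt m n j))" for n \<omega>
    by (intro ext cs_D K)
  ultimately show ?thesis by simp
qed

lemma measurable_An [measurable]: "(\<lambda>\<omega>. An K n (x n' \<omega>)) \<in> borel_measurable M"
  unfolding An_def
proof (rule borel_measurable_Max[OF finite_spairs])
  show "(\<lambda>\<omega>. Fterm g n (x n' \<omega>) p) \<in> borel_measurable M" for p
    unfolding Fterm_def by (cases p) simp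
qed

lemma measurable_rms [measurable]:
  assumes "\<And>i. i \<in> A \<Longrightarrow> (\<lambda>\<omega>. f \<omega> i) \<in> borel_measurable M"
  shows "(\<lambda>\<omega>. rms A (f \<omega>)) \<in> borel_measurable M"
  unfolding rms_def using assms by (intro measurable_compose[OF _ borel_measurable_sqrt] borel_measurable_divide borel_measurable_sum borel_measurable_power) auto

lemma measurable_wn [measurable]: "(\<lambda>\<omega>. wn n (x n' \<omega>)) \<in> borel_measurable M"
  unfolding wn_def by (rule measurable_rms) measurable

lemma measurable_Fg [measurable]:
  "(\<lambda>\<omega>. Fg g K m (\<lambda>j. x n \<omega> (h j))) \<in> borel_measurable M"
  unfolding Fg_def
proof (rule borel_measurable_Max[OF finite_gpairs])
  show "(\<lambda>\<omega>. Fterm g m (\<lambda>j. x n \<omega> (h j)) p) \<in> borel_measurable M" for p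
    unfolding Fterm_def by (cases p) simp
qed

lemma measurable_wg [measurable]: "(\<lambda>\<omega>. wg m (\<lambda>j. x n \<omega> (h j))) \<in> borel_measurable M"
  unfolding wg_def by (rule measurable_rms) measurable

text \<open>Passing to the grid point of the cell goes back by at most \<open>n div m + 1\<close>
  indices, so the oscillation is controlled by a maximum of partial sums that start at this grid
  point.\<close>

lemma x_diff_le:
  assumes m: "0 < m" and n: "0 < n"
  shows "\<bar>x n \<omega> k - x n \<omega> (gridpt m n (k * m div n))\<bar>
    \<le> norm \<mu> / \<sigma> * Smax (int (gridpt m n (k * m div n))) (n div m + 1) \<omega> / sqrt (real n)"
proof -
  define j where "j = k * m div n"
  define a where "a = gridpt m n j"
  have j: "j * n \<le> k * m" "k * m < j * n + n"
    unfolding j_def using div_mult_mod_eq[of "k * m" n] mod_less_divisor[OF n, of "k * m"] by linarith+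
  have a: "a * m \<le> n * j" "n * j < a * m + m"
    unfolding a_def gridpt_def using div_mult_mod_eq[of "n * j" m] mod_less_divisor[OF m, of "n * j"] by linarith+
  have "a * m \<le> k * m" using order_trans[OF a(1)] j(1) by (simp only: mult.commute)
  then have ak: "a \<le> k" using m by simp
  have nm: "n < (n div m) * m + m" using div_mult_mod_eq[of n m] mod_less_divisor[OF m, of n] by linarith
  have "k * m < a * m + m + n" using j(2) a(2) by (simp add: mult.commute)
  also have "\<dots> < (a + (n div m + 2)) * m" using nm by (simp add: algebra_simps)
  finally have "k < a + (n div m + 2)" by (simp only: mult_less_cancel2)
  then have d: "k - a \<le> n div m + 1" by simp
  have "x n \<omega> k - x n \<omega> a = X {int a<..int k} \<omega> / (\<sigma> * sqrt (real n))"
    using X_split[of 0 "int a" "int k" \<omega>] ak by (simp add: x_def diff_divide_distrib[symmetric])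
  then have "\<bar>x n \<omega> k - x n \<omega> a\<bar> = \<bar>X {int a<..int k} \<omega>\<bar> / (\<sigma> * sqrt (real n))"
    using \<sigma>_pos by (simp add: abs_mult)
  also have "\<dots> \<le> (norm (S {int a<..int k} \<omega>) * norm \<mu>) / (\<sigma> * sqrt (real n))"
    using \<sigma>_pos by (intro divide_right_mono abs_X_le_norm) auto
  also have "\<dots> \<le> (Smax (int a) (n div m + 1) \<omega> * norm \<mu>) / (\<sigma> * sqrt (real n))"
    using \<sigma>_pos Smax_ge[OF d, of "int a" \<omega>] ak by (intro divide_right_mono mult_right_mono) (auto simp: of_nat_diff)
  finally show ?thesis by (simp add: a_def j_def mult_ac)
qed

lemma abs_x_le:
  assumes "k \<le> l"
  shows "\<bar>x n \<omega> k\<bar> \<le> norm \<mu> / \<sigma> * Smax 0 l \<omega> / sqrt (real n)"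
proof -
  have "\<bar>x n \<omega> k\<bar> = \<bar>X {0<..int k} \<omega>\<bar> / (\<sigma> * sqrt (real n))"
    using \<sigma>_pos by (simp add: x_def abs_mult)
  also have "\<dots> \<le> (norm (S {0<..0 + int k} \<omega>) * norm \<mu>) / (\<sigma> * sqrt (real n))"
    using \<sigma>_pos abs_X_le_norm[of "{0<..int k}" \<omega>] by (intro divide_right_mono) auto
  also have "\<dots> \<le> (Smax 0 l \<omega> * norm \<mu>) / (\<sigma> * sqrt (real n))"
    using \<sigma>_pos Smax_ge[OF assms, of 0 \<omega>] by (intro divide_right_mono mult_right_mono) auto
  finally show ?thesis by (simp add: mult_ac)
qed

text \<open>Instead of bounding the probability of the exceptional event, its indicator is dominated by
  fourth powers, so that only moments have to be estimated.\<close>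

lemma grid_approximation:
  assumes \<Theta>: "uc2 \<Theta>" "\<And>a w. \<bar>\<Theta> a w\<bar> \<le> 1" and K: "2 \<le> K" and \<epsilon>: "\<epsilon> > 0"
  shows "\<forall>\<^sub>F m in sequentially. \<forall>\<^sub>F n in sequentially.
    \<bar>expectation (\<lambda>\<omega>. \<Theta> (An K n (x n \<omega>)) (wn n (x n \<omega>)))
      - expectation (\<lambda>\<omega>. \<Theta> (Fg g K m (\<lambda>j. x n \<omega> (gridpt m n j))) (wg m (\<lambda>j. x n \<omega> (gridpt m n j))))\<bar> \<le> \<epsilon>"
proof -
  obtain C :: real where C: "C > 0" "\<And>a n. expectation (\<lambda>\<omega>. Smax a n \<omega> ^ 4) \<le> C * (real n)\<^sup>2"
    by (rule moments_Smax) (rule that)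
  obtain \<delta> where \<delta>: "\<delta> > 0" "\<And>a b w z. \<bar>a - b\<bar> < \<delta> \<Longrightarrow> \<bar>w - z\<bar> < \<delta> \<Longrightarrow> \<bar>\<Theta> a w - \<Theta> b z\<bar> < \<epsilon> / 2"
    using uc2D[OF \<Theta>(1), of "\<epsilon> / 2"] \<epsilon> by (metis half_gt_zero)
  define q where "q = norm \<mu> / \<sigma>"
  have q0: "q \<ge> 0" using \<sigma>_pos by (simp add: q_def)
  have g1: "g 1 > 0" by (rule g_pos) simp
  have "(\<lambda>L. C * (real K)\<^sup>2 * q^4 * (1 / real L)^4) \<longlonglongrightarrow> C * (real K)\<^sup>2 * q^4 * 0^4"
    by (intro tendsto_intros lim_1_over_n)
  then have "\<forall>\<^sub>F L in sequentially. C * (real K)\<^sup>2 * q^4 * (1 / real L)^4 < \<epsilon> / 8"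
    using \<epsilon> by (intro order_tendstoD) auto
  then have "\<forall>\<^sub>F L in sequentially. C * (real K)\<^sup>2 * q^4 * (1 / real L)^4 < \<epsilon> / 8 \<and> L > 0"
    using eventually_gt_at_top[of 0] by eventually_elim auto
  then obtain L' :: nat where L': "C * (real K)\<^sup>2 * q^4 * (1 / real L')^4 < \<epsilon> / 8" "L' > 0"
    by (auto dest: eventually_happens)
  define L where "L = real L'"
  have L: "C * (real K)\<^sup>2 * q^4 / L^4 < \<epsilon> / 8" "L > 0" using L' by (auto simp: L_def power_divide)
  \<comment> \<open>The tolerances are set so that the error of \<open>An_close\<close> is at most
    \<open>\<delta> / 8 + \<delta> / 8 + \<delta> / 4\<close> and that of \<open>wn_close\<close> at
    most three times \<open>\<delta> / 8\<close>.\<close>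
  define \<epsilon>1 where "\<epsilon>1 = min (\<delta> * g 1 / 16) (\<delta> / 16)"
  have \<epsilon>1: "\<epsilon>1 > 0" "2 * \<epsilon>1 / g 1 \<le> \<delta> / 8" "2 * \<epsilon>1 \<le> \<delta> / 8"
    using \<delta>(1) g1 by (auto simp: \<epsilon>1_def field_simps min_def)
  define \<gamma> where "\<gamma> = \<delta> / (8 * L)"
  have \<gamma>: "\<gamma> > 0" "2 * L * \<gamma> = \<delta> / 4" using \<delta>(1) L(2) by (auto simp: \<gamma>_def)
  have e1: "\<forall>\<^sub>F m in sequentially. 2 * L / g 1 * (1 / real m) < \<delta> / 8"
    by (rule order_tendstoD(2)[OF tendsto_mult[OF tendsto_const lim_1_over_n]]) (use \<delta> in auto)
  have e2: "\<forall>\<^sub>F m in sequentially. L * (1 / real m) < \<delta> / 8"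
    by (rule order_tendstoD(2)[OF tendsto_mult[OF tendsto_const lim_1_over_n]]) (use \<delta> in auto)
  have e3: "\<forall>\<^sub>F m in sequentially. 4 * real K * C * q^4 / \<epsilon>1^4 * (1 / real m) < \<epsilon> / 8"
    by (rule order_tendstoD(2)[OF tendsto_mult[OF tendsto_const lim_1_over_n]]) (use \<epsilon> in auto)
  show ?thesis
    using e1 e2 e3 inverse_g_modulus[OF \<gamma>(1), of K] eventually_gt_at_top[of 0]
  proof eventually_elim
    case (elim m)
    have m: "0 < m" using elim by simp
    have "(\<lambda>n. 2 * L * sqrt (real m * (1 / real n))) \<longlonglongrightarrow> 2 * L * sqrt (real m * 0)"
      by (intro tendsto_intros lim_1_over_n)
    then have e4: "\<forall>\<^sub>F n in sequentially. 2 * L * sqrt (real m * (1 / real n)) < \<delta> / 8"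
      using \<delta>(1) by (intro order_tendstoD) auto
    show ?case
      using e4 eventually_gt_at_top[of "2 * m"]
    proof eventually_elim
      case (elim n)
      have n: "2 * m < n" "0 < n" using elim by auto
      let ?y = "\<lambda>\<omega> j. x n \<omega> (gridpt m n j)"
      let ?w = "n div m + 1"
      \<comment> \<open>\<open>R\<close> is at least 1 as soon as one of the bounds on an
        oscillation exceeds \<open>\<epsilon>1\<close> or the bound on the path exceeds
        \<open>L\<close>; where \<open>R < 1\<close>, the deterministic comparisons apply.\<close>
      define R where "R \<omega> = (\<Sum>j<K * m. (q * Smax (int (gridpt m n j)) ?w \<omega> / sqrt (real n) / \<epsilon>1)^4)
          + (q * Smax 0 (K * n) \<omega> / sqrt (real n) / L)^4" for \<omega>
      have R0: "R \<omega> \<ge> 0" for \<omega> unfolding R_def by (intro add_nonneg_nonneg sum_nonneg) auto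
      have pt: "\<bar>\<Theta> (An K n (x n \<omega>)) (wn n (x n \<omega>)) - \<Theta> (Fg g K m (?y \<omega>)) (wg m (?y \<omega>))\<bar> \<le> \<epsilon> / 2 + 2 * R \<omega>" for \<omega>
      proof (cases "R \<omega> \<ge> 1")
        case True
        have "\<bar>\<Theta> (An K n (x n \<omega>)) (wn n (x n \<omega>)) - \<Theta> (Fg g K m (?y \<omega>)) (wg m (?y \<omega>))\<bar> \<le> 2"
          using \<Theta>(2)[of "An K n (x n \<omega>)" "wn n (x n \<omega>)"] \<Theta>(2)[of "Fg g K m (?y \<omega>)" "wg m (?y \<omega>)"] by linarith
        then show ?thesis using True \<epsilon> by linarith
      next
        case False
        have small: "u \<le> s" if "(u / s)^4 < 1" "s > 0" "u \<ge> 0" for u s :: real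
        proof (rule ccontr)
          assume "\<not> u \<le> s"
          then have "1 \<le> u / s" using that by simp
          then have "1 \<le> (u / s)^4" by (rule one_le_power)
          then show False using that by simp
        qed
        have Sj: "q * Smax (int (gridpt m n j)) ?w \<omega> / sqrt (real n) \<le> \<epsilon>1" if j: "j < K * m" for j
        proof (rule small)
          have "(q * Smax (int (gridpt m n j)) ?w \<omega> / sqrt (real n) / \<epsilon>1)^4 \<le> (\<Sum>j<K * m. (q * Smax (int (gridpt m n j)) ?w \<omega> / sqrt (real n) / \<epsilon>1)^4)"
            using j by (intro member_le_sum) auto
          also have "\<dots> \<le> R \<omega>" by (simp add: R_def)
          finally show "(q * Smax (int (gridpt m n j)) ?w \<omega> / sqrt (real n) / \<epsilon>1)^4 < 1" using False by simp
        qed (use \<epsilon>1 q0 Smax_nonneg in auto)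
        have SL: "q * Smax 0 (K * n) \<omega> / sqrt (real n) \<le> L"
        proof (rule small)
          have "(q * Smax 0 (K * n) \<omega> / sqrt (real n) / L)^4 \<le> R \<omega>" unfolding R_def by (simp add: sum_nonneg)
          then show "(q * Smax 0 (K * n) \<omega> / sqrt (real n) / L)^4 < 1" using False by simp
        qed (use L q0 Smax_nonneg in auto)
        have osc: "\<bar>x n \<omega> k - ?y \<omega> (k * m div n)\<bar> \<le> \<epsilon>1" if "k < K * n" for k
        proof -
          have "k * m < K * m * n" using that m by (simp add: mult.commute mult.left_commute)
          then have "k * m div n < K * m" by (rule less_mult_imp_div_less)
          from Sj[OF this] show ?thesis using x_diff_le[OF m n(2), of \<omega> k] unfolding q_def by linarith
        qed
        have sup: "\<bar>x n \<omega> k\<bar> \<le> L" if "k \<le> K * n" for k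
          using abs_x_le[OF that, of n \<omega>] SL unfolding q_def by linarith
        have sup1: "\<bar>x n \<omega> k\<bar> \<le> L" if "k < K * n" for k using that by (intro sup) simp
        have sup2: "\<bar>?y \<omega> j\<bar> \<le> L" if "j < K * m" for j
        proof (rule sup)
          have "gridpt m n j \<le> gridpt m n (K * m)" using that by (intro gridpt_mono) simp
          also have "\<dots> = K * n * m div m" unfolding gridpt_def by (simp only: mult_ac)
          also have "\<dots> = K * n" using m by simp
          finally show "gridpt m n j \<le> K * n" .
        qed
        have mod: "\<bar>1 / g u - 1 / g w\<bar> \<le> \<gamma>" if "1 \<le> u" "u \<le> w" "w \<le> real K" "w - u \<le> 1 / real m" for u w
          using \<open>\<forall>u w. 1 \<le> u \<longrightarrow> u \<le> w \<longrightarrow> w \<le> real K \<longrightarrow> w - u \<le> 1 / real m \<longrightarrow> \<bar>1 / g u - 1 / g w\<bar> \<le> \<gamma>\<close> that by blast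
        have A: "\<bar>An K n (x n \<omega>) - Fg g K m (?y \<omega>)\<bar> \<le> (2 * \<epsilon>1 + 2 * L / real m) / g 1 + 2 * L * \<gamma>"
          by (rule An_close[OF K m n(1)]; (rule osc sup1 sup2 mod; assumption))
        have "(2 * \<epsilon>1 + 2 * L / real m) / g 1 = 2 * \<epsilon>1 / g 1 + 2 * L / g 1 * (1 / real m)"
          by (simp add: add_divide_distrib)
        then have A': "\<bar>An K n (x n \<omega>) - Fg g K m (?y \<omega>)\<bar> < \<delta>"
          using A \<epsilon>1(2) \<gamma>(2) \<open>2 * L / g 1 * (1 / real m) < \<delta> / 8\<close> \<delta>(1) by linarith
        have W: "\<bar>wn n (x n \<omega>) - wg m (?y \<omega>)\<bar> \<le> 2 * \<epsilon>1 + L / real m + 2 * L * sqrt (real m / real n)"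
          by (rule wn_close[OF K m n(1)]; (rule osc sup1 sup2; assumption))
        have "L / real m = L * (1 / real m)" "real m / real n = real m * (1 / real n)" by simp_all
        then have W': "\<bar>wn n (x n \<omega>) - wg m (?y \<omega>)\<bar> < \<delta>"
          using W \<epsilon>1(3) \<open>L * (1 / real m) < \<delta> / 8\<close> elim(1) \<delta>(1) by (simp only:)
        have "\<bar>\<Theta> (An K n (x n \<omega>)) (wn n (x n \<omega>)) - \<Theta> (Fg g K m (?y \<omega>)) (wg m (?y \<omega>))\<bar> < \<epsilon> / 2"
          by (rule \<delta>(2)[OF A' W'])
        then show ?thesis using R0[of \<omega>] by linarith
      qed
      have scale: "(q * u / sqrt (real n) / s)^4 = q^4 / ((real n)\<^sup>2 * s^4) * u^4" for u s
      proof -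
        have "sqrt (real n) ^ 4 = (real n)\<^sup>2" using power_mult[of "sqrt (real n)" 2 2] by simp
        then show ?thesis by (simp add: power_divide power_mult_distrib)
      qed
      have iR: "integrable M R" unfolding R_def scale by simp
      have ER: "expectation R \<le> \<epsilon> / 4"
      proof -
        have w: "real ?w \<le> 2 * real n / real m"
        proof -
          have "real (n div m) * real m \<le> real n"
            using div_times_less_eq_dividend[of n m] by (metis of_nat_le_iff of_nat_mult)
          then have "real ?w \<le> real n / real m + 1" using m by (simp add: field_simps)
          also have "1 \<le> real n / real m" using n m by simp
          finally show ?thesis by simp
        qed
        have "expectation R = (\<Sum>j<K * m. q^4 / ((real n)\<^sup>2 * \<epsilon>1^4) * expectation (\<lambda>\<omega>. Smax (int (gridpt m n j)) ?w \<omega> ^ 4))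
            + q^4 / ((real n)\<^sup>2 * L^4) * expectation (\<lambda>\<omega>. Smax 0 (K * n) \<omega> ^ 4)"
          unfolding R_def scale by simp
        also have "\<dots> \<le> (\<Sum>j<K * m. q^4 / ((real n)\<^sup>2 * \<epsilon>1^4) * (C * (2 * real n / real m)\<^sup>2))
            + q^4 / ((real n)\<^sup>2 * L^4) * (C * (real (K * n))\<^sup>2)"
        proof (intro add_mono sum_mono mult_left_mono C(2))
          fix j
          have "expectation (\<lambda>\<omega>. Smax (int (gridpt m n j)) ?w \<omega> ^ 4) \<le> C * (real ?w)\<^sup>2" by (rule C(2))
          also have "\<dots> \<le> C * (2 * real n / real m)\<^sup>2" using C(1) w by (intro mult_left_mono power_mono) auto
          finally show "expectation (\<lambda>\<omega>. Smax (int (gridpt m n j)) ?w \<omega> ^ 4) \<le> C * (2 * real n / real m)\<^sup>2" .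
        qed (use q0 in auto)
        \<comment> \<open>Here fourth moments pay off: \<open>K * m\<close> cells contribute a
          multiple of \<open>(1 / m)^2\<close> each, which leaves \<open>1 / m\<close>. Second
          moments would leave a term that does not vanish.\<close>
        also have "\<dots> = 4 * real K * C * q^4 / \<epsilon>1^4 * (1 / real m) + C * (real K)\<^sup>2 * q^4 / L^4"
          using n m L(2) \<epsilon>1(1) by (simp add: field_simps power2_eq_square)
        also have "\<dots> \<le> \<epsilon> / 8 + \<epsilon> / 8"
          using \<open>4 * real K * C * q^4 / \<epsilon>1^4 * (1 / real m) < \<epsilon> / 8\<close> L(1) by (intro add_mono) auto
        finally show ?thesis by simp
      qed
      have mA: "(\<lambda>\<omega>. \<Theta> (An K n (x n \<omega>)) (wn n (x n \<omega>))) \<in> borel_measurable M"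
        by (rule measurable_uc2[OF \<Theta>(1)]) measurable
      have mF: "(\<lambda>\<omega>. \<Theta> (Fg g K m (?y \<omega>)) (wg m (?y \<omega>))) \<in> borel_measurable M"
        by (rule measurable_uc2[OF \<Theta>(1)]) measurable
      have iA: "integrable M (\<lambda>\<omega>. \<Theta> (An K n (x n \<omega>)) (wn n (x n \<omega>)))"
        by (rule integrable_bounded[OF mA \<Theta>(2)])
      have iF: "integrable M (\<lambda>\<omega>. \<Theta> (Fg g K m (?y \<omega>)) (wg m (?y \<omega>)))"
        by (rule integrable_bounded[OF mF \<Theta>(2)])
      have "\<bar>expectation (\<lambda>\<omega>. \<Theta> (An K n (x n \<omega>)) (wn n (x n \<omega>))) - expectation (\<lambda>\<omega>. \<Theta> (Fg g K m (?y \<omega>)) (wg m (?y \<omega>)))\<bar>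
        = \<bar>expectation (\<lambda>\<omega>. \<Theta> (An K n (x n \<omega>)) (wn n (x n \<omega>)) - \<Theta> (Fg g K m (?y \<omega>)) (wg m (?y \<omega>)))\<bar>"
        using iA iF by simp
      also have "\<dots> \<le> expectation (\<lambda>\<omega>. \<bar>\<Theta> (An K n (x n \<omega>)) (wn n (x n \<omega>)) - \<Theta> (Fg g K m (?y \<omega>)) (wg m (?y \<omega>))\<bar>)"
        by (rule integral_abs_bound)
      also have "\<dots> \<le> expectation (\<lambda>\<omega>. \<epsilon> / 2 + 2 * R \<omega>)"
        using iA iF iR by (intro integral_mono pt) auto
      also have "\<dots> = \<epsilon> / 2 + 2 * expectation R" using iR by (simp add: prob_space)
      also have "\<dots> \<le> \<epsilon>" using ER by simp
      finally show ?case .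
    qed
  qed
qed

end

section \<open>The limit variable\<close>

lemma riemann_sum_tendsto:
  fixes H :: "real \<Rightarrow> real"
  assumes H: "continuous_on {0..1} H"
  shows "(\<lambda>m. (\<Sum>i<m. H (real i / real m)) / real m) \<longlonglongrightarrow> integral {0..1} H"
proof (rule LIMSEQ_I)
  fix \<epsilon> :: real assume \<epsilon>: "\<epsilon> > 0"
  have "uniformly_continuous_on {0..1} H"
    using H by (rule compact_uniformly_continuous) (rule compact_Icc)
  then obtain d where d: "d > 0" "\<And>u w. u \<in> {0..1} \<Longrightarrow> w \<in> {0..1} \<Longrightarrow> dist w u < d \<Longrightarrow> dist (H w) (H u) < \<epsilon> / 2"
    using \<epsilon> unfolding uniformly_continuous_on_def by (metis half_gt_zero)
  have "\<forall>\<^sub>F m in sequentially. 1 / real m < d"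
    using lim_1_over_n d(1) by (rule order_tendstoD)
  then obtain m0 where m0: "\<And>m. m \<ge> m0 \<Longrightarrow> 1 / real m < d" unfolding eventually_sequentially by blast
  have "norm ((\<Sum>i<m. H (real i / real m)) / real m - integral {0..1} H) < \<epsilon>" if m: "m \<ge> max m0 1" for m
  proof -
    have mp: "real m > 0" and md: "1 / real m < d" using m m0 by auto
    let ?a = "\<lambda>i. real i / real m"
    have a01: "0 \<le> ?a i" "i \<le> m \<Longrightarrow> ?a i \<le> 1" for i using mp by auto
    have aS: "?a (Suc i) - ?a i = 1 / real m" for i using mp by (simp add: diff_divide_distrib[symmetric])
    have amono: "i \<le> k \<Longrightarrow> ?a i \<le> ?a k" for i k using mp by (simp add: divide_right_mono)
    have Hi: "H integrable_on {0..1}" using H by (rule integrable_continuous_real)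
    have split: "integral {0..?a k} H = (\<Sum>i<k. integral {?a i..?a (Suc i)} H)" if "k \<le> m" for k
      using that
    proof (induction k)
      case (Suc k)
      have "H integrable_on {0..?a (Suc k)}" using a01(2)[OF Suc.prems] by (intro integrable_on_subinterval[OF Hi]) auto
      then have "integral {0..?a k} H + integral {?a k..?a (Suc k)} H = integral {0..?a (Suc k)} H"
        using a01(1)[of k] amono[of k "Suc k"] by (intro Henstock_Kurzweil_Integration.integral_combine) auto
      then show ?case using Suc by simp
    qed simp
    have cell: "\<bar>H (?a i) / real m - integral {?a i..?a (Suc i)} H\<bar> \<le> \<epsilon> / 2 / real m" if i: "i < m" for i
    proof -
      have sub: "{?a i..?a (Suc i)} \<subseteq> {0..1}" using a01(1)[of i] a01(2)[of "Suc i"] i by auto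
      have "norm (integral {?a i..?a (Suc i)} (\<lambda>u. H u - H (?a i))) \<le> \<epsilon> / 2 * (?a (Suc i) - ?a i)"
      proof (rule integral_bound)
        show "?a i \<le> ?a (Suc i)" by (rule amono) simp
        show "continuous_on {?a i..?a (Suc i)} (\<lambda>u. H u - H (?a i))"
          by (intro continuous_intros continuous_on_subset[OF H sub])
        fix u assume u: "u \<in> {?a i..?a (Suc i)}"
        then have "dist u (?a i) < d" using aS[of i] md by (auto simp: dist_real_def)
        then have "dist (H u) (H (?a i)) < \<epsilon> / 2" using subsetD[OF sub u] a01(1)[of i] a01(2)[of i] i by (intro d(2)) auto
        then show "norm (H u - H (?a i)) \<le> \<epsilon> / 2" by (simp add: dist_norm)
      qed
      moreover have "integral {?a i..?a (Suc i)} (\<lambda>u. H u - H (?a i)) = integral {?a i..?a (Suc i)} H - H (?a i) / real m"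
      proof -
        have "H integrable_on {?a i..?a (Suc i)}" by (rule integrable_on_subinterval[OF Hi sub])
        then have "integral {?a i..?a (Suc i)} (\<lambda>u. H u - H (?a i)) = integral {?a i..?a (Suc i)} H - integral {?a i..?a (Suc i)} (\<lambda>u. H (?a i))"
          by (rule Henstock_Kurzweil_Integration.integral_diff) (rule integrable_const_ivl)
        also have "integral {?a i..?a (Suc i)} (\<lambda>u. H (?a i)) = (?a (Suc i) - ?a i) * H (?a i)"
          using amono[of i "Suc i"] by simp
        finally show ?thesis unfolding aS by simp
      qed
      ultimately show ?thesis unfolding aS by (simp add: abs_minus_commute)
    qed
    have "integral {0..1} H = (\<Sum>i<m. integral {?a i..?a (Suc i)} H)" using split[of m] mp by simp
    then have "(\<Sum>i<m. H (?a i)) / real m - integral {0..1} H = (\<Sum>i<m. H (?a i) / real m - integral {?a i..?a (Suc i)} H)"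
      by (simp add: sum_subtractf sum_divide_distrib)
    then have "norm ((\<Sum>i<m. H (?a i)) / real m - integral {0..1} H) \<le> (\<Sum>i<m. \<bar>H (?a i) / real m - integral {?a i..?a (Suc i)} H\<bar>)"
      by (simp only: real_norm_def sum_abs)
    also have "\<dots> \<le> (\<Sum>i<m. \<epsilon> / 2 / real m)" using cell by (intro sum_mono) auto
    also have "\<dots> < \<epsilon>" using mp \<epsilon> by simp
    finally show ?thesis .
  qed
  then show "\<exists>no. \<forall>m\<ge>no. norm ((\<Sum>i<m. H (real i / real m)) / real m - integral {0..1} H) < \<epsilon>" by blast
qed

lemma floor_pow2_tendsto: "0 \<le> u \<Longrightarrow> (\<lambda>p. real (nat \<lfloor>2 ^ p * u\<rfloor>) / 2 ^ p) \<longlonglongrightarrow> u"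
proof (rule tendsto_sandwich[OF _ _ _ tendsto_const])
  assume u: "0 \<le> u"
  have "(\<lambda>p. u - (1 / 2) ^ p) \<longlonglongrightarrow> u - 0" by (intro tendsto_intros LIMSEQ_power_zero) simp
  then show "(\<lambda>p. u - (1 / 2) ^ p) \<longlonglongrightarrow> u" by simp
  have le: "2 ^ p * u - 1 \<le> real (nat \<lfloor>2 ^ p * u\<rfloor>)" "real (nat \<lfloor>2 ^ p * u\<rfloor>) \<le> 2 ^ p * u" for p
  proof -
    have "0 \<le> 2 ^ p * u" using u by simp
    then show "2 ^ p * u - 1 \<le> real (nat \<lfloor>2 ^ p * u\<rfloor>)" "real (nat \<lfloor>2 ^ p * u\<rfloor>) \<le> 2 ^ p * u" by linarith+
  qed
  show "\<forall>\<^sub>F p in sequentially. u - (1 / 2) ^ p \<le> real (nat \<lfloor>2 ^ p * u\<rfloor>) / 2 ^ p"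
  proof (intro always_eventually allI)
    fix p
    have "u - (1 / 2) ^ p = (2 ^ p * u - 1) / 2 ^ p" by (simp add: diff_divide_distrib power_divide)
    then show "u - (1 / 2) ^ p \<le> real (nat \<lfloor>2 ^ p * u\<rfloor>) / 2 ^ p" using divide_right_mono[OF le(1)[of p], of "2 ^ p"] by simp
  qed
  show "\<forall>\<^sub>F p in sequentially. real (nat \<lfloor>2 ^ p * u\<rfloor>) / 2 ^ p \<le> u"
    using le(2) by (intro always_eventually allI) (simp add: field_simps)
qed

section \<open>The supremum along dyadic grids\<close>

context weight
begin

text \<open>Dyadic grids are nested: doubling both indices on the finer grid gives the same points
  and the same term.\<close>

lemma Fg_dyadic_incseq:
  assumes K: "2 \<le> K"
  shows "incseq (\<lambda>p. Fg g K (2 ^ p) (\<lambda>j. b (real j / 2 ^ p)))"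
proof (rule incseq_SucI)
  fix p
  have "Fterm g (2 ^ p) (\<lambda>j. b (real j / 2 ^ p)) ` gpairs K (2 ^ p)
    \<subseteq> Fterm g (2 ^ Suc p) (\<lambda>j. b (real j / 2 ^ Suc p)) ` gpairs K (2 ^ Suc p)"
  proof
    fix v assume "v \<in> Fterm g (2 ^ p) (\<lambda>j. b (real j / 2 ^ p)) ` gpairs K (2 ^ p)"
    then obtain i j where ij: "(i, j) \<in> gpairs K (2 ^ p)" "v = Fterm g (2 ^ p) (\<lambda>j. b (real j / 2 ^ p)) (i, j)" by auto
    have "(2 * i, 2 * j) \<in> gpairs K (2 ^ Suc p)" using ij(1) by (auto simp: gpairs_def)
    moreover have "v = Fterm g (2 ^ Suc p) (\<lambda>j. b (real j / 2 ^ Suc p)) (2 * i, 2 * j)"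
      unfolding ij(2) by (simp add: Fterm_def)
    ultimately show "v \<in> Fterm g (2 ^ Suc p) (\<lambda>j. b (real j / 2 ^ Suc p)) ` gpairs K (2 ^ Suc p)" by blast
  qed
  then show "Fg g K (2 ^ p) (\<lambda>j. b (real j / 2 ^ p)) \<le> Fg g K (2 ^ Suc p) (\<lambda>j. b (real j / 2 ^ Suc p))"
    unfolding Fg_def using gpairs_nonempty[OF K, of "2 ^ p"] by (intro Max_mono) (auto simp: finite_gpairs)
qed

lemma Fg_dyadic_bdd:
  assumes K: "2 \<le> K" and b: "continuous_on {0..} b"
  shows "bdd_above (range (\<lambda>p. Fg g K (2 ^ p) (\<lambda>j. b (real j / 2 ^ p))))"
proof -
  have "compact (b ` {0..real K})"
    by (intro compact_continuous_image continuous_on_subset[OF b]) auto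
  then obtain L where L: "\<And>u. u \<in> {0..real K} \<Longrightarrow> norm (b u) \<le> L"
    using compact_imp_bounded bounded_iff by (metis (no_types, lifting) image_eqI)
  have "Fg g K (2 ^ p) (\<lambda>j. b (real j / 2 ^ p)) \<le> 2 * L / g 1" for p
    unfolding Fg_def
  proof (rule Max.boundedI)
    fix v assume "v \<in> Fterm g (2 ^ p) (\<lambda>j. b (real j / 2 ^ p)) ` gpairs K (2 ^ p)"
    then obtain i j where ij: "2 ^ p \<le> i" "i \<le> j" "j < K * 2 ^ p" "v = Fterm g (2 ^ p) (\<lambda>j. b (real j / 2 ^ p)) (i, j)"
      by (auto simp: gpairs_def)
    have one: "1 \<le> real j / real (2 ^ p)"
    proof -
      have "real (2 ^ p) \<le> real j" using ij by (intro of_nat_mono) simp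
      then show ?thesis by simp
    qed
    have rK: "real j / 2 ^ p \<le> real K" "real i / 2 ^ p \<le> real K"
    proof -
      have "real j \<le> real (K * 2 ^ p)" "real i \<le> real (K * 2 ^ p)" using ij by (intro of_nat_mono, simp)+
      then show "real j / 2 ^ p \<le> real K" "real i / 2 ^ p \<le> real K" by (simp_all add: field_simps)
    qed
    have rij: "\<bar>real i / real j\<bar> \<le> 1" using ij(2) by (cases "j = 0") auto
    have "\<bar>b (real i / 2 ^ p) - real i / real j * b (real j / 2 ^ p)\<bar> \<le> \<bar>b (real i / 2 ^ p)\<bar> + \<bar>real i / real j\<bar> * \<bar>b (real j / 2 ^ p)\<bar>"
      unfolding abs_mult[symmetric] by (rule abs_triangle_ineq4)
    also have "\<dots> \<le> L + 1 * L"
    proof (intro add_mono mult_mono)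
      show "\<bar>b (real i / 2 ^ p)\<bar> \<le> L" "\<bar>b (real j / 2 ^ p)\<bar> \<le> L"
        using L[of "real i / 2 ^ p"] L[of "real j / 2 ^ p"] rK by auto
    qed (use rij in auto)
    finally have n: "\<bar>b (real i / 2 ^ p) - real i / real j * b (real j / 2 ^ p)\<bar> \<le> 2 * L" by simp
    have "v \<le> \<bar>b (real i / 2 ^ p) - real i / real j * b (real j / 2 ^ p)\<bar> / g 1"
      unfolding ij(4) Fterm_def case_prod_conv by (intro divide_g_le one) auto
    also have "\<dots> \<le> 2 * L / g 1" using n g_pos[of 1] by (intro divide_right_mono) auto
    finally show "v \<le> 2 * L / g 1" .
  qed (use finite_gpairs gpairs_nonempty[OF K] in auto)
  then show ?thesis by (intro bdd_aboveI[of _ "2 * L / g 1"]) auto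
qed

text \<open>For a continuous path this is the supremum over
  \<open>1 \<le> r \<le> \<tau> < K\<close>. Written along dyadic grids it is a limit of a sequence
  of measurable functions.\<close>

definition Fsup :: "(real \<Rightarrow> real) \<Rightarrow> nat \<Rightarrow> real" where
  "Fsup b K = (SUP p. Fg g K (2 ^ p) (\<lambda>j. b (real j / 2 ^ p)))"

lemma Fsup_tendsto:
  "2 \<le> K \<Longrightarrow> continuous_on {0..} b \<Longrightarrow> (\<lambda>p. Fg g K (2 ^ p) (\<lambda>j. b (real j / 2 ^ p))) \<longlonglongrightarrow> Fsup b K"
  unfolding Fsup_def by (intro LIMSEQ_incseq_SUP Fg_dyadic_bdd Fg_dyadic_incseq)

lemma Fg_le_Fsup:
  "2 \<le> K \<Longrightarrow> continuous_on {0..} b \<Longrightarrow> Fg g K (2 ^ p) (\<lambda>j. b (real j / 2 ^ p)) \<le> Fsup b K"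
  unfolding Fsup_def by (intro cSUP_upper Fg_dyadic_bdd) auto

lemma Fg_nonneg:
  assumes "2 \<le> K" "0 < m"
  shows "0 \<le> Fg g K m y"
proof -
  obtain p where p: "p \<in> gpairs K m" using gpairs_nonempty[OF assms] by blast
  then obtain i j where ij: "p = (i, j)" "m \<le> j" by (auto simp: gpairs_def)
  have "1 \<le> real j / real m" using ij assms by simp
  then have "0 \<le> Fterm g m y p" using g_pos[of "real j / real m"] by (simp add: ij Fterm_def)
  also have "\<dots> \<le> Fg g K m y" unfolding Fg_def using p finite_gpairs by (intro Max_ge) auto
  finally show ?thesis .
qed

lemma Fsup_nonneg: "2 \<le> K \<Longrightarrow> continuous_on {0..} b \<Longrightarrow> 0 \<le> Fsup b K"
  using Fg_le_Fsup[of K b 0] Fg_nonneg[of K "2 ^ 0" "\<lambda>j. b (real j / 2 ^ 0)"] by simp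

lemma Fsup_mono:
  assumes K: "2 \<le> K" "K \<le> K'" and b: "continuous_on {0..} b"
  shows "Fsup b K \<le> Fsup b K'"
  unfolding Fsup_def
proof (rule cSUP_mono)
  show "bdd_above (range (\<lambda>p. Fg g K' (2 ^ p) (\<lambda>j. b (real j / 2 ^ p))))" using K by (intro Fg_dyadic_bdd b) simp
  have "gpairs K m \<subseteq> gpairs K' m" for m
  proof
    fix q assume "q \<in> gpairs K m"
    then obtain i j where q: "q = (i, j)" "m \<le> i" "i \<le> j" "j < K * m" by (auto simp: gpairs_def)
    then have "j < K' * m" using less_le_trans[OF _ mult_le_mono1[OF K(2)]] by blast
    then show "q \<in> gpairs K' m" using q by (simp add: gpairs_def)
  qed
  then have "Fg g K (2 ^ p) (\<lambda>j. b (real j / 2 ^ p)) \<le> Fg g K' (2 ^ p) (\<lambda>j. b (real j / 2 ^ p))" for p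
    unfolding Fg_def using gpairs_nonempty[OF K(1)] finite_gpairs by (intro Max_mono image_mono) auto
  then show "\<exists>m\<in>UNIV. Fg g K (2 ^ p) (\<lambda>j. b (real j / 2 ^ p)) \<le> Fg g K' (2 ^ m) (\<lambda>j. b (real j / 2 ^ m))" for p by blast
qed simp

text \<open>Rounding \<open>r\<close> and \<open>\<tau>\<close> down to dyadic points approximates
  every term by grid terms, by continuity of \<open>b\<close> and \<open>g\<close>. The rounding
  keeps \<open>1 \<le> r \<le> \<tau>\<close>, because 1 is itself dyadic and rounding is monotone.
  The offset in \<open>K + 2\<close> only meets the condition \<open>2 \<le> K\<close>.\<close>

lemma SUP_eq_SUP_Fsup:
  assumes b: "continuous_on {0..} b"
  shows "(SUP \<tau>\<in>{1..}. SUP r\<in>{1..\<tau>}. ereal (\<bar>b r - r / \<tau> * b \<tau>\<bar> / g \<tau>)) = (SUP K. ereal (Fsup b (K + 2)))"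
proof (rule antisym)
  show "(SUP \<tau>\<in>{1..}. SUP r\<in>{1..\<tau>}. ereal (\<bar>b r - r / \<tau> * b \<tau>\<bar> / g \<tau>)) \<le> (SUP K. ereal (Fsup b (K + 2)))"
  proof (intro SUP_least)
    fix \<tau> r :: real assume "\<tau> \<in> {1..}" "r \<in> {1..\<tau>}"
    then have \<tau>r: "1 \<le> \<tau>" "1 \<le> r" "r \<le> \<tau>" by auto
    obtain K where K: "\<tau> < real K" using reals_Archimedean2 by blast
    define ip jp where "ip p = nat \<lfloor>2 ^ p * r\<rfloor>" and "jp p = nat \<lfloor>2 ^ p * \<tau>\<rfloor>" for p :: nat
    have ilim: "(\<lambda>p. real (ip p) / 2 ^ p) \<longlonglongrightarrow> r" and jlim: "(\<lambda>p. real (jp p) / 2 ^ p) \<longlonglongrightarrow> \<tau>"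
      unfolding ip_def jp_def by (rule floor_pow2_tendsto, use \<tau>r in simp)+
    have mem: "(ip p, jp p) \<in> gpairs (K + 2) (2 ^ p)" for p
    proof -
      have "2 ^ p * 1 \<le> 2 ^ p * r" using \<tau>r by (intro mult_left_mono) auto
      then have "real (2 ^ p) \<le> 2 ^ p * r" by simp
      then have "2 ^ p \<le> nat \<lfloor>2 ^ p * r\<rfloor>" by (rule le_nat_floor)
      then have 1: "2 ^ p \<le> ip p" by (simp only: ip_def)
      have 2: "ip p \<le> jp p" unfolding ip_def jp_def using \<tau>r by (intro nat_mono floor_mono mult_left_mono) auto
      have "0 \<le> 2 ^ p * \<tau>" using \<tau>r by simp
      then have "real (jp p) \<le> 2 ^ p * \<tau>" unfolding jp_def by linarith
      also have "\<dots> < 2 ^ p * real (K + 2)" using K by (intro mult_strict_left_mono) auto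
      also have "\<dots> = real ((K + 2) * 2 ^ p)" by (simp add: algebra_simps)
      finally have 3: "jp p < (K + 2) * 2 ^ p" by (simp only: of_nat_less_iff)
      show ?thesis using 1 2 3 by (simp add: gpairs_def)
    qed
    have bl: "(\<lambda>p. b (u p)) \<longlonglongrightarrow> b v" if "u \<longlonglongrightarrow> v" "\<And>p. 0 \<le> u p" "0 \<le> v" for u v
      using continuous_on_tendsto_compose[OF b that(1)] that by auto
    have gl: "(\<lambda>p. g (real (jp p) / 2 ^ p)) \<longlonglongrightarrow> g \<tau>"
    proof -
      have "1 \<le> real (jp p) / 2 ^ p" for p
      proof -
        have "2 ^ p \<le> jp p" using mem[of p] by (simp add: gpairs_def)
        then have "real (2 ^ p) \<le> real (jp p)" by (rule of_nat_mono)
        then show ?thesis by simp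
      qed
      then show ?thesis using continuous_on_tendsto_compose[OF g_cont jlim] \<tau>r by auto
    qed
    have "(\<lambda>p. \<bar>b (real (ip p) / 2 ^ p) - (real (ip p) / 2 ^ p) / (real (jp p) / 2 ^ p) * b (real (jp p) / 2 ^ p)\<bar> / g (real (jp p) / 2 ^ p))
      \<longlonglongrightarrow> \<bar>b r - r / \<tau> * b \<tau>\<bar> / g \<tau>"
      using \<tau>r g_pos[OF \<tau>r(1)] by (intro tendsto_intros bl ilim jlim gl) auto
    moreover have "\<bar>b (real (ip p) / 2 ^ p) - (real (ip p) / 2 ^ p) / (real (jp p) / 2 ^ p) * b (real (jp p) / 2 ^ p)\<bar> / g (real (jp p) / 2 ^ p)
      \<le> Fsup b (K + 2)" for p
    proof -
      have "\<bar>b (real (ip p) / 2 ^ p) - (real (ip p) / 2 ^ p) / (real (jp p) / 2 ^ p) * b (real (jp p) / 2 ^ p)\<bar> / g (real (jp p) / 2 ^ p)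
        = Fterm g (2 ^ p) (\<lambda>j. b (real j / 2 ^ p)) (ip p, jp p)" by (simp add: Fterm_def)
      also have "\<dots> \<le> Fg g (K + 2) (2 ^ p) (\<lambda>j. b (real j / 2 ^ p))"
        unfolding Fg_def using mem finite_gpairs by (intro Max_ge) auto
      also have "\<dots> \<le> Fsup b (K + 2)" by (intro Fg_le_Fsup b) simp
      finally show ?thesis .
    qed
    ultimately have "\<bar>b r - r / \<tau> * b \<tau>\<bar> / g \<tau> \<le> Fsup b (K + 2)" by (intro LIMSEQ_le_const2) auto
    then have "ereal (\<bar>b r - r / \<tau> * b \<tau>\<bar> / g \<tau>) \<le> ereal (Fsup b (K + 2))" by simp
    also have "\<dots> \<le> (SUP K. ereal (Fsup b (K + 2)))" by (rule SUP_upper) simp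
    finally show "ereal (\<bar>b r - r / \<tau> * b \<tau>\<bar> / g \<tau>) \<le> (SUP K. ereal (Fsup b (K + 2)))" .
  qed
next
  show "(SUP K. ereal (Fsup b (K + 2))) \<le> (SUP \<tau>\<in>{1..}. SUP r\<in>{1..\<tau>}. ereal (\<bar>b r - r / \<tau> * b \<tau>\<bar> / g \<tau>))"
    (is "_ \<le> ?S")
  proof (intro SUP_least)
    fix K :: nat
    have le: "ereal (Fg g (K + 2) (2 ^ p) (\<lambda>j. b (real j / 2 ^ p))) \<le> ?S" for p
    proof -
      have "Fg g (K + 2) (2 ^ p) (\<lambda>j. b (real j / 2 ^ p)) \<in> Fterm g (2 ^ p) (\<lambda>j. b (real j / 2 ^ p)) ` gpairs (K + 2) (2 ^ p)"
        unfolding Fg_def using gpairs_nonempty[of "K + 2" "2 ^ p"] finite_gpairs by (intro Max_in) auto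
      then obtain i j where ij: "2 ^ p \<le> i" "i \<le> j"
        "Fg g (K + 2) (2 ^ p) (\<lambda>j. b (real j / 2 ^ p)) = Fterm g (2 ^ p) (\<lambda>j. b (real j / 2 ^ p)) (i, j)"
        by (auto simp: gpairs_def)
      define \<tau> r where "\<tau> = real j / 2 ^ p" and "r = real i / 2 ^ p"
      have "real (2 ^ p) \<le> real i" using ij(1) by (rule of_nat_mono)
      then have \<tau>r: "1 \<le> r" "r \<le> \<tau>" using ij(2) by (auto simp: r_def \<tau>_def divide_right_mono)
      have "ereal (Fg g (K + 2) (2 ^ p) (\<lambda>j. b (real j / 2 ^ p))) = ereal (\<bar>b r - r / \<tau> * b \<tau>\<bar> / g \<tau>)"
        unfolding ij(3) by (simp add: Fterm_def \<tau>_def r_def)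
      also have "\<dots> \<le> (SUP r\<in>{1..\<tau>}. ereal (\<bar>b r - r / \<tau> * b \<tau>\<bar> / g \<tau>))" using \<tau>r by (intro SUP_upper) auto
      also have "\<dots> \<le> ?S" using \<tau>r by (intro SUP_upper) auto
      finally show ?thesis .
    qed
    have lim: "(\<lambda>p. ereal (Fg g (K + 2) (2 ^ p) (\<lambda>j. b (real j / 2 ^ p)))) \<longlonglongrightarrow> ereal (Fsup b (K + 2))"
      by (intro tendsto_ereal Fsup_tendsto b) simp
    show "ereal (Fsup b (K + 2)) \<le> ?S" by (rule LIMSEQ_le_const2[OF lim]) (use le in blast)
  qed
qed

end

section \<open>The normaliser of the limit\<close>

definition Vroot :: "(real \<Rightarrow> real) \<Rightarrow> real" where
  "Vroot b = sqrt (LBINT u:{0..1}. (b u - u * b 1)\<^sup>2)"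

lemma
  assumes b: "continuous_on {0..} b"
  shows Vroot_integral: "Vroot b = sqrt (integral {0..1} (\<lambda>u. (b u - u * b 1)\<^sup>2))"
    and bridge_continuous: "continuous_on {0..1} (\<lambda>u. (b u - u * b 1)\<^sup>2)"
proof -
  have "continuous_on {0..1} b" by (rule continuous_on_subset[OF b]) auto
  then show c: "continuous_on {0..1} (\<lambda>u. (b u - u * b 1)\<^sup>2)" by (intro continuous_intros)
  show "Vroot b = sqrt (integral {0..1} (\<lambda>u. (b u - u * b 1)\<^sup>2))"
    unfolding Vroot_def set_borel_integral_eq_integral(2)[OF borel_integrable_atLeastAtMost'[OF c]] ..
qed

lemma wg_tendsto:
  assumes b: "continuous_on {0..} b"
  shows "(\<lambda>p. wg (2 ^ p) (\<lambda>j. b (real j / 2 ^ p))) \<longlonglongrightarrow> Vroot b"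
proof -
  have "filterlim (\<lambda>p. 2 ^ p :: nat) at_top sequentially"
    by (rule filterlim_subseq) (auto simp: strict_mono_Suc_iff)
  from filterlim_compose[OF riemann_sum_tendsto[OF bridge_continuous[OF b]] this]
  have "(\<lambda>p. sqrt ((\<Sum>i<2 ^ p. (b (real i / real (2 ^ p)) - real i / real (2 ^ p) * b 1)\<^sup>2) / real (2 ^ p))) \<longlonglongrightarrow> Vroot b"
    unfolding Vroot_integral[OF b] by (intro tendsto_real_sqrt)
  then show ?thesis by (simp add: wg_def rms_def)
qed

lemma Vroot_nonneg: "0 \<le> Vroot b"
  unfolding Vroot_def set_lebesgue_integral_def by (intro real_sqrt_ge_zero integral_nonneg_AE AE_I2) auto

text \<open>A continuous nonnegative integrand with integral 0 vanishes everywhere; the midpoint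
  alone suffices for positivity of the normaliser.\<close>

lemma Vroot_eq_0:
  assumes b: "continuous_on {0..} b" and 0: "Vroot b = 0"
  shows "b (1 / 2) = 1 / 2 * b 1"
proof -
  have i0: "integral {0..1} (\<lambda>u. (b u - u * b 1)\<^sup>2) = 0" using 0 Vroot_integral[OF b] by simp
  have "integral {0..1} (\<lambda>u. (b u - u * b 1)\<^sup>2) = 0 \<longleftrightarrow> (\<forall>u\<in>{0..1}. (b u - u * b 1)\<^sup>2 = 0)"
    by (rule integral_eq_0_iff[OF bridge_continuous[OF b]]) auto
  from iffD1[OF this i0] have "(b (1 / 2) - 1 / 2 * b 1)\<^sup>2 = 0" by (rule bspec) simp
  then show ?thesis by simp
qed

context brownian_motion
begin

text \<open>At the midpoint the bridge is half the difference of two independent normal increments.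
  That difference has a density, so it is almost surely nonzero.\<close>

lemma AE_Vroot_pos: "AE \<omega> in N. 0 < Vroot (\<lambda>t. B t \<omega>)"
proof -
  have "N.indep_vars (\<lambda>_. borel) (G 2) {..<2}"
    using B_indep[of "\<lambda>i. real i / real 2" 2] by (simp add: G_def[abs_def] divide_strict_right_mono)
  then have "N.indep_var (PiM {0} (\<lambda>_. borel)) (\<lambda>\<omega>. restrict (\<lambda>i. G 2 i \<omega>) {0})
      (PiM {1} (\<lambda>_. borel)) (\<lambda>\<omega>. restrict (\<lambda>i. G 2 i \<omega>) {1})"
    by (rule N.indep_var_restrict) auto
  then have "N.indep_var borel ((\<lambda>z. z 0) \<circ> (\<lambda>\<omega>. restrict (\<lambda>i. G 2 i \<omega>) {0})) borel ((\<lambda>z. z 1) \<circ> (\<lambda>\<omega>. restrict (\<lambda>i. G 2 i \<omega>) {1}))"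
    by (rule N.indep_var_compose) (auto intro: measurable_component_singleton)
  moreover have "(\<lambda>z. z 0) \<circ> (\<lambda>\<omega>. restrict (\<lambda>i. G 2 i \<omega>) {0}) = G 2 0" "(\<lambda>z. z 1) \<circ> (\<lambda>\<omega>. restrict (\<lambda>i. G 2 i \<omega>) {1}) = G 2 1"
    by (auto simp: fun_eq_iff)
  ultimately have ind: "N.indep_var borel (G 2 0) borel (G 2 1)" by simp
  have d: "distributed N lborel (G 2 0) (normal_density 0 (sqrt (1 / 2)))" "distributed N lborel (G 2 1) (normal_density 0 (sqrt (1 / 2)))"
    using B_normal[of 0 "1 / 2"] B_normal[of "1 / 2" 1] by (simp_all add: G_def[abs_def])
  have D: "distributed N lborel (\<lambda>\<omega>. G 2 0 \<omega> - G 2 1 \<omega>) (normal_density (0 - 0) (sqrt ((sqrt (1 / 2))\<^sup>2 + (sqrt (1 / 2))\<^sup>2)))"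
    by (rule N.diff_indep_normal[OF ind _ _ d]) auto
  have "AE \<omega> in N. G 2 0 \<omega> - G 2 1 \<omega> \<noteq> 0"
  proof (subst N.distributed_AE2[OF D, where P="\<lambda>z. z \<noteq> 0"])
    show "AE z in lborel. 0 < ennreal (normal_density (0 - 0) (sqrt ((sqrt (1 / 2))\<^sup>2 + (sqrt (1 / 2))\<^sup>2)) z) \<longrightarrow> z \<noteq> 0"
      using AE_lborel_singleton[of "0::real"] by eventually_elim simp
  qed simp
  then show ?thesis
  proof (rule AE_mp, intro AE_I2 impI)
    fix \<omega> assume \<omega>: "\<omega> \<in> space N" and ne: "G 2 0 \<omega> - G 2 1 \<omega> \<noteq> 0"
    have "Vroot (\<lambda>t. B t \<omega>) \<noteq> 0"
    proof
      assume "Vroot (\<lambda>t. B t \<omega>) = 0"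
      then have "B (1 / 2) \<omega> = 1 / 2 * B 1 \<omega>" by (rule Vroot_eq_0[OF B_continuous[OF \<omega>]])
      then show False using ne B_0[OF \<omega>] by (simp add: G_def)
    qed
    then show "0 < Vroot (\<lambda>t. B t \<omega>)" using Vroot_nonneg[of "\<lambda>t. B t \<omega>"] by linarith
  qed
qed

lemma measurable_B_grid: "(\<lambda>\<omega>. B (real j / 2 ^ p) \<omega>) \<in> borel_measurable N"
  by (intro B_measurable) simp

lemma measurable_wg_B [measurable]: "(\<lambda>\<omega>. wg (2 ^ p) (\<lambda>j. B (real j / 2 ^ p) \<omega>)) \<in> borel_measurable N"
  unfolding wg_def rms_def using measurable_B_grid B_measurable[of 1]
  by (intro measurable_compose[OF _ borel_measurable_sqrt]
        borel_measurable_divide borel_measurable_sum borel_measurable_power borel_measurable_diff borel_measurable_times) auto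

lemma measurable_Vroot [measurable]: "(\<lambda>\<omega>. Vroot (\<lambda>t. B t \<omega>)) \<in> borel_measurable N"
proof (rule borel_measurable_LIMSEQ_metric)
  show "(\<lambda>p. wg (2 ^ p) (\<lambda>j. B (real j / 2 ^ p) \<omega>)) \<longlonglongrightarrow> Vroot (\<lambda>t. B t \<omega>)" if "\<omega> \<in> space N" for \<omega>
    by (rule wg_tendsto[OF B_continuous[OF that]])
qed measurable

end

locale brownian_weight = weight g + brownian_motion N B for g and N :: "'v measure" and B
begin

lemma measurable_Fg_B [measurable]: "(\<lambda>\<omega>. Fg g K (2 ^ p) (\<lambda>j. B (real j / 2 ^ p) \<omega>)) \<in> borel_measurable N"
  unfolding Fg_def
proof (rule borel_measurable_Max[OF finite_gpairs])
  note measurable_B_grid [measurable]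
  show "(\<lambda>\<omega>. Fterm g (2 ^ p) (\<lambda>j. B (real j / 2 ^ p) \<omega>) q) \<in> borel_measurable N" for q
    unfolding Fterm_def by (cases q) simp
qed

lemma measurable_Fsup [measurable]: "2 \<le> K \<Longrightarrow> (\<lambda>\<omega>. Fsup (\<lambda>t. B t \<omega>) K) \<in> borel_measurable N"
proof (rule borel_measurable_LIMSEQ_metric)
  show "(\<lambda>p. Fg g K (2 ^ p) (\<lambda>j. B (real j / 2 ^ p) \<omega>)) \<longlonglongrightarrow> Fsup (\<lambda>t. B t \<omega>) K" if "2 \<le> K" "\<omega> \<in> space N" for \<omega>
    by (rule Fsup_tendsto[OF that(1) B_continuous[OF that(2)]])
qed measurable

lemma limit_variable_eq:
  assumes "\<omega> \<in> space N"
  shows "limit_variable g B \<omega> = ereal (1 / Vroot (\<lambda>t. B t \<omega>)) * (SUP K. ereal (Fsup (\<lambda>t. B t \<omega>) (K + 2)))"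
  unfolding limit_variable_def Vroot_def SUP_eq_SUP_Fsup[OF B_continuous[OF assms]] ..

lemma measurable_limit_variable: "limit_variable g B \<in> borel_measurable N"
proof -
  have "(\<lambda>\<omega>. ereal (1 / Vroot (\<lambda>t. B t \<omega>)) * (SUP K. ereal (Fsup (\<lambda>t. B t \<omega>) (K + 2)))) \<in> borel_measurable N"
    by measurable
  then show ?thesis by (simp add: limit_variable_eq cong: measurable_cong)
qed

lemma dyadic_limit:
  assumes \<Theta>: "uc2 \<Theta>" "\<And>a w. \<bar>\<Theta> a w\<bar> \<le> 1" and K: "2 \<le> K"
  shows "(\<lambda>p. N.expectation (\<lambda>\<omega>. \<Theta> (Fg g K (2 ^ p) (\<lambda>j. B (real j / 2 ^ p) \<omega>)) (wg (2 ^ p) (\<lambda>j. B (real j / 2 ^ p) \<omega>))))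
    \<longlonglongrightarrow> N.expectation (\<lambda>\<omega>. \<Theta> (Fsup (\<lambda>t. B t \<omega>) K) (Vroot (\<lambda>t. B t \<omega>)))"
proof (rule integral_dominated_convergence[where w="\<lambda>_. 1"])
  show "(\<lambda>\<omega>. \<Theta> (Fsup (\<lambda>t. B t \<omega>) K) (Vroot (\<lambda>t. B t \<omega>))) \<in> borel_measurable N"
    using K by (intro measurable_uc2[OF \<Theta>(1)] measurable_Fsup measurable_Vroot)
  show "(\<lambda>\<omega>. \<Theta> (Fg g K (2 ^ p) (\<lambda>j. B (real j / 2 ^ p) \<omega>)) (wg (2 ^ p) (\<lambda>j. B (real j / 2 ^ p) \<omega>))) \<in> borel_measurable N" for p
    by (intro measurable_uc2[OF \<Theta>(1)] measurable_Fg_B measurable_wg_B)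
  show "AE \<omega> in N. (\<lambda>p. \<Theta> (Fg g K (2 ^ p) (\<lambda>j. B (real j / 2 ^ p) \<omega>)) (wg (2 ^ p) (\<lambda>j. B (real j / 2 ^ p) \<omega>)))
      \<longlonglongrightarrow> \<Theta> (Fsup (\<lambda>t. B t \<omega>) K) (Vroot (\<lambda>t. B t \<omega>))"
    by (intro AE_I2 uc2_tendsto[OF \<Theta>(1)] Fsup_tendsto[OF K] wg_tendsto B_continuous)
qed (use \<Theta>(2) in auto)

end

sublocale monitoring \<subseteq> brownian_weight ..

context monitoring
begin

text \<open>A dyadic mesh is fixed for which both the grid error for large \<open>n\<close> and the
  distance of the Brownian grid functional from its limit are small; then \<open>n\<close> grows on
  that mesh.\<close>

lemma An_limit:
  assumes \<Theta>: "uc2 \<Theta>" "\<And>a w. \<bar>\<Theta> a w\<bar> \<le> 1" and K: "2 \<le> K"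
  shows "(\<lambda>n. expectation (\<lambda>\<omega>. \<Theta> (An K n (x n \<omega>)) (wn n (x n \<omega>))))
    \<longlonglongrightarrow> N.expectation (\<lambda>\<omega>. \<Theta> (Fsup (\<lambda>t. B t \<omega>) K) (Vroot (\<lambda>t. B t \<omega>)))"
proof (rule tendstoI)
  fix \<epsilon> :: real assume \<epsilon>: "\<epsilon> > 0"
  let ?y = "\<lambda>m n \<omega> j. x n \<omega> (gridpt m n j)"
  have pow: "filterlim (\<lambda>p. 2 ^ p :: nat) at_top sequentially"
    by (rule filterlim_subseq) (auto simp: strict_mono_Suc_iff)
  have "\<forall>\<^sub>F m in sequentially. \<forall>\<^sub>F n in sequentially.
    \<bar>expectation (\<lambda>\<omega>. \<Theta> (An K n (x n \<omega>)) (wn n (x n \<omega>))) - expectation (\<lambda>\<omega>. \<Theta> (Fg g K m (?y m n \<omega>)) (wg m (?y m n \<omega>)))\<bar> \<le> \<epsilon> / 4"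
    using \<epsilon> by (intro grid_approximation[OF \<Theta> K]) simp
  then have "\<forall>\<^sub>F p in sequentially. \<forall>\<^sub>F n in sequentially.
    \<bar>expectation (\<lambda>\<omega>. \<Theta> (An K n (x n \<omega>)) (wn n (x n \<omega>))) - expectation (\<lambda>\<omega>. \<Theta> (Fg g K (2 ^ p) (?y (2 ^ p) n \<omega>)) (wg (2 ^ p) (?y (2 ^ p) n \<omega>)))\<bar> \<le> \<epsilon> / 4"
    by (rule eventually_compose_filterlim[OF _ pow])
  moreover have "\<forall>\<^sub>F p in sequentially. dist (N.expectation (\<lambda>\<omega>. \<Theta> (Fg g K (2 ^ p) (\<lambda>j. B (real j / 2 ^ p) \<omega>)) (wg (2 ^ p) (\<lambda>j. B (real j / 2 ^ p) \<omega>))))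
    (N.expectation (\<lambda>\<omega>. \<Theta> (Fsup (\<lambda>t. B t \<omega>) K) (Vroot (\<lambda>t. B t \<omega>)))) < \<epsilon> / 4"
    using \<epsilon> by (intro tendstoD[OF dyadic_limit[OF \<Theta> K]]) simp
  ultimately obtain p where p: "\<forall>\<^sub>F n in sequentially.
    \<bar>expectation (\<lambda>\<omega>. \<Theta> (An K n (x n \<omega>)) (wn n (x n \<omega>))) - expectation (\<lambda>\<omega>. \<Theta> (Fg g K (2 ^ p) (?y (2 ^ p) n \<omega>)) (wg (2 ^ p) (?y (2 ^ p) n \<omega>)))\<bar> \<le> \<epsilon> / 4"
    "dist (N.expectation (\<lambda>\<omega>. \<Theta> (Fg g K (2 ^ p) (\<lambda>j. B (real j / 2 ^ p) \<omega>)) (wg (2 ^ p) (\<lambda>j. B (real j / 2 ^ p) \<omega>))))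
    (N.expectation (\<lambda>\<omega>. \<Theta> (Fsup (\<lambda>t. B t \<omega>) K) (Vroot (\<lambda>t. B t \<omega>)))) < \<epsilon> / 4"
    using eventually_happens[OF eventually_conj] trivial_limit_sequentially by blast
  have "\<forall>\<^sub>F n in sequentially. dist (expectation (\<lambda>\<omega>. \<Theta> (Fg g K (2 ^ p) (?y (2 ^ p) n \<omega>)) (wg (2 ^ p) (?y (2 ^ p) n \<omega>))))
    (N.expectation (\<lambda>\<omega>. \<Theta> (Fg g K (2 ^ p) (\<lambda>j. B (real j / 2 ^ p) \<omega>)) (wg (2 ^ p) (\<lambda>j. B (real j / 2 ^ p) \<omega>)))) < \<epsilon> / 4"
    using tendstoD[OF grid_limit[OF \<Theta> K, of "2 ^ p"], of "\<epsilon> / 4"] \<epsilon> by simp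
  with p(1) show "\<forall>\<^sub>F n in sequentially. dist (expectation (\<lambda>\<omega>. \<Theta> (An K n (x n \<omega>)) (wn n (x n \<omega>))))
    (N.expectation (\<lambda>\<omega>. \<Theta> (Fsup (\<lambda>t. B t \<omega>) K) (Vroot (\<lambda>t. B t \<omega>)))) < \<epsilon>"
  proof eventually_elim
    case (elim n)
    then show ?case using p(2) \<epsilon> unfolding dist_real_def by linarith
  qed
qed

end

section \<open>The monitoring statistic\<close>

lemma (in prob_space) prob_gt_le_second_moment:
  assumes [measurable]: "Y \<in> borel_measurable M" and i: "integrable M (\<lambda>\<omega>. (Y \<omega>)\<^sup>2)" and t: "0 < t"
  shows "prob {\<omega> \<in> space M. t < Y \<omega>} \<le> expectation (\<lambda>\<omega>. (Y \<omega>)\<^sup>2) / t\<^sup>2"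
proof -
  have "prob {\<omega> \<in> space M. t < Y \<omega>} = expectation (indicator {\<omega> \<in> space M. t < Y \<omega>})" by simp
  also have "\<dots> \<le> expectation (\<lambda>\<omega>. (Y \<omega>)\<^sup>2 / t\<^sup>2)"
  proof (rule integral_mono)
    show "indicator {\<omega> \<in> space M. t < Y \<omega>} \<omega> \<le> (Y \<omega>)\<^sup>2 / t\<^sup>2" for \<omega>
    proof (cases "t < Y \<omega>")
      case True
      then have "t\<^sup>2 \<le> (Y \<omega>)\<^sup>2" using t by (intro power_mono) auto
      then show ?thesis using t by (simp add: indicator_def)
    qed (simp add: indicator_def)
  qed (use i in \<open>auto simp: integrable_indicator_iff less_top[symmetric]\<close>)
  finally show ?thesis by simp
qed

lemma rms_cmult: "0 \<le> c \<Longrightarrow> rms A (\<lambda>i. c * f i) = c * rms A f"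
  by (simp add: rms_def power_mult_distrib sum_distrib_left[symmetric] real_sqrt_mult real_sqrt_divide)

locale monitoring_stat = monitoring M F Z e \<kappa> r \<mu> \<sigma> g N B
  for M :: "'w measure" and F and Z :: "int \<Rightarrow> 'w \<Rightarrow> 'k::real_inner" and e \<kappa> r \<mu> \<sigma>
    and g and N :: "'v measure" and B +
  fixes Y :: "nat \<Rightarrow> 'w \<Rightarrow> 'k"
  assumes Y_eq: "1 \<le> t \<Longrightarrow> \<omega> \<in> space M \<Longrightarrow> Y t \<omega> = \<mu> + Z (int t) \<omega>"
begin

abbreviation P :: "nat \<Rightarrow> 'w \<Rightarrow> 'k" where "P k \<equiv> S {0<..int k}"

lemma psum_eq: "\<omega> \<in> space M \<Longrightarrow> psum Y k \<omega> = real k *\<^sub>R \<mu> + P k \<omega>"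
proof (induction k)
  case 0
  then show ?case by (simp add: psum_def S_def)
next
  case (Suc k)
  have "{0<..int (Suc k)} = insert (int (Suc k)) {0<..int k}" by auto
  then have "P (Suc k) \<omega> = Z (int (Suc k)) \<omega> + P k \<omega>" by (simp add: S_def)
  then show ?case using Suc Y_eq[of "Suc k" \<omega>] by (simp add: psum_def algebra_simps)
qed

lemma measurable_inner_psum: "(\<lambda>\<omega>. psum Y a \<omega> \<bullet> psum Y b \<omega>) \<in> borel_measurable M"
proof -
  have "(\<lambda>\<omega>. real a * real b * (\<mu> \<bullet> \<mu>) + real a * (P b \<omega> \<bullet> \<mu>) + real b * (P a \<omega> \<bullet> \<mu>) + P a \<omega> \<bullet> P b \<omega>) \<in> borel_measurable M"
    by measurable
  moreover have "psum Y a \<omega> \<bullet> psum Y b \<omega>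
      = real a * real b * (\<mu> \<bullet> \<mu>) + real a * (P b \<omega> \<bullet> \<mu>) + real b * (P a \<omega> \<bullet> \<mu>) + P a \<omega> \<bullet> P b \<omega>" if "\<omega> \<in> space M" for \<omega>
    unfolding psum_eq[OF that] by (simp add: algebra_simps inner_commute)
  ultimately show ?thesis by (simp cong: measurable_cong)
qed

lemma measurable_T_stat [measurable]: "T_stat Y n k s \<in> borel_measurable M"
proof -
  note measurable_inner_psum [measurable]
  have "T_stat Y n k s = (\<lambda>\<omega>. 1 / real k * (1 / sqrt (real n)) * (psum Y k \<omega> \<bullet> psum Y s \<omega> - real s / real k * (psum Y k \<omega> \<bullet> psum Y k \<omega>)))"
    by (simp add: T_stat_def[abs_def] inner_diff_right right_diff_distrib mult_ac)
  then show ?thesis by simp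
qed

text \<open>The terms at \<open>t = 0\<close> and \<open>t = n\<close> both vanish, so the range of
  summation can be moved to \<open>{..<n}\<close>. The factor \<open>n^4\<close> splits into
  \<open>n^3\<close> from the squares of \<open>T_stat Y n n t\<close> and \<open>n\<close> from the
  mean.\<close>

lemma W_stat_eq:
  assumes n: "0 < n"
  shows "sqrt (W_stat Y n \<omega>) = rms {..<n} (\<lambda>t. T_stat Y n n t \<omega>)"
proof -
  let ?u = "\<lambda>t. psum Y n \<omega> \<bullet> (psum Y t \<omega> - (real t / real n) *\<^sub>R psum Y n \<omega>)"
  have T: "(T_stat Y n n t \<omega>)\<^sup>2 = (?u t)\<^sup>2 / real n ^ 3" for t
  proof -
    have "T_stat Y n n t \<omega> = ?u t / (real n * sqrt (real n))" by (simp add: T_stat_def)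
    then have "(T_stat Y n n t \<omega>)\<^sup>2 = (?u t)\<^sup>2 / (real n * sqrt (real n))\<^sup>2" by (simp only: power_divide)
    also have "(real n * sqrt (real n))\<^sup>2 = real n ^ 3" by (simp add: power_mult_distrib power2_eq_square power3_eq_cube)
    finally show ?thesis .
  qed
  have "T_stat Y n n 0 \<omega> = - (1 / real n * (1 / sqrt (real n))) * 0"
    by (simp add: T_stat_def psum_def)
  then have t0: "?u 0 = 0" by (simp add: psum_def)
  have tn: "?u n = 0" using n by simp
  have "(\<Sum>t=1..n. (?u t)\<^sup>2) = (\<Sum>t\<in>{..n}. (?u t)\<^sup>2)"
    using t0 by (intro sum.mono_neutral_left) (auto simp: Suc_le_eq)
  also have "\<dots> = (\<Sum>t<n. (?u t)\<^sup>2) + (?u n)\<^sup>2" unfolding lessThan_Suc_atMost[symmetric] sum.lessThan_Suc ..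
  also have "\<dots> = (\<Sum>t<n. (?u t)\<^sup>2)" unfolding tn by simp
  finally have "W_stat Y n \<omega> = (\<Sum>t<n. (?u t)\<^sup>2) / real n ^ 4" by (simp add: W_stat_def)
  also have "\<dots> = (\<Sum>t<n. (T_stat Y n n t \<omega>)\<^sup>2) / real n"
    unfolding T by (simp add: sum_divide_distrib power4_eq_xxxx power3_eq_cube)
  finally show ?thesis by (simp add: rms_def)
qed

lemma measurable_W_stat [measurable]: "W_stat Y n \<in> borel_measurable M"
proof -
  note measurable_inner_psum [measurable]
  show ?thesis unfolding W_stat_def[abs_def] inner_diff_right inner_scaleR_right by measurable
qed

lemma measurable_open_end_stat: "open_end_stat g Y n \<in> borel_measurable M"
proof -
  have G: "(\<lambda>\<omega>. G_stat Y n k \<omega>) \<in> borel_measurable M" for k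
    unfolding G_stat_def by (rule borel_measurable_Max) auto
  show ?thesis unfolding open_end_stat_def[abs_def]
    using G by (intro borel_measurable_SUP) auto
qed

text \<open>A bound, uniform in \<open>k\<close>, for the norm of the average of the first
  \<open>k\<close> observations.\<close>

definition \<kappa>Y :: real where "\<kappa>Y = \<kappa> + norm \<mu>"

lemma centered_sum_le:
  assumes "s \<le> k" "0 < k"
  shows "norm (P s \<omega> - (real s / real k) *\<^sub>R P k \<omega>) \<le> 2 * Smax 0 k \<omega>"
proof -
  have "norm (P s \<omega> - (real s / real k) *\<^sub>R P k \<omega>) \<le> norm (P s \<omega>) + real s / real k * norm (P k \<omega>)"
    by (rule order_trans[OF norm_triangle_ineq4]) simp
  also have "\<dots> \<le> Smax 0 k \<omega> + 1 * Smax 0 k \<omega>"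
    using Smax_ge[OF assms(1), of 0 \<omega>] Smax_ge[of k k 0 \<omega>] assms Smax_nonneg[of 0 k \<omega>]
    by (intro add_mono mult_mono) auto
  finally show ?thesis by simp
qed

lemma T_stat_eq:
  assumes "\<omega> \<in> space M" "0 < k"
  shows "T_stat Y n k s \<omega> = (\<mu> + (1 / real k) *\<^sub>R P k \<omega>) \<bullet> (P s \<omega> - (real s / real k) *\<^sub>R P k \<omega>) / sqrt (real n)"
proof -
  have "psum Y s \<omega> - (real s / real k) *\<^sub>R psum Y k \<omega> = P s \<omega> - (real s / real k) *\<^sub>R P k \<omega>"
    using assms(2) by (simp add: psum_eq[OF assms(1)] algebra_simps)
  moreover have "(1 / real k) *\<^sub>R psum Y k \<omega> = \<mu> + (1 / real k) *\<^sub>R P k \<omega>"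
    using assms(2) by (simp add: psum_eq[OF assms(1)] algebra_simps)
  ultimately show ?thesis by (simp add: T_stat_def)
qed

text \<open>The error is the inner product of the centred average with the centred partial sum,
  hence quadratic in \<open>Smax\<close>. On a bounded horizon its expectation is of order
  \<open>1 / sqrt n\<close>.\<close>

lemma T_stat_approx:
  assumes \<omega>: "\<omega> \<in> space M" and k: "0 < k" "s \<le> k"
  shows "\<bar>T_stat Y n k s \<omega> - \<sigma> * (x n \<omega> s - real s / real k * x n \<omega> k)\<bar> \<le> 2 * (Smax 0 k \<omega>)\<^sup>2 / (real k * sqrt (real n))"
proof -
  let ?R = "P s \<omega> - (real s / real k) *\<^sub>R P k \<omega>"
  have "\<mu> \<bullet> ?R / sqrt (real n) = \<sigma> * (x n \<omega> s - real s / real k * x n \<omega> k)"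
  proof -
    have "\<mu> \<bullet> ?R = X {0<..int s} \<omega> - real s / real k * X {0<..int k} \<omega>"
      by (simp add: X_def inner_diff_right inner_commute)
    moreover have \<sigma>x: "\<sigma> * x n \<omega> j = X {0<..int j} \<omega> / sqrt (real n)" for j using \<sigma>_pos by (simp add: x_def)
    have "\<sigma> * (x n \<omega> s - real s / real k * x n \<omega> k) = \<sigma> * x n \<omega> s - real s / real k * (\<sigma> * x n \<omega> k)"
      by (simp add: right_diff_distrib)
    ultimately show ?thesis unfolding \<sigma>x by (simp add: diff_divide_distrib)
  qed
  then have "T_stat Y n k s \<omega> - \<sigma> * (x n \<omega> s - real s / real k * x n \<omega> k) = (P k \<omega> \<bullet> ?R) / (real k * sqrt (real n))"
    unfolding T_stat_eq[OF \<omega> k(1)] by (simp add: inner_add_left add_divide_distrib)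
  moreover have "\<bar>(P k \<omega> \<bullet> ?R) / (real k * sqrt (real n))\<bar> = \<bar>P k \<omega> \<bullet> ?R\<bar> / (real k * sqrt (real n))"
    by (simp add: abs_mult)
  moreover have "\<bar>P k \<omega> \<bullet> ?R\<bar> \<le> Smax 0 k \<omega> * (2 * Smax 0 k \<omega>)"
    using Smax_ge[of k k 0 \<omega>] centered_sum_le[OF k(2,1), of \<omega>] Smax_nonneg[of 0 k \<omega>]
    by (intro order_trans[OF Cauchy_Schwarz_ineq2] mult_mono) auto
  then have "\<bar>P k \<omega> \<bullet> ?R\<bar> / (real k * sqrt (real n)) \<le> 2 * (Smax 0 k \<omega>)\<^sup>2 / (real k * sqrt (real n))"
    by (intro divide_right_mono) (auto simp: power2_eq_square)
  ultimately show ?thesis by simp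
qed

text \<open>Bounding the average by \<open>\<kappa>Y\<close> leaves an estimate that is linear in
  \<open>Smax\<close>. It is too crude for the limit, but on the unbounded tail it asks only for
  second moments.\<close>

lemma T_stat_bound:
  assumes \<omega>: "\<omega> \<in> space M" and k: "0 < k" "s \<le> k"
  shows "\<bar>T_stat Y n k s \<omega>\<bar> \<le> 2 * \<kappa>Y * Smax 0 k \<omega> / sqrt (real n)"
proof -
  have "norm (\<mu> + (1 / real k) *\<^sub>R P k \<omega>) \<le> norm \<mu> + 1 / real k * norm (P k \<omega>)"
    by (rule order_trans[OF norm_triangle_ineq]) simp
  also have "\<dots> \<le> norm \<mu> + 1 / real k * (real k * \<kappa>)"
    using norm_S_le[of "{0<..int k}" \<omega>] by (intro add_left_mono mult_left_mono) auto
  also have "\<dots> = \<kappa>Y" using k by (simp add: \<kappa>Y_def)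
  finally have "norm (\<mu> + (1 / real k) *\<^sub>R P k \<omega>) \<le> \<kappa>Y" .
  then have "\<bar>(\<mu> + (1 / real k) *\<^sub>R P k \<omega>) \<bullet> (P s \<omega> - (real s / real k) *\<^sub>R P k \<omega>)\<bar> \<le> \<kappa>Y * (2 * Smax 0 k \<omega>)"
    using centered_sum_le[OF k(2,1), of \<omega>] order_trans[OF norm_ge_zero]
    by (intro order_trans[OF Cauchy_Schwarz_ineq2] mult_mono) auto
  then have "\<bar>(\<mu> + (1 / real k) *\<^sub>R P k \<omega>) \<bullet> (P s \<omega> - (real s / real k) *\<^sub>R P k \<omega>)\<bar> / sqrt (real n) \<le> \<kappa>Y * (2 * Smax 0 k \<omega>) / sqrt (real n)"
    by (intro divide_right_mono) auto
  then show ?thesis unfolding T_stat_eq[OF \<omega> k(1)] by (simp add: mult_ac)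
qed

section \<open>The statistic on a truncated horizon\<close>

definition At :: "nat \<Rightarrow> nat \<Rightarrow> 'w \<Rightarrow> real" where
  "At K n \<omega> = Max ((\<lambda>(s, k). \<bar>T_stat Y n k s \<omega>\<bar> / g (real k / real n)) ` spairs K n)"

text \<open>The factor \<open>1 / g 1 + 1\<close> lets one bound serve both the weighted maximum,
  where \<open>1 / g 1\<close> appears, and the normaliser, where 1 does.\<close>

definition err :: "nat \<Rightarrow> nat \<Rightarrow> 'w \<Rightarrow> real" where
  "err K n \<omega> = 2 * (1 / g 1 + 1) * (Smax 0 (K * n) \<omega>)\<^sup>2 / (real n * sqrt (real n))"

lemma measurable_At [measurable]: "At K n \<in> borel_measurable M"
  unfolding At_def[abs_def] case_prod_beta by (intro borel_measurable_Max finite_spairs) measurable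

lemma spairs_nonempty: "2 \<le> K \<Longrightarrow> 2 < n \<Longrightarrow> spairs K n \<noteq> {}"
proof -
  assume a: "2 \<le> K" "2 < n"
  then have "2 * n \<le> K * n" by (intro mult_right_mono) auto
  then have "n + 2 < K * n" using a by linarith
  then have "(n + 1, n + 2) \<in> spairs K n" unfolding spairs_def by simp
  then show ?thesis by blast
qed

lemma At_approx:
  assumes \<omega>: "\<omega> \<in> space M" and K: "2 \<le> K" and n: "2 < n"
  shows "\<bar>At K n \<omega> / \<sigma> - An K n (x n \<omega>)\<bar> \<le> err K n \<omega> / \<sigma>"
proof -
  have "\<bar>Max ((\<lambda>(s, k). \<bar>T_stat Y n k s \<omega>\<bar> / g (real k / real n)) ` spairs K n)
      - Max ((\<lambda>p. \<sigma> * Fterm g n (x n \<omega>) p) ` spairs K n)\<bar> \<le> err K n \<omega>"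
  proof (rule Max_image_close[OF finite_spairs spairs_nonempty[OF K n]])
    fix p assume "p \<in> spairs K n"
    then obtain s k where p: "p = (s, k)" "n + 1 \<le> s" "s < k" "k < K * n" by (auto simp: spairs_def)
    have g1: "1 \<le> real k / real n" using p n by simp
    let ?u = "x n \<omega> s - real s / real k * x n \<omega> k"
    have "\<bar>\<bar>T_stat Y n k s \<omega>\<bar> / g (real k / real n) - \<sigma> * (\<bar>?u\<bar> / g (real k / real n))\<bar>
        = \<bar>\<bar>T_stat Y n k s \<omega>\<bar> - \<bar>\<sigma> * ?u\<bar>\<bar> / g (real k / real n)"
      using g_pos[OF g1] \<sigma>_pos by (simp add: abs_mult diff_divide_distrib[symmetric])
    also have "\<dots> \<le> \<bar>\<bar>T_stat Y n k s \<omega>\<bar> - \<bar>\<sigma> * ?u\<bar>\<bar> / g 1" by (intro divide_g_le g1) simp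
    also have "\<dots> \<le> (2 * (Smax 0 k \<omega>)\<^sup>2 / (real k * sqrt (real n))) / g 1"
      using T_stat_approx[OF \<omega>, of k s n] p g_pos[of 1] by (intro divide_right_mono order_trans[OF abs_triangle_ineq3]) auto
    also have "\<dots> \<le> (2 * (Smax 0 (K * n) \<omega>)\<^sup>2 / (real n * sqrt (real n))) / g 1"
      using p n g_pos[of 1] Smax_mono[of k "K * n" 0 \<omega>] Smax_nonneg[of 0 k \<omega>]
      by (intro divide_right_mono frac_le mult_mono power_mono) auto
    also have "\<dots> = 1 / g 1 * (2 * (Smax 0 (K * n) \<omega>)\<^sup>2 / (real n * sqrt (real n)))" by simp
    also have "\<dots> \<le> (1 / g 1 + 1) * (2 * (Smax 0 (K * n) \<omega>)\<^sup>2 / (real n * sqrt (real n)))"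
      by (intro mult_right_mono) auto
    also have "\<dots> = err K n \<omega>" by (simp add: err_def)
    finally show "\<bar>(case p of (s, k) \<Rightarrow> \<bar>T_stat Y n k s \<omega>\<bar> / g (real k / real n)) - \<sigma> * Fterm g n (x n \<omega>) p\<bar> \<le> err K n \<omega>"
      by (simp only: p(1) Fterm_def case_prod_conv)
  qed
  moreover have "Max ((\<lambda>p. \<sigma> * Fterm g n (x n \<omega>) p) ` spairs K n) = \<sigma> * An K n (x n \<omega>)"
  proof -
    have "mono (\<lambda>v. \<sigma> * v)" using \<sigma>_pos by (intro monoI mult_left_mono) auto
    from mono_Max_commute[OF this, of "Fterm g n (x n \<omega>) ` spairs K n"]
    show ?thesis using spairs_nonempty[OF K n] finite_spairs by (simp add: An_def image_image)
  qed
  ultimately have "\<bar>At K n \<omega> - \<sigma> * An K n (x n \<omega>)\<bar> \<le> err K n \<omega>" by (simp add: At_def)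
  then have "\<bar>At K n \<omega> - \<sigma> * An K n (x n \<omega>)\<bar> / \<sigma> \<le> err K n \<omega> / \<sigma>" using \<sigma>_pos by (intro divide_right_mono) auto
  moreover have "At K n \<omega> / \<sigma> - An K n (x n \<omega>) = (At K n \<omega> - \<sigma> * An K n (x n \<omega>)) / \<sigma>"
    using \<sigma>_pos by (simp add: field_simps)
  ultimately show ?thesis using \<sigma>_pos by simp
qed

lemma W_approx:
  assumes \<omega>: "\<omega> \<in> space M" and K: "2 \<le> K" and n: "2 < n"
  shows "\<bar>sqrt (W_stat Y n \<omega>) / \<sigma> - wn n (x n \<omega>)\<bar> \<le> err K n \<omega> / \<sigma>"
proof -
  have nK: "n \<le> K * n" using K by simp
  have "\<bar>rms {..<n} (\<lambda>t. T_stat Y n n t \<omega>) - rms {..<n} (\<lambda>t. \<sigma> * (x n \<omega> t - real t / real n * x n \<omega> n))\<bar> \<le> err K n \<omega>"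
  proof (rule rms_close)
    fix t assume "t \<in> {..<n}"
    then have "\<bar>T_stat Y n n t \<omega> - \<sigma> * (x n \<omega> t - real t / real n * x n \<omega> n)\<bar> \<le> 2 * (Smax 0 n \<omega>)\<^sup>2 / (real n * sqrt (real n))"
      using n by (intro T_stat_approx[OF \<omega>]) auto
    also have "\<dots> \<le> 1 * (2 * (Smax 0 (K * n) \<omega>)\<^sup>2 / (real n * sqrt (real n)))"
      using n Smax_mono[OF nK, of 0 \<omega>] Smax_nonneg[of 0 n \<omega>]
      unfolding mult_1 by (intro divide_right_mono mult_left_mono power_mono) auto
    also have "\<dots> \<le> (1 / g 1 + 1) * (2 * (Smax 0 (K * n) \<omega>)\<^sup>2 / (real n * sqrt (real n)))"
      using g_pos[of 1] by (intro mult_right_mono) auto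
    also have "\<dots> = err K n \<omega>" by (simp add: err_def)
    finally show "\<bar>T_stat Y n n t \<omega> - \<sigma> * (x n \<omega> t - real t / real n * x n \<omega> n)\<bar> \<le> err K n \<omega>" .
  qed (use g_pos[of 1] in \<open>auto simp: err_def\<close>)
  moreover have "rms {..<n} (\<lambda>t. \<sigma> * (x n \<omega> t - real t / real n * x n \<omega> n)) = \<sigma> * wn n (x n \<omega>)"
    unfolding wn_def using \<sigma>_pos by (intro rms_cmult) simp
  moreover have "sqrt (W_stat Y n \<omega>) = rms {..<n} (\<lambda>t. T_stat Y n n t \<omega>)" using n by (intro W_stat_eq) simp
  ultimately have "\<bar>sqrt (W_stat Y n \<omega>) - \<sigma> * wn n (x n \<omega>)\<bar> \<le> err K n \<omega>" by simp
  then have "\<bar>sqrt (W_stat Y n \<omega>) - \<sigma> * wn n (x n \<omega>)\<bar> / \<sigma> \<le> err K n \<omega> / \<sigma>" using \<sigma>_pos by (intro divide_right_mono) auto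
  moreover have "sqrt (W_stat Y n \<omega>) / \<sigma> - wn n (x n \<omega>) = (sqrt (W_stat Y n \<omega>) - \<sigma> * wn n (x n \<omega>)) / \<sigma>"
    using \<sigma>_pos by (simp add: field_simps)
  ultimately show ?thesis using \<sigma>_pos by simp
qed

lemma integrable_err [simp]: "integrable M (err K n)"
  unfolding err_def[abs_def] by simp

lemma expectation_err_tendsto_0: "(\<lambda>n. expectation (err K n)) \<longlonglongrightarrow> 0"
proof -
  obtain C :: real where C: "C > 0" "\<And>a n. expectation (\<lambda>\<omega>. Smax a n \<omega> ^ 2) \<le> C * real n"
    by (rule moments_Smax) (rule that)
  define c where "c = 2 * (1 / g 1 + 1)"
  have c0: "c \<ge> 0" using g_pos[of 1] by (simp add: c_def)
  have E: "expectation (err K n) = c * expectation (\<lambda>\<omega>. Smax 0 (K * n) \<omega> ^ 2) / (real n * sqrt (real n))" for n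
    by (simp add: err_def[abs_def] c_def)
  show ?thesis
  proof (rule tendsto_sandwich[OF _ _ tendsto_const])
    show "(\<lambda>n. c * C * real K * (1 / sqrt (real n))) \<longlonglongrightarrow> 0"
      using tendsto_mult[OF tendsto_const inverse_sqrt_tendsto_0, of "c * C * real K"] by simp
    show "\<forall>\<^sub>F n in sequentially. 0 \<le> expectation (err K n)" unfolding E using c0 by (intro always_eventually allI) simp
    show "\<forall>\<^sub>F n in sequentially. expectation (err K n) \<le> c * C * real K * (1 / sqrt (real n))"
    proof (rule eventually_sequentiallyI[of 1])
      fix n :: nat assume n: "1 \<le> n"
      have "expectation (err K n) \<le> c * (C * real (K * n)) / (real n * sqrt (real n))"
        unfolding E using c0 C(2)[of 0 "K * n"] by (intro divide_right_mono mult_left_mono) auto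
      also have "\<dots> = c * C * real K * (1 / sqrt (real n))" using n by simp
      finally show "expectation (err K n) \<le> c * C * real K * (1 / sqrt (real n))" .
    qed
  qed
qed

lemma stat_limit:
  assumes \<Theta>: "uc2 \<Theta>" "\<And>a w. \<bar>\<Theta> a w\<bar> \<le> 1" and K: "2 \<le> K"
  shows "(\<lambda>n. expectation (\<lambda>\<omega>. \<Theta> (At K n \<omega> / \<sigma>) (sqrt (W_stat Y n \<omega>) / \<sigma>)))
    \<longlonglongrightarrow> N.expectation (\<lambda>\<omega>. \<Theta> (Fsup (\<lambda>t. B t \<omega>) K) (Vroot (\<lambda>t. B t \<omega>)))"
proof (rule tendstoI)
  fix \<epsilon> :: real assume \<epsilon>: "\<epsilon> > 0"
  obtain \<delta> where \<delta>: "\<delta> > 0" "\<And>a b w z. \<bar>a - b\<bar> < \<delta> \<Longrightarrow> \<bar>w - z\<bar> < \<delta> \<Longrightarrow> \<bar>\<Theta> a w - \<Theta> b z\<bar> < \<epsilon> / 4"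
    using uc2D[OF \<Theta>(1), of "\<epsilon> / 4"] \<epsilon> by (metis zero_less_divide_iff zero_less_numeral)
  have "(\<lambda>n. 2 / (\<sigma> * \<delta>) * expectation (err K n)) \<longlonglongrightarrow> 2 / (\<sigma> * \<delta>) * 0"
    by (intro tendsto_mult tendsto_const expectation_err_tendsto_0)
  then have "\<forall>\<^sub>F n in sequentially. 2 / (\<sigma> * \<delta>) * expectation (err K n) < \<epsilon> / 4" using \<epsilon> by (intro order_tendstoD) auto
  moreover have "\<forall>\<^sub>F n in sequentially. dist (expectation (\<lambda>\<omega>. \<Theta> (An K n (x n \<omega>)) (wn n (x n \<omega>))))
    (N.expectation (\<lambda>\<omega>. \<Theta> (Fsup (\<lambda>t. B t \<omega>) K) (Vroot (\<lambda>t. B t \<omega>)))) < \<epsilon> / 4"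
    using \<epsilon> by (intro tendstoD[OF An_limit[OF \<Theta> K]]) simp
  ultimately show "\<forall>\<^sub>F n in sequentially. dist (expectation (\<lambda>\<omega>. \<Theta> (At K n \<omega> / \<sigma>) (sqrt (W_stat Y n \<omega>) / \<sigma>)))
    (N.expectation (\<lambda>\<omega>. \<Theta> (Fsup (\<lambda>t. B t \<omega>) K) (Vroot (\<lambda>t. B t \<omega>)))) < \<epsilon>"
    using eventually_gt_at_top[of 2]
  proof eventually_elim
    case (elim n)
    let ?T = "\<lambda>\<omega>. \<Theta> (At K n \<omega> / \<sigma>) (sqrt (W_stat Y n \<omega>) / \<sigma>)" and ?A = "\<lambda>\<omega>. \<Theta> (An K n (x n \<omega>)) (wn n (x n \<omega>))"
    have pt: "\<bar>?T \<omega> - ?A \<omega>\<bar> \<le> \<epsilon> / 4 + 2 / (\<sigma> * \<delta>) * err K n \<omega>" if \<omega>: "\<omega> \<in> space M" for \<omega>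
    proof (cases "err K n \<omega> / \<sigma> < \<delta>")
      case True
      have "\<bar>?T \<omega> - ?A \<omega>\<bar> < \<epsilon> / 4"
        using At_approx[OF \<omega> K elim(3)] W_approx[OF \<omega> K elim(3)] True by (intro \<delta>(2)) auto
      moreover have "err K n \<omega> \<ge> 0" using g_pos[of 1] by (simp add: err_def)
      then have "2 / (\<sigma> * \<delta>) * err K n \<omega> \<ge> 0" using \<sigma>_pos \<delta>(1) by simp
      ultimately show ?thesis by linarith
    next
      \<comment> \<open>Where the approximation fails, the trivial bound 2 is dominated by
        \<open>2 * err / (\<sigma> * \<delta>)\<close>; this is Markov's inequality carried out
        under the expectation.\<close>
      case False
      then have "1 \<le> err K n \<omega> / (\<sigma> * \<delta>)" using \<sigma>_pos \<delta>(1) by (simp add: field_simps)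
      moreover have "\<bar>?T \<omega> - ?A \<omega>\<bar> \<le> 2"
        using \<Theta>(2)[of "At K n \<omega> / \<sigma>" "sqrt (W_stat Y n \<omega>) / \<sigma>"] \<Theta>(2)[of "An K n (x n \<omega>)" "wn n (x n \<omega>)"] by linarith
      ultimately show ?thesis using \<epsilon> by simp
    qed
    have "?T \<in> borel_measurable M" by (rule measurable_uc2[OF \<Theta>(1)]) measurable
    then have iT: "integrable M ?T" by (rule integrable_bounded[OF _ \<Theta>(2)])
    have "?A \<in> borel_measurable M" by (rule measurable_uc2[OF \<Theta>(1)]) measurable
    then have iA: "integrable M ?A" by (rule integrable_bounded[OF _ \<Theta>(2)])
    have "\<bar>expectation ?T - expectation ?A\<bar> = \<bar>expectation (\<lambda>\<omega>. ?T \<omega> - ?A \<omega>)\<bar>" using iT iA by simp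
    also have "\<dots> \<le> expectation (\<lambda>\<omega>. \<bar>?T \<omega> - ?A \<omega>\<bar>)" by (rule integral_abs_bound)
    also have "\<dots> \<le> expectation (\<lambda>\<omega>. \<epsilon> / 4 + 2 / (\<sigma> * \<delta>) * err K n \<omega>)"
      using iT iA pt by (intro integral_mono) auto
    also have "\<dots> = \<epsilon> / 4 + 2 / (\<sigma> * \<delta>) * expectation (err K n)" by (simp add: prob_space)
    finally show ?case using elim \<epsilon> unfolding dist_real_def by linarith
  qed
qed

text \<open>Failure in the block of indices from \<open>K * 2 ^ l * n\<close> to
  \<open>K * 2 ^ Suc l * n\<close>: the maximum up to the right end is compared with
  \<open>g\<close> at the left end, where \<open>g\<close> is smallest in the block.\<close>

definition bad :: "nat \<Rightarrow> nat \<Rightarrow> real \<Rightarrow> nat \<Rightarrow> 'w set" where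
  "bad K n \<eta> l = {\<omega> \<in> space M. \<eta> * sqrt (real n) * g (2 ^ l * real K) < 2 * \<kappa>Y * Smax 0 (K * 2 ^ Suc l * n) \<omega>}"

lemma bad_sets [measurable]: "bad K n \<eta> l \<in> sets M"
  unfolding bad_def by measurable

text \<open>Chebyshev's inequality for each block. The factor \<open>n\<close> cancels between the
  second moment and the squared threshold, and what remains is a multiple of one term of the series
  in the weight assumption. The union bound is stated in \<open>ennreal\<close>, where the series
  always has a value.\<close>

lemma prob_bad:
  obtains C :: real where "C > 0"
    "\<And>K n \<eta>. 1 \<le> K \<Longrightarrow> 0 < n \<Longrightarrow> 0 < \<eta> \<Longrightarrow>
      emeasure M (\<Union>l. bad K n \<eta> l) \<le> ennreal (C / \<eta>\<^sup>2) * (\<Sum>l. ennreal (2 ^ l * real K / (g (2 ^ l * real K))\<^sup>2))"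
proof -
  obtain C :: real where C: "C > 0" "\<And>a n. expectation (\<lambda>\<omega>. Smax a n \<omega> ^ 2) \<le> C * real n"
    by (rule moments_Smax) (rule that)
  define c where "c = 8 * \<kappa>Y\<^sup>2 * C + 1"
  have "emeasure M (\<Union>l. bad K n \<eta> l) \<le> ennreal (c / \<eta>\<^sup>2) * (\<Sum>l. ennreal (2 ^ l * real K / (g (2 ^ l * real K))\<^sup>2))"
    if K: "1 \<le> K" and n: "0 < n" and \<eta>: "0 < \<eta>" for K n \<eta>
  proof -
    have one: "emeasure M (bad K n \<eta> l) \<le> ennreal (c / \<eta>\<^sup>2) * ennreal (2 ^ l * real K / (g (2 ^ l * real K))\<^sup>2)" for l
    proof -
      let ?t = "\<eta> * sqrt (real n) * g (2 ^ l * real K)" and ?Y = "\<lambda>\<omega>. 2 * \<kappa>Y * Smax 0 (K * 2 ^ Suc l * n) \<omega>"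
      have "1 * 1 \<le> 2 ^ l * real K" using K by (intro mult_mono) auto
      then have gp: "0 < g (2 ^ l * real K)" by (intro g_pos) simp
      have t: "0 < ?t" using \<eta> n gp by simp
      have i: "integrable M (\<lambda>\<omega>. (?Y \<omega>)\<^sup>2)" unfolding power_mult_distrib by simp
      have "prob (bad K n \<eta> l) \<le> expectation (\<lambda>\<omega>. (?Y \<omega>)\<^sup>2) / ?t\<^sup>2"
        unfolding bad_def using t i by (intro prob_gt_le_second_moment) auto
      also have "expectation (\<lambda>\<omega>. (?Y \<omega>)\<^sup>2) = 4 * \<kappa>Y\<^sup>2 * expectation (\<lambda>\<omega>. Smax 0 (K * 2 ^ Suc l * n) \<omega> ^ 2)"
        unfolding power_mult_distrib by simp
      also have "4 * \<kappa>Y\<^sup>2 * expectation (\<lambda>\<omega>. Smax 0 (K * 2 ^ Suc l * n) \<omega> ^ 2) / ?t\<^sup>2 \<le> 4 * \<kappa>Y\<^sup>2 * (C * real (K * 2 ^ Suc l * n)) / ?t\<^sup>2"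
        by (intro divide_right_mono mult_left_mono C(2)) auto
      also have "\<dots> = 8 * \<kappa>Y\<^sup>2 * C / \<eta>\<^sup>2 * (2 ^ l * real K / (g (2 ^ l * real K))\<^sup>2)"
        using n \<eta> gp by (simp add: power_mult_distrib field_simps)
      also have "\<dots> \<le> c / \<eta>\<^sup>2 * (2 ^ l * real K / (g (2 ^ l * real K))\<^sup>2)"
        by (intro mult_right_mono divide_right_mono) (auto simp: c_def)
      finally have "emeasure M (bad K n \<eta> l) \<le> ennreal (c / \<eta>\<^sup>2 * (2 ^ l * real K / (g (2 ^ l * real K))\<^sup>2))"
        unfolding emeasure_eq_measure by (rule ennreal_leI)
      also have "\<dots> = ennreal (c / \<eta>\<^sup>2) * ennreal (2 ^ l * real K / (g (2 ^ l * real K))\<^sup>2)"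
        using C(1) by (intro ennreal_mult) (auto simp: c_def)
      finally show ?thesis .
    qed
    have "emeasure M (\<Union>l. bad K n \<eta> l) \<le> (\<Sum>l. emeasure M (bad K n \<eta> l))"
      by (rule emeasure_subadditive_countably) auto
    also have "\<dots> \<le> (\<Sum>l. ennreal (c / \<eta>\<^sup>2) * ennreal (2 ^ l * real K / (g (2 ^ l * real K))\<^sup>2))"
      by (intro suminf_le one) auto
    also have "\<dots> = ennreal (c / \<eta>\<^sup>2) * (\<Sum>l. ennreal (2 ^ l * real K / (g (2 ^ l * real K))\<^sup>2))" by (rule ennreal_suminf_cmult)
    finally show ?thesis .
  qed
  moreover have "c > 0" using C(1) by (auto simp: c_def intro!: add_nonneg_pos)
  ultimately show ?thesis by (intro that[of c])
qed

text \<open>The bound of \<open>prob_bad\<close> does not involve \<open>n\<close>, so a single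
  \<open>K\<close> serves every positive \<open>n\<close>.\<close>

lemma prob_bad_small:
  assumes \<eta>: "0 < \<eta>" and \<epsilon>: "0 < \<epsilon>"
  shows "\<forall>\<^sub>F K in sequentially. \<forall>n>0. prob (\<Union>l. bad K n \<eta> l) \<le> \<epsilon>"
proof -
  obtain C :: real where C: "C > 0" "\<And>K n \<eta>. 1 \<le> K \<Longrightarrow> 0 < n \<Longrightarrow> 0 < \<eta> \<Longrightarrow>
      emeasure M (\<Union>l. bad K n \<eta> l) \<le> ennreal (C / \<eta>\<^sup>2) * (\<Sum>l. ennreal (2 ^ l * real K / (g (2 ^ l * real K))\<^sup>2))"
    by (rule prob_bad) (rule that)
  have "((\<lambda>K. ennreal (C / \<eta>\<^sup>2) * (\<Sum>l. ennreal (2 ^ l * real K / (g (2 ^ l * real K))\<^sup>2))) \<longlongrightarrow> ennreal (C / \<eta>\<^sup>2) * 0) sequentially"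
    by (intro ennreal_tendsto_cmult filterlim_compose[OF g_sum filterlim_real_sequentially]) simp
  then have "\<forall>\<^sub>F K in sequentially. ennreal (C / \<eta>\<^sup>2) * (\<Sum>l. ennreal (2 ^ l * real K / (g (2 ^ l * real K))\<^sup>2)) < ennreal \<epsilon>"
    using \<epsilon> by (intro order_tendstoD) auto
  then show ?thesis using eventually_ge_at_top[of 1]
  proof eventually_elim
    case (elim K)
    show ?case
    proof (intro allI impI)
      fix n :: nat assume "0 < n"
      then have "emeasure M (\<Union>l. bad K n \<eta> l) \<le> ennreal \<epsilon>" using C(2)[OF elim(2) _ \<eta>, of n] elim(1) by (meson le_less_trans less_imp_le)
      then show "prob (\<Union>l. bad K n \<eta> l) \<le> \<epsilon>" using \<epsilon> unfolding emeasure_eq_measure by simp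
    qed
  qed
qed

text \<open>An index beyond the horizon lies in some dyadic block, found as the least
  \<open>l\<close> for which \<open>k\<close> is below the right end. Monotonicity of
  \<open>g\<close> then passes from the left end to \<open>k / n\<close>.\<close>

lemma tail_term_le:
  assumes \<omega>: "\<omega> \<in> space M" "\<omega> \<notin> (\<Union>l. bad K n \<eta> l)" and K: "1 \<le> K" and n: "0 < n"
    and k: "K * n \<le> k" "s \<le> k"
  shows "\<bar>T_stat Y n k s \<omega>\<bar> / g (real k / real n) \<le> \<eta>"
proof -
  have Kn: "0 < K * n" using K n by simp
  define l where "l = (LEAST l. k < K * 2 ^ Suc l * n)"
  have "k < 2 ^ k" by simp
  also have "\<dots> \<le> (K * n) * 2 ^ Suc k" using Kn by (simp add: Suc_le_eq trans_le_add1)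
  finally have "k < K * 2 ^ Suc k * n" by (simp only: mult_ac)
  then have l1: "k < K * 2 ^ Suc l * n" unfolding l_def by (rule LeastI)
  have l2: "K * 2 ^ l * n \<le> k"
  proof (cases l)
    case 0
    then show ?thesis using k(1) by simp
  next
    case (Suc l')
    then have "\<not> k < K * 2 ^ Suc l' * n" using not_less_Least[of l' "\<lambda>l. k < K * 2 ^ Suc l * n"] l_def by auto
    then show ?thesis using Suc by simp
  qed
  have "real (K * 2 ^ l * n) \<le> real k" using l2 by (rule of_nat_mono)
  then have kn: "2 ^ l * real K \<le> real k / real n" using n by (simp add: field_simps)
  have "1 * 1 \<le> 2 ^ l * real K" using K by (intro mult_mono) auto
  then have one: "1 \<le> 2 ^ l * real K" by simp
  have gk: "0 < g (2 ^ l * real K)" "g (2 ^ l * real K) \<le> g (real k / real n)"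
    using one kn by (auto intro: g_pos g_mono)
  have k0: "0 < k" using Kn k(1) by linarith
  have \<kappa>Y0: "0 \<le> \<kappa>Y" using \<kappa>_nonneg by (simp add: \<kappa>Y_def)
  have "\<bar>T_stat Y n k s \<omega>\<bar> \<le> 2 * \<kappa>Y * Smax 0 k \<omega> / sqrt (real n)" by (rule T_stat_bound[OF \<omega>(1) k0 k(2)])
  also have "\<dots> \<le> 2 * \<kappa>Y * Smax 0 (K * 2 ^ Suc l * n) \<omega> / sqrt (real n)"
    using l1 \<kappa>Y0 by (intro divide_right_mono mult_left_mono Smax_mono) auto
  also have "\<dots> \<le> (\<eta> * sqrt (real n) * g (2 ^ l * real K)) / sqrt (real n)"
  proof (intro divide_right_mono)
    have "\<omega> \<notin> bad K n \<eta> l" using \<omega>(2) by blast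
    then show "2 * \<kappa>Y * Smax 0 (K * 2 ^ Suc l * n) \<omega> \<le> \<eta> * sqrt (real n) * g (2 ^ l * real K)"
      using \<omega>(1) unfolding bad_def mem_Collect_eq by linarith
  qed simp
  also have "\<dots> = \<eta> * g (2 ^ l * real K)" using n by simp
  finally have T: "\<bar>T_stat Y n k s \<omega>\<bar> \<le> \<eta> * g (2 ^ l * real K)" .
  then have "0 \<le> \<eta> * g (2 ^ l * real K)" by linarith
  then have \<eta>0: "0 \<le> \<eta>" using gk(1) by (simp add: zero_le_mult_iff)
  have "\<bar>T_stat Y n k s \<omega>\<bar> \<le> \<eta> * g (real k / real n)" using T mult_left_mono[OF gk(2) \<eta>0] by linarith
  then show ?thesis using gk by (simp add: pos_divide_le_eq)
qed

text \<open>Restricting the supremum to \<open>k < K * n\<close> can only lower it, and outside the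
  bad events every discarded term is at most \<open>\<eta>\<close> before normalisation.\<close>

lemma open_end_stat_bounds:
  assumes \<omega>: "\<omega> \<in> space M" "\<omega> \<notin> (\<Union>l. bad K n \<eta> l)" and K: "2 \<le> K" and n: "2 < n" and \<eta>: "0 \<le> \<eta>"
    and W: "0 < W_stat Y n \<omega>"
  shows "ereal (At K n \<omega> / sqrt (W_stat Y n \<omega>)) \<le> open_end_stat g Y n \<omega>"
    and "open_end_stat g Y n \<omega> \<le> ereal (At K n \<omega> / sqrt (W_stat Y n \<omega>) + \<eta> / sqrt (W_stat Y n \<omega>))"
    and "0 \<le> At K n \<omega>"
proof -
  let ?w = "sqrt (W_stat Y n \<omega>)"
  have w: "0 < ?w" using W by simp
  have g1: "1 \<le> real k / real n" if "n + 2 \<le> k" for k using that n by simp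
  have G_in: "\<exists>s\<in>{n+1..k-1}. 1 / g (real k / real n) * G_stat Y n k \<omega> = (\<bar>T_stat Y n k s \<omega>\<bar> / g (real k / real n)) / ?w"
    if k: "n + 2 \<le> k" for k
  proof -
    have "G_stat Y n k \<omega> \<in> (\<lambda>s. \<bar>T_stat Y n k s \<omega>\<bar> / ?w) ` {n+1..k-1}"
      unfolding G_stat_def using k by (intro Max_in) auto
    then show ?thesis by (auto simp: mult.commute)
  qed
  have At_ge: "\<bar>T_stat Y n k s \<omega>\<bar> / g (real k / real n) \<le> At K n \<omega>" if "(s, k) \<in> spairs K n" for s k
    unfolding At_def using that finite_spairs by (intro Max_ge) (auto intro: rev_image_eqI)
  obtain s k where sk: "(s, k) \<in> spairs K n" "At K n \<omega> = \<bar>T_stat Y n k s \<omega>\<bar> / g (real k / real n)"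
  proof -
    have "At K n \<omega> \<in> (\<lambda>(s, k). \<bar>T_stat Y n k s \<omega>\<bar> / g (real k / real n)) ` spairs K n"
      unfolding At_def using spairs_nonempty[OF K n] finite_spairs by (intro Max_in) auto
    then show ?thesis using that by auto
  qed
  then have k: "n + 1 \<le> s" "s < k" "n + 2 \<le> k" by (auto simp: spairs_def)
  show A0: "0 \<le> At K n \<omega>" using sk(2) g_pos[OF g1[OF k(3)]] by simp
  have "\<bar>T_stat Y n k s \<omega>\<bar> / ?w \<le> G_stat Y n k \<omega>" unfolding G_stat_def using k by (intro Max_ge) auto
  then have "1 / g (real k / real n) * (\<bar>T_stat Y n k s \<omega>\<bar> / ?w) \<le> 1 / g (real k / real n) * G_stat Y n k \<omega>"
    using g_pos[OF g1[OF k(3)]] by (intro mult_left_mono) auto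
  then have "ereal (At K n \<omega> / ?w) \<le> ereal (1 / g (real k / real n) * G_stat Y n k \<omega>)" by (simp add: sk(2))
  also have "\<dots> \<le> open_end_stat g Y n \<omega>" unfolding open_end_stat_def using k by (intro SUP_upper) auto
  finally show "ereal (At K n \<omega> / ?w) \<le> open_end_stat g Y n \<omega>" .
  show "open_end_stat g Y n \<omega> \<le> ereal (At K n \<omega> / ?w + \<eta> / ?w)"
    unfolding open_end_stat_def
  proof (rule SUP_least)
    fix k assume "k \<in> {n+2..}"
    then have k: "n + 2 \<le> k" by simp
    obtain s where s: "s \<in> {n+1..k-1}" "1 / g (real k / real n) * G_stat Y n k \<omega> = (\<bar>T_stat Y n k s \<omega>\<bar> / g (real k / real n)) / ?w"
      using G_in[OF k] by blast
    have "\<bar>T_stat Y n k s \<omega>\<bar> / g (real k / real n) \<le> At K n \<omega> + \<eta>"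
    proof (cases "k < K * n")
      case True
      then have "(s, k) \<in> spairs K n" using s(1) k by (auto simp: spairs_def)
      then show ?thesis using At_ge[of s k] \<eta> by linarith
    next
      case False
      then have "\<bar>T_stat Y n k s \<omega>\<bar> / g (real k / real n) \<le> \<eta>" using s(1) K n by (intro tail_term_le[OF \<omega>]) auto
      then show ?thesis using A0 by linarith
    qed
    then have "(\<bar>T_stat Y n k s \<omega>\<bar> / g (real k / real n)) / ?w \<le> (At K n \<omega> + \<eta>) / ?w"
      using w by (intro divide_right_mono) auto
    then show "ereal (1 / g (real k / real n) * G_stat Y n k \<omega>) \<le> ereal (At K n \<omega> / ?w + \<eta> / ?w)"
      unfolding s(2) by (simp add: add_divide_distrib)
  qed
qed

end

section \<open>Convergence in distribution\<close>

text \<open>\<open>\<psi>\<close> has a limit at infinity, so it is nearly constant beyond some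
  \<open>T\<close>, and below \<open>T + 1\<close> compactness applies. The overlap of length 1,
  together with \<open>\<delta> \<le> 1\<close>, covers pairs that straddle the boundary.\<close>

lemma uniformly_continuous_ereal:
  fixes \<psi> :: "ereal \<Rightarrow> real"
  assumes \<psi>: "continuous_on UNIV \<psi>" and \<epsilon>: "\<epsilon> > 0"
  obtains \<delta> where "\<delta> > 0" "\<And>x y. 0 \<le> x \<Longrightarrow> 0 \<le> y \<Longrightarrow> \<bar>x - y\<bar> < \<delta> \<Longrightarrow> \<bar>\<psi> (ereal x) - \<psi> (ereal y)\<bar> < \<epsilon>"
proof -
  have "((\<lambda>x::real. ereal x) \<longlongrightarrow> \<infinity>) at_top"
    unfolding tendsto_PInfty_eq_at_top by (rule filterlim_ident)
  then have "((\<lambda>x::real. \<psi> (ereal x)) \<longlongrightarrow> \<psi> \<infinity>) at_top"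
    by (rule continuous_on_tendsto_compose[OF \<psi>]) auto
  from tendstoD[OF this, of "\<epsilon> / 2"] \<epsilon>
  obtain T where T: "\<And>x. x \<ge> T \<Longrightarrow> dist (\<psi> (ereal x)) (\<psi> \<infinity>) < \<epsilon> / 2"
    unfolding eventually_at_top_linorder by auto
  have "continuous_on {0..T + 1} (\<lambda>x. \<psi> (ereal x))"
    by (rule continuous_on_compose2[OF \<psi>]) (auto intro!: continuous_on_ereal continuous_on_id)
  then have "uniformly_continuous_on {0..T + 1} (\<lambda>x. \<psi> (ereal x))"
    by (rule compact_uniformly_continuous) (rule compact_Icc)
  then obtain d where d: "d > 0" "\<And>x y. x \<in> {0..T + 1} \<Longrightarrow> y \<in> {0..T + 1} \<Longrightarrow> dist y x < d \<Longrightarrow> dist (\<psi> (ereal y)) (\<psi> (ereal x)) < \<epsilon>"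
    using \<epsilon> unfolding uniformly_continuous_on_def by metis
  show ?thesis
  proof (rule that[of "min d 1"])
    show "min d 1 > 0" using d(1) by simp
    fix x y :: real assume xy: "0 \<le> x" "0 \<le> y" "\<bar>x - y\<bar> < min d 1"
    show "\<bar>\<psi> (ereal x) - \<psi> (ereal y)\<bar> < \<epsilon>"
    proof (cases "x \<le> T + 1 \<and> y \<le> T + 1")
      case True
      then have "dist (\<psi> (ereal y)) (\<psi> (ereal x)) < \<epsilon>" using xy by (intro d(2)) (auto simp: dist_real_def abs_minus_commute)
      then show ?thesis by (simp add: dist_real_def abs_minus_commute)
    next
      case False
      then have "x \<ge> T" "y \<ge> T" using xy(3) by auto
      from T[OF this(1)] T[OF this(2)] show ?thesis unfolding dist_real_def by argo
    qed
  qed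
qed

lemma uc2_lipschitz:
  assumes L: "\<And>a b w z. \<bar>\<Theta> a w - \<Theta> b z\<bar> \<le> L * (\<bar>a - b\<bar> + \<bar>w - z\<bar>)"
  shows "uc2 \<Theta>"
  unfolding uc2_def
proof (intro allI impI)
  fix \<epsilon> :: real assume \<epsilon>: "\<epsilon> > 0"
  define c where "c = \<bar>L\<bar> + 1"
  have c: "c > 0" "L \<le> c" by (auto simp: c_def)
  define \<delta> where "\<delta> = \<epsilon> / (2 * c)"
  have \<delta>: "\<delta> > 0" using \<epsilon> c by (simp add: \<delta>_def)
  have "\<bar>\<Theta> a w - \<Theta> b z\<bar> < \<epsilon>" if "\<bar>a - b\<bar> < \<delta>" "\<bar>w - z\<bar> < \<delta>" for a b w z
  proof -
    have "\<bar>\<Theta> a w - \<Theta> b z\<bar> \<le> c * (\<bar>a - b\<bar> + \<bar>w - z\<bar>)"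
      by (rule order_trans[OF L]) (use c in \<open>intro mult_right_mono, auto\<close>)
    also have "\<dots> < c * (2 * \<delta>)" using that c by (intro mult_strict_left_mono) auto
    also have "\<dots> = \<epsilon>" using c by (simp add: \<delta>_def)
    finally show ?thesis .
  qed
  then show "\<exists>\<delta>>0. \<forall>a b w z. \<bar>a - b\<bar> < \<delta> \<longrightarrow> \<bar>w - z\<bar> < \<delta> \<longrightarrow> \<bar>\<Theta> a w - \<Theta> b z\<bar> < \<epsilon>" using \<delta> by blast
qed

text \<open>A Lipschitz substitute for \<open>a / w\<close>, equal to it when
  \<open>0 \<le> a \<le> j\<close> and \<open>1 / j \<le> w\<close>.\<close>

definition clipq :: "real \<Rightarrow> real \<Rightarrow> real \<Rightarrow> real" where
  "clipq j a w = min (max a 0) j / max w (1 / j)"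

lemma clipq_nonneg: "1 \<le> j \<Longrightarrow> 0 \<le> clipq j a w"
proof -
  assume j: "1 \<le> j"
  then have "0 \<le> 1 / j" by simp
  then show ?thesis using j unfolding clipq_def by (intro divide_nonneg_nonneg) (auto simp: le_max_iff_disj)
qed

text \<open>In the decomposed difference of quotients the numerator and each of the two reciprocals
  are at most \<open>j\<close>; the worst product is \<open>j^3\<close>.\<close>

lemma clipq_lipschitz:
  assumes j: "1 \<le> j"
  shows "\<bar>clipq j a w - clipq j b z\<bar> \<le> j ^ 3 * (\<bar>a - b\<bar> + \<bar>w - z\<bar>)"
proof -
  define u u' v v' where "u = min (max a 0) j" and "u' = min (max b 0) j" and "v = max w (1 / j)" and "v' = max z (1 / j)"
  have u: "\<bar>u - u'\<bar> \<le> \<bar>a - b\<bar>" "0 \<le> u'" "u' \<le> j" using j by (auto simp: u_def u'_def)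
  have v: "\<bar>v' - v\<bar> \<le> \<bar>w - z\<bar>" by (auto simp: v_def v'_def)
  have jp: "0 < 1 / j" using j by simp
  have vp: "1 / j \<le> v" "1 / j \<le> v'" "0 < v" "0 < v'" using less_le_trans[OF jp] by (auto simp: v_def v'_def)
  have iv: "1 / v \<le> j" "1 / v' \<le> j" using vp j by (simp_all add: field_simps)
  have "u / v - u' / v' = (u - u') * (1 / v) + u' * ((v' - v) * (1 / v * (1 / v')))"
    using vp by (simp add: field_simps)
  then have "\<bar>u / v - u' / v'\<bar> \<le> \<bar>(u - u') * (1 / v)\<bar> + \<bar>u' * ((v' - v) * (1 / v * (1 / v')))\<bar>"
    by (simp only: abs_triangle_ineq)
  also have "\<dots> = \<bar>u - u'\<bar> * (1 / v) + u' * (\<bar>v' - v\<bar> * (1 / v * (1 / v')))"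
    using vp u by (simp add: abs_mult)
  also have "\<dots> \<le> \<bar>a - b\<bar> * j + j * (\<bar>w - z\<bar> * (j * j))"
    using u v iv vp j by (intro add_mono mult_mono) auto
  also have "\<dots> \<le> j ^ 3 * \<bar>a - b\<bar> + j ^ 3 * \<bar>w - z\<bar>"
  proof (rule add_mono)
    have "j ^ 1 \<le> j ^ 3" using j by (intro power_increasing) auto
    then show "\<bar>a - b\<bar> * j \<le> j ^ 3 * \<bar>a - b\<bar>" using mult_right_mono[of j "j ^ 3" "\<bar>a - b\<bar>"] by (simp add: mult.commute)
    show "j * (\<bar>w - z\<bar> * (j * j)) \<le> j ^ 3 * \<bar>w - z\<bar>" by (simp add: power3_eq_cube)
  qed
  finally show ?thesis by (simp add: clipq_def u_def u'_def v_def v'_def algebra_simps)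
qed

text \<open>A continuous indicator of small normalisers: for \<open>1 \<le> j\<close> it is 1 up to
  \<open>1 / j\<close> and 0 from \<open>2 / j\<close> on.\<close>

definition small :: "real \<Rightarrow> real \<Rightarrow> real" where
  "small j w = 1 - ramp (1 / j) (1 / j) w"

lemma small_bounds: "0 \<le> small j w" "small j w \<le> 1"
  using ramp_bounds[of "1 / j" "1 / j" w] by (auto simp: small_def)

lemma small_eq_1: "1 \<le> j \<Longrightarrow> w \<le> 1 / j \<Longrightarrow> small j w = 1"
proof -
  assume a: "1 \<le> j" "w \<le> 1 / j"
  have "(w - 1 / j) / (1 / j) \<le> 0" using a by (intro divide_nonpos_nonneg) auto
  then show ?thesis by (simp add: small_def ramp_def)
qed

lemma small_eq_0: "1 \<le> j \<Longrightarrow> 2 / j \<le> w \<Longrightarrow> small j w = 0"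
proof -
  assume a: "1 \<le> j" "2 / j \<le> w"
  have "1 \<le> (w - 1 / j) / (1 / j)" using a by (simp add: field_simps)
  then show ?thesis by (simp add: small_def ramp_def)
qed

lemma small_lipschitz: "1 \<le> j \<Longrightarrow> \<bar>small j w - small j z\<bar> \<le> j * \<bar>w - z\<bar>"
  using ramp_lipschitz[of "1 / j" "1 / j" w z] by (simp add: small_def)

text \<open>Halving keeps the sum of two continuous indicators at most 1. The value is at least 1/2
  wherever \<open>clipq\<close> alters a nonnegative numerator or the denominator, which explains
  the factor 4 in \<open>clipq_cutoff\<close>.\<close>

definition cutoff :: "real \<Rightarrow> real \<Rightarrow> real \<Rightarrow> real" where
  "cutoff j a w = (small j w + ramp (j - 1) 1 a) / 2"

lemma cutoff_bounds: "0 \<le> cutoff j a w" "cutoff j a w \<le> 1"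
  using small_bounds[of j w] ramp_bounds[of "j - 1" 1 a] by (auto simp: cutoff_def)

lemma uc2_cutoff: "1 \<le> j \<Longrightarrow> uc2 (cutoff j)"
proof (rule uc2_lipschitz)
  fix a b w z :: real assume j: "1 \<le> j"
  have "\<bar>cutoff j a w - cutoff j b z\<bar> \<le> \<bar>small j w - small j z\<bar> + \<bar>ramp (j - 1) 1 a - ramp (j - 1) 1 b\<bar>"
  proof -
    have "cutoff j a w - cutoff j b z = ((small j w - small j z) + (ramp (j - 1) 1 a - ramp (j - 1) 1 b)) / 2"
      by (simp add: cutoff_def field_simps)
    then show ?thesis
      using abs_triangle_ineq[of "small j w - small j z" "ramp (j - 1) 1 a - ramp (j - 1) 1 b"] by simp
  qed
  also have "\<dots> \<le> j * \<bar>w - z\<bar> + 1 * \<bar>a - b\<bar>"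
    using small_lipschitz[OF j, of w z] ramp_lipschitz[of 1 "j - 1" a b] by simp
  also have "\<dots> \<le> j * \<bar>w - z\<bar> + j * \<bar>a - b\<bar>" using j by (intro add_left_mono mult_right_mono) auto
  finally show "\<bar>cutoff j a w - cutoff j b z\<bar> \<le> j * (\<bar>a - b\<bar> + \<bar>w - z\<bar>)" by (simp add: algebra_simps)
qed

lemma uc2_small: "1 \<le> j \<Longrightarrow> uc2 (\<lambda>a w. small j w)"
proof (rule uc2_lipschitz)
  fix a b w z :: real assume j: "1 \<le> j"
  show "\<bar>small j w - small j z\<bar> \<le> j * (\<bar>a - b\<bar> + \<bar>w - z\<bar>)"
    using small_lipschitz[OF j, of w z] j by (simp add: distrib_left add_increasing)
qed

lemma uc2_clipq:
  assumes \<psi>: "continuous_on UNIV (\<psi> :: ereal \<Rightarrow> real)" and j: "1 \<le> j"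
  shows "uc2 (\<lambda>a w. \<psi> (ereal (clipq j a w)))"
  unfolding uc2_def
proof (intro allI impI)
  fix \<epsilon> :: real assume "\<epsilon> > 0"
  then obtain \<delta> where \<delta>: "\<delta> > 0" "\<And>x y. 0 \<le> x \<Longrightarrow> 0 \<le> y \<Longrightarrow> \<bar>x - y\<bar> < \<delta> \<Longrightarrow> \<bar>\<psi> (ereal x) - \<psi> (ereal y)\<bar> < \<epsilon>"
    using uniformly_continuous_ereal[OF \<psi>] by metis
  have "uc2 (clipq j)" by (rule uc2_lipschitz) (rule clipq_lipschitz[OF j])
  then obtain \<delta>' where \<delta>': "\<delta>' > 0" "\<And>a b w z. \<bar>a - b\<bar> < \<delta>' \<Longrightarrow> \<bar>w - z\<bar> < \<delta>' \<Longrightarrow> \<bar>clipq j a w - clipq j b z\<bar> < \<delta>"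
    using uc2D[OF _ \<delta>(1)] by metis
  then show "\<exists>\<delta>>0. \<forall>a b w z. \<bar>a - b\<bar> < \<delta> \<longrightarrow> \<bar>w - z\<bar> < \<delta> \<longrightarrow> \<bar>\<psi> (ereal (clipq j a w)) - \<psi> (ereal (clipq j b z))\<bar> < \<epsilon>"
    using \<delta>(2) clipq_nonneg[OF j] by blast
qed

lemma clipq_cutoff:
  fixes \<psi> :: "ereal \<Rightarrow> real"
  assumes \<psi>1: "\<And>y. \<bar>\<psi> y\<bar> \<le> 1" and j: "1 \<le> j" and a: "0 \<le> a"
  shows "\<bar>\<psi> (ereal (a / w)) - \<psi> (ereal (clipq j a w))\<bar> \<le> 4 * cutoff j a w"
proof (cases "a \<le> j \<and> 1 / j \<le> w")
  case True
  then have "clipq j a w = a / w" using a by (simp add: clipq_def)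
  then show ?thesis using cutoff_bounds(1)[of j a w] by simp
next
  case False
  have two: "\<bar>\<psi> (ereal (a / w)) - \<psi> (ereal (clipq j a w))\<bar> \<le> 2"
    using \<psi>1[of "ereal (a / w)"] \<psi>1[of "ereal (clipq j a w)"] by linarith
  have "2 \<le> 4 * cutoff j a w"
  proof (cases "w \<le> 1 / j")
    case True
    then show ?thesis using small_eq_1[OF j True] ramp_bounds[of "j - 1" 1 a] by (simp add: cutoff_def)
  next
    case w: False
    then have "j < a" using False by linarith
    then have "ramp (j - 1) 1 a = 1" by (simp add: ramp_def)
    then show ?thesis using small_bounds[of j w] by (simp add: cutoff_def)
  qed
  then show ?thesis using two by linarith
qed

section \<open>Passage to the quotient and to the open end\<close>

context monitoring_stat
begin

lemma At_nonneg:
  assumes "2 \<le> K" "2 < n"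
  shows "0 \<le> At K n \<omega>"
proof -
  obtain p where p: "p \<in> spairs K n" using spairs_nonempty[OF assms] by blast
  then obtain s k where sk: "p = (s, k)" "n \<le> k" by (auto simp: spairs_def)
  have "1 \<le> real k / real n" using sk assms by simp
  then have "0 \<le> (\<lambda>(s, k). \<bar>T_stat Y n k s \<omega>\<bar> / g (real k / real n)) p" using g_pos[of "real k / real n"] by (simp add: sk)
  also have "\<dots> \<le> At K n \<omega>" unfolding At_def using p finite_spairs by (intro Max_ge imageI) auto
  finally show ?thesis .
qed

text \<open>On a bounded horizon the supremum is finite and the normaliser almost surely positive,
  so on almost every path the cutoff is 0 from some \<open>j\<close> on.\<close>

lemma cutoff_tendsto_0:
  assumes K: "2 \<le> K"
  shows "(\<lambda>j. N.expectation (\<lambda>\<omega>. cutoff (real (Suc j)) (Fsup (\<lambda>t. B t \<omega>) K) (Vroot (\<lambda>t. B t \<omega>)))) \<longlonglongrightarrow> 0"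
proof -
  have "(\<lambda>j. N.expectation (\<lambda>\<omega>. cutoff (real (Suc j)) (Fsup (\<lambda>t. B t \<omega>) K) (Vroot (\<lambda>t. B t \<omega>)))) \<longlonglongrightarrow> N.expectation (\<lambda>\<omega>. 0)"
  proof (rule integral_dominated_convergence[where w="\<lambda>_. 1"])
    show "(\<lambda>\<omega>. cutoff (real (Suc j)) (Fsup (\<lambda>t. B t \<omega>) K) (Vroot (\<lambda>t. B t \<omega>))) \<in> borel_measurable N" for j
      using K by (intro measurable_uc2[OF uc2_cutoff] measurable_Fsup measurable_Vroot) auto
    show "AE \<omega> in N. (\<lambda>j. cutoff (real (Suc j)) (Fsup (\<lambda>t. B t \<omega>) K) (Vroot (\<lambda>t. B t \<omega>))) \<longlonglongrightarrow> 0"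
      using AE_Vroot_pos
    proof (eventually_elim)
      case (elim \<omega>)
      let ?a = "Fsup (\<lambda>t. B t \<omega>) K" and ?w = "Vroot (\<lambda>t. B t \<omega>)"
      obtain k where k: "max (2 / ?w) ?a \<le> real k" using real_arch_simple by blast
      have "cutoff (real (Suc j)) ?a ?w = 0" if "j \<ge> k" for j
      proof -
        have "2 / ?w \<le> real (Suc j)" "?a \<le> real j" using k that by auto
        then have "2 / real (Suc j) \<le> ?w" using elim by (simp add: field_simps)
        then have "small (real (Suc j)) ?w = 0" by (intro small_eq_0) auto
        moreover have "ramp (real (Suc j) - 1) 1 ?a = 0" using \<open>?a \<le> real j\<close> by (simp add: ramp_def)
        ultimately show ?thesis by (simp only: cutoff_def) simp
      qed
      then show ?case by (intro tendsto_eventually eventually_sequentiallyI[of k])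
    qed
  qed (use cutoff_bounds in \<open>auto simp: abs_of_nonneg\<close>)
  then show ?thesis by simp
qed

text \<open>A continuous mapping argument for a quotient that is singular at 0. At a fixed level
  \<open>j\<close> both the clipped quotient and the cutoff are admissible test functions, and the
  cutoff bounds the clipping error for the statistic as well as for the limit.\<close>

lemma ratio_limit:
  fixes \<psi> :: "ereal \<Rightarrow> real"
  assumes \<psi>: "continuous_on UNIV \<psi>" "\<And>y. \<bar>\<psi> y\<bar> \<le> 1" and K: "2 \<le> K"
  shows "(\<lambda>n. expectation (\<lambda>\<omega>. \<psi> (ereal (At K n \<omega> / sqrt (W_stat Y n \<omega>)))))
    \<longlonglongrightarrow> N.expectation (\<lambda>\<omega>. \<psi> (ereal (Fsup (\<lambda>t. B t \<omega>) K / Vroot (\<lambda>t. B t \<omega>))))"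
proof (rule tendstoI)
  fix \<epsilon> :: real assume \<epsilon>: "\<epsilon> > 0"
  have [measurable]: "\<psi> \<in> borel_measurable borel" by (rule borel_measurable_continuous_onI[OF \<psi>(1)])
  let ?a = "\<lambda>n \<omega>. At K n \<omega> / \<sigma>" and ?w = "\<lambda>n \<omega>. sqrt (W_stat Y n \<omega>) / \<sigma>"
  let ?A = "\<lambda>\<omega>. Fsup (\<lambda>t. B t \<omega>) K" and ?V = "\<lambda>\<omega>. Vroot (\<lambda>t. B t \<omega>)"
  have "\<forall>\<^sub>F j in sequentially. N.expectation (\<lambda>\<omega>. cutoff (real (Suc j)) (?A \<omega>) (?V \<omega>)) < \<epsilon> / 20"
    using \<epsilon> by (intro order_tendstoD[OF cutoff_tendsto_0[OF K]]) simp
  then obtain j' where j': "N.expectation (\<lambda>\<omega>. cutoff (real (Suc j')) (?A \<omega>) (?V \<omega>)) < \<epsilon> / 20"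
    by (auto dest: eventually_happens)
  define j where "j = real (Suc j')"
  have j: "1 \<le> j" "N.expectation (\<lambda>\<omega>. cutoff j (?A \<omega>) (?V \<omega>)) < \<epsilon> / 20" using j' by (auto simp: j_def)
  have c1: "\<bar>cutoff j a w\<bar> \<le> 1" for a w using cutoff_bounds[of j a w] by simp
  have "\<forall>\<^sub>F n in sequentially. dist (expectation (\<lambda>\<omega>. cutoff j (?a n \<omega>) (?w n \<omega>))) (N.expectation (\<lambda>\<omega>. cutoff j (?A \<omega>) (?V \<omega>))) < \<epsilon> / 20"
    using \<epsilon> by (intro tendstoD[OF stat_limit[OF uc2_cutoff[OF j(1)] c1 K]]) simp
  moreover have "\<forall>\<^sub>F n in sequentially. dist (expectation (\<lambda>\<omega>. \<psi> (ereal (clipq j (?a n \<omega>) (?w n \<omega>))))) (N.expectation (\<lambda>\<omega>. \<psi> (ereal (clipq j (?A \<omega>) (?V \<omega>))))) < \<epsilon> / 20"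
    using \<epsilon> by (intro tendstoD[OF stat_limit[OF uc2_clipq[OF \<psi>(1) j(1)] \<psi>(2) K]]) simp
  ultimately show "\<forall>\<^sub>F n in sequentially. dist (expectation (\<lambda>\<omega>. \<psi> (ereal (At K n \<omega> / sqrt (W_stat Y n \<omega>)))))
     (N.expectation (\<lambda>\<omega>. \<psi> (ereal (?A \<omega> / ?V \<omega>)))) < \<epsilon>"
    using eventually_gt_at_top[of 2]
  proof eventually_elim
    case (elim n)
    have eq: "At K n \<omega> / sqrt (W_stat Y n \<omega>) = ?a n \<omega> / ?w n \<omega>" for \<omega> using \<sigma>_pos by simp
    have a0: "0 \<le> ?a n \<omega>" for \<omega> using At_nonneg[OF K elim(3)] \<sigma>_pos by simp
    have m1: "(\<lambda>\<omega>. \<psi> (ereal (?a n \<omega> / ?w n \<omega>))) \<in> borel_measurable M" by measurable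
    have m2: "(\<lambda>\<omega>. \<psi> (ereal (clipq j (?a n \<omega>) (?w n \<omega>)))) \<in> borel_measurable M"
      by (rule measurable_uc2[OF uc2_clipq[OF \<psi>(1) j(1)]]) measurable
    have m3: "(\<lambda>\<omega>. cutoff j (?a n \<omega>) (?w n \<omega>)) \<in> borel_measurable M"
      by (rule measurable_uc2[OF uc2_cutoff[OF j(1)]]) measurable
    note mF = measurable_Fsup[OF K]
    have n1: "(\<lambda>\<omega>. \<psi> (ereal (?A \<omega> / ?V \<omega>))) \<in> borel_measurable N" using mF by measurable
    have n2: "(\<lambda>\<omega>. \<psi> (ereal (clipq j (?A \<omega>) (?V \<omega>)))) \<in> borel_measurable N"
      by (rule measurable_uc2[OF uc2_clipq[OF \<psi>(1) j(1)] mF measurable_Vroot])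
    have n3: "(\<lambda>\<omega>. cutoff j (?A \<omega>) (?V \<omega>)) \<in> borel_measurable N"
      by (rule measurable_uc2[OF uc2_cutoff[OF j(1)] mF measurable_Vroot])
    note iM = integrable_bounded[OF m1 \<psi>(2)] integrable_bounded[OF m2 \<psi>(2)] integrable_bounded[OF m3 c1]
    have iN: "integrable N (\<lambda>\<omega>. \<psi> (ereal (?A \<omega> / ?V \<omega>)))" "integrable N (\<lambda>\<omega>. \<psi> (ereal (clipq j (?A \<omega>) (?V \<omega>))))"
      "integrable N (\<lambda>\<omega>. cutoff j (?A \<omega>) (?V \<omega>))"
      using n1 n2 n3 \<psi>(2) c1 by (auto intro!: N.integrable_const_bound[where B=1] AE_I2)
    have 1: "\<bar>expectation (\<lambda>\<omega>. \<psi> (ereal (?a n \<omega> / ?w n \<omega>))) - expectation (\<lambda>\<omega>. \<psi> (ereal (clipq j (?a n \<omega>) (?w n \<omega>))))\<bar>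
      \<le> 4 * expectation (\<lambda>\<omega>. cutoff j (?a n \<omega>) (?w n \<omega>))"
    proof -
      have "\<bar>expectation (\<lambda>\<omega>. \<psi> (ereal (?a n \<omega> / ?w n \<omega>))) - expectation (\<lambda>\<omega>. \<psi> (ereal (clipq j (?a n \<omega>) (?w n \<omega>))))\<bar>
        = \<bar>expectation (\<lambda>\<omega>. \<psi> (ereal (?a n \<omega> / ?w n \<omega>)) - \<psi> (ereal (clipq j (?a n \<omega>) (?w n \<omega>))))\<bar>"
        using Bochner_Integration.integral_diff[OF iM(1,2)] by (simp only:)
      also have "\<dots> \<le> expectation (\<lambda>\<omega>. \<bar>\<psi> (ereal (?a n \<omega> / ?w n \<omega>)) - \<psi> (ereal (clipq j (?a n \<omega>) (?w n \<omega>)))\<bar>)"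
        by (rule integral_abs_bound)
      also have "\<dots> \<le> expectation (\<lambda>\<omega>. 4 * cutoff j (?a n \<omega>) (?w n \<omega>))"
        by (intro integral_mono clipq_cutoff[OF \<psi>(2) j(1) a0] integrable_abs Bochner_Integration.integrable_diff integrable_mult_right iM)
      finally show ?thesis by simp
    qed
    have 2: "\<bar>N.expectation (\<lambda>\<omega>. \<psi> (ereal (?A \<omega> / ?V \<omega>))) - N.expectation (\<lambda>\<omega>. \<psi> (ereal (clipq j (?A \<omega>) (?V \<omega>))))\<bar>
      \<le> 4 * N.expectation (\<lambda>\<omega>. cutoff j (?A \<omega>) (?V \<omega>))"
    proof -
      have "\<bar>N.expectation (\<lambda>\<omega>. \<psi> (ereal (?A \<omega> / ?V \<omega>))) - N.expectation (\<lambda>\<omega>. \<psi> (ereal (clipq j (?A \<omega>) (?V \<omega>))))\<bar>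
        = \<bar>N.expectation (\<lambda>\<omega>. \<psi> (ereal (?A \<omega> / ?V \<omega>)) - \<psi> (ereal (clipq j (?A \<omega>) (?V \<omega>))))\<bar>"
        using Bochner_Integration.integral_diff[OF iN(1,2)] by (simp only:)
      also have "\<dots> \<le> N.expectation (\<lambda>\<omega>. \<bar>\<psi> (ereal (?A \<omega> / ?V \<omega>)) - \<psi> (ereal (clipq j (?A \<omega>) (?V \<omega>)))\<bar>)"
        by (rule integral_abs_bound)
      also have "\<dots> \<le> N.expectation (\<lambda>\<omega>. 4 * cutoff j (?A \<omega>) (?V \<omega>))"
        by (intro integral_mono clipq_cutoff[OF \<psi>(2) j(1)] Fsup_nonneg[OF K] B_continuous
            integrable_abs Bochner_Integration.integrable_diff integrable_mult_right iN)
      finally show ?thesis by simp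
    qed
    show ?case unfolding eq using 1 2 elim(1,2) j(2) \<epsilon> unfolding dist_real_def by argo
  qed
qed

text \<open>The suprema increase with the horizon, and \<open>\<psi>\<close> is continuous on the
  extended reals, so an infinite supremum does no harm. Where \<open>Vroot\<close> is 0, both sides
  follow the convention \<open>1 / 0 = 0\<close> and agree.\<close>

lemma horizon_limit:
  fixes \<psi> :: "ereal \<Rightarrow> real"
  assumes \<psi>: "continuous_on UNIV \<psi>" "\<And>y. \<bar>\<psi> y\<bar> \<le> 1"
  shows "(\<lambda>K. N.expectation (\<lambda>\<omega>. \<psi> (ereal (Fsup (\<lambda>t. B t \<omega>) (K + 2) / Vroot (\<lambda>t. B t \<omega>)))))
    \<longlonglongrightarrow> N.expectation (\<lambda>\<omega>. \<psi> (limit_variable g B \<omega>))"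
proof (rule integral_dominated_convergence[where w="\<lambda>_. 1"])
  have [measurable]: "\<psi> \<in> borel_measurable borel" by (rule borel_measurable_continuous_onI[OF \<psi>(1)])
  note measurable_limit_variable [measurable]
  show "(\<lambda>\<omega>. \<psi> (limit_variable g B \<omega>)) \<in> borel_measurable N" by measurable
  show "(\<lambda>\<omega>. \<psi> (ereal (Fsup (\<lambda>t. B t \<omega>) (K + 2) / Vroot (\<lambda>t. B t \<omega>)))) \<in> borel_measurable N" for K
    using measurable_Fsup[of "K + 2"] by measurable
  show "AE \<omega> in N. (\<lambda>K. \<psi> (ereal (Fsup (\<lambda>t. B t \<omega>) (K + 2) / Vroot (\<lambda>t. B t \<omega>)))) \<longlonglongrightarrow> \<psi> (limit_variable g B \<omega>)"
  proof (rule AE_I2)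
    fix \<omega> assume \<omega>: "\<omega> \<in> space N"
    have "incseq (\<lambda>K. ereal (Fsup (\<lambda>t. B t \<omega>) (K + 2)))"
      by (rule incseq_SucI) (simp, rule Fsup_mono, auto intro: B_continuous[OF \<omega>])
    then have "(\<lambda>K. ereal (Fsup (\<lambda>t. B t \<omega>) (K + 2))) \<longlonglongrightarrow> (SUP K. ereal (Fsup (\<lambda>t. B t \<omega>) (K + 2)))"
      by (rule LIMSEQ_SUP)
    then have "(\<lambda>K. ereal (1 / Vroot (\<lambda>t. B t \<omega>)) * ereal (Fsup (\<lambda>t. B t \<omega>) (K + 2))) \<longlonglongrightarrow> limit_variable g B \<omega>"
      unfolding limit_variable_eq[OF \<omega>] by (intro tendsto_cmult_ereal) auto
    then have "(\<lambda>K. ereal (Fsup (\<lambda>t. B t \<omega>) (K + 2) / Vroot (\<lambda>t. B t \<omega>))) \<longlonglongrightarrow> limit_variable g B \<omega>" by simp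
    then show "(\<lambda>K. \<psi> (ereal (Fsup (\<lambda>t. B t \<omega>) (K + 2) / Vroot (\<lambda>t. B t \<omega>)))) \<longlonglongrightarrow> \<psi> (limit_variable g B \<omega>)"
      by (rule continuous_on_tendsto_compose[OF \<psi>(1)]) auto
  qed
qed (use \<psi>(2) in auto)

text \<open>The constants are chosen in the order \<open>j\<close>, \<open>\<eta>\<close>,
  \<open>K\<close>, \<open>n\<close>: \<open>j\<close> excludes small normalisers,
  \<open>\<eta>\<close> keeps the tail harmless after division by the others, and \<open>K\<close>
  makes the bad events improbable and the truncated limit close to the full one.\<close>

lemma open_end_limit_le_1:
  fixes \<psi> :: "ereal \<Rightarrow> real"
  assumes \<psi>: "continuous_on UNIV \<psi>" "\<And>y. \<bar>\<psi> y\<bar> \<le> 1"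
  shows "(\<lambda>n. expectation (\<lambda>\<omega>. \<psi> (open_end_stat g Y n \<omega>))) \<longlonglongrightarrow> N.expectation (\<lambda>\<omega>. \<psi> (limit_variable g B \<omega>))"
proof (rule tendstoI)
  fix \<epsilon>0 :: real assume "\<epsilon>0 > 0"
  define \<epsilon> where "\<epsilon> = \<epsilon>0 / 20"
  have \<epsilon>: "\<epsilon> > 0" using \<open>\<epsilon>0 > 0\<close> by (simp add: \<epsilon>_def)
  have [measurable]: "\<psi> \<in> borel_measurable borel" by (rule borel_measurable_continuous_onI[OF \<psi>(1)])
  note measurable_open_end_stat [measurable]
  obtain \<delta> where \<delta>: "\<delta> > 0" "\<And>x y. 0 \<le> x \<Longrightarrow> 0 \<le> y \<Longrightarrow> \<bar>x - y\<bar> < \<delta> \<Longrightarrow> \<bar>\<psi> (ereal x) - \<psi> (ereal y)\<bar> < \<epsilon>"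
    using uniformly_continuous_ereal[OF \<psi>(1) \<epsilon>] by metis
  let ?V = "\<lambda>\<omega>. Vroot (\<lambda>t. B t \<omega>)"
  have two: "(2::nat) \<le> 2" by simp
  have "\<forall>\<^sub>F j in sequentially. N.expectation (\<lambda>\<omega>. cutoff (real (Suc j)) (Fsup (\<lambda>t. B t \<omega>) 2) (?V \<omega>)) < \<epsilon>"
    using \<epsilon> by (intro order_tendstoD[OF cutoff_tendsto_0[OF two]]) simp
  then obtain j' where j': "N.expectation (\<lambda>\<omega>. cutoff (real (Suc j')) (Fsup (\<lambda>t. B t \<omega>) 2) (?V \<omega>)) < \<epsilon>"
    by (auto dest: eventually_happens)
  define j where "j = real (Suc j')"
  have j1: "1 \<le> j" by (simp add: j_def)
  have s1: "\<bar>small j w\<bar> \<le> 1" for w using small_bounds[of j w] by simp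
  have c1: "\<bar>cutoff j a w\<bar> \<le> 1" for a w using cutoff_bounds[of j a w] by simp
  have ms: "(\<lambda>\<omega>. small j (?V \<omega>)) \<in> borel_measurable N"
    by (rule measurable_uc2[OF uc2_small[OF j1] measurable_Vroot measurable_Vroot])
  have mc: "(\<lambda>\<omega>. cutoff j (Fsup (\<lambda>t. B t \<omega>) 2) (?V \<omega>)) \<in> borel_measurable N"
    by (rule measurable_uc2[OF uc2_cutoff[OF j1] measurable_Fsup[OF two] measurable_Vroot])
  \<comment> \<open>The normaliser does not depend on the horizon, so the cutoff at horizon 2 allows
    \<open>j\<close> to be fixed before \<open>K\<close>.\<close>
  have "N.expectation (\<lambda>\<omega>. small j (?V \<omega>)) \<le> N.expectation (\<lambda>\<omega>. 2 * cutoff j (Fsup (\<lambda>t. B t \<omega>) 2) (?V \<omega>))"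
  proof (rule integral_mono)
    show "integrable N (\<lambda>\<omega>. small j (?V \<omega>))" using ms s1 by (intro N.integrable_const_bound[where B=1] AE_I2) auto
    show "integrable N (\<lambda>\<omega>. 2 * cutoff j (Fsup (\<lambda>t. B t \<omega>) 2) (?V \<omega>))"
      using mc c1 by (intro integrable_mult_right N.integrable_const_bound[where B=1] AE_I2) auto
    show "small j (?V \<omega>) \<le> 2 * cutoff j (Fsup (\<lambda>t. B t \<omega>) 2) (?V \<omega>)" for \<omega>
      using ramp_bounds(1)[of "j - 1" 1] by (simp add: cutoff_def)
  qed
  then have sV: "N.expectation (\<lambda>\<omega>. small j (?V \<omega>)) < 2 * \<epsilon>" using j' by (simp add: j_def)
  \<comment> \<open>With this choice \<open>\<eta> / ?w \<omega>\<close> is at most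
    \<open>\<delta> / 2\<close> whenever \<open>?w \<omega> / \<sigma>\<close> exceeds
    \<open>1 / j\<close>.\<close>
  define \<eta> where "\<eta> = \<delta> * \<sigma> / (2 * j)"
  have \<eta>: "\<eta> > 0" using \<delta>(1) \<sigma>_pos j1 by (simp add: \<eta>_def)
  have "\<forall>\<^sub>F K in sequentially. \<forall>n>0. prob (\<Union>l. bad (K + 2) n \<eta> l) \<le> \<epsilon>"
    using eventually_compose_filterlim[OF prob_bad_small[OF \<eta> \<epsilon>] filterlim_add_const_nat_at_top[of 2]] .
  moreover have "\<forall>\<^sub>F K in sequentially. dist (N.expectation (\<lambda>\<omega>. \<psi> (ereal (Fsup (\<lambda>t. B t \<omega>) (K + 2) / ?V \<omega>)))) (N.expectation (\<lambda>\<omega>. \<psi> (limit_variable g B \<omega>))) < \<epsilon>"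
    by (rule tendstoD[OF horizon_limit[OF \<psi>] \<epsilon>])
  ultimately have "\<forall>\<^sub>F K in sequentially. (\<forall>n>0. prob (\<Union>l. bad (K + 2) n \<eta> l) \<le> \<epsilon>) \<and>
    dist (N.expectation (\<lambda>\<omega>. \<psi> (ereal (Fsup (\<lambda>t. B t \<omega>) (K + 2) / ?V \<omega>)))) (N.expectation (\<lambda>\<omega>. \<psi> (limit_variable g B \<omega>))) < \<epsilon>"
    by (rule eventually_conj)
  then obtain K' where K': "\<forall>n>0. prob (\<Union>l. bad (K' + 2) n \<eta> l) \<le> \<epsilon>"
    "dist (N.expectation (\<lambda>\<omega>. \<psi> (ereal (Fsup (\<lambda>t. B t \<omega>) (K' + 2) / ?V \<omega>)))) (N.expectation (\<lambda>\<omega>. \<psi> (limit_variable g B \<omega>))) < \<epsilon>"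
    by (auto dest: eventually_happens)
  define K where "K = K' + 2"
  have K: "2 \<le> K" by (simp add: K_def)
  let ?Bad = "\<lambda>n. \<Union>l. bad K n \<eta> l"
  have "\<forall>\<^sub>F n in sequentially. dist (expectation (\<lambda>\<omega>. small j (sqrt (W_stat Y n \<omega>) / \<sigma>))) (N.expectation (\<lambda>\<omega>. small j (?V \<omega>))) < \<epsilon>"
    by (rule tendstoD[OF stat_limit[OF uc2_small[OF j1] s1 K] \<epsilon>])
  moreover have "\<forall>\<^sub>F n in sequentially. dist (expectation (\<lambda>\<omega>. \<psi> (ereal (At K n \<omega> / sqrt (W_stat Y n \<omega>)))))
     (N.expectation (\<lambda>\<omega>. \<psi> (ereal (Fsup (\<lambda>t. B t \<omega>) K / ?V \<omega>)))) < \<epsilon>"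
    by (rule tendstoD[OF ratio_limit[OF \<psi> K] \<epsilon>])
  ultimately show "\<forall>\<^sub>F n in sequentially. dist (expectation (\<lambda>\<omega>. \<psi> (open_end_stat g Y n \<omega>))) (N.expectation (\<lambda>\<omega>. \<psi> (limit_variable g B \<omega>))) < \<epsilon>0"
    using eventually_gt_at_top[of 2]
  proof eventually_elim
    case (elim n)
    let ?w = "\<lambda>\<omega>. sqrt (W_stat Y n \<omega>)"
    let ?G = "\<lambda>\<omega>. \<psi> (open_end_stat g Y n \<omega>)" and ?A = "\<lambda>\<omega>. \<psi> (ereal (At K n \<omega> / ?w \<omega>))"
    have pt: "\<bar>?G \<omega> - ?A \<omega>\<bar> \<le> \<epsilon> + 2 * indicator (?Bad n) \<omega> + 2 * small j (?w \<omega> / \<sigma>)" if \<omega>: "\<omega> \<in> space M" for \<omega>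
    proof (cases "\<omega> \<in> ?Bad n \<or> ?w \<omega> / \<sigma> \<le> 1 / j")
      case True
      have le2: "\<bar>?G \<omega> - ?A \<omega>\<bar> \<le> 2" using \<psi>(2)[of "open_end_stat g Y n \<omega>"] \<psi>(2)[of "ereal (At K n \<omega> / ?w \<omega>)"] by linarith
      from True show ?thesis
      proof
        assume "\<omega> \<in> ?Bad n"
        then have "indicator (?Bad n) \<omega> = (1::real)" by (rule indicator_simps)
        then show ?thesis using le2 \<epsilon> small_bounds(1)[of j "?w \<omega> / \<sigma>"] by linarith
      next
        assume "?w \<omega> / \<sigma> \<le> 1 / j"
        then have "small j (?w \<omega> / \<sigma>) = 1" by (rule small_eq_1[OF j1])
        moreover have "(0::real) \<le> indicator (?Bad n) \<omega>" by simp
        ultimately show ?thesis using le2 \<epsilon> by linarith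
      qed
    next
      case False
      then have nb: "\<omega> \<notin> ?Bad n" and w: "1 / j < ?w \<omega> / \<sigma>" by auto
      have "0 < 1 / j" using j1 by simp
      then have "0 < ?w \<omega> / \<sigma>" using w by linarith
      then have w0: "0 < ?w \<omega>" using \<sigma>_pos by (simp add: zero_less_divide_iff)
      then have W0: "0 < W_stat Y n \<omega>" by simp
      note bounds = open_end_stat_bounds[OF \<omega> nb K elim(3) less_imp_le[OF \<eta>] W0]
      obtain v where v: "open_end_stat g Y n \<omega> = ereal v"
        using bounds(1,2) by (cases "open_end_stat g Y n \<omega>") auto
      have vb: "At K n \<omega> / ?w \<omega> \<le> v" "v \<le> At K n \<omega> / ?w \<omega> + \<eta> / ?w \<omega>" using bounds(1,2) unfolding v by auto
      have a0: "0 \<le> At K n \<omega> / ?w \<omega>" using bounds(3) w0 by simp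
      have "\<eta> / ?w \<omega> \<le> \<eta> * (j / \<sigma>)"
      proof -
        have "1 / ?w \<omega> \<le> j / \<sigma>" using w w0 \<sigma>_pos j1 by (simp add: field_simps)
        from mult_left_mono[OF this, of \<eta>] show ?thesis using \<eta> by simp
      qed
      also have "\<dots> < \<delta>" using \<delta>(1) \<sigma>_pos j1 by (simp add: \<eta>_def)
      finally have "\<bar>v - At K n \<omega> / ?w \<omega>\<bar> < \<delta>" using vb by linarith
      then have "\<bar>?G \<omega> - ?A \<omega>\<bar> < \<epsilon>" unfolding v using a0 vb by (intro \<delta>(2)) auto
      moreover have "(0::real) \<le> indicator (?Bad n) \<omega>" by simp
      ultimately show ?thesis using small_bounds(1)[of j "?w \<omega> / \<sigma>"] by linarith
    qed
    have mG: "?G \<in> borel_measurable M" by measurable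
    have mA: "?A \<in> borel_measurable M" by measurable
    have mw: "(\<lambda>\<omega>. ?w \<omega> / \<sigma>) \<in> borel_measurable M" by measurable
    have mS: "(\<lambda>\<omega>. small j (?w \<omega> / \<sigma>)) \<in> borel_measurable M"
      by (rule measurable_uc2[OF uc2_small[OF j1] mw mw])
    have Bad: "?Bad n \<in> sets M" by measurable
    have iI: "integrable M (\<lambda>\<omega>. 2 * indicator (?Bad n) \<omega> :: real)"
      using Bad by (intro integrable_mult_right) (simp add: integrable_indicator_iff less_top[symmetric])
    note i = integrable_bounded[OF mG \<psi>(2)] integrable_bounded[OF mA \<psi>(2)] integrable_bounded[OF mS s1]
    have "\<bar>expectation ?G - expectation ?A\<bar> = \<bar>expectation (\<lambda>\<omega>. ?G \<omega> - ?A \<omega>)\<bar>"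
      using Bochner_Integration.integral_diff[OF i(1,2)] by (simp only:)
    also have "\<dots> \<le> expectation (\<lambda>\<omega>. \<bar>?G \<omega> - ?A \<omega>\<bar>)" by (rule integral_abs_bound)
    also have "\<dots> \<le> expectation (\<lambda>\<omega>. \<epsilon> + 2 * indicator (?Bad n) \<omega> + 2 * small j (?w \<omega> / \<sigma>))"
      using i iI by (intro integral_mono pt integrable_abs Bochner_Integration.integrable_diff Bochner_Integration.integrable_add integrable_mult_right) auto
    also have "\<dots> = \<epsilon> + 2 * prob (?Bad n) + 2 * expectation (\<lambda>\<omega>. small j (?w \<omega> / \<sigma>))"
      using i iI Bad by (simp add: prob_space)
    finally have "\<bar>expectation ?G - expectation ?A\<bar> \<le> \<epsilon> + 2 * prob (?Bad n) + 2 * expectation (\<lambda>\<omega>. small j (?w \<omega> / \<sigma>))" .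
    moreover have "prob (?Bad n) \<le> \<epsilon>" using K'(1) elim(3) by (simp add: K_def)
    ultimately show ?case using elim(1,2) sV K'(2) unfolding dist_real_def K_def[symmetric] \<epsilon>_def by argo
  qed
qed

theorem open_end_converges: "converges_in_distribution M (open_end_stat g Y) N (limit_variable g B)"
  unfolding converges_in_distribution_def
proof (intro conjI allI impI measurable_open_end_stat measurable_limit_variable)
  fix \<psi> :: "ereal \<Rightarrow> real" assume \<psi>: "continuous_on UNIV \<psi> \<and> bounded (range \<psi>)"
  then obtain c where c: "\<And>y. \<bar>\<psi> y\<bar> \<le> c" unfolding bounded_iff by auto
  define c' where "c' = max c 1"
  have c': "c' > 0" by (simp add: c'_def)
  have "\<bar>\<psi> y / c'\<bar> \<le> 1" for y using c[of y] c' by (simp add: c'_def)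
  moreover have "continuous_on UNIV (\<lambda>y. \<psi> y / c')" using \<psi> c' by (intro continuous_intros) auto
  ultimately have "(\<lambda>n. expectation (\<lambda>\<omega>. \<psi> (open_end_stat g Y n \<omega>) / c')) \<longlonglongrightarrow> N.expectation (\<lambda>\<omega>. \<psi> (limit_variable g B \<omega>) / c')"
    using open_end_limit_le_1[of "\<lambda>y. \<psi> y / c'"] by simp
  from tendsto_mult[OF this tendsto_const[of c']] c'
  show "(\<lambda>n. expectation (\<lambda>\<omega>. \<psi> (open_end_stat g Y n \<omega>))) \<longlonglongrightarrow> N.expectation (\<lambda>\<omega>. \<psi> (limit_variable g B \<omega>))" by simp
qed

end

section \<open>The embedding\<close>

text \<open>Injectivity of \<open>fn\<close> identifies the inverse image of the kernel section with
  the element that represents evaluation at \<open>\<phi> x\<close>.\<close>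

lemma rkhs_embed_reproducing:
  assumes "is_rkhs (laplace_kernel v) fn"
  shows "fn (rkhs_embed v fn \<phi> x) = laplace_kernel v (\<phi> x)"
    and "fn u (\<phi> x) = u \<bullet> rkhs_embed v fn \<phi> x"
proof -
  obtain k where k: "fn k = laplace_kernel v (\<phi> x)" "\<And>u. fn u (\<phi> x) = u \<bullet> k"
    using assms unfolding is_rkhs_def by metis
  moreover have "inj fn" using assms by (simp add: is_rkhs_def)
  ultimately have "rkhs_embed v fn \<phi> x = k" unfolding rkhs_embed_def by (metis inv_f_f)
  then show "fn (rkhs_embed v fn \<phi> x) = laplace_kernel v (\<phi> x)" "fn u (\<phi> x) = u \<bullet> rkhs_embed v fn \<phi> x"
    using k by simp_all
qed

lemma rkhs_embed_inner:
  assumes "is_rkhs (laplace_kernel v) fn"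
  shows "rkhs_embed v fn \<phi> x \<bullet> rkhs_embed v fn \<phi> y = laplace_transform v ((norm (\<phi> x - \<phi> y))\<^sup>2)"
  using rkhs_embed_reproducing(1)[OF assms, of \<phi> x] rkhs_embed_reproducing(2)[OF assms, of "rkhs_embed v fn \<phi> x" \<phi> y]
  by (simp add: laplace_kernel_def)

lemma laplace_transform_tendsto_0:
  assumes v: "sets v = sets (restrict_space borel {0..})" "finite_measure v"
    and x: "x \<longlonglongrightarrow> 0" "\<And>n. 0 \<le> x n"
  shows "(\<lambda>n. laplace_transform v (x n)) \<longlonglongrightarrow> laplace_transform v 0"
  unfolding laplace_transform_def
proof (rule integral_dominated_convergence[where w="\<lambda>_. 1"])
  interpret finite_measure v by fact
  have sp: "space v = {0..}" using sets_eq_imp_space_eq[OF v(1)] by (simp add: space_restrict_space)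
  have m: "(\<lambda>t. exp (- (t * u))) \<in> borel_measurable v" for u :: real
  proof -
    have "(\<lambda>t. exp (- (t * u))) \<in> borel_measurable (restrict_space borel {0..})"
      by (rule measurable_restrict_space1) measurable
    then show ?thesis by (simp cong: measurable_cong_sets add: v(1))
  qed
  show "(\<lambda>t. exp (- (t * 0))) \<in> borel_measurable v" "(\<lambda>t. exp (- (t * x n))) \<in> borel_measurable v" for n
    by (rule m)+
  show "AE t in v. (\<lambda>n. exp (- (t * x n))) \<longlonglongrightarrow> exp (- (t * 0))"
    by (intro AE_I2 tendsto_intros x)
  show "AE t in v. norm (exp (- (t * x n))) \<le> 1" for n
    using x(2)[of n] sp by (intro AE_I2) auto
  show "integrable v (\<lambda>_. 1 :: real)" by (rule integrable_const)
qed

text \<open>The squared distance of two embedded points is \<open>2 * f 0 - 2 * f (dist a b)\<close>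
  with \<open>f\<close> the Laplace transform, which is continuous at 0. The continuity transfers
  separability from the metric space to its image.\<close>

lemma rkhs_embed_continuous:
  fixes \<phi> :: "'x::metric_space \<Rightarrow> 'h::real_inner"
  assumes k: "is_rkhs (laplace_kernel v) fn"
    and v: "sets v = sets (restrict_space borel {0..})" "finite_measure v"
    and \<phi>: "\<And>x x'. dist x x' = (norm (\<phi> x - \<phi> x'))\<^sup>2"
  shows "continuous_on UNIV (rkhs_embed v fn \<phi>)"
proof (subst continuous_on_sequentially, intro allI ballI impI, elim conjE)
  fix y :: "nat \<Rightarrow> 'x" and x assume y: "y \<longlonglongrightarrow> x"
  let ?E = "rkhs_embed v fn \<phi>" and ?f = "laplace_transform v"
  have "(\<lambda>n. dist (y n) x) \<longlonglongrightarrow> 0" using y unfolding tendsto_dist_iff[of y] .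
  then have "(\<lambda>n. sqrt (2 * ?f 0 - 2 * ?f (dist (y n) x))) \<longlonglongrightarrow> sqrt (2 * ?f 0 - 2 * ?f 0)"
    by (intro tendsto_intros laplace_transform_tendsto_0[OF v]) auto
  moreover have "dist (?E (y n)) (?E x) = sqrt (2 * ?f 0 - 2 * ?f (dist (y n) x))" for n
  proof -
    have inn: "?E a \<bullet> ?E b = ?f (dist a b)" for a b unfolding rkhs_embed_inner[OF k] \<phi> ..
    have "(norm (?E (y n) - ?E x))\<^sup>2 = 2 * ?f 0 - 2 * ?f (dist (y n) x)"
      unfolding power2_norm_eq_inner by (simp add: inner_diff_left inner_diff_right inn dist_commute)
    then show ?thesis by (metis dist_norm norm_ge_zero real_sqrt_unique)
  qed
  ultimately have "(\<lambda>n. dist (?E (y n)) (?E x)) \<longlonglongrightarrow> 0" by simp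
  then show "(?E \<circ> y) \<longlonglongrightarrow> ?E x" by (subst tendsto_dist_iff) (simp only: o_def)
qed

section \<open>Consequences of stationarity and mixing\<close>

lemma cesaro_tendsto:
  fixes d :: "nat \<Rightarrow> real"
  assumes d: "d \<longlonglongrightarrow> L"
  shows "(\<lambda>n. (\<Sum>i<n. d i) / real n) \<longlonglongrightarrow> L"
proof (rule LIMSEQ_I)
  fix \<epsilon> :: real assume \<epsilon>: "\<epsilon> > 0"
  obtain n0 where n0: "\<And>n. n \<ge> n0 \<Longrightarrow> norm (d n - L) < \<epsilon> / 2"
    using LIMSEQ_D[OF d, of "\<epsilon> / 2"] \<epsilon> by auto
  define c where "c = (\<Sum>i<n0. \<bar>d i - L\<bar>)"
  have "(\<lambda>n. c * (1 / real n)) \<longlonglongrightarrow> c * 0" by (intro tendsto_intros lim_1_over_n)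
  then have "\<forall>\<^sub>F n in sequentially. c * (1 / real n) < \<epsilon> / 2" using \<epsilon> by (intro order_tendstoD) auto
  then obtain n1 where n1: "\<And>n. n \<ge> n1 \<Longrightarrow> c * (1 / real n) < \<epsilon> / 2" unfolding eventually_sequentially by blast
  have "norm ((\<Sum>i<n. d i) / real n - L) < \<epsilon>" if n: "n \<ge> max (max n0 n1) 1" for n
  proof -
    have np: "real n > 0" using n by simp
    have "(\<Sum>i<n. d i) / real n - L = (\<Sum>i<n. d i - L) / real n" using np by (simp add: sum_subtractf field_simps)
    then have "norm ((\<Sum>i<n. d i) / real n - L) = \<bar>\<Sum>i<n. d i - L\<bar> / real n" by simp
    also have "\<dots> \<le> (\<Sum>i<n. \<bar>d i - L\<bar>) / real n" by (intro divide_right_mono sum_abs) simp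
    also have "(\<Sum>i<n. \<bar>d i - L\<bar>) = c + (\<Sum>i\<in>{n0..<n}. \<bar>d i - L\<bar>)"
    proof -
      have "{..<n} = {..<n0} \<union> {n0..<n}" using n by auto
      then show ?thesis unfolding c_def by (simp add: sum.union_disjoint ivl_disj_int)
    qed
    also have "(\<Sum>i\<in>{n0..<n}. \<bar>d i - L\<bar>) \<le> (\<Sum>i\<in>{n0..<n}. \<epsilon> / 2)" using n0 by (intro sum_mono) (auto intro: less_imp_le)
    also have "\<dots> \<le> real n * (\<epsilon> / 2)" using \<epsilon> by simp
    finally have "norm ((\<Sum>i<n. d i) / real n - L) \<le> (c + real n * (\<epsilon> / 2)) / real n" using np by (simp add: divide_right_mono)
    also have "\<dots> = c * (1 / real n) + \<epsilon> / 2" using np by (simp add: field_simps)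
    also have "\<dots> < \<epsilon>" using n1[of n] n by linarith
    finally show ?thesis .
  qed
  then show "\<exists>no. \<forall>n\<ge>no. norm ((\<Sum>i<n. d i) / real n - L) < \<epsilon>" by blast
qed

text \<open>An unordered sum may be evaluated along any exhaustion by finite sets; the symmetric
  intervals are those that occur in the variance of partial sums.\<close>

lemma has_sum_int_symmetric:
  fixes c :: "int \<Rightarrow> real"
  assumes "(c has_sum L) UNIV"
  shows "(\<lambda>n. \<Sum>t\<in>{- int n..int n}. c t) \<longlonglongrightarrow> L"
proof -
  have "filterlim (\<lambda>n. {- int n..int n}) (finite_subsets_at_top UNIV) sequentially"
    unfolding filterlim_finite_subsets_at_top
  proof (intro allI impI)
    fix X :: "int set" assume "finite X \<and> X \<subseteq> UNIV"
    then have fX: "finite X" by simp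
    define k where "k = nat (\<Sum>x\<in>X. \<bar>x\<bar>)"
    have "X \<subseteq> {- int n..int n}" if "n \<ge> k" for n
    proof
      fix x assume "x \<in> X"
      then have "\<bar>x\<bar> \<le> (\<Sum>x\<in>X. \<bar>x\<bar>)" using fX by (intro member_le_sum) auto
      also have "\<dots> \<le> int n" using that by (simp add: k_def)
      finally show "x \<in> {- int n..int n}" by auto
    qed
    then show "\<forall>\<^sub>F n in sequentially. finite {- int n..int n} \<and> X \<subseteq> {- int n..int n} \<and> {- int n..int n} \<subseteq> UNIV"
      by (intro eventually_sequentiallyI[of k]) auto
  qed
  from filterlim_compose[OF assms[unfolded has_sum_def] this] show ?thesis .
qed

lemma stationary_distr:
  assumes st: "strictly_stationary M S Z" and G: "G \<in> borel_measurable (\<Pi>\<^sub>M t\<in>UNIV. S)"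
  shows "distr M borel (\<lambda>\<omega>. G (\<lambda>t. Z (t + h) \<omega>)) = distr M borel (\<lambda>\<omega>. G (\<lambda>t. Z t \<omega>))"
proof -
  have m: "(\<lambda>\<omega> t. Z (t + h) \<omega>) \<in> measurable M (\<Pi>\<^sub>M t\<in>UNIV. S)" for h
    using st unfolding strictly_stationary_def by (intro measurable_abs_UNIV) auto
  have "distr M borel (\<lambda>\<omega>. G (\<lambda>t. Z (t + h) \<omega>)) = distr (distr M (\<Pi>\<^sub>M t\<in>UNIV. S) (\<lambda>\<omega> t. Z (t + h) \<omega>)) borel G" for h
    by (subst distr_distr[OF G m]) (simp add: o_def)
  from this[of h] this[of 0] show ?thesis using st by (simp add: strictly_stationary_def)
qed

lemma space_gen_field [simp]: "space (gen_field M S Z I) = space M"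
  by (simp add: gen_field_def space_measure_of_conv)

lemma sets_gen_field: "sets (gen_field M S Z I) = sigma_sets (space M) {Z t -` A \<inter> space M | t A. t \<in> I \<and> A \<in> sets S}"
  unfolding gen_field_def by (rule sets_measure_of) auto

lemma measurable_gen_field:
  assumes "t \<in> I" "Z t \<in> measurable M S"
  shows "Z t \<in> measurable (gen_field M S Z I) S"
proof (rule measurableI)
  show "Z t \<omega> \<in> space S" if "\<omega> \<in> space (gen_field M S Z I)" for \<omega>
    using that measurable_space[OF assms(2)] by simp
  show "Z t -` A \<inter> space (gen_field M S Z I) \<in> sets (gen_field M S Z I)" if "A \<in> sets S" for A
    unfolding sets_gen_field space_gen_field using that assms(1) by (intro sigma_sets.Basic) auto
qed

lemma gen_field_subalgebra:
  assumes "\<And>t. Z t \<in> measurable M S" "U \<in> borel_measurable (gen_field M S Z I)"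
  shows "U \<in> borel_measurable M"
proof (rule measurable_from_subalg[OF _ assms(2)])
  have "{Z t -` A \<inter> space M | t A. t \<in> I \<and> A \<in> sets S} \<subseteq> sets M"
    using measurable_sets[OF assms(1)] by auto
  then show "subalgebra M (gen_field M S Z I)"
    unfolding subalgebra_def sets_gen_field by (simp add: sets.sigma_sets_subset)
qed

lemma (in prob_space) covar_eq:
  assumes "integrable M U" "integrable M V" "integrable M (\<lambda>\<omega>. U \<omega> * V \<omega>)"
  shows "covar M U V = expectation (\<lambda>\<omega>. U \<omega> * V \<omega>) - expectation U * expectation V"
proof -
  have "covar M U V = expectation (\<lambda>\<omega>. U \<omega> * V \<omega> - expectation U * V \<omega> - expectation V * U \<omega> + expectation U * expectation V)"
    unfolding covar_def by (simp add: algebra_simps)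
  also have "\<dots> = expectation (\<lambda>\<omega>. U \<omega> * V \<omega>) - expectation U * expectation V"
    using assms by (simp add: prob_space)
  finally show ?thesis .
qed

text \<open>The inequality between geometric and arithmetic mean makes the correlation bound
  additive, and variances are bounded by second moments. Capping \<open>rho_mix\<close> at 1 yields
  a real coefficient; where the cap acts, \<open>amgm\<close> gives the bound directly.\<close>

lemma (in prob_space) covar_le_rho_mix:
  assumes Z: "\<And>t. Z t \<in> measurable M S"
    and U: "U \<in> borel_measurable (gen_field M S Z I)" and V: "V \<in> borel_measurable (gen_field M S Z J)"
    and IJ: "I \<noteq> {}" "J \<noteq> {}" "\<And>i j. i \<in> I \<Longrightarrow> j \<in> J \<Longrightarrow> int m \<le> \<bar>i - j\<bar>"
    and bdd: "\<And>\<omega>. \<bar>U \<omega>\<bar> \<le> c" "\<And>\<omega>. \<bar>V \<omega>\<bar> \<le> c"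
  shows "\<bar>expectation (\<lambda>\<omega>. U \<omega> * V \<omega>) - expectation U * expectation V\<bar>
    \<le> enn2real (min 1 (rho_mix M S Z m)) / 2 * (expectation (\<lambda>\<omega>. (U \<omega>)\<^sup>2) + expectation (\<lambda>\<omega>. (V \<omega>)\<^sup>2))"
proof -
  define \<rho> where "\<rho> = enn2real (min 1 (rho_mix M S Z m))"
  have \<rho>0: "0 \<le> \<rho>" by (simp add: \<rho>_def)
  have UM [measurable]: "U \<in> borel_measurable M" by (rule gen_field_subalgebra[OF Z U])
  have VM [measurable]: "V \<in> borel_measurable M" by (rule gen_field_subalgebra[OF Z V])
  have int: "integrable M (\<lambda>\<omega>. f \<omega> * h \<omega>)"
    if "f \<in> borel_measurable M" "h \<in> borel_measurable M" "\<And>\<omega>. \<bar>f \<omega>\<bar> \<le> a" "\<And>\<omega>. \<bar>h \<omega>\<bar> \<le> b" for f h :: "'a \<Rightarrow> real" and a b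
  proof (rule integrable_const_bound[where B="a * b"])
    show "AE \<omega> in M. norm (f \<omega> * h \<omega>) \<le> a * b"
      using that(3,4) order_trans[OF abs_ge_zero that(3)] unfolding real_norm_def abs_mult
      by (intro AE_I2 mult_mono) auto
  qed (use that(1,2) in measurable)
  have iU: "integrable M U" "integrable M V" using int[of U "\<lambda>_. 1" c 1] int[of V "\<lambda>_. 1" c 1] bdd by auto
  have iUV: "integrable M (\<lambda>\<omega>. U \<omega> * V \<omega>)" "integrable M (\<lambda>\<omega>. U \<omega> * U \<omega>)" "integrable M (\<lambda>\<omega>. V \<omega> * V \<omega>)"
    using int bdd UM VM by blast+
  let ?cUV = "covar M U V" and ?cU = "covar M U U" and ?cV = "covar M V V"
  have cov_le: "?cU \<le> expectation (\<lambda>\<omega>. (U \<omega>)\<^sup>2)" "?cV \<le> expectation (\<lambda>\<omega>. (V \<omega>)\<^sup>2)"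
    unfolding covar_eq[OF iU(1) iU(1) iUV(2)] covar_eq[OF iU(2) iU(2) iUV(3)] by (simp_all add: power2_eq_square)
  have c0: "0 \<le> ?cU" "0 \<le> ?cV" unfolding covar_def by (simp_all add: integral_nonneg_AE)
  have amgm: "\<bar>?cUV\<bar> \<le> (?cU + ?cV) / 2"
  proof -
    let ?u = "\<lambda>\<omega>. U \<omega> - expectation U" and ?v = "\<lambda>\<omega>. V \<omega> - expectation V"
    have bu: "\<bar>?u \<omega>\<bar> \<le> c + \<bar>expectation U\<bar>" "\<bar>?v \<omega>\<bar> \<le> c + \<bar>expectation V\<bar>" for \<omega>
      using bdd[of \<omega>] by linarith+
    have i: "integrable M (\<lambda>\<omega>. ?u \<omega> * ?v \<omega>)" "integrable M (\<lambda>\<omega>. ?u \<omega> * ?u \<omega>)" "integrable M (\<lambda>\<omega>. ?v \<omega> * ?v \<omega>)"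
      by (rule int[OF _ _ bu(1) bu(2)] int[OF _ _ bu(1) bu(1)] int[OF _ _ bu(2) bu(2)]; measurable)+
    have "\<bar>?cUV\<bar> \<le> expectation (\<lambda>\<omega>. \<bar>?u \<omega> * ?v \<omega>\<bar>)" unfolding covar_def by (rule integral_abs_bound)
    also have "\<dots> \<le> expectation (\<lambda>\<omega>. (?u \<omega> * ?u \<omega> + ?v \<omega> * ?v \<omega>) / 2)"
    proof (rule integral_mono)
      show "\<bar>?u \<omega> * ?v \<omega>\<bar> \<le> (?u \<omega> * ?u \<omega> + ?v \<omega> * ?v \<omega>) / 2" for \<omega>
        using sum_squares_bound[of "\<bar>?u \<omega>\<bar>" "\<bar>?v \<omega>\<bar>"] by (simp add: abs_mult power2_eq_square)
    qed (use i in auto)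
    also have "\<dots> = (?cU + ?cV) / 2" using i unfolding covar_def by simp
    finally show ?thesis .
  qed
  have "\<bar>?cUV\<bar> \<le> \<rho> / 2 * (?cU + ?cV)"
  \<comment> \<open>\<open>rho_coeff\<close> ranges over positive variances only. A variable of
    variance 0 is almost surely constant, so the covariance vanishes.\<close>
  proof (cases "?cU = 0 \<or> ?cV = 0")
    case True
    have "AE \<omega> in M. (U \<omega> - expectation U) * (V \<omega> - expectation V) = 0"
      using True
    proof
      assume "?cU = 0"
      then have "expectation (\<lambda>\<omega>. (U \<omega> - expectation U) * (U \<omega> - expectation U)) = 0" by (simp add: covar_def)
      moreover have "integrable M (\<lambda>\<omega>. (U \<omega> - expectation U) * (U \<omega> - expectation U))"
        using iU iUV by (simp add: algebra_simps)
      ultimately have "AE \<omega> in M. (U \<omega> - expectation U) * (U \<omega> - expectation U) = 0"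
        by (subst (asm) integral_nonneg_eq_0_iff_AE) auto
      then show ?thesis by eventually_elim simp
    next
      assume "?cV = 0"
      then have "expectation (\<lambda>\<omega>. (V \<omega> - expectation V) * (V \<omega> - expectation V)) = 0" by (simp add: covar_def)
      moreover have "integrable M (\<lambda>\<omega>. (V \<omega> - expectation V) * (V \<omega> - expectation V))"
        using iU iUV by (simp add: algebra_simps)
      ultimately have "AE \<omega> in M. (V \<omega> - expectation V) * (V \<omega> - expectation V) = 0"
        by (subst (asm) integral_nonneg_eq_0_iff_AE) auto
      then show ?thesis by eventually_elim simp
    qed
    then have "?cUV = 0" unfolding covar_def by (rule integral_eq_zero_AE)
    then show ?thesis using \<rho>0 c0 by simp
  next
    case False
    then have pos: "0 < ?cU" "0 < ?cV" using c0 by auto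
    show ?thesis
    proof (cases "1 \<le> rho_mix M S Z m")
      case True
      then have "\<rho> = 1" by (simp add: \<rho>_def min_absorb1)
      then show ?thesis using amgm by simp
    next
      case less: False
      then have \<rho>: "rho_mix M S Z m = ennreal \<rho>"
        by (auto simp: \<rho>_def min_absorb2 not_le less_top[symmetric] intro!: ennreal_enn2real[symmetric] dest: less_trans[OF _ ennreal_one_less_top])
      have "ennreal (\<bar>?cUV\<bar> / sqrt (?cU * ?cV)) \<le> rho_coeff M (gen_field M S Z I) (gen_field M S Z J)"
        unfolding rho_coeff_def using U V pos iUV
        by (intro Sup_upper CollectI exI[of _ U] exI[of _ V]) (auto simp: power2_eq_square)
      also have "\<dots> \<le> rho_mix M S Z m"
        unfolding rho_mix_def using IJ by (intro Sup_upper CollectI exI[of _ I] exI[of _ J]) auto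
      finally have "\<bar>?cUV\<bar> / sqrt (?cU * ?cV) \<le> \<rho>" unfolding \<rho> using \<rho>0 by simp
      moreover have sp: "0 < sqrt (?cU * ?cV)" using pos by simp
      ultimately have "\<bar>?cUV\<bar> \<le> \<rho> * sqrt (?cU * ?cV)" by (simp add: pos_divide_le_eq)
      also have "\<dots> \<le> \<rho> * ((?cU + ?cV) / 2)" using \<rho>0 c0 by (intro mult_left_mono arith_geo_mean_sqrt) auto
      finally show ?thesis by simp
    qed
  qed
  also have "\<dots> \<le> \<rho> / 2 * (expectation (\<lambda>\<omega>. (U \<omega>)\<^sup>2) + expectation (\<lambda>\<omega>. (V \<omega>)\<^sup>2))"
    using cov_le \<rho>0 by (intro mult_left_mono add_mono) auto
  finally show ?thesis unfolding covar_eq[OF iU iUV(1)] \<rho>_def .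
qed

lemma measurable_inner_const: "(\<lambda>y :: 'k::real_inner. y \<bullet> h) \<in> borel_measurable borel"
  by (intro borel_measurable_continuous_onI continuous_intros)

theorem theorem5:
  fixes \<phi> :: "'x::{metric_space,second_countable_topology} \<Rightarrow> 'h::{real_inner,complete_space}"
    and v :: "real measure"
    and fn :: "'k::{real_inner,complete_space} \<Rightarrow> 'h \<Rightarrow> real"
    and M :: "'w measure"
    and X1 X2 :: "int \<Rightarrow> 'w \<Rightarrow> 'x"
    and X :: "nat \<Rightarrow> 'w \<Rightarrow> 'x"
    and Y1 Y2 :: "int \<Rightarrow> 'w \<Rightarrow> 'k"
    and Y :: "nat \<Rightarrow> 'w \<Rightarrow> 'k"
    and \<mu>1 :: 'k
    and Q :: "'k \<Rightarrow> 'k"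
    and g :: "real \<Rightarrow> real"
    and N :: "'v measure"
    and B :: "real \<Rightarrow> 'v \<Rightarrow> real"
  assumes "negative_type (dist :: 'x \<Rightarrow> 'x \<Rightarrow> real)"
    and "\<And>x x'. dist x x' = (norm (\<phi> x - \<phi> x'))\<^sup>2"
    and "sets v = sets (restrict_space borel {0..})" and "finite_measure v"
    and "measure v {0<..} > 0"
    and "is_rkhs (laplace_kernel v) fn"
    and "prob_space M"
    and "\<And>t. X1 t \<in> borel_measurable M" and "\<And>t. X2 t \<in> borel_measurable M"
    and "\<And>t. X t \<in> borel_measurable M"
    and "\<And>t \<omega>. Y1 t \<omega> = rkhs_embed v fn \<phi> (X1 t \<omega>)"
    and "\<And>t \<omega>. Y2 t \<omega> = rkhs_embed v fn \<phi> (X2 t \<omega>)"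
    and "\<And>t \<omega>. Y t \<omega> = rkhs_embed v fn \<phi> (X t \<omega>)"
    and "strictly_stationary M (borel \<Otimes>\<^sub>M borel) (pair_process Y1 Y2)"
    and null_hypothesis: "\<And>t \<omega>. t \<ge> 1 \<Longrightarrow> \<omega> \<in> space M \<Longrightarrow> Y t \<omega> = Y1 (int t) \<omega>"
    and "has_expectation M (Y1 1) \<mu>1"
    and "is_long_run_cov M Y1 \<mu>1 Q"
    and "mixing_assumption M Y1 Y2 \<mu>1 Q"
    and "weight_assumption g"
    and "standard_brownian_motion N B"
  shows "converges_in_distribution M (\<lambda>n. open_end_stat g Y n) N (limit_variable g B)"
proof -
  interpret M: prob_space M by fact
  let ?S = "borel \<Otimes>\<^sub>M borel :: ('k \<times> 'k) measure" and ?E = "rkhs_embed v fn \<phi>" and ?P = "pair_process Y1 Y2"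
  have P_meas: "?P t \<in> measurable M ?S" for t using assms(14) by (simp add: strictly_stationary_def)
  define Z where "Z t \<omega> = Y1 t \<omega> - \<mu>1" for t \<omega>
  \<comment> \<open>All embedded points have squared norm \<open>laplace_transform v 0\<close>, the
    value of the kernel on the diagonal.\<close>
  define \<kappa> where "\<kappa> = sqrt (laplace_transform v 0) + norm \<mu>1"
  define r where "r m = enn2real (min 1 (rho_mix M ?S ?P m))" for m
  define \<sigma> where "\<sigma> = sqrt (Q \<mu>1 \<bullet> \<mu>1)"
  have Q_pos: "0 < Q \<mu>1 \<bullet> \<mu>1" using assms(18) by (simp add: mixing_assumption_def)
  have Econt: "continuous_on UNIV ?E" by (rule rkhs_embed_continuous[OF assms(6,3,4,2)])

  \<comment> \<open>A countable orthonormal system for the centred observations\<close>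
  obtain D :: "'x set" where D: "countable D" "\<And>X. open X \<Longrightarrow> X \<noteq> {} \<Longrightarrow> \<exists>d\<in>D. d \<in> X"
    using countable_dense_exists by metis
  have "D \<noteq> {}" using D(2)[of UNIV] by auto
  \<comment> \<open>\<open>\<mu>1\<close> heads the dense sequence because each
    \<open>Z t \<omega>\<close> is an embedded point minus \<open>\<mu>1\<close> and has to lie in
    the closed span.\<close>
  define y where "y n = (case n of 0 \<Rightarrow> \<mu>1 | Suc k \<Rightarrow> ?E (from_nat_into D k))" for n
  have y_dense: "\<exists>k. norm (?E x - y (Suc k)) < \<epsilon>" if "\<epsilon> > 0" for x \<epsilon>
  proof -
    have "open (?E -` ball (?E x) \<epsilon>)" by (rule open_vimage[OF open_ball Econt])
    moreover have "x \<in> ?E -` ball (?E x) \<epsilon>" using that by simp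
    ultimately obtain d where d: "d \<in> D" "d \<in> ?E -` ball (?E x) \<epsilon>" using D(2) by blast
    obtain k where "from_nat_into D k = d" using from_nat_into_surj[OF D(1) d(1)] by blast
    then show ?thesis using d(2) by (intro exI[of _ k]) (simp add: y_def dist_norm)
  qed
  obtain e :: "nat \<Rightarrow> 'k" where e: "\<And>i j. i \<noteq> j \<Longrightarrow> e i \<bullet> e j = 0" "\<And>i. norm (e i) = 1 \<or> e i = 0"
    "\<And>n. y n \<in> span (e ` {..n})"
    by (rule gram_schmidt_sequence[of y]) (rule that)
  have Z_span: "\<exists>n. \<exists>z\<in>span (e ` {..n}). norm (Z t \<omega> - z) < \<epsilon>" if \<epsilon>: "\<epsilon> > 0" for t \<omega> \<epsilon>
  proof -
    obtain k where k: "norm (?E (X1 t \<omega>) - y (Suc k)) < \<epsilon>" using y_dense[OF \<epsilon>] by blast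
    have "\<mu>1 = y 0" by (simp add: y_def)
    moreover have "y 0 \<in> span (e ` {..Suc k})" using e(3)[of 0] span_mono[of "e ` {..0}" "e ` {..Suc k}"] by auto
    ultimately have "y (Suc k) - \<mu>1 \<in> span (e ` {..Suc k})" using e(3)[of "Suc k"] by (simp add: span_diff)
    moreover have "norm (Z t \<omega> - (y (Suc k) - \<mu>1)) < \<epsilon>" using k assms(11) by (simp add: Z_def)
    ultimately show ?thesis by blast
  qed
  have Z_comp: "(\<lambda>z. fst z \<bullet> h) \<in> borel_measurable ?S" for h :: 'k
    by (rule measurable_compose[OF measurable_fst measurable_inner_const])
  have Z_F: "(\<lambda>\<omega>. Z i \<omega> \<bullet> h) \<in> borel_measurable (gen_field M ?S ?P I)" if "i \<in> I" for i I h
  proof -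
    have "(\<lambda>\<omega>. fst (?P i \<omega>) \<bullet> h) \<in> borel_measurable (gen_field M ?S ?P I)"
      by (rule measurable_compose[OF measurable_gen_field[OF that P_meas] Z_comp])
    then have "(\<lambda>\<omega>. fst (?P i \<omega>) \<bullet> h - \<mu>1 \<bullet> h) \<in> borel_measurable (gen_field M ?S ?P I)" by simp
    then show ?thesis by (simp add: Z_def pair_process_def inner_diff_left)
  qed
  have Z_M [measurable]: "(\<lambda>\<omega>. Z i \<omega> \<bullet> h) \<in> borel_measurable M" for i h
    using gen_field_subalgebra[OF P_meas Z_F[of i UNIV h]] by simp
  have Z_bound: "norm (Z t \<omega>) \<le> \<kappa>" for t \<omega>
  proof -
    have "norm (?E x) = sqrt (laplace_transform v 0)" for x
      unfolding norm_eq_sqrt_inner rkhs_embed_inner[OF assms(6)] by simp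
    then show ?thesis unfolding Z_def assms(11) \<kappa>_def using norm_triangle_ineq4 by metis
  qed
  have G_meas: "(\<lambda>z. fst (z i) \<bullet> h) \<in> borel_measurable (\<Pi>\<^sub>M t\<in>(UNIV :: int set). ?S)" for i h
    by (rule measurable_compose[OF _ Z_comp, where f="\<lambda>z. z i"]) (rule measurable_component_singleton, simp)
  have shift: "M.expectation (\<lambda>\<omega>. G (\<lambda>t. ?P (t + h) \<omega>)) = M.expectation (\<lambda>\<omega>. G (\<lambda>t. ?P t \<omega>))"
    if G: "G \<in> borel_measurable (\<Pi>\<^sub>M t\<in>UNIV. ?S)" for G :: "(int \<Rightarrow> 'k \<times> 'k) \<Rightarrow> real" and h
  proof -
    have m: "(\<lambda>\<omega>. G (\<lambda>t. ?P (t + h) \<omega>)) \<in> borel_measurable M" for h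
      by (rule measurable_compose[OF measurable_abs_UNIV G]) (rule P_meas)
    have "M.expectation (\<lambda>\<omega>. G (\<lambda>t. ?P (t + h) \<omega>)) = integral\<^sup>L (distr M borel (\<lambda>\<omega>. G (\<lambda>t. ?P (t + h) \<omega>))) (\<lambda>x. x)" for h
      using m by (subst integral_distr) auto
    from this[of h] this[of 0] show ?thesis using stationary_distr[OF assms(14) G, of h] by simp
  qed
  have Z_mean: "M.expectation (\<lambda>\<omega>. Z i \<omega> \<bullet> h) = 0" for i h
  proof -
    have "M.expectation (\<lambda>\<omega>. fst (?P (1 + (i - 1)) \<omega>) \<bullet> h) = M.expectation (\<lambda>\<omega>. fst (?P 1 \<omega>) \<bullet> h)"
      by (rule shift[OF G_meas])
    then have e1: "M.expectation (\<lambda>\<omega>. Y1 i \<omega> \<bullet> h) = \<mu>1 \<bullet> h"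
      using assms(16) by (simp add: pair_process_def has_expectation_def)
    have "integrable M (\<lambda>\<omega>. Z i \<omega> \<bullet> h)"
    proof (rule M.integrable_const_bound[where B="\<kappa> * norm h"])
      show "AE \<omega> in M. norm (Z i \<omega> \<bullet> h) \<le> \<kappa> * norm h"
        unfolding real_norm_def by (intro AE_I2 order_trans[OF Cauchy_Schwarz_ineq2] mult_right_mono Z_bound) simp
    qed measurable
    then have "integrable M (\<lambda>\<omega>. Z i \<omega> \<bullet> h + \<mu>1 \<bullet> h)" by simp
    then have "integrable M (\<lambda>\<omega>. Y1 i \<omega> \<bullet> h)" by (simp add: Z_def inner_diff_left)
    then show ?thesis using e1 by (simp add: Z_def inner_diff_left M.prob_space)
  qed
  have r_lim: "r \<longlonglongrightarrow> 0"
  proof -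
    have "rho_mix M ?S ?P \<longlonglongrightarrow> 0" using assms(18) by (simp add: mixing_assumption_def rho_mixing_def)
    then have "(\<lambda>m. min 1 (rho_mix M ?S ?P m)) \<longlonglongrightarrow> min 1 0" by (intro tendsto_min tendsto_const)
    then have "(\<lambda>m. min 1 (rho_mix M ?S ?P m)) \<longlonglongrightarrow> ennreal 0" by simp
    then show ?thesis unfolding r_def by (rule tendsto_enn2real) simp
  qed
  interpret mixing_process M "gen_field M ?S ?P" Z e \<kappa> r
  proof
    show "U \<in> borel_measurable M" if "U \<in> borel_measurable (gen_field M ?S ?P I)" for U :: "'w \<Rightarrow> real" and I
      by (rule gen_field_subalgebra[OF P_meas that])
    show "(\<lambda>\<omega>. Z i \<omega> \<bullet> h) \<in> borel_measurable (gen_field M ?S ?P I)" if "i \<in> I" for i I h by (rule Z_F[OF that])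
    show "norm (Z i \<omega>) \<le> \<kappa>" for i \<omega> by (rule Z_bound)
    show "(\<lambda>m. \<Sum>l<m. (Z i \<omega> \<bullet> e l) * (Z j \<omega> \<bullet> e l)) \<longlonglongrightarrow> Z i \<omega> \<bullet> Z j \<omega>" for i j \<omega>
      by (rule parseval_closure[OF e(1,2) Z_span])
    show "M.expectation (\<lambda>\<omega>. Z i \<omega> \<bullet> h) = 0" for i h by (rule Z_mean)
    show "0 \<le> r m" for m by (simp add: r_def)
    show "r \<longlonglongrightarrow> 0" by (rule r_lim)
    show "\<bar>M.expectation (\<lambda>\<omega>. U \<omega> * V \<omega>) - M.expectation U * M.expectation V\<bar>
        \<le> r m / 2 * (M.expectation (\<lambda>\<omega>. (U \<omega>)\<^sup>2) + M.expectation (\<lambda>\<omega>. (V \<omega>)\<^sup>2))"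
      if "U \<in> borel_measurable (gen_field M ?S ?P I)" "V \<in> borel_measurable (gen_field M ?S ?P J)" "I \<noteq> {}" "J \<noteq> {}"
      "\<And>\<omega>. \<bar>U \<omega>\<bar> \<le> c" "\<And>\<omega>. \<bar>V \<omega>\<bar> \<le> c" "\<And>i j. i \<in> I \<Longrightarrow> j \<in> J \<Longrightarrow> int m \<le> \<bar>i - j\<bar>"
    for U V :: "'w \<Rightarrow> real" and I J c m
      unfolding r_def by (rule M.covar_le_rho_mix[OF P_meas that(1-4,7,5,6)])
  qed

  \<comment> \<open>Long-run variance in the direction of the mean\<close>
  define c where "c t = M.expectation (\<lambda>\<omega>. (Z 0 \<omega> \<bullet> \<mu>1) * (Z t \<omega> \<bullet> \<mu>1))" for t
  have c_sum: "(c has_sum (Q \<mu>1 \<bullet> \<mu>1)) UNIV"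
    using assms(17) unfolding is_long_run_cov_def c_def Z_def by blast
  have iZZ: "integrable M (\<lambda>\<omega>. (Z i \<omega> \<bullet> \<mu>1) * (Z j \<omega> \<bullet> \<mu>1))" for i j
    using integrable_S(3)[of "{i}" \<mu>1 "{j}" \<mu>1] by (simp add: S_def)
  have cov: "M.expectation (\<lambda>\<omega>. (Z i \<omega> \<bullet> \<mu>1) * (Z j \<omega> \<bullet> \<mu>1)) = c (j - i)" for i j
  proof -
    let ?G = "\<lambda>z :: int \<Rightarrow> 'k \<times> 'k. (fst (z 0) \<bullet> \<mu>1 - \<mu>1 \<bullet> \<mu>1) * (fst (z (j - i)) \<bullet> \<mu>1 - \<mu>1 \<bullet> \<mu>1)"
    have "?G \<in> borel_measurable (\<Pi>\<^sub>M t\<in>UNIV. ?S)"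
      using G_meas[of 0 \<mu>1] G_meas[of "j - i" \<mu>1] by simp
    from shift[OF this, of i] show ?thesis by (simp add: c_def Z_def pair_process_def inner_diff_left)
  qed
  have c_sym: "c (- t) = c t" for t
    using cov[of t 0] by (simp add: c_def mult.commute)
  \<comment> \<open>The increment of the variance from \<open>n\<close> to \<open>n + 1\<close>
    indices: it is \<open>c 0\<close> plus twice the sum of \<open>c 1\<close> to
    \<open>c n\<close>, which is this symmetric sum. The variance divided by \<open>n\<close> is
    thus a Cesaro mean of a convergent sequence.\<close>
  define d where "d n = (\<Sum>t\<in>{- int n..int n}. c t)" for n
  have d_lim: "d \<longlonglongrightarrow> Q \<mu>1 \<bullet> \<mu>1" unfolding d_def by (rule has_sum_int_symmetric[OF c_sum])
  have d_eq: "d n = c 0 + 2 * (\<Sum>t\<in>{1..int n}. c t)" for n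
  proof -
    have "{- int n..int n} = insert 0 ({1..int n} \<union> uminus ` {1..int n})"
      by (auto simp: image_iff)
    moreover have "(\<Sum>t\<in>uminus ` {1..int n}. c t) = (\<Sum>t\<in>{1..int n}. c t)"
      by (subst sum.reindex) (auto simp: c_sym)
    moreover have "{1..int n} \<inter> uminus ` {1..int n} = {}" "0 \<notin> {1..int n} \<union> uminus ` {1..int n}" by auto
    ultimately show ?thesis unfolding d_def by (simp add: sum.union_disjoint)
  qed
  let ?v = "\<lambda>n. M.expectation (\<lambda>\<omega>. (S {0<..int n} \<omega> \<bullet> \<mu>1)\<^sup>2)"
  have v_eq: "?v n = (\<Sum>i<n. d i)" for n
  proof (induction n)
    case 0
    then show ?case by (simp add: S_def)
  next
    case (Suc n)
    have ins: "{0<..int (Suc n)} = insert (int (Suc n)) {0<..int n}" by auto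
    have "S {0<..int (Suc n)} \<omega> \<bullet> \<mu>1 = S {0<..int n} \<omega> \<bullet> \<mu>1 + Z (int (Suc n)) \<omega> \<bullet> \<mu>1" for \<omega>
      unfolding S_def ins by (simp add: inner_add_left)
    then have "(S {0<..int (Suc n)} \<omega> \<bullet> \<mu>1)\<^sup>2 = (S {0<..int n} \<omega> \<bullet> \<mu>1)\<^sup>2
        + (Z (int (Suc n)) \<omega> \<bullet> \<mu>1) * (Z (int (Suc n)) \<omega> \<bullet> \<mu>1)
        + 2 * (\<Sum>i\<in>{0<..int n}. (Z i \<omega> \<bullet> \<mu>1) * (Z (int (Suc n)) \<omega> \<bullet> \<mu>1))" for \<omega>
      by (simp only: power2_sum) (simp add: power2_eq_square S_def inner_sum_left sum_distrib_right)
    then have "?v (Suc n) = ?v n + c 0 + 2 * (\<Sum>i\<in>{0<..int n}. c (int (Suc n) - i))"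
      using iZZ by (simp add: cov del: of_nat_Suc)
    also have "(\<Sum>i\<in>{0<..int n}. c (int (Suc n) - i)) = (\<Sum>t\<in>{1..int n}. c t)"
      by (rule sum.reindex_bij_witness[of _ "\<lambda>t. int (Suc n) - t" "\<lambda>i. int (Suc n) - i"]) auto
    finally show ?case using Suc by (simp add: d_eq)
  qed
  interpret mixing_clt M "gen_field M ?S ?P" Z e \<kappa> r \<mu>1 \<sigma>
  proof
    show "0 < \<sigma>" using Q_pos by (simp add: \<sigma>_def)
    show "(\<lambda>n. ?v n / real n) \<longlonglongrightarrow> \<sigma>\<^sup>2"
      unfolding v_eq using cesaro_tendsto[OF d_lim] Q_pos by (simp add: \<sigma>_def)
    show "distr M borel (\<lambda>\<omega>. S {a<..a + int p} \<omega> \<bullet> \<mu>1) = distr M borel (\<lambda>\<omega>. S {0<..int p} \<omega> \<bullet> \<mu>1)" for a p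
    proof -
      \<comment> \<open>The window sum is one measurable functional evaluated along the shifted pair
        process, so stationarity gives equality of laws.\<close>
      let ?G = "\<lambda>z :: int \<Rightarrow> 'k \<times> 'k. \<Sum>i\<in>{0<..int p}. (fst (z i) \<bullet> \<mu>1 - \<mu>1 \<bullet> \<mu>1)"
      have G: "?G \<in> borel_measurable (\<Pi>\<^sub>M t\<in>UNIV. ?S)"
        using G_meas by (intro borel_measurable_sum borel_measurable_diff) auto
      have "S {a<..a + int p} \<omega> \<bullet> \<mu>1 = ?G (\<lambda>t. ?P (t + a) \<omega>)" for \<omega>
      proof -
        have "S {a<..a + int p} \<omega> = (\<Sum>i\<in>{0<..int p}. Z (i + a) \<omega>)"
          unfolding S_def by (rule sum.reindex_bij_witness[of _ "\<lambda>i. i + a" "\<lambda>i. i - a"]) auto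
        then show ?thesis by (simp add: inner_sum_left Z_def pair_process_def inner_diff_left)
      qed
      moreover have "S {0<..int p} \<omega> \<bullet> \<mu>1 = ?G (\<lambda>t. ?P t \<omega>)" for \<omega>
        by (simp add: S_def inner_sum_left Z_def pair_process_def inner_diff_left)
      ultimately show ?thesis using stationary_distr[OF assms(14) G, of a] by simp
    qed
  qed
  interpret monitoring_stat M "gen_field M ?S ?P" Z e \<kappa> r \<mu>1 \<sigma> g N B Y
  proof
    show "weight_assumption g" "standard_brownian_motion N B" by fact+
    show "Y t \<omega> = \<mu>1 + Z (int t) \<omega>" if "1 \<le> t" "\<omega> \<in> space M" for t \<omega>
      using null_hypothesis[OF that] by (simp add: Z_def)
  qed
  show ?thesis using open_end_converges by simp
qed

end
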